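(* There are isomorphisms, natural in the commutative monoid $X$, \[ HQ^{CM}_n(X)=HQ^{CA}_n(\widetilde{\mathbb{Z}}X)\qquad (n\ge 0), \] where Beck modules over $X$ are identified with left modules over the $X$-graded commutative ring $\widetilde{\mathbb{Z}}X$. For any right Beck module $M$ over $X$, \[ HQ^{CM}_n(X;M)=HQ^{CA}_n(\widetilde{\mathbb{Z}}X;M)\qquad (n\ge 0), \] and for any left Beck module $N$ over $X$, \[ HQ_{CM}^n(X;N)=HQ_{CA}^n(\widetilde{\mathbb{Z}}X;N)\qquad (n\ge 0). \]
   Context: Commutative monoids are written additively; $\mathbf{ComMon}$ is their category. **Leech category and Beck modules.** For a commutative monoid $X$, the Leech category $L_X$ has object set $X$, morphisms $L_X(x,z)=\{y\in X: x+y=z\}$, and composition given by addition. The morphism given by $y$ from $x$ to $x+y$ is written $y_*$. A (left) Beck module over $X$, i.e. an abelian group object in $\mathbf{ComMon}/X$, is identified with a covariant functor $N:L_X\to\mathbf{Ab}$, $x\mapsto N_x$. A right Beck module is a contravariant functor $M:L_X\to\mathbf{Ab}$, $x\mapsto M^x$. The category of left Beck modules is denoted $\mathbf{LMod}_X$. The tensor product $M\otimes_{L_X}N$ is the usual tensor product (coend) of a contravariant and a covariant functor. **Quillen (co)homology of commutative monoids.** Let $\mathrm{Ab}_X:\mathbf{ComMon}/X\to\mathbf{LMod}_X$ be the left adjoint of the forgetful functor. For $\alpha:Y\to X$, $\mathrm{Ab}_X(Y)$ represents derivations: $\mathrm{Hom}(\mathrm{Ab}_X(Y),N)$ is the group of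 families $s(y)\in N_{\alpha(y)}$ $(y\in Y)$ with $s(y+y')=\alpha(y)_*s(y')+\alpha(y')_*s(y)$. Let $\mathbb{N}_\bullet X\to X$ be the simplicial cotriple resolution from the adjunction (free commutative monoid, forgetful functor) between $\mathbf{Set}$ and $\mathbf{ComMon}$ (any cofibrant replacement of $X$ in simplicial commutative monoids may be used). With $\mathrm{ch}$ the chain complex associated to a simplicial object in an abelian category, $HQ_n^{CM}(X)=\pi_n(\mathrm{Ab}_X\mathbb{N}_\bullet X)$, $HQ_n^{CM}(X;M)=\pi_n(M\otimes_{L_X}\mathrm{Ab}_X\mathbb{N}_\bullet X)$, $HQ^n_{CM}(X;N)=H^n(\mathrm{Hom}(\mathrm{ch}\,\mathrm{Ab}_X\mathbb{N}_\bullet X,N))$. **Graded algebra.** Let $K$ be a commutative ring. An $X$-graded $K$-module is a family $(V_x)_{x\in X}$ of $K$-modules, with tensor product $(V\otimes_K W)_z=\bigoplus_{x+y=z}V_x\otimes_K W_y$, unit $K$ in degree $0$, and symmetry $v\otimes w\mapsto w\otimes v$ (no signs). A commutative $X$-graded $K$-algebra $A$ is a commutative monoid for this tensor product. A left $A$-module $N$ is an $X$-graded $K$-module with an action $A_y\otimes N_x\to N_{x+y}$. A right $A$-module $M$ is a family $(M^x)_{x\in X}$ of $K$-modules with maps $\varphi_{x,y}:M^{x+y}\otimes_K A_y\to M^x$ that are unital, $\varphi_{x,0}(m\otimes1)=m$, and associative, $\varphi_{x,y}(\varphi_{x+y,z}(m\otimes a)\otimes b)=\varphi_{x,y+z}(m\otimes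 ab)$ for $a\in A_z$, $b\in A_y$. The $K$-module $M\otimes_AN$ is the quotient of $\bigoplus_zM^z\otimes_K N_z$ by the relations $m\otimes an=ma\otimes n$ for $m\in M^{x+y}$, $a\in A_y$, $n\in N_x$. **Graded André–Quillen (co)homology.** For $B\to A$ a map of commutative $X$-graded $K$-algebras, $\mathrm{Ab}_A(B)$ is the left $A$-module representing $N\mapsto\mathrm{Der}_K(B,N)$ (degree-preserving $K$-linear derivations). Let $\mathrm{Sym}^X_{K\bullet}A\to A$ be the simplicial cotriple resolution from the adjunction (free commutative $X$-graded $K$-algebra, forgetful functor) between $X$-graded sets and commutative $X$-graded $K$-algebras. Then $HQ^{CA}_n(A)=\pi_n(\mathrm{Ab}_A\mathrm{Sym}^X_{K\bullet}A)$ (a left $A$-module), $HQ^{CA}_n(A;M)=\pi_n(M\otimes_A\mathrm{Ab}_A\mathrm{Sym}^X_{K\bullet}A)$ for $M$ a right $A$-module, and $HQ_{CA}^n(A;N)=H^n(\mathrm{Hom}_A(\mathrm{ch}\,\mathrm{Ab}_A\mathrm{Sym}^X_{K\bullet}A,N))$ for $N$ a left $A$-module. **The graded monoid ring.** $\widetilde{\mathbb{Z}}X$ is the commutative $X$-graded $\mathbb{Z}$-algebra with $(\widetilde{\mathbb{Z}}X)_x=\mathbb{Z}$ free on a generator $1_x$, unit $1=1_0$, and $1_x1_y=1_{x+y}$; for it, $K=\mathbb{Z}$. A left (right) Beck module over $X$ is regarded as a left (right) $\widetilde{\mathbb{Z}}X$-module with the same groups, $1_y$ acting through the morphisms $y_*$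 of $L_X$. *)

theory Defs
  imports "HOL-Algebra.Free_Abelian_Groups" "HOL-Library.Multiset" "HOL-Library.FSet"
begin

text \<open>
  Commutative monoids and abelian groups are records of HOL-Algebra, so their operation is written
  multiplicatively although it is addition in the mathematical text: \<open>x \<otimes> y\<close> stands for
  $x + y$, \<open>\<one>\<close> for $0$, and \<open>a [^] k\<close> for $k a$.
\<close>


section \<open>Abelian groups given by generators and relations\<close>

definition presented :: "'g set \<Rightarrow> ('g \<Rightarrow>\<^sub>0 int) set \<Rightarrow> ('g \<Rightarrow>\<^sub>0 int) set monoid" where
  "presented S R = free_Abelian_group S Mod generate (free_Abelian_group S) R"

definition presented_class :: "'g set \<Rightarrow> ('g \<Rightarrow>\<^sub>0 int) set \<Rightarrow> 'g \<Rightarrow> ('g \<Rightarrow>\<^sub>0 int) set" where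
  "presented_class S R g =
    generate (free_Abelian_group S) R #>\<^bsub>free_Abelian_group S\<^esub> frag_of g"

text \<open>The map into \<open>G Mod H\<close> which \<open>f\<close> induces on cosets.\<close>

definition coset_map :: "'b monoid \<Rightarrow> 'b set \<Rightarrow> ('a \<Rightarrow> 'b) \<Rightarrow> 'a set \<Rightarrow> 'b set" where
  "coset_map G H f C = (\<Union>c\<in>C. H #>\<^bsub>G\<^esub> f c)"

text \<open>The homomorphism into \<open>presented S R\<close> which is \<open>f\<close> on generators.\<close>

definition presented_map ::
    "'h set \<Rightarrow> ('h \<Rightarrow>\<^sub>0 int) set \<Rightarrow> ('g \<Rightarrow> 'h) \<Rightarrow> ('g \<Rightarrow>\<^sub>0 int) set \<Rightarrow> ('h \<Rightarrow>\<^sub>0 int) set" where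
  "presented_map S R f =
    coset_map (free_Abelian_group S) (generate (free_Abelian_group S) R)
      (frag_extend (\<lambda>g. frag_of (f g)))"

lemma presented_normal:
  assumes "R \<subseteq> carrier (free_Abelian_group S)"
  shows "generate (free_Abelian_group S) R \<lhd> free_Abelian_group S"
  by (meson abelian_free_Abelian_group assms comm_group.subgroup_imp_normal group.generate_is_subgroup
      group_free_Abelian_group)

lemma comm_group_presented:
  assumes "R \<subseteq> carrier (free_Abelian_group S)"
  shows "comm_group (presented S R)"
  unfolding presented_def
  by (meson abelian_free_Abelian_group assms comm_group.abelian_FactGroup group.generate_is_subgroup
      group_free_Abelian_group)

lemma presented_class_closed:
  assumes "s \<in> S"
  shows "presented_class S R s \<in> carrier (presented S R)"
  using assms by (auto simp: presented_def presented_class_def carrier_FactGroup)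

lemma presented_class_eqI:
  assumes R: "R \<subseteq> carrier (free_Abelian_group S)"
    and in_R: "frag_of a - frag_of b - frag_of c \<in> R" and S: "a \<in> S" "b \<in> S" "c \<in> S"
  shows "presented_class S R a = presented_class S R b \<otimes>\<^bsub>presented S R\<^esub> presented_class S R c"
proof -
  let ?F = "free_Abelian_group S"
  let ?H = "generate ?F R"
  interpret F: group ?F by simp
  interpret normal ?H ?F using R by (rule presented_normal)
  have "presented_class S R b \<otimes>\<^bsub>presented S R\<^esub> presented_class S R c = ?H #>\<^bsub>?F\<^esub> (frag_of b + frag_of c)"
    using S by (simp add: presented_def presented_class_def rcos_sum)
  also have "\<dots> = ?H #>\<^bsub>?F\<^esub> frag_of a"
  proof (rule F.repr_independence)
    have "frag_of a = (frag_of a - frag_of b - frag_of c) \<otimes>\<^bsub>?F\<^esub> (frag_of b + frag_of c)"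
      by simp
    moreover have "frag_of a - frag_of b - frag_of c \<in> ?H"
      using in_R by (rule generate.incl)
    ultimately show "frag_of a \<in> ?H #>\<^bsub>?F\<^esub> (frag_of b + frag_of c)"
      unfolding r_coset_def by blast
    show "frag_of b + frag_of c \<in> carrier ?F"
      using S keys_add[of "frag_of b" "frag_of c"] by auto
    show "subgroup ?H ?F" by (rule is_subgroup)
  qed
  finally show ?thesis by (simp add: presented_class_def)
qed

lemma presented_hom_eqI:
  assumes R: "R \<subseteq> carrier (free_Abelian_group S)"
    and G: "group G" and k: "k \<in> hom (presented S R) G" and k': "k' \<in> hom (presented S R) G"
    and eq: "\<And>s. s \<in> S \<Longrightarrow> k (presented_class S R s) = k' (presented_class S R s)"
    and c: "c \<in> carrier (presented S R)"
  shows "k c = k' c"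
proof -
  let ?F = "free_Abelian_group S"
  let ?H = "generate ?F R"
  let ?p = "\<lambda>a. ?H #>\<^bsub>?F\<^esub> a"
  interpret normal ?H ?F using R by (rule presented_normal)
  have p: "?p \<in> hom ?F (presented S R)"
    unfolding presented_def by (rule r_coset_hom_Mod)
  have "group (presented S R)"
    using comm_group_presented[OF R] by (simp add: comm_group_def)
  define K K' where "K = k \<circ> ?p" and "K' = k' \<circ> ?p"
  have "K \<in> hom ?F G" "K' \<in> hom ?F G"
    unfolding K_def K'_def by (rule Group.hom_compose[OF p k], rule Group.hom_compose[OF p k'])
  then interpret kp: group_hom ?F G K + kp': group_hom ?F G K'
    using G by (simp_all add: group_hom_def group_hom_axioms_def)
  obtain a where a: "Poly_Mapping.keys a \<subseteq> S" "c = ?p a"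
    using c by (auto simp: presented_def carrier_FactGroup)
  have "Poly_Mapping.keys a \<subseteq> S \<and> K a = K' a"
    using a(1)
  proof (induction a rule: frag_induction)
    case zero
    then show ?case using kp.hom_one kp'.hom_one by simp
  next
    case (one x)
    then show ?case using eq[of x] by (simp add: presented_class_def K_def K'_def)
  next
    case (diff a b)
    then have ab: "a \<in> carrier ?F" "b \<in> carrier ?F" "inv\<^bsub>?F\<^esub> b \<in> carrier ?F" "K a = K' a" "K b = K' b"
      by simp_all
    have "K (a - b) = K (a \<otimes>\<^bsub>?F\<^esub> inv\<^bsub>?F\<^esub> b)"
      using diff by simp
    also have "\<dots> = K' (a \<otimes>\<^bsub>?F\<^esub> inv\<^bsub>?F\<^esub> b)"
      unfolding kp.hom_mult[OF ab(1,3)] kp.hom_inv[OF ab(2)] kp'.hom_mult[OF ab(1,3)] kp'.hom_inv[OF ab(2)]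
      by (simp only: ab)
    also have "\<dots> = K' (a - b)"
      using diff by simp
    finally show ?case
      using diff keys_diff[of a b] by blast
  qed
  then show ?thesis using a by (simp add: K_def K'_def)
qed

lemma presented_hom_exists:
  assumes G: "comm_group G" and f: "\<And>s. s \<in> S \<Longrightarrow> f s \<in> carrier G"
    and R: "\<And>r. r \<in> R \<Longrightarrow> \<exists>a\<in>S. \<exists>b\<in>S. \<exists>c\<in>S. r = frag_of a - frag_of b - frag_of c \<and> f a = f b \<otimes>\<^bsub>G\<^esub> f c"
  obtains k where "k \<in> hom (presented S R) G" "\<And>s. s \<in> S \<Longrightarrow> k (presented_class S R s) = f s"
proof -
  let ?F = "free_Abelian_group S"
  interpret G: comm_group G by fact
  interpret F: comm_group ?F by (rule abelian_free_Abelian_group)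
  obtain h where h: "h \<in> hom ?F G" "\<And>s. s \<in> S \<Longrightarrow> h (frag_of s) = f s"
    using G.free_Abelian_group_universal[of f S] f by blast
  interpret h: group_hom ?F G h
    by (intro group_hom.intro group_hom_axioms.intro h G.is_group) simp
  have F3: "frag_of a - frag_of b - frag_of c = frag_of a \<otimes>\<^bsub>?F\<^esub> inv\<^bsub>?F\<^esub> (frag_of b \<otimes>\<^bsub>?F\<^esub> frag_of c)"
    if "a \<in> S" "b \<in> S" "c \<in> S" for a b c
  proof -
    have "Poly_Mapping.keys (frag_of b + frag_of c) \<subseteq> S"
      using that keys_add[of "frag_of b" "frag_of c"] by auto
    then show ?thesis by simp
  qed
  have Rc: "R \<subseteq> carrier ?F"
  proof
    fix r assume "r \<in> R"
    then obtain a b c where "a \<in> S" "b \<in> S" "c \<in> S" "r = frag_of a - frag_of b - frag_of c"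
      using R by blast
    then show "r \<in> carrier ?F"
      by (simp only: F3) (simp del: mult_free_Abelian_group inv_free_Abelian_group carrier_free_Abelian_group_iff)
  qed
  have "h r = \<one>\<^bsub>G\<^esub>" if r: "r \<in> R" for r
  proof -
    obtain a b c where abc: "a \<in> S" "b \<in> S" "c \<in> S" "r = frag_of a - frag_of b - frag_of c"
      "f a = f b \<otimes>\<^bsub>G\<^esub> f c"
      using R[OF r] by blast
    have cc: "frag_of a \<in> carrier ?F" "frag_of b \<in> carrier ?F" "frag_of c \<in> carrier ?F"
      using abc by auto
    have "h r = h (frag_of a) \<otimes>\<^bsub>G\<^esub> inv\<^bsub>G\<^esub> (h (frag_of b) \<otimes>\<^bsub>G\<^esub> h (frag_of c))"
      unfolding abc(4) F3[OF abc(1-3)] h.hom_mult[OF cc(1) F.inv_closed[OF F.m_closed[OF cc(2,3)]]]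
        h.hom_inv[OF F.m_closed[OF cc(2,3)]] h.hom_mult[OF cc(2,3)] ..
    then show ?thesis
      using abc f by (simp add: h)
  qed
  then have "R \<subseteq> kernel ?F G h"
    using Rc unfolding kernel_def by blast
  then have "generate ?F R \<subseteq> kernel ?F G h"
    by (rule F.generate_subgroup_incl[OF _ h.subgroup_kernel])
  then have ker: "h x = \<one>\<^bsub>G\<^esub>" if "x \<in> generate ?F R" for x
    using that by (auto simp: kernel_def)
  interpret N: normal "generate ?F R" ?F using Rc by (rule presented_normal)
  obtain k where k: "k \<in> hom (?F Mod generate ?F R) G"
    "\<And>x. x \<in> carrier ?F \<Longrightarrow> k (generate ?F R #>\<^bsub>?F\<^esub> x) = h x"
  proof (rule FactGroup_universal[OF h(1) N.normal_axioms])
    show "h x = h y" if "x \<in> carrier ?F" "y \<in> carrier ?F"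
      "generate ?F R #>\<^bsub>?F\<^esub> x = generate ?F R #>\<^bsub>?F\<^esub> y" for x y
    proof -
      have "x \<in> generate ?F R #>\<^bsub>?F\<^esub> y"
        using that(1) group.rcos_self[OF group_free_Abelian_group _ normal.axioms(1)[OF N.normal_axioms]] that(3)
        by metis
      then obtain z where z: "z \<in> generate ?F R" "x = z \<otimes>\<^bsub>?F\<^esub> y"
        by (auto simp: r_coset_def)
      then have "h x = h z \<otimes>\<^bsub>G\<^esub> h y"
        using subgroup.mem_carrier[OF normal.axioms(1)[OF N.normal_axioms]] that(2) h.hom_mult by blast
      then show ?thesis
        using z that(2) by (simp add: ker del: carrier_free_Abelian_group_iff)
    qed
  qed blast
  show thesis
  proof
    show "k \<in> hom (presented S R) G" using k by (simp add: presented_def)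
    show "k (presented_class S R s) = f s" if "s \<in> S" for s
      using k(2)[of "frag_of s"] that h(2) by (simp add: presented_class_def)
  qed
qed


lemma presented_map:
  assumes R: "R \<subseteq> carrier (free_Abelian_group S)" and R': "R' \<subseteq> carrier (free_Abelian_group S')"
    and f: "\<And>s. s \<in> S \<Longrightarrow> f s \<in> S'"
    and fR: "\<And>r. r \<in> R \<Longrightarrow> frag_extend (\<lambda>g. frag_of (f g)) r \<in> R'"
  shows presented_map_hom: "presented_map S' R' f \<in> hom (presented S R) (presented S' R')"
    and presented_map_class:
      "\<And>s. s \<in> S \<Longrightarrow> presented_map S' R' f (presented_class S R s) = presented_class S' R' (f s)"
proof -
  let ?F = "free_Abelian_group S" and ?F' = "free_Abelian_group S'"
  let ?H = "generate ?F R" and ?H' = "generate ?F' R'"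
  let ?h = "frag_extend (\<lambda>g. frag_of (f g))"
  have h_closed: "Poly_Mapping.keys (?h a) \<subseteq> S'" if "Poly_Mapping.keys a \<subseteq> S" for a
    using keys_frag_extend[of "\<lambda>g. frag_of (f g)" a] f that by auto
  have h: "?h \<in> hom ?F ?F'"
    by (auto simp: hom_def frag_extend_add dest!: h_closed)
  interpret h: group_hom ?F ?F' ?h
    using h by (simp add: group_hom_def group_hom_axioms_def)
  interpret N: normal ?H ?F using R by (rule presented_normal)
  interpret N': normal ?H' ?F' using R' by (rule presented_normal)
  have hH: "?h a \<in> ?H'" if "a \<in> ?H" for a
    using that
  proof induction
    case one
    then show ?case using generate.one[of ?F' R'] by simp
  next
    case (incl r)
    then show ?case by (intro generate.incl fR)
  next
    case (inv r)
    then have "?h (inv\<^bsub>?F\<^esub> r) = inv\<^bsub>?F'\<^esub> ?h r" using R by (intro h.hom_inv) blast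
    then show ?case using generate.inv[OF fR[OF inv]] by simp
  next
    case (eng a b)
    then show ?case using generate.eng[of "?h a" ?F' R' "?h b"] by (simp add: frag_extend_add)
  qed
  have cosets: "presented_map S' R' f (?H #>\<^bsub>?F\<^esub> a) = ?H' #>\<^bsub>?F'\<^esub> ?h a" if a: "a \<in> carrier ?F" for a
  proof -
    have "?H' #>\<^bsub>?F'\<^esub> ?h c = ?H' #>\<^bsub>?F'\<^esub> ?h a" if c: "c \<in> ?H #>\<^bsub>?F\<^esub> a" for c
    proof -
      obtain b where b: "b \<in> ?H" "c = b \<otimes>\<^bsub>?F\<^esub> a" using c by (auto simp: r_coset_def)
      have "?h c \<in> ?H' #>\<^bsub>?F'\<^esub> ?h a"
        using hH[OF b(1)] unfolding r_coset_def b(2) by (auto simp: frag_extend_add)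
      then show ?thesis
        using group.repr_independence[OF group_free_Abelian_group, of "?h c" S' ?H' "?h a"]
          normal.axioms(1)[OF N'.normal_axioms] a h.hom_closed by metis
    qed
    have "a \<in> ?H #>\<^bsub>?F\<^esub> a"
      using a group.rcos_self[OF group_free_Abelian_group _ normal.axioms(1)[OF N.normal_axioms]] by blast
    show ?thesis unfolding presented_map_def coset_map_def
      by (rule SUP_eq_const) (use \<open>a \<in> ?H #>\<^bsub>?F\<^esub> a\<close> in blast, fact)
  qed
  show "presented_map S' R' f (presented_class S R s) = presented_class S' R' (f s)" if "s \<in> S" for s
    using cosets[of "frag_of s"] that by (simp add: presented_class_def)
  show "presented_map S' R' f \<in> hom (presented S R) (presented S' R')"
    unfolding presented_def
  proof (rule homI)
    fix C assume "C \<in> carrier (?F Mod ?H)"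
    then show "presented_map S' R' f C \<in> carrier (?F' Mod ?H')"
      using h.hom_closed unfolding carrier_FactGroup by (auto simp only: cosets)
  next
    fix C D assume C: "C \<in> carrier (?F Mod ?H)" and D: "D \<in> carrier (?F Mod ?H)"
    then obtain a b where ab: "a \<in> carrier ?F" "C = ?H #>\<^bsub>?F\<^esub> a" "b \<in> carrier ?F" "D = ?H #>\<^bsub>?F\<^esub> b"
      by (auto simp only: carrier_FactGroup)
    have "C \<otimes>\<^bsub>?F Mod ?H\<^esub> D = ?H #>\<^bsub>?F\<^esub> (a \<otimes>\<^bsub>?F\<^esub> b)"
      using ab by (simp only: mult_FactGroup N.rcos_sum)
    moreover have "a \<otimes>\<^bsub>?F\<^esub> b \<in> carrier ?F" using ab by blast
    ultimately show "presented_map S' R' f (C \<otimes>\<^bsub>?F Mod ?H\<^esub> D) =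
        presented_map S' R' f C \<otimes>\<^bsub>?F' Mod ?H'\<^esub> presented_map S' R' f D"
      using ab h.hom_closed by (simp only: cosets h.hom_mult mult_FactGroup N'.rcos_sum)
  qed
qed

lemma frag_of_diff3_closed:
  assumes "a \<in> S" "b \<in> S" "c \<in> S"
  shows "frag_of a - frag_of b - frag_of c \<in> carrier (free_Abelian_group S)"
  using assms keys_diff[of "frag_of a - frag_of b" "frag_of c"] keys_diff[of "frag_of a" "frag_of b"]
  by auto

lemma frag_extend_diff3:
  "frag_extend (\<lambda>g. frag_of (f g)) (frag_of a - frag_of b - frag_of c) =
    frag_of (f a) - frag_of (f b) - frag_of (f c)"
  by (simp add: frag_extend_diff)


section \<open>Simplicial abelian groups and cochain complexes\<close>

text \<open>
  A simplicial abelian group enters only through its groups \<open>C n\<close> and its face maps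
  \<open>d n i\<close> from \<open>C (Suc n)\<close> to \<open>C n\<close>, where \<open>i \<le> Suc n\<close>; the degeneracies play no role in
  the associated chain complex, whose homology groups are the \<open>\<pi>\<^sub>n\<close>.
\<close>

definition simp_diff ::
    "(nat \<Rightarrow> 'c monoid) \<Rightarrow> (nat \<Rightarrow> nat \<Rightarrow> 'c \<Rightarrow> 'c) \<Rightarrow> nat \<Rightarrow> 'c \<Rightarrow> 'c" where
  "simp_diff C d n c = (\<Otimes>\<^bsub>C n\<^esub>i\<in>{..Suc n}. d n i c [^]\<^bsub>C n\<^esub> ((-1) ^ i :: int))"

definition simp_cycles :: "(nat \<Rightarrow> 'c monoid) \<Rightarrow> (nat \<Rightarrow> nat \<Rightarrow> 'c \<Rightarrow> 'c) \<Rightarrow> nat \<Rightarrow> 'c set" where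
  "simp_cycles C d n =
    (if n = 0 then carrier (C 0) else kernel (C n) (C (n - 1)) (simp_diff C d (n - 1)))"

definition simp_boundaries :: "(nat \<Rightarrow> 'c monoid) \<Rightarrow> (nat \<Rightarrow> nat \<Rightarrow> 'c \<Rightarrow> 'c) \<Rightarrow> nat \<Rightarrow> 'c set" where
  "simp_boundaries C d n = simp_diff C d n ` carrier (C (Suc n))"

definition simp_pi ::
    "(nat \<Rightarrow> 'c monoid) \<Rightarrow> (nat \<Rightarrow> nat \<Rightarrow> 'c \<Rightarrow> 'c) \<Rightarrow> nat \<Rightarrow> 'c set monoid" where
  "simp_pi C d n = (C n)\<lparr>carrier := simp_cycles C d n\<rparr> Mod simp_boundaries C d n"

text \<open>The map into \<open>simp_pi C d n\<close> induced by a map \<open>f\<close> into \<open>C n\<close>.\<close>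

definition simp_pi_map ::
    "(nat \<Rightarrow> 'c monoid) \<Rightarrow> (nat \<Rightarrow> nat \<Rightarrow> 'c \<Rightarrow> 'c) \<Rightarrow> nat \<Rightarrow> ('b \<Rightarrow> 'c) \<Rightarrow> 'b set \<Rightarrow> 'c set" where
  "simp_pi_map C d n f = coset_map (C n) (simp_boundaries C d n) f"

definition coboundaries :: "(nat \<Rightarrow> 'c monoid) \<Rightarrow> (nat \<Rightarrow> 'c \<Rightarrow> 'c) \<Rightarrow> nat \<Rightarrow> 'c set" where
  "coboundaries C \<delta> n = (if n = 0 then {\<one>\<^bsub>C 0\<^esub>} else \<delta> (n - 1) ` carrier (C (n - 1)))"

definition cohomology :: "(nat \<Rightarrow> 'c monoid) \<Rightarrow> (nat \<Rightarrow> 'c \<Rightarrow> 'c) \<Rightarrow> nat \<Rightarrow> 'c set monoid" where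
  "cohomology C \<delta> n =
    (C n)\<lparr>carrier := kernel (C n) (C (Suc n)) (\<delta> n)\<rparr> Mod coboundaries C \<delta> n"


section \<open>Beck modules\<close>

text \<open>
  A functor from (the opposite of) the Leech category \<open>L\<^sub>X\<close> to abelian groups. As \<open>L\<^sub>X\<close> has exactly
  one morphism for each pair \<open>(y, x)\<close>, namely \<open>y\<^sub>*\<close> from \<open>x\<close> to \<open>x \<otimes> y\<close>, such a functor is a
  family of groups together with a map \<open>tr N y x\<close> for each such pair: from the group at \<open>x\<close> to
  the one at \<open>x \<otimes> y\<close> for left, and in the opposite direction for right Beck modules.
\<close>

record ('x, 'c) graded =
  part :: "'x \<Rightarrow> 'c monoid"

record ('x, 'c) beck = "('x, 'c) graded" +
  tr :: "'x \<Rightarrow> 'x \<Rightarrow> 'c \<Rightarrow> 'c"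

definition left_beck :: "'x monoid \<Rightarrow> ('x, 'c) beck \<Rightarrow> bool" where
  "left_beck X N \<longleftrightarrow>
    (\<forall>x\<in>carrier X. comm_group (part N x)) \<and>
    (\<forall>x\<in>carrier X. \<forall>y\<in>carrier X. tr N y x \<in> hom (part N x) (part N (x \<otimes>\<^bsub>X\<^esub> y))) \<and>
    (\<forall>x\<in>carrier X. \<forall>n\<in>carrier (part N x). tr N \<one>\<^bsub>X\<^esub> x n = n) \<and>
    (\<forall>x\<in>carrier X. \<forall>y\<in>carrier X. \<forall>z\<in>carrier X. \<forall>n\<in>carrier (part N x).
      tr N z (x \<otimes>\<^bsub>X\<^esub> y) (tr N y x n) = tr N (y \<otimes>\<^bsub>X\<^esub> z) x n)"

definition right_beck :: "'x monoid \<Rightarrow> ('x, 'c) beck \<Rightarrow> bool" where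
  "right_beck X M \<longleftrightarrow>
    (\<forall>x\<in>carrier X. comm_group (part M x)) \<and>
    (\<forall>x\<in>carrier X. \<forall>y\<in>carrier X. tr M y x \<in> hom (part M (x \<otimes>\<^bsub>X\<^esub> y)) (part M x)) \<and>
    (\<forall>x\<in>carrier X. \<forall>m\<in>carrier (part M x). tr M \<one>\<^bsub>X\<^esub> x m = m) \<and>
    (\<forall>x\<in>carrier X. \<forall>y\<in>carrier X. \<forall>z\<in>carrier X. \<forall>m\<in>carrier (part M (x \<otimes>\<^bsub>X\<^esub> y \<otimes>\<^bsub>X\<^esub> z)).
      tr M y x (tr M z (x \<otimes>\<^bsub>X\<^esub> y) m) = tr M (y \<otimes>\<^bsub>X\<^esub> z) x m)"

text \<open>The restriction of a left or right Beck module along a homomorphism of monoids.\<close>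

definition beck_pullback :: "('x \<Rightarrow> 'y) \<Rightarrow> ('y, 'c) beck \<Rightarrow> ('x, 'c) beck" where
  "beck_pullback f N = \<lparr>part = (\<lambda>x. part N (f x)), tr = (\<lambda>y x. tr N (f y) (f x))\<rparr>"

text \<open>Homomorphisms are made extensional so that equality of elements is equality of maps.\<close>

definition beck_Hom ::
    "'x monoid \<Rightarrow> ('x, 'c) beck \<Rightarrow> ('x, 'd) beck \<Rightarrow> ('x \<Rightarrow> 'c \<Rightarrow> 'd) monoid" where
  "beck_Hom X P N =
    \<lparr>carrier = {\<theta> \<in> extensional (carrier X).
       (\<forall>x\<in>carrier X. \<theta> x \<in> extensional (carrier (part P x)) \<inter> hom (part P x) (part N x)) \<and>
       (\<forall>x\<in>carrier X. \<forall>y\<in>carrier X. \<forall>c\<in>carrier (part P x).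
          \<theta> (x \<otimes>\<^bsub>X\<^esub> y) (tr P y x c) = tr N y x (\<theta> x c))},
     monoid.mult = (\<lambda>\<theta> \<kappa>. \<lambda>x\<in>carrier X. \<lambda>c\<in>carrier (part P x). \<theta> x c \<otimes>\<^bsub>part N x\<^esub> \<kappa> x c),
     one = (\<lambda>x\<in>carrier X. \<lambda>c\<in>carrier (part P x). \<one>\<^bsub>part N x\<^esub>)\<rparr>"


section \<open>Tensor products\<close>

definition tensor_gens ::
    "'x monoid \<Rightarrow> ('x, 'm, 'p) graded_scheme \<Rightarrow> ('x, 'c, 'q) graded_scheme \<Rightarrow> ('x \<times> 'm \<times> 'c) set" where
  "tensor_gens X M N =
    {(z, m, n). z \<in> carrier X \<and> m \<in> carrier (part M z) \<and> n \<in> carrier (part N z)}"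

text \<open>The relations defining the direct sum over \<open>z\<close> of the tensor products \<open>M\<^sup>z \<otimes> N\<^sub>z\<close>.\<close>

definition bilinear_rels ::
    "'x monoid \<Rightarrow> ('x, 'm, 'p) graded_scheme \<Rightarrow> ('x, 'c, 'q) graded_scheme \<Rightarrow>
     ('x \<times> 'm \<times> 'c \<Rightarrow>\<^sub>0 int) set" where
  "bilinear_rels X M N =
    {frag_of (z, m \<otimes>\<^bsub>part M z\<^esub> m', n) - frag_of (z, m, n) - frag_of (z, m', n) |z m m' n.
       z \<in> carrier X \<and> m \<in> carrier (part M z) \<and> m' \<in> carrier (part M z) \<and> n \<in> carrier (part N z)} \<union>
    {frag_of (z, m, n \<otimes>\<^bsub>part N z\<^esub> n') - frag_of (z, m, n) - frag_of (z, m, n') |z m n n'.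
       z \<in> carrier X \<and> m \<in> carrier (part M z) \<and> n \<in> carrier (part N z) \<and> n' \<in> carrier (part N z)}"

text \<open>The coend \<open>M \<otimes>\<^bsub>L\<^sub>X\<^esub> N\<close> of a right and a left Beck module.\<close>

definition beck_tensor_rels ::
    "'x monoid \<Rightarrow> ('x, 'm) beck \<Rightarrow> ('x, 'c) beck \<Rightarrow> ('x \<times> 'm \<times> 'c \<Rightarrow>\<^sub>0 int) set" where
  "beck_tensor_rels X M N = bilinear_rels X M N \<union>
    {frag_of (x, tr M y x m, n) - frag_of (x \<otimes>\<^bsub>X\<^esub> y, m, tr N y x n) |x y m n.
       x \<in> carrier X \<and> y \<in> carrier X \<and> m \<in> carrier (part M (x \<otimes>\<^bsub>X\<^esub> y)) \<and> n \<in> carrier (part N x)}"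

definition beck_tensor ::
    "'x monoid \<Rightarrow> ('x, 'm) beck \<Rightarrow> ('x, 'c) beck \<Rightarrow> ('x \<times> 'm \<times> 'c \<Rightarrow>\<^sub>0 int) set monoid" where
  "beck_tensor X M N = presented (tensor_gens X M N) (beck_tensor_rels X M N)"


section \<open>Quillen homology of commutative monoids\<close>

subsection \<open>Free commutative monoids and the cotriple resolution\<close>

text \<open>
  All levels of the iterated free commutative monoid on (the underlying set of) a monoid live in
  one type of nested multisets. \<open>Base\<close> tags the elements of the given monoid.
\<close>

datatype 'a nested = Base (unBase: 'a) | Node (children: "'a nested multiset")

definition mset_prod :: "'a monoid \<Rightarrow> 'a multiset \<Rightarrow> 'a" where
  "mset_prod G m = (\<Otimes>\<^bsub>G\<^esub>x\<in>set_mset m. x [^]\<^bsub>G\<^esub> count m x)"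

definition free_cmon :: "'a nested set \<Rightarrow> 'a nested monoid" where
  "free_cmon S =
    \<lparr>carrier = {Node m |m. set_mset m \<subseteq> S},
     monoid.mult = (\<lambda>a b. Node (children a + children b)),
     one = Node {#}\<rparr>"

text \<open>
  \<open>cm_iter X k\<close> is the \<open>k\<close>-fold iterate of the cotriple applied to \<open>X\<close>, so
  \<open>cm_iter X (Suc n)\<close> is the object of \<open>n\<close>-simplices of the cotriple resolution.
\<close>

primrec cm_iter :: "'a monoid \<Rightarrow> nat \<Rightarrow> 'a nested monoid" where
  "cm_iter X 0 =
    \<lparr>carrier = Base ` carrier X,
     monoid.mult = (\<lambda>a b. Base (unBase a \<otimes>\<^bsub>X\<^esub> unBase b)),
     one = Base \<one>\<^bsub>X\<^esub>\<rparr>"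
| "cm_iter X (Suc k) = free_cmon (carrier (cm_iter X k))"

definition cm_counit :: "'a monoid \<Rightarrow> nat \<Rightarrow> 'a nested \<Rightarrow> 'a nested" where
  "cm_counit X k t = mset_prod (cm_iter X k) (children t)"

text \<open>
  With $N$ the cotriple and $\varepsilon$ its counit, \<open>cm_face X i k\<close> is
  $N^i \varepsilon N^{k-i} : N^{k+1} X \to N^k X$, for \<open>i \<le> k\<close>.
\<close>

primrec cm_face :: "'a monoid \<Rightarrow> nat \<Rightarrow> nat \<Rightarrow> 'a nested \<Rightarrow> 'a nested" where
  "cm_face X 0 k t = cm_counit X k t"
| "cm_face X (Suc i) k t = Node (image_mset (cm_face X i (k - 1)) (children t))"

primrec cm_aug :: "'a monoid \<Rightarrow> nat \<Rightarrow> 'a nested \<Rightarrow> 'a" where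
  "cm_aug X 0 t = unBase t"
| "cm_aug X (Suc k) t = cm_aug X k (cm_counit X k t)"

subsection \<open>The abelianization functor\<close>

text \<open>
  For \<open>\<alpha>\<close> from \<open>Y\<close> to \<open>X\<close>, the left Beck module representing derivations: the generator
  \<open>(u, y)\<close> stands for \<open>u\<^sub>*\<close> applied to the universal derivation at \<open>y\<close>.
\<close>

definition cm_Ab_gens :: "'x monoid \<Rightarrow> 'y monoid \<Rightarrow> ('y \<Rightarrow> 'x) \<Rightarrow> 'x \<Rightarrow> ('x \<times> 'y) set" where
  "cm_Ab_gens X Y \<alpha> x = {(u, y). u \<in> carrier X \<and> y \<in> carrier Y \<and> u \<otimes>\<^bsub>X\<^esub> \<alpha> y = x}"

definition cm_Ab_rels :: "'x monoid \<Rightarrow> 'y monoid \<Rightarrow> ('y \<Rightarrow> 'x) \<Rightarrow> 'x \<Rightarrow> ('x \<times> 'y \<Rightarrow>\<^sub>0 int) set" where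
  "cm_Ab_rels X Y \<alpha> x =
    {frag_of (u, y \<otimes>\<^bsub>Y\<^esub> y') - frag_of (u \<otimes>\<^bsub>X\<^esub> \<alpha> y, y') - frag_of (u \<otimes>\<^bsub>X\<^esub> \<alpha> y', y) |u y y'.
       u \<in> carrier X \<and> y \<in> carrier Y \<and> y' \<in> carrier Y \<and> u \<otimes>\<^bsub>X\<^esub> (\<alpha> y \<otimes>\<^bsub>X\<^esub> \<alpha> y') = x}"

definition cm_Ab :: "'x monoid \<Rightarrow> 'y monoid \<Rightarrow> ('y \<Rightarrow> 'x) \<Rightarrow> ('x, ('x \<times> 'y \<Rightarrow>\<^sub>0 int) set) beck" where
  "cm_Ab X Y \<alpha> =
    \<lparr>part = (\<lambda>x. presented (cm_Ab_gens X Y \<alpha> x) (cm_Ab_rels X Y \<alpha> x)),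
     tr = (\<lambda>y x. presented_map (cm_Ab_gens X Y \<alpha> (x \<otimes>\<^bsub>X\<^esub> y)) (cm_Ab_rels X Y \<alpha> (x \<otimes>\<^bsub>X\<^esub> y))
                  (\<lambda>(u, b). (y \<otimes>\<^bsub>X\<^esub> u, b)))\<rparr>"

definition cm_derivations ::
    "'x monoid \<Rightarrow> 'y monoid \<Rightarrow> ('y \<Rightarrow> 'x) \<Rightarrow> ('x, 'c) beck \<Rightarrow> ('y \<Rightarrow> 'c) set" where
  "cm_derivations X Y \<alpha> N =
    {s \<in> (\<Pi>\<^sub>E y\<in>carrier Y. carrier (part N (\<alpha> y))). \<forall>y\<in>carrier Y. \<forall>y'\<in>carrier Y.
       s (y \<otimes>\<^bsub>Y\<^esub> y') = tr N (\<alpha> y) (\<alpha> y') (s y') \<otimes>\<^bsub>part N (\<alpha> (y \<otimes>\<^bsub>Y\<^esub> y'))\<^esub> tr N (\<alpha> y') (\<alpha> y) (s y)}"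

lemma cm_Ab_rels_closed:
  assumes X: "comm_monoid X" and Y: "monoid Y" and \<alpha>: "\<alpha> \<in> hom Y X"
  shows "cm_Ab_rels X Y \<alpha> x \<subseteq> carrier (free_Abelian_group (cm_Ab_gens X Y \<alpha> x))"
proof
  interpret X: comm_monoid X by fact
  interpret Y: monoid Y by fact
  have cl: "\<alpha> y \<in> carrier X" if "y \<in> carrier Y" for y
    using \<alpha> that by (rule hom_in_carrier)
  fix r assume "r \<in> cm_Ab_rels X Y \<alpha> x"
  then show "r \<in> carrier (free_Abelian_group (cm_Ab_gens X Y \<alpha> x))"
    unfolding cm_Ab_rels_def
    by (auto simp del: carrier_free_Abelian_group_iff intro!: frag_of_diff3_closed
        simp: cm_Ab_gens_def cl hom_mult[OF \<alpha>] X.m_ac)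
qed

lemma cm_Ab_tr:
  assumes X: "comm_monoid X" and Y: "monoid Y" and \<alpha>: "\<alpha> \<in> hom Y X" and y: "y \<in> carrier X"
  shows "tr (cm_Ab X Y \<alpha>) y x \<in> hom (part (cm_Ab X Y \<alpha>) x) (part (cm_Ab X Y \<alpha>) (x \<otimes>\<^bsub>X\<^esub> y))" (is ?hom)
    and "(u, b) \<in> cm_Ab_gens X Y \<alpha> x \<Longrightarrow>
      tr (cm_Ab X Y \<alpha>) y x (presented_class (cm_Ab_gens X Y \<alpha> x) (cm_Ab_rels X Y \<alpha> x) (u, b)) =
      presented_class (cm_Ab_gens X Y \<alpha> (x \<otimes>\<^bsub>X\<^esub> y)) (cm_Ab_rels X Y \<alpha> (x \<otimes>\<^bsub>X\<^esub> y)) (y \<otimes>\<^bsub>X\<^esub> u, b)"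
proof -
  interpret X: comm_monoid X by fact
  interpret Y: monoid Y by fact
  have cl: "\<alpha> y \<in> carrier X" if "y \<in> carrier Y" for y
    using \<alpha> that by (rule hom_in_carrier)
  have 1: "(\<lambda>(u, b). (y \<otimes>\<^bsub>X\<^esub> u, b)) s \<in> cm_Ab_gens X Y \<alpha> (x \<otimes>\<^bsub>X\<^esub> y)"
    if "s \<in> cm_Ab_gens X Y \<alpha> x" for s
    using that y by (auto simp: cm_Ab_gens_def cl X.m_ac)
  have 2: "frag_extend (\<lambda>g. frag_of ((\<lambda>(u, b). (y \<otimes>\<^bsub>X\<^esub> u, b)) g)) r \<in> cm_Ab_rels X Y \<alpha> (x \<otimes>\<^bsub>X\<^esub> y)"
    if r: "r \<in> cm_Ab_rels X Y \<alpha> x" for r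
  proof -
    obtain u b b' where *: "r = frag_of (u, b \<otimes>\<^bsub>Y\<^esub> b') - frag_of (u \<otimes>\<^bsub>X\<^esub> \<alpha> b, b') - frag_of (u \<otimes>\<^bsub>X\<^esub> \<alpha> b', b)"
      "u \<in> carrier X" "b \<in> carrier Y" "b' \<in> carrier Y" "u \<otimes>\<^bsub>X\<^esub> (\<alpha> b \<otimes>\<^bsub>X\<^esub> \<alpha> b') = x"
      using r by (auto simp: cm_Ab_rels_def)
    show ?thesis
      unfolding cm_Ab_rels_def *(1) frag_extend_diff3
      by (rule CollectI, rule exI[of _ "y \<otimes>\<^bsub>X\<^esub> u"], rule exI[of _ b], rule exI[of _ b'])
         (use * y in \<open>auto simp: X.m_assoc cl X.m_ac\<close>)
  qed
  note R = cm_Ab_rels_closed[OF X Y \<alpha>]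
  show ?hom
    unfolding cm_Ab_def by simp (rule presented_map_hom[OF R R]; fact 1 2)
  show "tr (cm_Ab X Y \<alpha>) y x (presented_class (cm_Ab_gens X Y \<alpha> x) (cm_Ab_rels X Y \<alpha> x) (u, b)) =
      presented_class (cm_Ab_gens X Y \<alpha> (x \<otimes>\<^bsub>X\<^esub> y)) (cm_Ab_rels X Y \<alpha> (x \<otimes>\<^bsub>X\<^esub> y)) (y \<otimes>\<^bsub>X\<^esub> u, b)"
    if "(u, b) \<in> cm_Ab_gens X Y \<alpha> x"
    using presented_map_class[OF R R, of x "\<lambda>(u, b). (y \<otimes>\<^bsub>X\<^esub> u, b)" "x \<otimes>\<^bsub>X\<^esub> y", OF _ _ that] 1 2
    by (simp add: cm_Ab_def)
qed


text \<open>\<open>cm_Ab X Y \<alpha>\<close> represents derivations.\<close>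

lemma cm_Ab_represents:
  assumes X: "comm_monoid X" and Y: "comm_monoid Y" and \<alpha>: "\<alpha> \<in> hom Y X" and N: "left_beck X N"
  shows "bij_betw
    (\<lambda>\<theta>. \<lambda>y\<in>carrier Y. \<theta> (\<alpha> y)
       (presented_class (cm_Ab_gens X Y \<alpha> (\<alpha> y)) (cm_Ab_rels X Y \<alpha> (\<alpha> y)) (\<one>\<^bsub>X\<^esub>, y)))
    (carrier (beck_Hom X (cm_Ab X Y \<alpha>) N)) (cm_derivations X Y \<alpha> N)"
    (is "bij_betw ?D ?Hom ?Der")
proof -
  interpret X: comm_monoid X by fact
  interpret Y: comm_monoid Y by fact
  let ?P = "cm_Ab X Y \<alpha>"
  let ?S = "cm_Ab_gens X Y \<alpha>" and ?R = "cm_Ab_rels X Y \<alpha>"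
  let ?cl = "\<lambda>x. presented_class (?S x) (?R x)"
  have cl [simp]: "\<alpha> y \<in> carrier X" if "y \<in> carrier Y" for y
    using \<alpha> that by (rule hom_in_carrier)
  have Ym: "monoid Y" by unfold_locales
  note R = cm_Ab_rels_closed[OF X Ym \<alpha>]
  have part_P: "part ?P x = presented (?S x) (?R x)" for x by (simp add: cm_Ab_def)
  have gr: "comm_group (part N x)" if "x \<in> carrier X" for x
    using N that by (simp add: left_beck_def)
  have trN: "tr N y x \<in> hom (part N x) (part N (x \<otimes>\<^bsub>X\<^esub> y))" if "x \<in> carrier X" "y \<in> carrier X" for x y
    using N that by (simp add: left_beck_def)
  have trN_closed: "tr N y x n \<in> carrier (part N (x \<otimes>\<^bsub>X\<^esub> y))"
    if "x \<in> carrier X" "y \<in> carrier X" "n \<in> carrier (part N x)" for x y n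
    using trN[OF that(1,2)] that(3) by (rule hom_in_carrier)
  have trN_1: "tr N \<one>\<^bsub>X\<^esub> x n = n" if "x \<in> carrier X" "n \<in> carrier (part N x)" for x n
    using N that by (simp add: left_beck_def)
  have trN_tr: "tr N z (x \<otimes>\<^bsub>X\<^esub> y) (tr N y x n) = tr N (y \<otimes>\<^bsub>X\<^esub> z) x n"
    if "x \<in> carrier X" "y \<in> carrier X" "z \<in> carrier X" "n \<in> carrier (part N x)" for x y z n
    using N that by (simp add: left_beck_def)
  have one_gen: "(\<one>\<^bsub>X\<^esub>, y) \<in> ?S (\<alpha> y)" if "y \<in> carrier Y" for y
    using that by (simp add: cm_Ab_gens_def)
  have class_eq: "?cl (u \<otimes>\<^bsub>X\<^esub> \<alpha> y) (u, y) = tr ?P u (\<alpha> y) (?cl (\<alpha> y) (\<one>\<^bsub>X\<^esub>, y))"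
    if "u \<in> carrier X" "y \<in> carrier Y" for u y
    using cm_Ab_tr(2)[OF X Ym \<alpha> that(1) one_gen[OF that(2)]] that by (simp add: X.m_comm)
  have \<theta>_class: "\<theta> (u \<otimes>\<^bsub>X\<^esub> \<alpha> y) (?cl (u \<otimes>\<^bsub>X\<^esub> \<alpha> y) (u, y)) = tr N u (\<alpha> y) (?D \<theta> y)"
    if "\<theta> \<in> ?Hom" "u \<in> carrier X" "y \<in> carrier Y" for \<theta> u y
  proof -
    have "?cl (\<alpha> y) (\<one>\<^bsub>X\<^esub>, y) \<in> carrier (part ?P (\<alpha> y))"
      using that by (simp add: part_P presented_class_closed one_gen)
    then have "\<theta> (\<alpha> y \<otimes>\<^bsub>X\<^esub> u) (tr ?P u (\<alpha> y) (?cl (\<alpha> y) (\<one>\<^bsub>X\<^esub>, y))) =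
        tr N u (\<alpha> y) (\<theta> (\<alpha> y) (?cl (\<alpha> y) (\<one>\<^bsub>X\<^esub>, y)))"
      using that by (simp add: beck_Hom_def)
    then show ?thesis
      using that by (simp add: class_eq) (simp add: X.m_comm)
  qed
  have \<theta>_hom: "\<theta> x \<in> hom (presented (?S x) (?R x)) (part N x)" if "\<theta> \<in> ?Hom" "x \<in> carrier X" for \<theta> x
    using that by (simp add: beck_Hom_def part_P)
  show ?thesis
  proof (rule bij_betw_imageI)
    show "inj_on ?D ?Hom"
    proof (rule inj_onI)
      fix \<theta> \<theta>' assume H: "\<theta> \<in> ?Hom" "\<theta>' \<in> ?Hom" and eq: "?D \<theta> = ?D \<theta>'"
      show "\<theta> = \<theta>'"
      proof (rule extensionalityI[of _ "carrier X"])
        fix x assume x: "x \<in> carrier X"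
        show "\<theta> x = \<theta>' x"
        proof (rule extensionalityI[of _ "carrier (part ?P x)"])
          show "\<theta> x \<in> extensional (carrier (part ?P x))" "\<theta>' x \<in> extensional (carrier (part ?P x))"
            using H x by (auto simp: beck_Hom_def)
          fix c assume "c \<in> carrier (part ?P x)"
          then have c: "c \<in> carrier (presented (?S x) (?R x))" by (simp add: part_P)
          show "\<theta> x c = \<theta>' x c"
          proof (rule presented_hom_eqI[OF R _ \<theta>_hom[OF H(1) x] \<theta>_hom[OF H(2) x] _ c])
            show "group (part N x)" using gr[OF x] by (simp add: comm_group_def)
            fix s assume "s \<in> ?S x"
            then obtain u y where "s = (u, y)" "u \<in> carrier X" "y \<in> carrier Y" "x = u \<otimes>\<^bsub>X\<^esub> \<alpha> y"
              by (auto simp: cm_Ab_gens_def)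
            then show "\<theta> x (?cl x s) = \<theta>' x (?cl x s)"
              using \<theta>_class[of \<theta> u y] \<theta>_class[of \<theta>' u y] eq H by simp
          qed
        qed
      qed (use H in \<open>auto simp: beck_Hom_def\<close>)
    qed
  next
    have D_closed: "?D \<theta> y \<in> carrier (part N (\<alpha> y))" if "\<theta> \<in> ?Hom" "y \<in> carrier Y" for \<theta> y
      using hom_in_carrier[OF \<theta>_hom presented_class_closed[OF one_gen], OF that(1) cl] that by simp
    show "?D ` ?Hom = ?Der"
    proof (intro equalityI subsetI)
      fix s assume "s \<in> ?D ` ?Hom"
      then obtain \<theta> where \<theta>: "\<theta> \<in> ?Hom" and s: "s = ?D \<theta>" by blast
      have "s (y \<otimes>\<^bsub>Y\<^esub> y') = tr N (\<alpha> y) (\<alpha> y') (s y') \<otimes>\<^bsub>part N (\<alpha> (y \<otimes>\<^bsub>Y\<^esub> y'))\<^esub> tr N (\<alpha> y') (\<alpha> y) (s y)"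
        if y: "y \<in> carrier Y" "y' \<in> carrier Y" for y y'
      proof -
        let ?z = "\<alpha> (y \<otimes>\<^bsub>Y\<^esub> y')"
        have z: "?z = \<alpha> y \<otimes>\<^bsub>X\<^esub> \<alpha> y'" using y by (simp add: hom_mult[OF \<alpha>])
        have gens: "(\<one>\<^bsub>X\<^esub>, y \<otimes>\<^bsub>Y\<^esub> y') \<in> ?S ?z" "(\<alpha> y, y') \<in> ?S ?z" "(\<alpha> y', y) \<in> ?S ?z"
          using y by (auto simp: cm_Ab_gens_def z X.m_comm)
        have rel: "frag_of (\<one>\<^bsub>X\<^esub>, y \<otimes>\<^bsub>Y\<^esub> y') - frag_of (\<alpha> y, y') - frag_of (\<alpha> y', y) \<in> ?R ?z"
          unfolding cm_Ab_rels_def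
          by (rule CollectI, rule exI[of _ "\<one>\<^bsub>X\<^esub>"], rule exI[of _ y], rule exI[of _ y'])
            (use y in \<open>simp add: z\<close>)
        have "s (y \<otimes>\<^bsub>Y\<^esub> y') = \<theta> ?z (?cl ?z (\<one>\<^bsub>X\<^esub>, y \<otimes>\<^bsub>Y\<^esub> y'))"
          using y by (simp add: s)
        also have "\<dots> = \<theta> ?z (?cl ?z (\<alpha> y, y')) \<otimes>\<^bsub>part N ?z\<^esub> \<theta> ?z (?cl ?z (\<alpha> y', y))"
          unfolding presented_class_eqI[OF R rel gens]
          by (rule hom_mult[OF \<theta>_hom[OF \<theta>]]) (use y gens in \<open>auto intro: presented_class_closed\<close>)
        also have "\<theta> ?z (?cl ?z (\<alpha> y, y')) = tr N (\<alpha> y) (\<alpha> y') (s y')"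
          using \<theta>_class[OF \<theta>, of "\<alpha> y" y'] y by (simp add: z s)
        also have "\<theta> ?z (?cl ?z (\<alpha> y', y)) = tr N (\<alpha> y') (\<alpha> y) (s y)"
          using \<theta>_class[OF \<theta>, of "\<alpha> y'" y] y by (simp add: z s X.m_comm)
        finally show ?thesis .
      qed
      then show "s \<in> ?Der"
        using D_closed[OF \<theta>] by (auto simp: cm_derivations_def s)
    next
      fix s assume s: "s \<in> ?Der"
      have s_closed: "s y \<in> carrier (part N (\<alpha> y))" if "y \<in> carrier Y" for y
        using s that by (auto simp: cm_derivations_def)
      have s_mult: "s (y \<otimes>\<^bsub>Y\<^esub> y') =
          tr N (\<alpha> y) (\<alpha> y') (s y') \<otimes>\<^bsub>part N (\<alpha> (y \<otimes>\<^bsub>Y\<^esub> y'))\<^esub> tr N (\<alpha> y') (\<alpha> y) (s y)"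
        if "y \<in> carrier Y" "y' \<in> carrier Y" for y y'
        using s that by (auto simp: cm_derivations_def)
      let ?f = "\<lambda>(u, y). tr N u (\<alpha> y) (s y)"
      have f_closed: "?f g \<in> carrier (part N x)" if g: "g \<in> ?S x" for g x
      proof -
        obtain u y where "g = (u, y)" "u \<in> carrier X" "y \<in> carrier Y" "x = \<alpha> y \<otimes>\<^bsub>X\<^esub> u"
          using g by (auto simp: cm_Ab_gens_def X.m_comm)
        then show ?thesis using trN_closed[of "\<alpha> y" u "s y"] s_closed by simp
      qed
      have "\<exists>k. \<forall>x\<in>carrier X. k x \<in> hom (presented (?S x) (?R x)) (part N x) \<and>
          (\<forall>g\<in>?S x. k x (?cl x g) = ?f g)"
      proof (intro bchoice ballI)
        fix x assume x: "x \<in> carrier X"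
        have rels: "\<exists>a\<in>?S x. \<exists>b\<in>?S x. \<exists>c\<in>?S x.
            r = frag_of a - frag_of b - frag_of c \<and> ?f a = ?f b \<otimes>\<^bsub>part N x\<^esub> ?f c"
          if r: "r \<in> ?R x" for r
        proof -
          obtain u y y' where *:
            "r = frag_of (u, y \<otimes>\<^bsub>Y\<^esub> y') - frag_of (u \<otimes>\<^bsub>X\<^esub> \<alpha> y, y') - frag_of (u \<otimes>\<^bsub>X\<^esub> \<alpha> y', y)"
            "u \<in> carrier X" "y \<in> carrier Y" "y' \<in> carrier Y" "u \<otimes>\<^bsub>X\<^esub> (\<alpha> y \<otimes>\<^bsub>X\<^esub> \<alpha> y') = x"
            using r by (auto simp: cm_Ab_rels_def)
          have z: "\<alpha> (y \<otimes>\<^bsub>Y\<^esub> y') = \<alpha> y \<otimes>\<^bsub>X\<^esub> \<alpha> y'" "\<alpha> y' \<otimes>\<^bsub>X\<^esub> \<alpha> y = \<alpha> y \<otimes>\<^bsub>X\<^esub> \<alpha> y'"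
            "\<alpha> y \<otimes>\<^bsub>X\<^esub> \<alpha> y' \<otimes>\<^bsub>X\<^esub> u = x"
            using * by (simp_all add: hom_mult[OF \<alpha>] X.m_comm)
          have t: "tr N (\<alpha> y) (\<alpha> y') (s y') \<in> carrier (part N (\<alpha> y \<otimes>\<^bsub>X\<^esub> \<alpha> y'))"
            "tr N (\<alpha> y') (\<alpha> y) (s y) \<in> carrier (part N (\<alpha> y \<otimes>\<^bsub>X\<^esub> \<alpha> y'))"
            using trN_closed[of "\<alpha> y'" "\<alpha> y" "s y'"] trN_closed[of "\<alpha> y" "\<alpha> y'" "s y"] * s_closed z by auto
          have "?f (u, y \<otimes>\<^bsub>Y\<^esub> y') = tr N u (\<alpha> y \<otimes>\<^bsub>X\<^esub> \<alpha> y') (tr N (\<alpha> y) (\<alpha> y') (s y')) \<otimes>\<^bsub>part N x\<^esub>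
              tr N u (\<alpha> y \<otimes>\<^bsub>X\<^esub> \<alpha> y') (tr N (\<alpha> y') (\<alpha> y) (s y))"
            using hom_mult[OF trN t] * by (simp add: s_mult z)
          also have "tr N u (\<alpha> y \<otimes>\<^bsub>X\<^esub> \<alpha> y') (tr N (\<alpha> y) (\<alpha> y') (s y')) = ?f (u \<otimes>\<^bsub>X\<^esub> \<alpha> y, y')"
            using trN_tr[of "\<alpha> y'" "\<alpha> y" u "s y'", unfolded z(2)] * s_closed by (simp add: X.m_comm)
          also have "tr N u (\<alpha> y \<otimes>\<^bsub>X\<^esub> \<alpha> y') (tr N (\<alpha> y') (\<alpha> y) (s y)) = ?f (u \<otimes>\<^bsub>X\<^esub> \<alpha> y', y)"
            using trN_tr[of "\<alpha> y" "\<alpha> y'" u "s y"] * s_closed by (simp add: X.m_comm)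
          finally have "?f (u, y \<otimes>\<^bsub>Y\<^esub> y') =
            ?f (u \<otimes>\<^bsub>X\<^esub> \<alpha> y, y') \<otimes>\<^bsub>part N x\<^esub> ?f (u \<otimes>\<^bsub>X\<^esub> \<alpha> y', y)" .
          moreover have "(u, y \<otimes>\<^bsub>Y\<^esub> y') \<in> ?S x" "(u \<otimes>\<^bsub>X\<^esub> \<alpha> y, y') \<in> ?S x" "(u \<otimes>\<^bsub>X\<^esub> \<alpha> y', y) \<in> ?S x"
            unfolding cm_Ab_gens_def *(5)[symmetric] using *(2-4) by (simp_all add: z(1) X.m_ac)
          ultimately show ?thesis using *(1) by blast
        qed
        show "\<exists>k. k \<in> hom (presented (?S x) (?R x)) (part N x) \<and> (\<forall>g\<in>?S x. k (?cl x g) = ?f g)"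
        proof (rule presented_hom_exists[of "part N x" "?S x" ?f "?R x"])
          show "comm_group (part N x)" by (rule gr[OF x])
        qed (use f_closed rels in blast)+
      qed
      then obtain k where k: "\<And>x. x \<in> carrier X \<Longrightarrow> k x \<in> hom (presented (?S x) (?R x)) (part N x)"
        and kf: "\<And>x g. x \<in> carrier X \<Longrightarrow> g \<in> ?S x \<Longrightarrow> k x (?cl x g) = ?f g"
        by blast
      define \<theta> where "\<theta> = (\<lambda>x\<in>carrier X. \<lambda>c\<in>carrier (part ?P x). k x c)"
      have k_tr: "k (x \<otimes>\<^bsub>X\<^esub> y) (tr ?P y x c) = tr N y x (k x c)"
        if xy: "x \<in> carrier X" "y \<in> carrier X" and c: "c \<in> carrier (part ?P x)" for x y c
      proof -
        note t = cm_Ab_tr[OF X Ym \<alpha> xy(2), unfolded part_P]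
        have "(k (x \<otimes>\<^bsub>X\<^esub> y) \<circ> tr ?P y x) c = (tr N y x \<circ> k x) c"
        proof (rule presented_hom_eqI[OF R])
          show "group (part N (x \<otimes>\<^bsub>X\<^esub> y))" using gr[of "x \<otimes>\<^bsub>X\<^esub> y"] xy by (simp add: comm_group_def)
          show "k (x \<otimes>\<^bsub>X\<^esub> y) \<circ> tr ?P y x \<in> hom (presented (?S x) (?R x)) (part N (x \<otimes>\<^bsub>X\<^esub> y))"
            by (rule Group.hom_compose[OF t(1) k]) (use xy in simp)
          show "tr N y x \<circ> k x \<in> hom (presented (?S x) (?R x)) (part N (x \<otimes>\<^bsub>X\<^esub> y))"
            by (rule Group.hom_compose[OF k trN]) (use xy in simp_all)
          show "c \<in> carrier (presented (?S x) (?R x))" using c by (simp add: part_P)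
          fix g assume g: "g \<in> ?S x"
          then obtain u b where ub: "g = (u, b)" "u \<in> carrier X" "b \<in> carrier Y" "x = u \<otimes>\<^bsub>X\<^esub> \<alpha> b"
            by (auto simp: cm_Ab_gens_def)
          have "(y \<otimes>\<^bsub>X\<^esub> u, b) \<in> ?S (x \<otimes>\<^bsub>X\<^esub> y)"
            using ub xy by (auto simp: cm_Ab_gens_def X.m_ac)
          then show "(k (x \<otimes>\<^bsub>X\<^esub> y) \<circ> tr ?P y x) (?cl x g) = (tr N y x \<circ> k x) (?cl x g)"
            using t(2)[of u b x] g ub(1) xy kf[of x g] kf[of "x \<otimes>\<^bsub>X\<^esub> y" "(y \<otimes>\<^bsub>X\<^esub> u, b)"]
              trN_tr[of "\<alpha> b" u y "s b", unfolded X.m_comm[OF cl[OF ub(3)] ub(2)] X.m_comm[OF ub(2) xy(2)]]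
              s_closed[of b] ub(2,3)
            by (simp flip: ub(4))
        qed
        then show ?thesis by simp
      qed
      have tr_closed: "tr ?P y x c \<in> carrier (part ?P (x \<otimes>\<^bsub>X\<^esub> y))"
        if "y \<in> carrier X" "c \<in> carrier (part ?P x)" for x y c
        using hom_in_carrier[OF cm_Ab_tr(1)[OF X Ym \<alpha> that(1)] that(2)] .
      have "\<theta> \<in> ?Hom"
        unfolding beck_Hom_def \<theta>_def using k
        by (auto simp: k_tr[unfolded part_P] tr_closed[unfolded part_P] part_P hom_def Pi_iff
            intro!: monoid.m_closed[OF group.is_monoid[OF comm_group.axioms(2)[OF comm_group_presented[OF R]]]])
      moreover have "?D \<theta> = s"
      proof (rule extensionalityI[of _ "carrier Y"])
        show "s \<in> extensional (carrier Y)" using s by (auto simp: cm_derivations_def PiE_def)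
        fix y assume y: "y \<in> carrier Y"
        have "?D \<theta> y = k (\<alpha> y) (?cl (\<alpha> y) (\<one>\<^bsub>X\<^esub>, y))"
          using y by (simp add: \<theta>_def part_P presented_class_closed one_gen)
        also have "\<dots> = s y"
          using y by (simp add: kf one_gen trN_1 s_closed)
        finally show "?D \<theta> y = s y" .
      qed simp
      ultimately show "s \<in> ?D ` ?Hom" by blast
    qed
  qed
qed

text \<open>
  The map into the degree \<open>x\<close> part of \<open>cm_Ab X Y \<alpha>\<close> induced by \<open>g\<close> on coefficients and \<open>f\<close> on
  monoids; here \<open>g = id\<close> for a map of monoids over \<open>X\<close>.
\<close>

definition cm_Ab_map ::
    "'x monoid \<Rightarrow> 'y monoid \<Rightarrow> ('y \<Rightarrow> 'x) \<Rightarrow> ('w \<Rightarrow> 'x) \<Rightarrow> ('z \<Rightarrow> 'y) \<Rightarrow> 'x \<Rightarrow>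
     ('w \<times> 'z \<Rightarrow>\<^sub>0 int) set \<Rightarrow> ('x \<times> 'y \<Rightarrow>\<^sub>0 int) set" where
  "cm_Ab_map X Y \<alpha> g f x =
    presented_map (cm_Ab_gens X Y \<alpha> x) (cm_Ab_rels X Y \<alpha> x) (\<lambda>(u, y). (g u, f y))"

subsection \<open>Homology and cohomology\<close>

type_synonym 'x cm_el = "('x \<times> 'x nested \<Rightarrow>\<^sub>0 int) set"

text \<open>The simplicial left Beck module obtained by abelianizing the cotriple resolution.\<close>

definition cm_res :: "'x monoid \<Rightarrow> nat \<Rightarrow> ('x, 'x cm_el) beck" where
  "cm_res X n = cm_Ab X (cm_iter X (Suc n)) (cm_aug X (Suc n))"

definition cm_res_face :: "'x monoid \<Rightarrow> 'x \<Rightarrow> nat \<Rightarrow> nat \<Rightarrow> 'x cm_el \<Rightarrow> 'x cm_el" where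
  "cm_res_face X x n i =
    cm_Ab_map X (cm_iter X (Suc n)) (cm_aug X (Suc n)) id (cm_face X i (Suc n)) x"

definition cm_res_diff :: "'x monoid \<Rightarrow> 'x \<Rightarrow> nat \<Rightarrow> 'x cm_el \<Rightarrow> 'x cm_el" where
  "cm_res_diff X x = simp_diff (\<lambda>n. part (cm_res X n) x) (cm_res_face X x)"

definition HQ_CM :: "'x monoid \<Rightarrow> nat \<Rightarrow> ('x, 'x cm_el set) beck" where
  "HQ_CM X n =
    \<lparr>part = (\<lambda>x. simp_pi (\<lambda>k. part (cm_res X k) x) (cm_res_face X x) n),
     tr = (\<lambda>y x. simp_pi_map (\<lambda>k. part (cm_res X k) (x \<otimes>\<^bsub>X\<^esub> y)) (cm_res_face X (x \<otimes>\<^bsub>X\<^esub> y)) n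
                  (tr (cm_res X n) y x))\<rparr>"

definition cm_tensor_res ::
    "'x monoid \<Rightarrow> ('x, 'm) beck \<Rightarrow> nat \<Rightarrow> ('x \<times> 'm \<times> 'x cm_el \<Rightarrow>\<^sub>0 int) set monoid" where
  "cm_tensor_res X M n = beck_tensor X M (cm_res X n)"

definition cm_tensor_res_face ::
    "'x monoid \<Rightarrow> ('x, 'm) beck \<Rightarrow> nat \<Rightarrow> nat \<Rightarrow>
     ('x \<times> 'm \<times> 'x cm_el \<Rightarrow>\<^sub>0 int) set \<Rightarrow> ('x \<times> 'm \<times> 'x cm_el \<Rightarrow>\<^sub>0 int) set" where
  "cm_tensor_res_face X M n i =
    presented_map (tensor_gens X M (cm_res X n)) (beck_tensor_rels X M (cm_res X n))
      (\<lambda>(z, m, c). (z, m, cm_res_face X z n i c))"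

definition HQ_CM_homology ::
    "'x monoid \<Rightarrow> ('x, 'm) beck \<Rightarrow> nat \<Rightarrow> ('x \<times> 'm \<times> 'x cm_el \<Rightarrow>\<^sub>0 int) set set monoid" where
  "HQ_CM_homology X M n = simp_pi (cm_tensor_res X M) (cm_tensor_res_face X M) n"

definition cm_cochains ::
    "'x monoid \<Rightarrow> ('x, 'c) beck \<Rightarrow> nat \<Rightarrow> ('x \<Rightarrow> 'x cm_el \<Rightarrow> 'c) monoid" where
  "cm_cochains X N n = beck_Hom X (cm_res X n) N"

definition cm_coboundary ::
    "'x monoid \<Rightarrow> nat \<Rightarrow> ('x \<Rightarrow> 'x cm_el \<Rightarrow> 'c) \<Rightarrow> ('x \<Rightarrow> 'x cm_el \<Rightarrow> 'c)" where
  "cm_coboundary X n \<theta> =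
    (\<lambda>x\<in>carrier X. \<lambda>c\<in>carrier (part (cm_res X (Suc n)) x). \<theta> x (cm_res_diff X x n c))"

definition HQ_CM_cohomology ::
    "'x monoid \<Rightarrow> ('x, 'c) beck \<Rightarrow> nat \<Rightarrow> ('x \<Rightarrow> 'x cm_el \<Rightarrow> 'c) set monoid" where
  "HQ_CM_cohomology X N n = cohomology (cm_cochains X N) (cm_coboundary X) n"

subsection \<open>Functoriality in the monoid\<close>

text \<open>
  The maps induced by a homomorphism \<open>f\<close> from \<open>X\<close> to \<open>X'\<close>. The coefficients in homology and
  cohomology are modules over \<open>X'\<close>, restricted along \<open>f\<close> for the groups of \<open>X\<close>; cohomology is
  contravariant.
\<close>

definition cm_res_map ::
    "'x monoid \<Rightarrow> ('w \<Rightarrow> 'x) \<Rightarrow> nat \<Rightarrow> 'w \<Rightarrow> 'w cm_el \<Rightarrow> 'x cm_el" where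
  "cm_res_map X' f n x =
    cm_Ab_map X' (cm_iter X' (Suc n)) (cm_aug X' (Suc n)) f (map_nested f) (f x)"

definition HQ_CM_map ::
    "'x monoid \<Rightarrow> ('w \<Rightarrow> 'x) \<Rightarrow> nat \<Rightarrow> 'w \<Rightarrow> 'w cm_el set \<Rightarrow> 'x cm_el set" where
  "HQ_CM_map X' f n x =
    simp_pi_map (\<lambda>k. part (cm_res X' k) (f x)) (cm_res_face X' (f x)) n (cm_res_map X' f n x)"

definition HQ_CM_homology_map ::
    "'x monoid \<Rightarrow> ('w \<Rightarrow> 'x) \<Rightarrow> ('x, 'm) beck \<Rightarrow> nat \<Rightarrow>
     ('w \<times> 'm \<times> 'w cm_el \<Rightarrow>\<^sub>0 int) set set \<Rightarrow> ('x \<times> 'm \<times> 'x cm_el \<Rightarrow>\<^sub>0 int) set set" where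
  "HQ_CM_homology_map X' f M n =
    simp_pi_map (cm_tensor_res X' M) (cm_tensor_res_face X' M) n
      (presented_map (tensor_gens X' M (cm_res X' n)) (beck_tensor_rels X' M (cm_res X' n))
        (\<lambda>(z, m, c). (f z, m, cm_res_map X' f n z c)))"

definition HQ_CM_cohomology_map ::
    "'w monoid \<Rightarrow> 'x monoid \<Rightarrow> ('w \<Rightarrow> 'x) \<Rightarrow> ('x, 'c) beck \<Rightarrow> nat \<Rightarrow>
     ('x \<Rightarrow> 'x cm_el \<Rightarrow> 'c) set \<Rightarrow> ('w \<Rightarrow> 'w cm_el \<Rightarrow> 'c) set" where
  "HQ_CM_cohomology_map X X' f N n =
    coset_map (cm_cochains X (beck_pullback f N) n)
      (coboundaries (cm_cochains X (beck_pullback f N)) (cm_coboundary X) n)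
      (\<lambda>\<theta>. \<lambda>x\<in>carrier X. \<lambda>c\<in>carrier (part (cm_res X n) x). \<theta> (f x) (cm_res_map X' f n x c))"


section \<open>Commutative graded rings and their modules\<close>

text \<open>
  The ground ring is \<open>K = \<int>\<close>: \<open>K\<close>-modules are abelian groups and \<open>K\<close>-linearity is additivity.
  The part in degree \<open>x\<close> of a graded ring \<open>A\<close> is the group \<open>part A x\<close>; \<open>gmul A x y\<close> is the
  multiplication of elements of degrees \<open>x\<close> and \<open>y\<close>.
\<close>

record ('x, 'a) gring = "('x, 'a) graded" +
  gmul :: "'x \<Rightarrow> 'x \<Rightarrow> 'a \<Rightarrow> 'a \<Rightarrow> 'a"
  gone :: "'a"

definition comm_gring :: "'x monoid \<Rightarrow> ('x, 'a) gring \<Rightarrow> bool" where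
  "comm_gring X A \<longleftrightarrow>
    (\<forall>x\<in>carrier X. comm_group (part A x)) \<and>
    gone A \<in> carrier (part A \<one>\<^bsub>X\<^esub>) \<and>
    (\<forall>x\<in>carrier X. \<forall>y\<in>carrier X. \<forall>a\<in>carrier (part A x).
      gmul A x y a \<in> hom (part A y) (part A (x \<otimes>\<^bsub>X\<^esub> y))) \<and>
    (\<forall>x\<in>carrier X. \<forall>y\<in>carrier X. \<forall>b\<in>carrier (part A y).
      (\<lambda>a. gmul A x y a b) \<in> hom (part A x) (part A (x \<otimes>\<^bsub>X\<^esub> y))) \<and>
    (\<forall>x\<in>carrier X. \<forall>a\<in>carrier (part A x). gmul A \<one>\<^bsub>X\<^esub> x (gone A) a = a) \<and>
    (\<forall>x\<in>carrier X. \<forall>y\<in>carrier X. \<forall>a\<in>carrier (part A x). \<forall>b\<in>carrier (part A y).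
      gmul A x y a b = gmul A y x b a) \<and>
    (\<forall>x\<in>carrier X. \<forall>y\<in>carrier X. \<forall>z\<in>carrier X.
      \<forall>a\<in>carrier (part A x). \<forall>b\<in>carrier (part A y). \<forall>c\<in>carrier (part A z).
      gmul A (x \<otimes>\<^bsub>X\<^esub> y) z (gmul A x y a b) c = gmul A x (y \<otimes>\<^bsub>X\<^esub> z) a (gmul A y z b c))"

text \<open>Homomorphisms from \<open>B\<close> to \<open>A\<close>, as families of maps indexed by degrees.\<close>

definition gring_hom :: "'x monoid \<Rightarrow> ('x, 'b) gring \<Rightarrow> ('x, 'a) gring \<Rightarrow> ('x \<Rightarrow> 'b \<Rightarrow> 'a) set" where
  "gring_hom X B A = {\<beta>.
    (\<forall>x\<in>carrier X. \<beta> x \<in> hom (part B x) (part A x)) \<and>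
    \<beta> \<one>\<^bsub>X\<^esub> (gone B) = gone A \<and>
    (\<forall>x\<in>carrier X. \<forall>y\<in>carrier X. \<forall>b\<in>carrier (part B x). \<forall>b'\<in>carrier (part B y).
      \<beta> (x \<otimes>\<^bsub>X\<^esub> y) (gmul B x y b b') = gmul A x y (\<beta> x b) (\<beta> y b'))}"

lemma comm_gringD:
  assumes "comm_gring X A"
  shows "x \<in> carrier X \<Longrightarrow> comm_group (part A x)"
    and "gone A \<in> carrier (part A \<one>\<^bsub>X\<^esub>)"
    and "x \<in> carrier X \<Longrightarrow> y \<in> carrier X \<Longrightarrow> a \<in> carrier (part A x) \<Longrightarrow>
      gmul A x y a \<in> hom (part A y) (part A (x \<otimes>\<^bsub>X\<^esub> y))"
    and "x \<in> carrier X \<Longrightarrow> y \<in> carrier X \<Longrightarrow> b \<in> carrier (part A y) \<Longrightarrow>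
      (\<lambda>a. gmul A x y a b) \<in> hom (part A x) (part A (x \<otimes>\<^bsub>X\<^esub> y))"
    and "x \<in> carrier X \<Longrightarrow> a \<in> carrier (part A x) \<Longrightarrow> gmul A \<one>\<^bsub>X\<^esub> x (gone A) a = a"
    and "x \<in> carrier X \<Longrightarrow> y \<in> carrier X \<Longrightarrow> a \<in> carrier (part A x) \<Longrightarrow> b \<in> carrier (part A y) \<Longrightarrow>
      gmul A x y a b = gmul A y x b a"
    and "x \<in> carrier X \<Longrightarrow> y \<in> carrier X \<Longrightarrow> z \<in> carrier X \<Longrightarrow>
      a \<in> carrier (part A x) \<Longrightarrow> b \<in> carrier (part A y) \<Longrightarrow> c \<in> carrier (part A z) \<Longrightarrow>
      gmul A (x \<otimes>\<^bsub>X\<^esub> y) z (gmul A x y a b) c = gmul A x (y \<otimes>\<^bsub>X\<^esub> z) a (gmul A y z b c)"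
  using assms unfolding comm_gring_def by blast+

lemma comm_gring_mult_closed:
  assumes "comm_gring X A" "x \<in> carrier X" "y \<in> carrier X" "a \<in> carrier (part A x)" "b \<in> carrier (part A y)"
  shows "gmul A x y a b \<in> carrier (part A (x \<otimes>\<^bsub>X\<^esub> y))"
  by (rule hom_in_carrier[OF comm_gringD(3)[OF assms(1-4)] assms(5)])

lemma comm_gring_add_closed:
  assumes "comm_gring X A" "x \<in> carrier X" "a \<in> carrier (part A x)" "b \<in> carrier (part A x)"
  shows "a \<otimes>\<^bsub>part A x\<^esub> b \<in> carrier (part A x)"
  by (rule monoid.m_closed[OF group.is_monoid[OF comm_group.axioms(2)[OF comm_gringD(1)[OF assms(1,2)]]] assms(3,4)])

lemma gring_homD:
  assumes "\<beta> \<in> gring_hom X B A"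
  shows "x \<in> carrier X \<Longrightarrow> \<beta> x \<in> hom (part B x) (part A x)"
    and "x \<in> carrier X \<Longrightarrow> b \<in> carrier (part B x) \<Longrightarrow> \<beta> x b \<in> carrier (part A x)"
    and "x \<in> carrier X \<Longrightarrow> y \<in> carrier X \<Longrightarrow> b \<in> carrier (part B x) \<Longrightarrow> b' \<in> carrier (part B y) \<Longrightarrow>
      \<beta> (x \<otimes>\<^bsub>X\<^esub> y) (gmul B x y b b') = gmul A x y (\<beta> x b) (\<beta> y b')"
  using assms by (auto simp: gring_hom_def hom_def)

text \<open>
  In a left module, \<open>act N y x a\<close> is the action of \<open>a\<close> of degree \<open>y\<close> from degree \<open>x\<close> to degree
  \<open>x \<otimes> y\<close>; in a right module, \<open>act M y x a\<close> is the one from degree \<open>x \<otimes> y\<close> to degree \<open>x\<close>, that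
  is, \<open>act M y x a m\<close> is $\varphi_{x,y}(m \otimes a)$.
\<close>

record ('x, 'a, 'c) gmod = "('x, 'c) graded" +
  act :: "'x \<Rightarrow> 'x \<Rightarrow> 'a \<Rightarrow> 'c \<Rightarrow> 'c"

definition left_gmod :: "'x monoid \<Rightarrow> ('x, 'a) gring \<Rightarrow> ('x, 'a, 'c) gmod \<Rightarrow> bool" where
  "left_gmod X A N \<longleftrightarrow>
    (\<forall>x\<in>carrier X. comm_group (part N x)) \<and>
    (\<forall>x\<in>carrier X. \<forall>y\<in>carrier X. \<forall>a\<in>carrier (part A y).
      act N y x a \<in> hom (part N x) (part N (x \<otimes>\<^bsub>X\<^esub> y))) \<and>
    (\<forall>x\<in>carrier X. \<forall>y\<in>carrier X. \<forall>n\<in>carrier (part N x).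
      (\<lambda>a. act N y x a n) \<in> hom (part A y) (part N (x \<otimes>\<^bsub>X\<^esub> y))) \<and>
    (\<forall>x\<in>carrier X. \<forall>n\<in>carrier (part N x). act N \<one>\<^bsub>X\<^esub> x (gone A) n = n) \<and>
    (\<forall>x\<in>carrier X. \<forall>y\<in>carrier X. \<forall>z\<in>carrier X.
      \<forall>n\<in>carrier (part N x). \<forall>a\<in>carrier (part A y). \<forall>b\<in>carrier (part A z).
      act N z (x \<otimes>\<^bsub>X\<^esub> y) b (act N y x a n) = act N (z \<otimes>\<^bsub>X\<^esub> y) x (gmul A z y b a) n)"

definition right_gmod :: "'x monoid \<Rightarrow> ('x, 'a) gring \<Rightarrow> ('x, 'a, 'c) gmod \<Rightarrow> bool" where
  "right_gmod X A M \<longleftrightarrow>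
    (\<forall>x\<in>carrier X. comm_group (part M x)) \<and>
    (\<forall>x\<in>carrier X. \<forall>y\<in>carrier X. \<forall>a\<in>carrier (part A y).
      act M y x a \<in> hom (part M (x \<otimes>\<^bsub>X\<^esub> y)) (part M x)) \<and>
    (\<forall>x\<in>carrier X. \<forall>y\<in>carrier X. \<forall>m\<in>carrier (part M (x \<otimes>\<^bsub>X\<^esub> y)).
      (\<lambda>a. act M y x a m) \<in> hom (part A y) (part M x)) \<and>
    (\<forall>x\<in>carrier X. \<forall>m\<in>carrier (part M x). act M \<one>\<^bsub>X\<^esub> x (gone A) m = m) \<and>
    (\<forall>x\<in>carrier X. \<forall>y\<in>carrier X. \<forall>z\<in>carrier X. \<forall>m\<in>carrier (part M (x \<otimes>\<^bsub>X\<^esub> y \<otimes>\<^bsub>X\<^esub> z)).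
      \<forall>a\<in>carrier (part A z). \<forall>b\<in>carrier (part A y).
      act M y x b (act M z (x \<otimes>\<^bsub>X\<^esub> y) a m) = act M (y \<otimes>\<^bsub>X\<^esub> z) x (gmul A z y a b) m)"

definition gmod_Hom ::
    "'x monoid \<Rightarrow> ('x, 'a) gring \<Rightarrow> ('x, 'a, 'c) gmod \<Rightarrow> ('x, 'a, 'd) gmod \<Rightarrow>
     ('x \<Rightarrow> 'c \<Rightarrow> 'd) monoid" where
  "gmod_Hom X A P N =
    \<lparr>carrier = {\<theta> \<in> extensional (carrier X).
       (\<forall>x\<in>carrier X. \<theta> x \<in> extensional (carrier (part P x)) \<inter> hom (part P x) (part N x)) \<and>
       (\<forall>x\<in>carrier X. \<forall>y\<in>carrier X. \<forall>a\<in>carrier (part A y). \<forall>c\<in>carrier (part P x).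
          \<theta> (x \<otimes>\<^bsub>X\<^esub> y) (act P y x a c) = act N y x a (\<theta> x c))},
     monoid.mult = (\<lambda>\<theta> \<kappa>. \<lambda>x\<in>carrier X. \<lambda>c\<in>carrier (part P x). \<theta> x c \<otimes>\<^bsub>part N x\<^esub> \<kappa> x c),
     one = (\<lambda>x\<in>carrier X. \<lambda>c\<in>carrier (part P x). \<one>\<^bsub>part N x\<^esub>)\<rparr>"

definition gmod_iso ::
    "'x monoid \<Rightarrow> ('x, 'a) gring \<Rightarrow> ('x, 'a, 'c) gmod \<Rightarrow> ('x, 'a, 'd) gmod \<Rightarrow>
     ('x \<Rightarrow> 'c \<Rightarrow> 'd) set" where
  "gmod_iso X A P N = {\<theta>.
    (\<forall>x\<in>carrier X. \<theta> x \<in> iso (part P x) (part N x)) \<and>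
    (\<forall>x\<in>carrier X. \<forall>y\<in>carrier X. \<forall>a\<in>carrier (part A y). \<forall>c\<in>carrier (part P x).
      \<theta> (x \<otimes>\<^bsub>X\<^esub> y) (act P y x a c) = act N y x a (\<theta> x c))}"

definition gmod_tensor_rels ::
    "'x monoid \<Rightarrow> ('x, 'a) gring \<Rightarrow> ('x, 'a, 'm) gmod \<Rightarrow> ('x, 'a, 'c) gmod \<Rightarrow>
     ('x \<times> 'm \<times> 'c \<Rightarrow>\<^sub>0 int) set" where
  "gmod_tensor_rels X A M N = bilinear_rels X M N \<union>
    {frag_of (x \<otimes>\<^bsub>X\<^esub> y, m, act N y x a n) - frag_of (x, act M y x a m, n) |x y m a n.
       x \<in> carrier X \<and> y \<in> carrier X \<and> m \<in> carrier (part M (x \<otimes>\<^bsub>X\<^esub> y)) \<and>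
       a \<in> carrier (part A y) \<and> n \<in> carrier (part N x)}"

definition gmod_tensor ::
    "'x monoid \<Rightarrow> ('x, 'a) gring \<Rightarrow> ('x, 'a, 'm) gmod \<Rightarrow> ('x, 'a, 'c) gmod \<Rightarrow>
     ('x \<times> 'm \<times> 'c \<Rightarrow>\<^sub>0 int) set monoid" where
  "gmod_tensor X A M N = presented (tensor_gens X M N) (gmod_tensor_rels X A M N)"


section \<open>Andre--Quillen homology of commutative graded rings\<close>

subsection \<open>Free commutative graded rings and the cotriple resolution\<close>

text \<open>
  The free commutative graded ring on a graded set \<open>S\<close> is the polynomial ring over \<open>\<int>\<close> on
  all pairs \<open>(y, s)\<close> with \<open>s\<close> in \<open>S y\<close>; a monomial is a multiset of such pairs, and its degree is
  the sum of the degrees of its factors. Again all levels of the iteration live in one type, in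
  which a polynomial is stored as the finite graph of its nonzero coefficients because the type
  of finitely supported functions does not admit recursion through it.
\<close>

datatype ('x, 'a) gnested =
    GBase (unGBase: 'a)
  | GNode "(('x \<times> ('x, 'a) gnested) multiset \<times> int) fset"

definition GPoly :: "(('x \<times> ('x, 'a) gnested) multiset \<Rightarrow>\<^sub>0 int) \<Rightarrow> ('x, 'a) gnested" where
  "GPoly p = GNode (Abs_fset ((\<lambda>m. (m, Poly_Mapping.lookup p m)) ` Poly_Mapping.keys p))"

definition unGPoly :: "('x, 'a) gnested \<Rightarrow> (('x \<times> ('x, 'a) gnested) multiset \<Rightarrow>\<^sub>0 int)" where
  "unGPoly t = (THE p. GPoly p = t)"

lemma GPoly_inject:
  fixes p q :: "('x \<times> ('x, 'a) gnested) multiset \<Rightarrow>\<^sub>0 int"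
  shows "GPoly p = GPoly q \<longleftrightarrow> p = q"
proof
  assume "GPoly p = GPoly q"
  then have eq: "(\<lambda>m. (m, Poly_Mapping.lookup p m)) ` Poly_Mapping.keys p =
      (\<lambda>m. (m, Poly_Mapping.lookup q m)) ` Poly_Mapping.keys q"
    unfolding GPoly_def by (simp add: Abs_fset_inject)
  show "p = q"
  proof (rule poly_mapping_eqI)
    fix m
    have *: "(m, k) \<in> (\<lambda>m. (m, Poly_Mapping.lookup r m)) ` Poly_Mapping.keys r \<longleftrightarrow>
        k \<noteq> 0 \<and> Poly_Mapping.lookup r m = k" for r :: "('x \<times> ('x, 'a) gnested) multiset \<Rightarrow>\<^sub>0 int" and k
      by (auto simp: in_keys_iff)
    have "k \<noteq> 0 \<and> Poly_Mapping.lookup p m = k \<longleftrightarrow> k \<noteq> 0 \<and> Poly_Mapping.lookup q m = k" for k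
      unfolding *[symmetric] eq ..
    then show "Poly_Mapping.lookup p m = Poly_Mapping.lookup q m"
      by metis
  qed
qed simp

lemma unGPoly_GPoly [simp]: "unGPoly (GPoly p) = p"
  by (simp add: unGPoly_def GPoly_inject)

definition monomials :: "'x monoid \<Rightarrow> ('x \<Rightarrow> 'b set) \<Rightarrow> 'x \<Rightarrow> ('x \<times> 'b) multiset set" where
  "monomials X S x =
    {m. (\<forall>(y, s)\<in>set_mset m. y \<in> carrier X \<and> s \<in> S y) \<and> mset_prod X (image_mset fst m) = x}"

definition free_gring ::
    "'x monoid \<Rightarrow> ('x \<Rightarrow> ('x, 'a) gnested set) \<Rightarrow> ('x, ('x, 'a) gnested) gring" where
  "free_gring X S =
    \<lparr>part = (\<lambda>x. \<lparr>carrier = {GPoly p |p. Poly_Mapping.keys p \<subseteq> monomials X S x},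
                  monoid.mult = (\<lambda>a b. GPoly (unGPoly a + unGPoly b)),
                  one = GPoly 0\<rparr>),
     gmul = (\<lambda>x y a b. GPoly (unGPoly a * unGPoly b)),
     gone = GPoly 1\<rparr>"

primrec ca_iter :: "'x monoid \<Rightarrow> ('x, 'a) gring \<Rightarrow> nat \<Rightarrow> ('x, ('x, 'a) gnested) gring" where
  "ca_iter X A 0 =
    \<lparr>part = (\<lambda>x. \<lparr>carrier = GBase ` carrier (part A x),
                  monoid.mult = (\<lambda>a b. GBase (unGBase a \<otimes>\<^bsub>part A x\<^esub> unGBase b)),
                  one = GBase \<one>\<^bsub>part A x\<^esub>\<rparr>),
     gmul = (\<lambda>x y a b. GBase (gmul A x y (unGBase a) (unGBase b))),
     gone = GBase (gone A)\<rparr>"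
| "ca_iter X A (Suc k) = free_gring X (\<lambda>x. carrier (part (ca_iter X A k) x))"

text \<open>The commutative monoid of homogeneous elements of a graded ring under multiplication.\<close>

definition homogeneous :: "'x monoid \<Rightarrow> ('x, 'a) gring \<Rightarrow> ('x \<times> 'a) monoid" where
  "homogeneous X A =
    \<lparr>carrier = {(x, a). x \<in> carrier X \<and> a \<in> carrier (part A x)},
     monoid.mult = (\<lambda>(x, a) (y, b). (x \<otimes>\<^bsub>X\<^esub> y, gmul A x y a b)),
     one = (\<one>\<^bsub>X\<^esub>, gone A)\<rparr>"

definition ca_counit ::
    "'x monoid \<Rightarrow> ('x, 'a) gring \<Rightarrow> nat \<Rightarrow> 'x \<Rightarrow> ('x, 'a) gnested \<Rightarrow> ('x, 'a) gnested" where
  "ca_counit X A k x t =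
    (\<Otimes>\<^bsub>part (ca_iter X A k) x\<^esub>m\<in>Poly_Mapping.keys (unGPoly t).
       snd (mset_prod (homogeneous X (ca_iter X A k)) m)
         [^]\<^bsub>part (ca_iter X A k) x\<^esub> Poly_Mapping.lookup (unGPoly t) m)"

text \<open>
  The map of polynomials given by substituting variables, where \<open>h y\<close> is the effect on variables
  of degree \<open>y\<close> and \<open>f\<close> the effect on degrees.
\<close>

definition gpoly_map ::
    "('x \<Rightarrow> 'w) \<Rightarrow> ('x \<Rightarrow> ('x, 'a) gnested \<Rightarrow> ('w, 'b) gnested) \<Rightarrow> ('x, 'a) gnested \<Rightarrow> ('w, 'b) gnested" where
  "gpoly_map f h t =
    GPoly (frag_extend (\<lambda>m. frag_of (image_mset (\<lambda>(y, s). (f y, h y s)) m)) (unGPoly t))"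

text \<open>
  With $S$ the cotriple and $\varepsilon$ its counit, \<open>ca_face X A i k x\<close> is the part in degree
  \<open>x\<close> of $S^i \varepsilon S^{k-i} : S^{k+1} A \to S^k A$, for \<open>i \<le> k\<close>.
\<close>

primrec ca_face ::
    "'x monoid \<Rightarrow> ('x, 'a) gring \<Rightarrow> nat \<Rightarrow> nat \<Rightarrow> 'x \<Rightarrow> ('x, 'a) gnested \<Rightarrow> ('x, 'a) gnested" where
  "ca_face X A 0 k x t = ca_counit X A k x t"
| "ca_face X A (Suc i) k x t = gpoly_map id (ca_face X A i (k - 1)) t"

primrec ca_aug :: "'x monoid \<Rightarrow> ('x, 'a) gring \<Rightarrow> nat \<Rightarrow> 'x \<Rightarrow> ('x, 'a) gnested \<Rightarrow> 'a" where
  "ca_aug X A 0 x t = unGBase t"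
| "ca_aug X A (Suc k) x t = ca_aug X A k x (ca_counit X A k x t)"

subsection \<open>The abelianization functor\<close>

text \<open>
  For a homomorphism \<open>\<beta>\<close> from \<open>B\<close> to \<open>A\<close>, the left \<open>A\<close>-module representing derivations: the
  generator \<open>(u, a, v, b)\<close> stands for \<open>a\<close>, of degree \<open>u\<close>, times the universal derivation at \<open>b\<close>,
  of degree \<open>v\<close>.
\<close>

definition ca_Ab_gens ::
    "'x monoid \<Rightarrow> ('x, 'a) gring \<Rightarrow> ('x, 'b) gring \<Rightarrow> 'x \<Rightarrow> ('x \<times> 'a \<times> 'x \<times> 'b) set" where
  "ca_Ab_gens X A B x =
    {(u, a, v, b). u \<in> carrier X \<and> v \<in> carrier X \<and> u \<otimes>\<^bsub>X\<^esub> v = x \<and>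
       a \<in> carrier (part A u) \<and> b \<in> carrier (part B v)}"

definition ca_Ab_rels ::
    "'x monoid \<Rightarrow> ('x, 'a) gring \<Rightarrow> ('x, 'b) gring \<Rightarrow> ('x \<Rightarrow> 'b \<Rightarrow> 'a) \<Rightarrow> 'x \<Rightarrow>
     ('x \<times> 'a \<times> 'x \<times> 'b \<Rightarrow>\<^sub>0 int) set" where
  "ca_Ab_rels X A B \<beta> x =
    {frag_of (u, a \<otimes>\<^bsub>part A u\<^esub> a', v, b) - frag_of (u, a, v, b) - frag_of (u, a', v, b) |u v a a' b.
       u \<in> carrier X \<and> v \<in> carrier X \<and> u \<otimes>\<^bsub>X\<^esub> v = x \<and>
       a \<in> carrier (part A u) \<and> a' \<in> carrier (part A u) \<and> b \<in> carrier (part B v)} \<union>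
    {frag_of (u, a, v, b \<otimes>\<^bsub>part B v\<^esub> b') - frag_of (u, a, v, b) - frag_of (u, a, v, b') |u v a b b'.
       u \<in> carrier X \<and> v \<in> carrier X \<and> u \<otimes>\<^bsub>X\<^esub> v = x \<and>
       a \<in> carrier (part A u) \<and> b \<in> carrier (part B v) \<and> b' \<in> carrier (part B v)} \<union>
    {frag_of (u, a, v \<otimes>\<^bsub>X\<^esub> w, gmul B v w b b')
       - frag_of (u \<otimes>\<^bsub>X\<^esub> v, gmul A u v a (\<beta> v b), w, b')
       - frag_of (u \<otimes>\<^bsub>X\<^esub> w, gmul A u w a (\<beta> w b'), v, b) |u v w a b b'.
       u \<in> carrier X \<and> v \<in> carrier X \<and> w \<in> carrier X \<and> u \<otimes>\<^bsub>X\<^esub> (v \<otimes>\<^bsub>X\<^esub> w) = x \<and>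
       a \<in> carrier (part A u) \<and> b \<in> carrier (part B v) \<and> b' \<in> carrier (part B w)}"

definition ca_Ab ::
    "'x monoid \<Rightarrow> ('x, 'a) gring \<Rightarrow> ('x, 'b) gring \<Rightarrow> ('x \<Rightarrow> 'b \<Rightarrow> 'a) \<Rightarrow>
     ('x, 'a, ('x \<times> 'a \<times> 'x \<times> 'b \<Rightarrow>\<^sub>0 int) set) gmod" where
  "ca_Ab X A B \<beta> =
    \<lparr>part = (\<lambda>x. presented (ca_Ab_gens X A B x) (ca_Ab_rels X A B \<beta> x)),
     act = (\<lambda>y x c. presented_map (ca_Ab_gens X A B (x \<otimes>\<^bsub>X\<^esub> y)) (ca_Ab_rels X A B \<beta> (x \<otimes>\<^bsub>X\<^esub> y))
                      (\<lambda>(u, a, v, b). (y \<otimes>\<^bsub>X\<^esub> u, gmul A y u c a, v, b)))\<rparr>"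

definition ca_derivations ::
    "'x monoid \<Rightarrow> ('x, 'b) gring \<Rightarrow> ('x \<Rightarrow> 'b \<Rightarrow> 'a) \<Rightarrow> ('x, 'a, 'c) gmod \<Rightarrow> ('x \<Rightarrow> 'b \<Rightarrow> 'c) set" where
  "ca_derivations X B \<beta> N =
    {s \<in> extensional (carrier X).
       (\<forall>x\<in>carrier X. s x \<in> extensional (carrier (part B x)) \<inter> hom (part B x) (part N x)) \<and>
       (\<forall>x\<in>carrier X. \<forall>y\<in>carrier X. \<forall>b\<in>carrier (part B x). \<forall>b'\<in>carrier (part B y).
         s (x \<otimes>\<^bsub>X\<^esub> y) (gmul B x y b b') =
           act N x y (\<beta> x b) (s y b') \<otimes>\<^bsub>part N (x \<otimes>\<^bsub>X\<^esub> y)\<^esub> act N y x (\<beta> y b') (s x b))}"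

lemma ca_Ab_rels_cases:
  assumes "r \<in> ca_Ab_rels X A B \<beta> x"
  obtains
    (left) u v a a' b where
      "r = frag_of (u, a \<otimes>\<^bsub>part A u\<^esub> a', v, b) - frag_of (u, a, v, b) - frag_of (u, a', v, b)"
      "u \<in> carrier X" "v \<in> carrier X" "u \<otimes>\<^bsub>X\<^esub> v = x"
      "a \<in> carrier (part A u)" "a' \<in> carrier (part A u)" "b \<in> carrier (part B v)"
  | (right) u v a b b' where
      "r = frag_of (u, a, v, b \<otimes>\<^bsub>part B v\<^esub> b') - frag_of (u, a, v, b) - frag_of (u, a, v, b')"
      "u \<in> carrier X" "v \<in> carrier X" "u \<otimes>\<^bsub>X\<^esub> v = x"
      "a \<in> carrier (part A u)" "b \<in> carrier (part B v)" "b' \<in> carrier (part B v)"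
  | (Leibniz) u v w a b b' where
      "r = frag_of (u, a, v \<otimes>\<^bsub>X\<^esub> w, gmul B v w b b')
        - frag_of (u \<otimes>\<^bsub>X\<^esub> v, gmul A u v a (\<beta> v b), w, b')
        - frag_of (u \<otimes>\<^bsub>X\<^esub> w, gmul A u w a (\<beta> w b'), v, b)"
      "u \<in> carrier X" "v \<in> carrier X" "w \<in> carrier X" "u \<otimes>\<^bsub>X\<^esub> (v \<otimes>\<^bsub>X\<^esub> w) = x"
      "a \<in> carrier (part A u)" "b \<in> carrier (part B v)" "b' \<in> carrier (part B w)"
  using assms unfolding ca_Ab_rels_def by blast

lemma ca_Ab_rels_intros:
  "u \<in> carrier X \<Longrightarrow> v \<in> carrier X \<Longrightarrow> u \<otimes>\<^bsub>X\<^esub> v = x \<Longrightarrow>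
    a \<in> carrier (part A u) \<Longrightarrow> a' \<in> carrier (part A u) \<Longrightarrow> b \<in> carrier (part B v) \<Longrightarrow>
    frag_of (u, a \<otimes>\<^bsub>part A u\<^esub> a', v, b) - frag_of (u, a, v, b) - frag_of (u, a', v, b)
      \<in> ca_Ab_rels X A B \<beta> x"
  "u \<in> carrier X \<Longrightarrow> v \<in> carrier X \<Longrightarrow> u \<otimes>\<^bsub>X\<^esub> v = x \<Longrightarrow>
    a \<in> carrier (part A u) \<Longrightarrow> b \<in> carrier (part B v) \<Longrightarrow> b' \<in> carrier (part B v) \<Longrightarrow>
    frag_of (u, a, v, b \<otimes>\<^bsub>part B v\<^esub> b') - frag_of (u, a, v, b) - frag_of (u, a, v, b')
      \<in> ca_Ab_rels X A B \<beta> x"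
  "u \<in> carrier X \<Longrightarrow> v \<in> carrier X \<Longrightarrow> w \<in> carrier X \<Longrightarrow> u \<otimes>\<^bsub>X\<^esub> (v \<otimes>\<^bsub>X\<^esub> w) = x \<Longrightarrow>
    a \<in> carrier (part A u) \<Longrightarrow> b \<in> carrier (part B v) \<Longrightarrow> b' \<in> carrier (part B w) \<Longrightarrow>
    frag_of (u, a, v \<otimes>\<^bsub>X\<^esub> w, gmul B v w b b')
      - frag_of (u \<otimes>\<^bsub>X\<^esub> v, gmul A u v a (\<beta> v b), w, b')
      - frag_of (u \<otimes>\<^bsub>X\<^esub> w, gmul A u w a (\<beta> w b'), v, b) \<in> ca_Ab_rels X A B \<beta> x"
  unfolding ca_Ab_rels_def by blast+

lemma ca_Ab_rels_gens:
  assumes X: "comm_monoid X" and A: "comm_gring X A" and B: "comm_gring X B" and \<beta>: "\<beta> \<in> gring_hom X B A"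
  shows "u \<in> carrier X \<Longrightarrow> v \<in> carrier X \<Longrightarrow> w \<in> carrier X \<Longrightarrow> u \<otimes>\<^bsub>X\<^esub> (v \<otimes>\<^bsub>X\<^esub> w) = x \<Longrightarrow>
    a \<in> carrier (part A u) \<Longrightarrow> b \<in> carrier (part B v) \<Longrightarrow> b' \<in> carrier (part B w) \<Longrightarrow>
    (u, a, v \<otimes>\<^bsub>X\<^esub> w, gmul B v w b b') \<in> ca_Ab_gens X A B x \<and>
    (u \<otimes>\<^bsub>X\<^esub> v, gmul A u v a (\<beta> v b), w, b') \<in> ca_Ab_gens X A B x \<and>
    (u \<otimes>\<^bsub>X\<^esub> w, gmul A u w a (\<beta> w b'), v, b) \<in> ca_Ab_gens X A B x"
proof -
  interpret X: comm_monoid X by fact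
  assume *: "u \<in> carrier X" "v \<in> carrier X" "w \<in> carrier X" "u \<otimes>\<^bsub>X\<^esub> (v \<otimes>\<^bsub>X\<^esub> w) = x"
    "a \<in> carrier (part A u)" "b \<in> carrier (part B v)" "b' \<in> carrier (part B w)"
  then have "u \<otimes>\<^bsub>X\<^esub> v \<otimes>\<^bsub>X\<^esub> w = x" "u \<otimes>\<^bsub>X\<^esub> w \<otimes>\<^bsub>X\<^esub> v = x"
    by (simp add: X.m_assoc, metis X.m_assoc X.m_comm)
  with * show ?thesis
    by (simp add: ca_Ab_gens_def comm_gring_mult_closed[OF A] comm_gring_mult_closed[OF B] gring_homD[OF \<beta>])
qed

lemma ca_Ab_rels_closed:
  assumes X: "comm_monoid X" and A: "comm_gring X A" and B: "comm_gring X B" and \<beta>: "\<beta> \<in> gring_hom X B A"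
  shows "ca_Ab_rels X A B \<beta> x \<subseteq> carrier (free_Abelian_group (ca_Ab_gens X A B x))"
proof
  fix r assume "r \<in> ca_Ab_rels X A B \<beta> x"
  then show "r \<in> carrier (free_Abelian_group (ca_Ab_gens X A B x))"
  proof (cases rule: ca_Ab_rels_cases)
    case left
    show ?thesis unfolding left(1)
      by (rule frag_of_diff3_closed) (use left in \<open>auto simp: ca_Ab_gens_def comm_gring_add_closed[OF A]\<close>)
  next
    case right
    show ?thesis unfolding right(1)
      by (rule frag_of_diff3_closed) (use right in \<open>auto simp: ca_Ab_gens_def comm_gring_add_closed[OF B]\<close>)
  next
    case Leibniz
    show ?thesis unfolding Leibniz(1)
      by (rule frag_of_diff3_closed) (use ca_Ab_rels_gens[OF assms Leibniz(2-)] in simp_all)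
  qed
qed

lemma ca_Ab_act:
  assumes X: "comm_monoid X" and A: "comm_gring X A" and B: "comm_gring X B" and \<beta>: "\<beta> \<in> gring_hom X B A"
    and x: "x \<in> carrier X" and y: "y \<in> carrier X" and c: "c \<in> carrier (part A y)"
  shows "act (ca_Ab X A B \<beta>) y x c \<in> hom (part (ca_Ab X A B \<beta>) x) (part (ca_Ab X A B \<beta>) (x \<otimes>\<^bsub>X\<^esub> y))" (is ?hom)
    and "(u, a, v, b) \<in> ca_Ab_gens X A B x \<Longrightarrow>
      act (ca_Ab X A B \<beta>) y x c (presented_class (ca_Ab_gens X A B x) (ca_Ab_rels X A B \<beta> x) (u, a, v, b)) =
      presented_class (ca_Ab_gens X A B (x \<otimes>\<^bsub>X\<^esub> y)) (ca_Ab_rels X A B \<beta> (x \<otimes>\<^bsub>X\<^esub> y))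
        (y \<otimes>\<^bsub>X\<^esub> u, gmul A y u c a, v, b)"
    and "(u, a, v, b) \<in> ca_Ab_gens X A B x \<Longrightarrow>
      (y \<otimes>\<^bsub>X\<^esub> u, gmul A y u c a, v, b) \<in> ca_Ab_gens X A B (x \<otimes>\<^bsub>X\<^esub> y)"
proof -
  interpret X: comm_monoid X by fact
  let ?m = "\<lambda>(u, a, v, b). (y \<otimes>\<^bsub>X\<^esub> u, gmul A y u c a, v, b)"
  have deg: "y \<otimes>\<^bsub>X\<^esub> u \<otimes>\<^bsub>X\<^esub> v = x \<otimes>\<^bsub>X\<^esub> y" if "u \<in> carrier X" "v \<in> carrier X" "u \<otimes>\<^bsub>X\<^esub> v = x" for u v
    using that y by (metis X.m_assoc X.m_comm X.m_closed)
  have 1: "?m s \<in> ca_Ab_gens X A B (x \<otimes>\<^bsub>X\<^esub> y)" if "s \<in> ca_Ab_gens X A B x" for s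
    using that y c by (auto simp: ca_Ab_gens_def comm_gring_mult_closed[OF A] deg)
  have 2: "frag_extend (\<lambda>g. frag_of (?m g)) r \<in> ca_Ab_rels X A B \<beta> (x \<otimes>\<^bsub>X\<^esub> y)"
    if "r \<in> ca_Ab_rels X A B \<beta> x" for r
    using that
  proof (cases rule: ca_Ab_rels_cases)
    case (left u v a a' b)
    have "gmul A y u c (a \<otimes>\<^bsub>part A u\<^esub> a') = gmul A y u c a \<otimes>\<^bsub>part A (y \<otimes>\<^bsub>X\<^esub> u)\<^esub> gmul A y u c a'"
      by (rule hom_mult[OF comm_gringD(3)[OF A y left(2) c] left(5,6)])
    then show ?thesis
      using ca_Ab_rels_intros(1)[of "y \<otimes>\<^bsub>X\<^esub> u" X v "x \<otimes>\<^bsub>X\<^esub> y" "gmul A y u c a" A "gmul A y u c a'" b B \<beta>]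
        left y c by (simp add: frag_extend_diff deg comm_gring_mult_closed[OF A])
  next
    case (right u v a b b')
    then show ?thesis
      using ca_Ab_rels_intros(2)[of "y \<otimes>\<^bsub>X\<^esub> u" X v "x \<otimes>\<^bsub>X\<^esub> y" "gmul A y u c a" A b B b' \<beta>]
        y c by (simp add: frag_extend_diff deg comm_gring_mult_closed[OF A])
  next
    case (Leibniz u v w a b b')
    have "gmul A y (u \<otimes>\<^bsub>X\<^esub> v) c (gmul A u v a (\<beta> v b)) = gmul A (y \<otimes>\<^bsub>X\<^esub> u) v (gmul A y u c a) (\<beta> v b)"
      "gmul A y (u \<otimes>\<^bsub>X\<^esub> w) c (gmul A u w a (\<beta> w b')) = gmul A (y \<otimes>\<^bsub>X\<^esub> u) w (gmul A y u c a) (\<beta> w b')"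
      using comm_gringD(7)[OF A] Leibniz y c by (simp_all add: gring_homD[OF \<beta>])
    then show ?thesis
      using ca_Ab_rels_intros(3)[of "y \<otimes>\<^bsub>X\<^esub> u" X v w "x \<otimes>\<^bsub>X\<^esub> y" "gmul A y u c a" A b B b' \<beta>]
        Leibniz y c deg[of u "v \<otimes>\<^bsub>X\<^esub> w"]
      by (simp add: frag_extend_diff comm_gring_mult_closed[OF A] X.m_assoc)
  qed
  note R = ca_Ab_rels_closed[OF X A B \<beta>]
  show ?hom
    unfolding ca_Ab_def by simp (rule presented_map_hom[OF R R]; fact 1 2)
  show "act (ca_Ab X A B \<beta>) y x c (presented_class (ca_Ab_gens X A B x) (ca_Ab_rels X A B \<beta> x) (u, a, v, b)) =
      presented_class (ca_Ab_gens X A B (x \<otimes>\<^bsub>X\<^esub> y)) (ca_Ab_rels X A B \<beta> (x \<otimes>\<^bsub>X\<^esub> y))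
        (y \<otimes>\<^bsub>X\<^esub> u, gmul A y u c a, v, b)"
    if "(u, a, v, b) \<in> ca_Ab_gens X A B x"
    using presented_map_class[OF R R, of x ?m "x \<otimes>\<^bsub>X\<^esub> y", OF _ _ that] 1 2
    by (simp add: ca_Ab_def)
  show "(y \<otimes>\<^bsub>X\<^esub> u, gmul A y u c a, v, b) \<in> ca_Ab_gens X A B (x \<otimes>\<^bsub>X\<^esub> y)"
    if "(u, a, v, b) \<in> ca_Ab_gens X A B x"
    using 1[OF that] by simp
qed

text \<open>\<open>ca_Ab X A B \<beta>\<close> represents derivations.\<close>

lemma ca_Ab_represents:
  assumes X: "comm_monoid X" and A: "comm_gring X A" and B: "comm_gring X B" and \<beta>: "\<beta> \<in> gring_hom X B A"
    and N: "left_gmod X A N"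
  shows "bij_betw
    (\<lambda>\<theta>. \<lambda>x\<in>carrier X. \<lambda>b\<in>carrier (part B x). \<theta> x
       (presented_class (ca_Ab_gens X A B x) (ca_Ab_rels X A B \<beta> x) (\<one>\<^bsub>X\<^esub>, gone A, x, b)))
    (carrier (gmod_Hom X A (ca_Ab X A B \<beta>) N)) (ca_derivations X B \<beta> N)"
    (is "bij_betw ?D ?Hom ?Der")
proof -
  interpret X: comm_monoid X by fact
  let ?P = "ca_Ab X A B \<beta>"
  let ?S = "ca_Ab_gens X A B" and ?R = "ca_Ab_rels X A B \<beta>"
  let ?cl = "\<lambda>x. presented_class (?S x) (?R x)"
  note R = ca_Ab_rels_closed[OF X A B \<beta>]
  note \<beta>_closed [simp] = gring_homD(2)[OF \<beta>]
  have gone [simp]: "gone A \<in> carrier (part A \<one>\<^bsub>X\<^esub>)" by (rule comm_gringD(2)[OF A])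
  have mul_gone: "gmul A u \<one>\<^bsub>X\<^esub> a (gone A) = a" if "u \<in> carrier X" "a \<in> carrier (part A u)" for u a
    using comm_gringD(5)[OF A that] comm_gringD(6)[OF A that(1) X.one_closed that(2) gone] by simp
  have part_P: "part ?P x = presented (?S x) (?R x)" for x by (simp add: ca_Ab_def)
  have gr: "comm_group (part N x)" if "x \<in> carrier X" for x
    using N that by (simp add: left_gmod_def)
  have actN: "act N y x a \<in> hom (part N x) (part N (x \<otimes>\<^bsub>X\<^esub> y))"
    if "x \<in> carrier X" "y \<in> carrier X" "a \<in> carrier (part A y)" for x y a
    using N that by (simp add: left_gmod_def)
  have actN': "(\<lambda>a. act N y x a n) \<in> hom (part A y) (part N (x \<otimes>\<^bsub>X\<^esub> y))"
    if "x \<in> carrier X" "y \<in> carrier X" "n \<in> carrier (part N x)" for x y n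
    using N that by (simp add: left_gmod_def)
  have actN_closed: "act N y x a n \<in> carrier (part N (x \<otimes>\<^bsub>X\<^esub> y))"
    if "x \<in> carrier X" "y \<in> carrier X" "a \<in> carrier (part A y)" "n \<in> carrier (part N x)" for x y a n
    using actN[OF that(1-3)] that(4) by (rule hom_in_carrier)
  have actN_1: "act N \<one>\<^bsub>X\<^esub> x (gone A) n = n" if "x \<in> carrier X" "n \<in> carrier (part N x)" for x n
    using N that by (simp add: left_gmod_def)
  have actN_act: "act N z (x \<otimes>\<^bsub>X\<^esub> y) b (act N y x a n) = act N (z \<otimes>\<^bsub>X\<^esub> y) x (gmul A z y b a) n"
    if "x \<in> carrier X" "y \<in> carrier X" "z \<in> carrier X" "n \<in> carrier (part N x)"
      "a \<in> carrier (part A y)" "b \<in> carrier (part A z)" for x y z a b n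
    using N that by (simp add: left_gmod_def)
  have one_gen: "(\<one>\<^bsub>X\<^esub>, gone A, v, b) \<in> ?S v" if "v \<in> carrier X" "b \<in> carrier (part B v)" for v b
    using that by (simp add: ca_Ab_gens_def)
  have class_eq: "?cl (v \<otimes>\<^bsub>X\<^esub> u) (u, a, v, b) = act ?P u v a (?cl v (\<one>\<^bsub>X\<^esub>, gone A, v, b))"
    if "u \<in> carrier X" "v \<in> carrier X" "a \<in> carrier (part A u)" "b \<in> carrier (part B v)" for u v a b
    using ca_Ab_act(2)[OF X A B \<beta> that(2,1,3) one_gen[OF that(2,4)]] that by (simp add: mul_gone)
  have \<theta>_class: "\<theta> (v \<otimes>\<^bsub>X\<^esub> u) (?cl (v \<otimes>\<^bsub>X\<^esub> u) (u, a, v, b)) = act N u v a (?D \<theta> v b)"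
    if "\<theta> \<in> ?Hom" "u \<in> carrier X" "v \<in> carrier X" "a \<in> carrier (part A u)" "b \<in> carrier (part B v)" for \<theta> u v a b
  proof -
    have "?cl v (\<one>\<^bsub>X\<^esub>, gone A, v, b) \<in> carrier (part ?P v)"
      using that by (simp add: part_P presented_class_closed one_gen)
    then have "\<theta> (v \<otimes>\<^bsub>X\<^esub> u) (act ?P u v a (?cl v (\<one>\<^bsub>X\<^esub>, gone A, v, b))) =
        act N u v a (\<theta> v (?cl v (\<one>\<^bsub>X\<^esub>, gone A, v, b)))"
      using that by (simp add: gmod_Hom_def)
    then show ?thesis
      unfolding class_eq[OF that(2-5)] using that by simp
  qed
  have \<theta>_hom: "\<theta> x \<in> hom (presented (?S x) (?R x)) (part N x)" if "\<theta> \<in> ?Hom" "x \<in> carrier X" for \<theta> x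
    using that by (simp add: gmod_Hom_def part_P)
  show ?thesis
  proof (rule bij_betw_imageI)
    show "inj_on ?D ?Hom"
    proof (rule inj_onI)
      fix \<theta> \<theta>' assume H: "\<theta> \<in> ?Hom" "\<theta>' \<in> ?Hom" and eq: "?D \<theta> = ?D \<theta>'"
      show "\<theta> = \<theta>'"
      proof (rule extensionalityI[of _ "carrier X"])
        fix x assume x: "x \<in> carrier X"
        show "\<theta> x = \<theta>' x"
        proof (rule extensionalityI[of _ "carrier (part ?P x)"])
          show "\<theta> x \<in> extensional (carrier (part ?P x))" "\<theta>' x \<in> extensional (carrier (part ?P x))"
            using H x by (auto simp: gmod_Hom_def)
          fix c assume "c \<in> carrier (part ?P x)"
          then have c: "c \<in> carrier (presented (?S x) (?R x))" by (simp add: part_P)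
          show "\<theta> x c = \<theta>' x c"
          proof (rule presented_hom_eqI[OF R _ \<theta>_hom[OF H(1) x] \<theta>_hom[OF H(2) x] _ c])
            show "group (part N x)" using gr[OF x] by (simp add: comm_group_def)
            fix s assume "s \<in> ?S x"
            then obtain u a v b where s: "s = (u, a, v, b)" "u \<in> carrier X" "v \<in> carrier X"
              "a \<in> carrier (part A u)" "b \<in> carrier (part B v)" "x = u \<otimes>\<^bsub>X\<^esub> v"
              by (auto simp: ca_Ab_gens_def)
            then have x': "x = v \<otimes>\<^bsub>X\<^esub> u" by (simp add: X.m_comm)
            show "\<theta> x (?cl x s) = \<theta>' x (?cl x s)"
              unfolding s(1) x' \<theta>_class[OF H(1) s(2-5)] \<theta>_class[OF H(2) s(2-5)] eq ..
          qed
        qed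
      qed (use H in \<open>auto simp: gmod_Hom_def\<close>)
    qed
  next
    show "?D ` ?Hom = ?Der"
    proof (intro equalityI subsetI)
      fix s assume "s \<in> ?D ` ?Hom"
      then obtain \<theta> where \<theta>: "\<theta> \<in> ?Hom" and s: "s = ?D \<theta>" by blast
      have s_val: "s x b = \<theta> x (?cl x (\<one>\<^bsub>X\<^esub>, gone A, x, b))"
        if "x \<in> carrier X" "b \<in> carrier (part B x)" for x b
        using that by (simp add: s)
      have s_hom: "s x \<in> hom (part B x) (part N x)" if x: "x \<in> carrier X" for x
      proof (rule homI)
        fix b assume b: "b \<in> carrier (part B x)"
        show "s x b \<in> carrier (part N x)"
          unfolding s_val[OF x b]
          by (rule hom_in_carrier[OF \<theta>_hom[OF \<theta> x] presented_class_closed[OF one_gen[OF x b]]])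
      next
        fix b b' assume b: "b \<in> carrier (part B x)" "b' \<in> carrier (part B x)"
        have bb: "b \<otimes>\<^bsub>part B x\<^esub> b' \<in> carrier (part B x)"
          by (rule comm_gring_add_closed[OF B x b])
        have "?cl x (\<one>\<^bsub>X\<^esub>, gone A, x, b \<otimes>\<^bsub>part B x\<^esub> b') =
            ?cl x (\<one>\<^bsub>X\<^esub>, gone A, x, b) \<otimes>\<^bsub>presented (?S x) (?R x)\<^esub> ?cl x (\<one>\<^bsub>X\<^esub>, gone A, x, b')"
          by (rule presented_class_eqI[OF R ca_Ab_rels_intros(2)])
            (use x b bb in \<open>simp_all add: one_gen\<close>)
        then show "s x (b \<otimes>\<^bsub>part B x\<^esub> b') = s x b \<otimes>\<^bsub>part N x\<^esub> s x b'"
          using b bb x hom_mult[OF \<theta>_hom[OF \<theta> x]] by (simp add: s_val presented_class_closed one_gen)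
      qed
      have "s (v \<otimes>\<^bsub>X\<^esub> w) (gmul B v w b b') =
          act N v w (\<beta> v b) (s w b') \<otimes>\<^bsub>part N (v \<otimes>\<^bsub>X\<^esub> w)\<^esub> act N w v (\<beta> w b') (s v b)"
        if v: "v \<in> carrier X" "w \<in> carrier X" "b \<in> carrier (part B v)" "b' \<in> carrier (part B w)" for v w b b'
      proof -
        let ?z = "v \<otimes>\<^bsub>X\<^esub> w"
        have gone_mul: "gmul A \<one>\<^bsub>X\<^esub> v (gone A) (\<beta> v b) = \<beta> v b" "gmul A \<one>\<^bsub>X\<^esub> w (gone A) (\<beta> w b') = \<beta> w b'"
          using v comm_gringD(5)[OF A] by simp_all
        have gens: "(\<one>\<^bsub>X\<^esub>, gone A, ?z, gmul B v w b b') \<in> ?S ?z" "(v, \<beta> v b, w, b') \<in> ?S ?z" "(w, \<beta> w b', v, b) \<in> ?S ?z"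
          using ca_Ab_rels_gens[OF X A B \<beta>, of "\<one>\<^bsub>X\<^esub>" v w ?z "gone A" b b'] v by (simp_all add: gone_mul)
        have rel: "frag_of (\<one>\<^bsub>X\<^esub>, gone A, ?z, gmul B v w b b') - frag_of (v, \<beta> v b, w, b') - frag_of (w, \<beta> w b', v, b) \<in> ?R ?z"
          using ca_Ab_rels_intros(3)[of "\<one>\<^bsub>X\<^esub>" X v w ?z "gone A" A b B b' \<beta>] v by (simp add: gone_mul)
        have "s ?z (gmul B v w b b') = \<theta> ?z (?cl ?z (\<one>\<^bsub>X\<^esub>, gone A, ?z, gmul B v w b b'))"
          using v by (simp add: s_val comm_gring_mult_closed[OF B])
        also have "\<dots> = \<theta> ?z (?cl ?z (v, \<beta> v b, w, b')) \<otimes>\<^bsub>part N ?z\<^esub> \<theta> ?z (?cl ?z (w, \<beta> w b', v, b))"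
          unfolding presented_class_eqI[OF R rel gens]
          by (rule hom_mult[OF \<theta>_hom[OF \<theta>]]) (use v gens in \<open>auto intro: presented_class_closed\<close>)
        also have "\<theta> ?z (?cl ?z (w, \<beta> w b', v, b)) = act N w v (\<beta> w b') (s v b)"
          unfolding s by (rule \<theta>_class[OF \<theta>]) (use v in simp_all)
        also have "\<theta> ?z (?cl ?z (v, \<beta> v b, w, b')) = act N v w (\<beta> v b) (s w b')"
          unfolding s X.m_comm[OF v(1,2)] by (rule \<theta>_class[OF \<theta>]) (use v in simp_all)
        finally show ?thesis .
      qed
      then show "s \<in> ?Der"
        using s_hom by (simp add: ca_derivations_def) (simp add: s)
    next
      fix s assume s: "s \<in> ?Der"
      have s_hom: "s v \<in> hom (part B v) (part N v)" if "v \<in> carrier X" for v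
        using s that by (auto simp: ca_derivations_def)
      have s_closed: "s v b \<in> carrier (part N v)" if "v \<in> carrier X" "b \<in> carrier (part B v)" for v b
        using s_hom[OF that(1)] that(2) by (rule hom_in_carrier)
      have s_mult: "s (v \<otimes>\<^bsub>X\<^esub> w) (gmul B v w b b') =
          act N v w (\<beta> v b) (s w b') \<otimes>\<^bsub>part N (v \<otimes>\<^bsub>X\<^esub> w)\<^esub> act N w v (\<beta> w b') (s v b)"
        if "v \<in> carrier X" "w \<in> carrier X" "b \<in> carrier (part B v)" "b' \<in> carrier (part B w)" for v w b b'
        using s that by (auto simp: ca_derivations_def)
      let ?f = "\<lambda>(u, a, v, b). act N u v a (s v b)"
      have f_closed: "?f g \<in> carrier (part N x)" if g: "g \<in> ?S x" for g x
      proof -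
        obtain u a v b where "g = (u, a, v, b)" "u \<in> carrier X" "v \<in> carrier X" "x = v \<otimes>\<^bsub>X\<^esub> u"
          "a \<in> carrier (part A u)" "b \<in> carrier (part B v)"
          using g by (auto simp: ca_Ab_gens_def X.m_comm)
        then show ?thesis using actN_closed[of v u a "s v b"] s_closed by simp
      qed
      have "\<exists>k. \<forall>x\<in>carrier X. k x \<in> hom (presented (?S x) (?R x)) (part N x) \<and>
          (\<forall>g\<in>?S x. k x (?cl x g) = ?f g)"
      proof (intro bchoice ballI)
        fix x assume x: "x \<in> carrier X"
        have rels: "\<exists>a\<in>?S x. \<exists>b\<in>?S x. \<exists>c\<in>?S x.
            r = frag_of a - frag_of b - frag_of c \<and> ?f a = ?f b \<otimes>\<^bsub>part N x\<^esub> ?f c"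
          if r: "r \<in> ?R x" for r
          using r
        proof (cases rule: ca_Ab_rels_cases)
          case (left u v a a' b)
          have x': "v \<otimes>\<^bsub>X\<^esub> u = x" using left by (simp add: X.m_comm)
          have "?f (u, a \<otimes>\<^bsub>part A u\<^esub> a', v, b) = ?f (u, a, v, b) \<otimes>\<^bsub>part N x\<^esub> ?f (u, a', v, b)"
            using hom_mult[OF actN'[OF left(3,2) s_closed[OF left(3,7)]] left(5,6)] by (simp add: x')
          moreover have "(u, a \<otimes>\<^bsub>part A u\<^esub> a', v, b) \<in> ?S x" "(u, a, v, b) \<in> ?S x" "(u, a', v, b) \<in> ?S x"
            using left by (simp_all add: ca_Ab_gens_def comm_gring_add_closed[OF A])
          ultimately show ?thesis using left(1) by blast
        next
          case (right u v a b b')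
          have x': "v \<otimes>\<^bsub>X\<^esub> u = x" using right by (simp add: X.m_comm)
          have "?f (u, a, v, b \<otimes>\<^bsub>part B v\<^esub> b') = ?f (u, a, v, b) \<otimes>\<^bsub>part N x\<^esub> ?f (u, a, v, b')"
            using hom_mult[OF actN[OF right(3,2,5)] s_closed[OF right(3,6)] s_closed[OF right(3,7)]]
              hom_mult[OF s_hom[OF right(3)] right(6,7)] by (simp add: x')
          moreover have "(u, a, v, b \<otimes>\<^bsub>part B v\<^esub> b') \<in> ?S x" "(u, a, v, b) \<in> ?S x" "(u, a, v, b') \<in> ?S x"
            using right by (simp_all add: ca_Ab_gens_def comm_gring_add_closed[OF B])
          ultimately show ?thesis using right(1) by blast
        next
          case (Leibniz u v w a b b')
          have wv: "w \<otimes>\<^bsub>X\<^esub> v = v \<otimes>\<^bsub>X\<^esub> w" and x': "v \<otimes>\<^bsub>X\<^esub> w \<otimes>\<^bsub>X\<^esub> u = x"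
            using Leibniz X.m_comm[of "v \<otimes>\<^bsub>X\<^esub> w" u] by (simp_all add: X.m_comm[of w v])
          have t: "act N v w (\<beta> v b) (s w b') \<in> carrier (part N (v \<otimes>\<^bsub>X\<^esub> w))"
            "act N w v (\<beta> w b') (s v b) \<in> carrier (part N (v \<otimes>\<^bsub>X\<^esub> w))"
            using actN_closed[of w v "\<beta> v b" "s w b'"] actN_closed[of v w "\<beta> w b'" "s v b"] Leibniz(2-)
              s_closed wv by simp_all
          have "?f (u, a, v \<otimes>\<^bsub>X\<^esub> w, gmul B v w b b') =
              act N u (v \<otimes>\<^bsub>X\<^esub> w) a (act N v w (\<beta> v b) (s w b')) \<otimes>\<^bsub>part N x\<^esub>
              act N u (v \<otimes>\<^bsub>X\<^esub> w) a (act N w v (\<beta> w b') (s v b))"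
            using hom_mult[OF actN[OF X.m_closed[OF Leibniz(3,4)] Leibniz(2,6)] t]
            by (simp add: s_mult[OF Leibniz(3,4,7,8)] x')
          also have "act N u (v \<otimes>\<^bsub>X\<^esub> w) a (act N v w (\<beta> v b) (s w b')) =
              ?f (u \<otimes>\<^bsub>X\<^esub> v, gmul A u v a (\<beta> v b), w, b')"
            using actN_act[of w v u "s w b'" "\<beta> v b" a, unfolded wv] Leibniz(2-) s_closed by simp
          also have "act N u (v \<otimes>\<^bsub>X\<^esub> w) a (act N w v (\<beta> w b') (s v b)) =
              ?f (u \<otimes>\<^bsub>X\<^esub> w, gmul A u w a (\<beta> w b'), v, b)"
            using actN_act[of v w u "s v b" "\<beta> w b'" a] Leibniz(2-) s_closed by simp
          finally have "?f (u, a, v \<otimes>\<^bsub>X\<^esub> w, gmul B v w b b') =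
              ?f (u \<otimes>\<^bsub>X\<^esub> v, gmul A u v a (\<beta> v b), w, b') \<otimes>\<^bsub>part N x\<^esub>
              ?f (u \<otimes>\<^bsub>X\<^esub> w, gmul A u w a (\<beta> w b'), v, b)" .
          then show ?thesis using Leibniz(1) ca_Ab_rels_gens[OF X A B \<beta> Leibniz(2-)] by blast
        qed
        show "\<exists>k. k \<in> hom (presented (?S x) (?R x)) (part N x) \<and> (\<forall>g\<in>?S x. k (?cl x g) = ?f g)"
        proof (rule presented_hom_exists[of "part N x" "?S x" ?f "?R x"])
          show "comm_group (part N x)" by (rule gr[OF x])
        qed (use f_closed rels in blast)+
      qed
      then obtain k where k: "\<And>x. x \<in> carrier X \<Longrightarrow> k x \<in> hom (presented (?S x) (?R x)) (part N x)"
        and kf: "\<And>x g. x \<in> carrier X \<Longrightarrow> g \<in> ?S x \<Longrightarrow> k x (?cl x g) = ?f g"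
        by blast
      define \<theta> where "\<theta> = (\<lambda>x\<in>carrier X. \<lambda>c\<in>carrier (part ?P x). k x c)"
      have k_act: "k (x \<otimes>\<^bsub>X\<^esub> y) (act ?P y x a c) = act N y x a (k x c)"
        if xy: "x \<in> carrier X" "y \<in> carrier X" "a \<in> carrier (part A y)" and c: "c \<in> carrier (part ?P x)" for x y a c
      proof -
        note t = ca_Ab_act[OF X A B \<beta> xy, unfolded part_P]
        have "(k (x \<otimes>\<^bsub>X\<^esub> y) \<circ> act ?P y x a) c = (act N y x a \<circ> k x) c"
        proof (rule presented_hom_eqI[OF R])
          show "group (part N (x \<otimes>\<^bsub>X\<^esub> y))" using gr[of "x \<otimes>\<^bsub>X\<^esub> y"] xy by (simp add: comm_group_def)
          show "k (x \<otimes>\<^bsub>X\<^esub> y) \<circ> act ?P y x a \<in> hom (presented (?S x) (?R x)) (part N (x \<otimes>\<^bsub>X\<^esub> y))"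
            by (rule Group.hom_compose[OF t(1) k]) (use xy in simp)
          show "act N y x a \<circ> k x \<in> hom (presented (?S x) (?R x)) (part N (x \<otimes>\<^bsub>X\<^esub> y))"
            by (rule Group.hom_compose[OF k actN]) (use xy in simp_all)
          show "c \<in> carrier (presented (?S x) (?R x))" using c by (simp add: part_P)
          fix g assume g: "g \<in> ?S x"
          then obtain u a' v b where ub: "g = (u, a', v, b)" "u \<in> carrier X" "v \<in> carrier X"
            "a' \<in> carrier (part A u)" "b \<in> carrier (part B v)" "u \<otimes>\<^bsub>X\<^esub> v = x"
            by (auto simp: ca_Ab_gens_def)
          have x': "v \<otimes>\<^bsub>X\<^esub> u = x" using ub by (simp add: X.m_comm)
          have "k (x \<otimes>\<^bsub>X\<^esub> y) (act ?P y x a (?cl x g)) = k (x \<otimes>\<^bsub>X\<^esub> y) (?cl (x \<otimes>\<^bsub>X\<^esub> y) (y \<otimes>\<^bsub>X\<^esub> u, gmul A y u a a', v, b))"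
            using t(2)[of u a' v b] g ub(1) by simp
          also have "\<dots> = act N (y \<otimes>\<^bsub>X\<^esub> u) v (gmul A y u a a') (s v b)"
            using kf[OF X.m_closed[OF xy(1,2)] t(3)[of u a' v b]] g ub(1) by simp
          also have "\<dots> = act N y x a (act N u v a' (s v b))"
            using actN_act[of v u y "s v b" a' a] ub xy s_closed x' by simp
          also have "\<dots> = act N y x a (k x (?cl x g))"
            using kf[OF xy(1) g] ub(1) by simp
          finally show "(k (x \<otimes>\<^bsub>X\<^esub> y) \<circ> act ?P y x a) (?cl x g) = (act N y x a \<circ> k x) (?cl x g)"
            by simp
        qed
        then show ?thesis by simp
      qed
      have act_closed: "act ?P y x a c \<in> carrier (part ?P (x \<otimes>\<^bsub>X\<^esub> y))"
        if "x \<in> carrier X" "y \<in> carrier X" "a \<in> carrier (part A y)" "c \<in> carrier (part ?P x)" for x y a c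
        using hom_in_carrier[OF ca_Ab_act(1)[OF X A B \<beta> that(1-3)] that(4)] .
      have "\<theta> \<in> ?Hom"
        unfolding gmod_Hom_def \<theta>_def using k
        by (auto simp: k_act[unfolded part_P] act_closed[unfolded part_P] part_P hom_def Pi_iff
            intro!: monoid.m_closed[OF group.is_monoid[OF comm_group.axioms(2)[OF comm_group_presented[OF R]]]])
      moreover have "?D \<theta> = s"
      proof (rule extensionalityI[of _ "carrier X"])
        show "s \<in> extensional (carrier X)" using s by (auto simp: ca_derivations_def)
        fix x assume x: "x \<in> carrier X"
        show "?D \<theta> x = s x"
        proof (rule extensionalityI[of _ "carrier (part B x)"])
          show "s x \<in> extensional (carrier (part B x))" using s x by (auto simp: ca_derivations_def)
          show "?D \<theta> x \<in> extensional (carrier (part B x))" using x by simp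
          fix b assume b: "b \<in> carrier (part B x)"
          have "?D \<theta> x b = k x (?cl x (\<one>\<^bsub>X\<^esub>, gone A, x, b))"
            using x b by (simp add: \<theta>_def part_P presented_class_closed one_gen)
          also have "\<dots> = s x b"
            using x b by (simp add: kf one_gen actN_1 s_closed)
          finally show "?D \<theta> x b = s x b" .
        qed
      qed simp
      ultimately show "s \<in> ?D ` ?Hom" by blast
    qed
  qed
qed

text \<open>
  The map into the degree \<open>x\<close> part of \<open>ca_Ab X A B \<beta>\<close> induced by \<open>g\<close> on degrees, \<open>h\<close> on
  coefficients and \<open>f\<close> on rings; \<open>g\<close> and \<open>h\<close> are identities for a map of graded rings over \<open>A\<close>.
\<close>

definition ca_Ab_map ::
    "'x monoid \<Rightarrow> ('x, 'a) gring \<Rightarrow> ('x, 'b) gring \<Rightarrow> ('x \<Rightarrow> 'b \<Rightarrow> 'a) \<Rightarrow>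
     ('w \<Rightarrow> 'x) \<Rightarrow> ('w \<Rightarrow> 'd \<Rightarrow> 'a) \<Rightarrow> ('w \<Rightarrow> 'e \<Rightarrow> 'b) \<Rightarrow> 'x \<Rightarrow>
     ('w \<times> 'd \<times> 'w \<times> 'e \<Rightarrow>\<^sub>0 int) set \<Rightarrow> ('x \<times> 'a \<times> 'x \<times> 'b \<Rightarrow>\<^sub>0 int) set" where
  "ca_Ab_map X A B \<beta> g h f x =
    presented_map (ca_Ab_gens X A B x) (ca_Ab_rels X A B \<beta> x)
      (\<lambda>(u, a, v, b). (g u, h u a, g v, f v b))"

subsection \<open>Homology and cohomology\<close>

type_synonym ('x, 'a) ca_el = "('x \<times> 'a \<times> 'x \<times> ('x, 'a) gnested \<Rightarrow>\<^sub>0 int) set"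

definition ca_res :: "'x monoid \<Rightarrow> ('x, 'a) gring \<Rightarrow> nat \<Rightarrow> ('x, 'a, ('x, 'a) ca_el) gmod" where
  "ca_res X A n = ca_Ab X A (ca_iter X A (Suc n)) (ca_aug X A (Suc n))"

definition ca_res_face ::
    "'x monoid \<Rightarrow> ('x, 'a) gring \<Rightarrow> 'x \<Rightarrow> nat \<Rightarrow> nat \<Rightarrow> ('x, 'a) ca_el \<Rightarrow> ('x, 'a) ca_el" where
  "ca_res_face X A x n i =
    ca_Ab_map X A (ca_iter X A (Suc n)) (ca_aug X A (Suc n)) id (\<lambda>_. id) (ca_face X A i (Suc n)) x"

definition ca_res_diff ::
    "'x monoid \<Rightarrow> ('x, 'a) gring \<Rightarrow> 'x \<Rightarrow> nat \<Rightarrow> ('x, 'a) ca_el \<Rightarrow> ('x, 'a) ca_el" where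
  "ca_res_diff X A x = simp_diff (\<lambda>n. part (ca_res X A n) x) (ca_res_face X A x)"

definition HQ_CA :: "'x monoid \<Rightarrow> ('x, 'a) gring \<Rightarrow> nat \<Rightarrow> ('x, 'a, ('x, 'a) ca_el set) gmod" where
  "HQ_CA X A n =
    \<lparr>part = (\<lambda>x. simp_pi (\<lambda>k. part (ca_res X A k) x) (ca_res_face X A x) n),
     act = (\<lambda>y x a. simp_pi_map (\<lambda>k. part (ca_res X A k) (x \<otimes>\<^bsub>X\<^esub> y)) (ca_res_face X A (x \<otimes>\<^bsub>X\<^esub> y)) n
                     (act (ca_res X A n) y x a))\<rparr>"

definition ca_tensor_res ::
    "'x monoid \<Rightarrow> ('x, 'a) gring \<Rightarrow> ('x, 'a, 'm) gmod \<Rightarrow> nat \<Rightarrow>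
     ('x \<times> 'm \<times> ('x, 'a) ca_el \<Rightarrow>\<^sub>0 int) set monoid" where
  "ca_tensor_res X A M n = gmod_tensor X A M (ca_res X A n)"

definition ca_tensor_res_face ::
    "'x monoid \<Rightarrow> ('x, 'a) gring \<Rightarrow> ('x, 'a, 'm) gmod \<Rightarrow> nat \<Rightarrow> nat \<Rightarrow>
     ('x \<times> 'm \<times> ('x, 'a) ca_el \<Rightarrow>\<^sub>0 int) set \<Rightarrow> ('x \<times> 'm \<times> ('x, 'a) ca_el \<Rightarrow>\<^sub>0 int) set" where
  "ca_tensor_res_face X A M n i =
    presented_map (tensor_gens X M (ca_res X A n)) (gmod_tensor_rels X A M (ca_res X A n))
      (\<lambda>(z, m, c). (z, m, ca_res_face X A z n i c))"

definition HQ_CA_homology ::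
    "'x monoid \<Rightarrow> ('x, 'a) gring \<Rightarrow> ('x, 'a, 'm) gmod \<Rightarrow> nat \<Rightarrow>
     ('x \<times> 'm \<times> ('x, 'a) ca_el \<Rightarrow>\<^sub>0 int) set set monoid" where
  "HQ_CA_homology X A M n = simp_pi (ca_tensor_res X A M) (ca_tensor_res_face X A M) n"

definition ca_cochains ::
    "'x monoid \<Rightarrow> ('x, 'a) gring \<Rightarrow> ('x, 'a, 'c) gmod \<Rightarrow> nat \<Rightarrow>
     ('x \<Rightarrow> ('x, 'a) ca_el \<Rightarrow> 'c) monoid" where
  "ca_cochains X A N n = gmod_Hom X A (ca_res X A n) N"

definition ca_coboundary ::
    "'x monoid \<Rightarrow> ('x, 'a) gring \<Rightarrow> nat \<Rightarrow>
     ('x \<Rightarrow> ('x, 'a) ca_el \<Rightarrow> 'c) \<Rightarrow> ('x \<Rightarrow> ('x, 'a) ca_el \<Rightarrow> 'c)" where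
  "ca_coboundary X A n \<theta> =
    (\<lambda>x\<in>carrier X. \<lambda>c\<in>carrier (part (ca_res X A (Suc n)) x). \<theta> x (ca_res_diff X A x n c))"

definition HQ_CA_cohomology ::
    "'x monoid \<Rightarrow> ('x, 'a) gring \<Rightarrow> ('x, 'a, 'c) gmod \<Rightarrow> nat \<Rightarrow>
     ('x \<Rightarrow> ('x, 'a) ca_el \<Rightarrow> 'c) set monoid" where
  "HQ_CA_cohomology X A N n = cohomology (ca_cochains X A N) (ca_coboundary X A) n"

subsection \<open>Functoriality in the grading monoid and the graded ring\<close>

text \<open>
  Here \<open>f\<close> is a homomorphism from a monoid \<open>X\<close> to \<open>X'\<close>, and \<open>h x\<close> maps the part in degree \<open>x\<close> of
  an \<open>X\<close>-graded ring \<open>A\<close> to the part in degree \<open>f x\<close> of an \<open>X'\<close>-graded ring \<open>A'\<close>,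
  compatibly with the ring structures.
\<close>

primrec ca_iter_map ::
    "('w \<Rightarrow> 'x) \<Rightarrow> ('w \<Rightarrow> 'd \<Rightarrow> 'a) \<Rightarrow> nat \<Rightarrow> 'w \<Rightarrow> ('w, 'd) gnested \<Rightarrow> ('x, 'a) gnested" where
  "ca_iter_map f h 0 x t = GBase (h x (unGBase t))"
| "ca_iter_map f h (Suc k) x t = gpoly_map f (ca_iter_map f h k) t"

definition gmod_pullback ::
    "('w \<Rightarrow> 'x) \<Rightarrow> ('w \<Rightarrow> 'd \<Rightarrow> 'a) \<Rightarrow> ('x, 'a, 'c) gmod \<Rightarrow> ('w, 'd, 'c) gmod" where
  "gmod_pullback f h N =
    \<lparr>part = (\<lambda>x. part N (f x)), act = (\<lambda>y x a. act N (f y) (f x) (h y a))\<rparr>"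

definition ca_res_map ::
    "'x monoid \<Rightarrow> ('x, 'a) gring \<Rightarrow> ('w \<Rightarrow> 'x) \<Rightarrow> ('w \<Rightarrow> 'd \<Rightarrow> 'a) \<Rightarrow> nat \<Rightarrow> 'w \<Rightarrow>
     ('w, 'd) ca_el \<Rightarrow> ('x, 'a) ca_el" where
  "ca_res_map X' A' f h n x =
    ca_Ab_map X' A' (ca_iter X' A' (Suc n)) (ca_aug X' A' (Suc n))
      f h (ca_iter_map f h (Suc n)) (f x)"

definition HQ_CA_map ::
    "'x monoid \<Rightarrow> ('x, 'a) gring \<Rightarrow> ('w \<Rightarrow> 'x) \<Rightarrow> ('w \<Rightarrow> 'd \<Rightarrow> 'a) \<Rightarrow> nat \<Rightarrow> 'w \<Rightarrow>
     ('w, 'd) ca_el set \<Rightarrow> ('x, 'a) ca_el set" where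
  "HQ_CA_map X' A' f h n x =
    simp_pi_map (\<lambda>k. part (ca_res X' A' k) (f x)) (ca_res_face X' A' (f x)) n
      (ca_res_map X' A' f h n x)"

definition HQ_CA_homology_map ::
    "'x monoid \<Rightarrow> ('x, 'a) gring \<Rightarrow> ('w \<Rightarrow> 'x) \<Rightarrow> ('w \<Rightarrow> 'd \<Rightarrow> 'a) \<Rightarrow> ('x, 'a, 'm) gmod \<Rightarrow> nat \<Rightarrow>
     ('w \<times> 'm \<times> ('w, 'd) ca_el \<Rightarrow>\<^sub>0 int) set set \<Rightarrow> ('x \<times> 'm \<times> ('x, 'a) ca_el \<Rightarrow>\<^sub>0 int) set set" where
  "HQ_CA_homology_map X' A' f h M n =
    simp_pi_map (ca_tensor_res X' A' M) (ca_tensor_res_face X' A' M) n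
      (presented_map (tensor_gens X' M (ca_res X' A' n)) (gmod_tensor_rels X' A' M (ca_res X' A' n))
        (\<lambda>(z, m, c). (f z, m, ca_res_map X' A' f h n z c)))"

definition HQ_CA_cohomology_map ::
    "'w monoid \<Rightarrow> ('w, 'd) gring \<Rightarrow> 'x monoid \<Rightarrow> ('x, 'a) gring \<Rightarrow>
     ('w \<Rightarrow> 'x) \<Rightarrow> ('w \<Rightarrow> 'd \<Rightarrow> 'a) \<Rightarrow> ('x, 'a, 'c) gmod \<Rightarrow> nat \<Rightarrow>
     ('x \<Rightarrow> ('x, 'a) ca_el \<Rightarrow> 'c) set \<Rightarrow> ('w \<Rightarrow> ('w, 'd) ca_el \<Rightarrow> 'c) set" where
  "HQ_CA_cohomology_map X A X' A' f h N n =
    coset_map (ca_cochains X A (gmod_pullback f h N) n)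
      (coboundaries (ca_cochains X A (gmod_pullback f h N)) (ca_coboundary X A) n)
      (\<lambda>\<theta>. \<lambda>x\<in>carrier X. \<lambda>c\<in>carrier (part (ca_res X A n) x). \<theta> (f x) (ca_res_map X' A' f h n x c))"


section \<open>The graded monoid ring\<close>

text \<open>
  Every graded part is \<open>\<int>\<close>, with generator \<open>1\<close>. A homomorphism \<open>f\<close> of monoids induces
  the identity of \<open>\<int>\<close> from degree \<open>x\<close> to degree \<open>f x\<close>.
\<close>

definition graded_monoid_ring :: "'x monoid \<Rightarrow> ('x, int) gring" where
  "graded_monoid_ring X =
    \<lparr>part = (\<lambda>x. integer_group), gmul = (\<lambda>x y a b. a * b), gone = 1\<rparr>"

definition graded_monoid_ring_map :: "('w \<Rightarrow> 'x) \<Rightarrow> 'w \<Rightarrow> int \<Rightarrow> int" where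
  "graded_monoid_ring_map f x a = a"

definition left_beck_gmod :: "'x monoid \<Rightarrow> ('x, 'c) beck \<Rightarrow> ('x, int, 'c) gmod" where
  "left_beck_gmod X N =
    \<lparr>part = part N, act = (\<lambda>y x k n. tr N y x n [^]\<^bsub>part N (x \<otimes>\<^bsub>X\<^esub> y)\<^esub> k)\<rparr>"

definition right_beck_gmod :: "('x, 'c) beck \<Rightarrow> ('x, int, 'c) gmod" where
  "right_beck_gmod M =
    \<lparr>part = part M, act = (\<lambda>y x k m. tr M y x m [^]\<^bsub>part M x\<^esub> k)\<rparr>"

lemma comm_gring_graded_monoid_ring:
  assumes "comm_monoid X"
  shows "comm_gring X (graded_monoid_ring X)"
  by (simp add: comm_gring_def graded_monoid_ring_def hom_def algebra_simps abelian_integer_group)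

lemma int_pow_hom:
  assumes h: "h \<in> hom G H" and H: "comm_group H"
  shows "(\<lambda>n. h n [^]\<^bsub>H\<^esub> (k::int)) \<in> hom G H"
    and "n \<in> carrier G \<Longrightarrow> (\<lambda>k::int. h n [^]\<^bsub>H\<^esub> k) \<in> hom integer_group H"
proof -
  interpret H: comm_group H by fact
  note cl = hom_in_carrier[OF h]
  show "(\<lambda>n. h n [^]\<^bsub>H\<^esub> k) \<in> hom G H"
    by (rule homI) (simp_all add: cl hom_mult[OF h] H.int_pow_distrib)
  show "(\<lambda>k::int. h n [^]\<^bsub>H\<^esub> k) \<in> hom integer_group H" if "n \<in> carrier G"
    using that by (intro homI) (simp_all add: cl H.int_pow_mult)
qed

lemma left_gmod_left_beck_gmod:
  assumes X: "comm_monoid X" and N: "left_beck X N"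
  shows "left_gmod X (graded_monoid_ring X) (left_beck_gmod X N)"
proof -
  interpret X: comm_monoid X by fact
  have gr: "comm_group (part N x)" if "x \<in> carrier X" for x
    using N that by (simp add: left_beck_def)
  then have gr': "group (part N x)" if "x \<in> carrier X" for x
    using that by (simp add: comm_group_def)
  have tr: "tr N y x \<in> hom (part N x) (part N (x \<otimes>\<^bsub>X\<^esub> y))" if "x \<in> carrier X" "y \<in> carrier X" for x y
    using N that by (simp add: left_beck_def)
  have tr_1: "tr N \<one>\<^bsub>X\<^esub> x n = n" if "x \<in> carrier X" "n \<in> carrier (part N x)" for x n
    using N that by (simp add: left_beck_def)
  have tr_tr: "tr N z (x \<otimes>\<^bsub>X\<^esub> y) (tr N y x n) = tr N (y \<otimes>\<^bsub>X\<^esub> z) x n"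
    if "x \<in> carrier X" "y \<in> carrier X" "z \<in> carrier X" "n \<in> carrier (part N x)" for x y z n
    using N that by (simp add: left_beck_def)
  have "tr N z (x \<otimes>\<^bsub>X\<^esub> y) (tr N y x n [^]\<^bsub>part N (x \<otimes>\<^bsub>X\<^esub> y)\<^esub> a) [^]\<^bsub>part N (x \<otimes>\<^bsub>X\<^esub> y \<otimes>\<^bsub>X\<^esub> z)\<^esub> b =
      tr N (z \<otimes>\<^bsub>X\<^esub> y) x n [^]\<^bsub>part N (x \<otimes>\<^bsub>X\<^esub> (z \<otimes>\<^bsub>X\<^esub> y))\<^esub> (b * a)"
    if *: "x \<in> carrier X" "y \<in> carrier X" "z \<in> carrier X" "n \<in> carrier (part N x)"
    for x y z n and a b :: int
  proof -
    have x: "x \<otimes>\<^bsub>X\<^esub> y \<in> carrier X" "x \<otimes>\<^bsub>X\<^esub> y \<otimes>\<^bsub>X\<^esub> z \<in> carrier X" using * by simp_all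
    have t: "tr N y x n \<in> carrier (part N (x \<otimes>\<^bsub>X\<^esub> y))"
      using hom_in_carrier[OF tr[OF *(1,2)] *(4)] .
    have "tr N z (x \<otimes>\<^bsub>X\<^esub> y) (tr N y x n [^]\<^bsub>part N (x \<otimes>\<^bsub>X\<^esub> y)\<^esub> a) =
        tr N (y \<otimes>\<^bsub>X\<^esub> z) x n [^]\<^bsub>part N (x \<otimes>\<^bsub>X\<^esub> y \<otimes>\<^bsub>X\<^esub> z)\<^esub> a"
      using hom_int_pow[OF tr[OF x(1) *(3)] t gr'[OF x(1)] gr'[OF x(2)]] tr_tr[OF *] by simp
    moreover have "tr N (y \<otimes>\<^bsub>X\<^esub> z) x n \<in> carrier (part N (x \<otimes>\<^bsub>X\<^esub> y \<otimes>\<^bsub>X\<^esub> z))"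
      using hom_in_carrier[OF tr[OF x(1) *(3)] t] tr_tr[OF *] by simp
    ultimately show ?thesis
      using group.int_pow_pow[OF gr'[OF x(2)]] * by (simp add: X.m_assoc X.m_comm[of z y] mult.commute)
  qed
  then show ?thesis
    unfolding left_gmod_def left_beck_gmod_def graded_monoid_ring_def
    by (simp add: gr tr int_pow_hom[OF tr gr] tr_1 group.int_pow_1[OF gr'])
qed

lemma right_gmod_right_beck_gmod:
  assumes X: "comm_monoid X" and M: "right_beck X M"
  shows "right_gmod X (graded_monoid_ring X) (right_beck_gmod M)"
proof -
  interpret X: comm_monoid X by fact
  have gr: "comm_group (part M x)" if "x \<in> carrier X" for x
    using M that by (simp add: right_beck_def)
  then have gr': "group (part M x)" if "x \<in> carrier X" for x
    using that by (simp add: comm_group_def)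
  have tr: "tr M y x \<in> hom (part M (x \<otimes>\<^bsub>X\<^esub> y)) (part M x)" if "x \<in> carrier X" "y \<in> carrier X" for x y
    using M that by (simp add: right_beck_def)
  have tr_1: "tr M \<one>\<^bsub>X\<^esub> x m = m" if "x \<in> carrier X" "m \<in> carrier (part M x)" for x m
    using M that by (simp add: right_beck_def)
  have tr_tr: "tr M y x (tr M z (x \<otimes>\<^bsub>X\<^esub> y) m) = tr M (y \<otimes>\<^bsub>X\<^esub> z) x m"
    if "x \<in> carrier X" "y \<in> carrier X" "z \<in> carrier X" "m \<in> carrier (part M (x \<otimes>\<^bsub>X\<^esub> y \<otimes>\<^bsub>X\<^esub> z))" for x y z m
    using M that by (simp add: right_beck_def)
  have "tr M y x (tr M z (x \<otimes>\<^bsub>X\<^esub> y) m [^]\<^bsub>part M (x \<otimes>\<^bsub>X\<^esub> y)\<^esub> a) [^]\<^bsub>part M x\<^esub> b =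
      tr M (y \<otimes>\<^bsub>X\<^esub> z) x m [^]\<^bsub>part M x\<^esub> (a * b)"
    if *: "x \<in> carrier X" "y \<in> carrier X" "z \<in> carrier X" "m \<in> carrier (part M (x \<otimes>\<^bsub>X\<^esub> y \<otimes>\<^bsub>X\<^esub> z))"
    for x y z m and a b :: int
  proof -
    have x: "x \<otimes>\<^bsub>X\<^esub> y \<in> carrier X" using * by simp
    have t: "tr M z (x \<otimes>\<^bsub>X\<^esub> y) m \<in> carrier (part M (x \<otimes>\<^bsub>X\<^esub> y))"
      using hom_in_carrier[OF tr[OF x *(3)] *(4)] .
    have "tr M y x (tr M z (x \<otimes>\<^bsub>X\<^esub> y) m [^]\<^bsub>part M (x \<otimes>\<^bsub>X\<^esub> y)\<^esub> a) =
        tr M (y \<otimes>\<^bsub>X\<^esub> z) x m [^]\<^bsub>part M x\<^esub> a"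
      using hom_int_pow[OF tr[OF *(1,2)] t gr'[OF x] gr'[OF *(1)]] tr_tr[OF *] by simp
    moreover have "tr M (y \<otimes>\<^bsub>X\<^esub> z) x m \<in> carrier (part M x)"
      using hom_in_carrier[OF tr[OF *(1,2)] t] tr_tr[OF *] by simp
    ultimately show ?thesis
      using group.int_pow_pow[OF gr'[OF *(1)]] by simp
  qed
  then show ?thesis
    unfolding right_gmod_def right_beck_gmod_def graded_monoid_ring_def
    by (simp add: gr tr int_pow_hom[OF tr gr] tr_1 group.int_pow_1[OF gr'])
qed

end

theory Submission
  imports Defs
begin

text \<open>
  Both theories are computed from free simplicial resolutions. In degree \<open>n\<close> the monoid \<open>X\<close> is
  resolved by the \<open>n + 1\<close> times iterated free commutative monoid, whose elements are nested multisets
  of elements of \<open>X\<close>, and the graded monoid ring by the \<open>n + 1\<close> times iterated free commutative graded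
  ring, whose elements are nested polynomials. The first resolution is a deformation retract of the
  second one after abelianization, through maps of simplicial modules that can be written down.

  \<^item> A multiset is a monomial. Applied at all levels, this gives an inclusion (\<open>embed\<close>) of the nested
    multisets into the nested polynomials. It commutes with faces (\<open>embed_face\<close>) and is natural
    in the monoid (\<open>embed_map_nested\<close>).
  \<^item> A polynomial is an integral combination of monomials. Applied at all levels, this assigns to a
    nested polynomial a combination of nested multisets (\<open>lin\<close>). It commutes with faces
    (\<open>lin_face\<close>) and is left inverse to the inclusion (\<open>lin_poly_embed\<close>). It does not take values in a monoid,
    but an abelianization extends additively to combinations, and the Leibniz rule for combinations
    is that for their terms, since the augmentation of a polynomial is the sum of the coefficients of its
    linearization (\<open>coeff_sum_lin_poly\<close>, \<open>Leibniz_nested_terms\<close>).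
  \<^item> The composite of the two on nested polynomials is homotopic to the identity. The homotopy
    (\<open>htpy\<close>) replaces a variable by the variable named after its linearization. Its faces are the
    composite at one end (\<open>gface_0_htpy\<close>) and the identity at the other end (\<open>gface_last_htpy\<close>).

  All of these are compatible with the augmentations, so that they induce maps of modules on the
  abelianizations, which is the content of \<open>gmod_retract\<close>. A retract of simplicial modules gives
  isomorphisms on the homology of each graded part (\<open>simp_pi_iso\<close>), on homology after tensoring with
  a right module (\<open>simplicial_retract_tensor\<close>), and on the cohomology of homomorphisms into a left
  module (\<open>cohomology_iso\<close>). Finally, tensor products and groups of homomorphisms of Beck
  modules are those of modules over the graded monoid ring (\<open>beck_tensor_eq\<close>, \<open>beck_Hom_eq_zHom\<close>),
  because homomorphisms and tensors over the integers take care of the integer multiples.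
\<close>

section \<open>Polynomials with integer coefficients\<close>

abbreviation var :: "'v \<Rightarrow> ('v multiset \<Rightarrow>\<^sub>0 int)" where
  "var v \<equiv> frag_of {#v#}"

text \<open>
  Polynomials are elements of the free abelian group on the multisets of variables, and multisets of
  variables are the monomials. Evaluation is allowed in any commutative ring, so that augmentations,
  which take integer values, and maps between polynomial rings are instances of one operation.
\<close>

definition poly_subst :: "('v \<Rightarrow> 'r::comm_ring_1) \<Rightarrow> ('v multiset \<Rightarrow>\<^sub>0 int) \<Rightarrow> 'r" where
  "poly_subst g p =
    (\<Sum>m\<in>Poly_Mapping.keys p. of_int (Poly_Mapping.lookup p m) * (\<Prod>v\<in>#m. g v))"

lemma poly_subst_superset:
  assumes "finite I" "Poly_Mapping.keys p \<subseteq> I"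
  shows "poly_subst g p = (\<Sum>m\<in>I. of_int (Poly_Mapping.lookup p m) * (\<Prod>v\<in>#m. g v))"
  unfolding poly_subst_def
  by (rule sum.mono_neutral_left) (use assms in \<open>auto simp: in_keys_iff\<close>)

lemma poly_subst_zero [simp]: "poly_subst g 0 = 0"
  by (simp add: poly_subst_def)

lemma poly_subst_frag_of [simp]: "poly_subst g (frag_of m) = (\<Prod>v\<in>#m. g v)"
  by (simp add: poly_subst_def)

lemma poly_subst_one [simp]: "poly_subst g 1 = 1"
  using poly_subst_frag_of[of g "{#}"] by (simp add: single_one)

lemma poly_subst_add: "poly_subst g (p + q) = poly_subst g p + poly_subst g q"
proof -
  let ?I = "Poly_Mapping.keys p \<union> Poly_Mapping.keys q"
  have "Poly_Mapping.keys (p + q) \<subseteq> ?I" by (rule keys_add)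
  then show ?thesis
    by (simp add: poly_subst_superset[of ?I] lookup_add ring_distribs sum.distrib)
qed

lemma poly_subst_uminus: "poly_subst g (- p) = - poly_subst g p"
  by (simp add: poly_subst_def sum_negf)

lemma poly_subst_diff: "poly_subst g (p - q) = poly_subst g p - poly_subst g q"
  using poly_subst_add[of g p "- q"] by (simp add: poly_subst_uminus)

lemma frag_of_mult: "frag_of a * frag_of b = frag_of (a + b)"
  by (simp add: mult_single)

lemma poly_subst_mult: "poly_subst g (p * q) = poly_subst g p * poly_subst g q"
proof -
  have "poly_subst g (frag_of m * q) = poly_subst g (frag_of m) * poly_subst g q" for m
    using subset_UNIV
    by (induction q rule: frag_induction)
      (simp_all add: frag_of_mult poly_subst_diff right_diff_distrib)
  with subset_UNIV show ?thesis
    by (induction p rule: frag_induction) (simp_all add: poly_subst_diff left_diff_distrib)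
qed

lemma poly_subst_prod_mset: "poly_subst g (\<Prod>v\<in>#m. f v) = (\<Prod>v\<in>#m. poly_subst g (f v))"
  by (induction m) (simp_all add: poly_subst_mult)

lemma poly_subst_subst: "poly_subst g (poly_subst f p) = poly_subst (\<lambda>v. poly_subst g (f v)) p"
  using subset_UNIV
  by (induction p rule: frag_induction) (simp_all add: poly_subst_diff poly_subst_prod_mset)

lemma poly_subst_of_int: "poly_subst g (of_int k) = of_int k"
  by (induction k rule: int_induct[where k = 0]) (simp_all add: poly_subst_add poly_subst_diff)

lemma poly_subst_cong:
  assumes "\<And>m v. m \<in> Poly_Mapping.keys p \<Longrightarrow> v \<in># m \<Longrightarrow> f v = g v"
  shows "poly_subst f p = poly_subst g p"
  unfolding poly_subst_def
  by (intro sum.cong refl arg_cong2[where f = "(*)"] arg_cong[where f = prod_mset] image_mset_cong)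
    (use assms in blast)

lemma prod_mset_frag_of: "(\<Prod>v\<in>#m. frag_of (f v)) = frag_of (\<Sum>v\<in>#m. f v)"
  by (induction m) (simp_all add: frag_of_mult single_one)

lemma prod_mset_var: "(\<Prod>v\<in>#m. var (f v)) = frag_of (image_mset f m)"
  by (simp add: prod_mset_frag_of)

lemma poly_subst_monomials: "poly_subst (\<lambda>v. frag_of (f v)) p = frag_extend (\<lambda>m. frag_of (\<Sum>v\<in>#m. f v)) p"
  using subset_UNIV
  by (induction p rule: frag_induction) (simp_all add: poly_subst_diff frag_extend_diff prod_mset_frag_of)

lemma poly_subst_vars: "poly_subst (\<lambda>v. var (f v)) p = frag_extend (\<lambda>m. frag_of (image_mset f m)) p"
  using subset_UNIV
  by (induction p rule: frag_induction) (simp_all add: poly_subst_diff frag_extend_diff prod_mset_var)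

lemma poly_subst_var: "poly_subst var p = p"
  using poly_subst_vars[of "\<lambda>v. v" p] frag_expansion[of p] by simp

lemma of_int_mult_frag: "of_int k * (p :: 'v multiset \<Rightarrow>\<^sub>0 int) = frag_cmul k p"
  by (induction k rule: int_induct[where k = 0])
    (simp_all add: ring_distribs frag_cmul_distrib frag_cmul_diff_distrib)

section \<open>Products of multisets in a monoid\<close>

locale grading_monoid = comm_monoid G for G :: "'x monoid" (structure)

lemma grading_monoidI [intro]: "comm_monoid G \<Longrightarrow> grading_monoid G"
  by (simp add: grading_monoid_def)

lemma (in grading_monoid) mset_prod_superset:
  assumes "finite I" "set_mset m \<subseteq> I" "I \<subseteq> carrier G"
  shows "mset_prod G m = (\<Otimes>x\<in>I. x [^] count m x)"
  unfolding mset_prod_def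
  by (rule finprod_mono_neutral_cong_left) (use assms in \<open>auto simp: not_in_iff\<close>)

lemma (in grading_monoid) mset_prod_empty [simp]: "mset_prod G {#} = \<one>"
  by (simp add: mset_prod_def)

lemma (in grading_monoid) mset_prod_closed:
  assumes "set_mset m \<subseteq> carrier G"
  shows "mset_prod G m \<in> carrier G"
  unfolding mset_prod_def by (rule finprod_closed) (use assms in auto)

lemma (in grading_monoid) mset_prod_union:
  assumes "set_mset m \<subseteq> carrier G" "set_mset m' \<subseteq> carrier G"
  shows "mset_prod G (m + m') = mset_prod G m \<otimes> mset_prod G m'"
proof -
  let ?I = "set_mset m \<union> set_mset m'"
  have I: "finite ?I" "?I \<subseteq> carrier G" using assms by auto
  have "mset_prod G (m + m') = (\<Otimes>x\<in>?I. x [^] count m x \<otimes> x [^] count m' x)"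
    unfolding mset_prod_superset[OF I(1) _ I(2), of "m + m'", simplified]
    by (rule finprod_cong') (use I in \<open>auto simp: nat_pow_mult subsetD\<close>)
  also have "\<dots> = mset_prod G m \<otimes> mset_prod G m'"
    unfolding mset_prod_superset[OF I(1) _ I(2), of m, simplified]
      mset_prod_superset[OF I(1) _ I(2), of m', simplified]
    by (rule finprod_multf) (use I in auto)
  finally show ?thesis .
qed

lemma (in grading_monoid) mset_prod_single:
  assumes "x \<in> carrier G"
  shows "mset_prod G {#x#} = x"
  using assms by (simp add: mset_prod_def)

lemma (in grading_monoid) mset_prod_add_mset:
  assumes "x \<in> carrier G" "set_mset m \<subseteq> carrier G"
  shows "mset_prod G (add_mset x m) = x \<otimes> mset_prod G m"
  using mset_prod_union[of "{#x#}" m] assms by (simp add: mset_prod_single)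

lemma mset_prod_hom:
  assumes G: "comm_monoid G" and H: "comm_monoid H" and f: "f \<in> hom G H" "f \<one>\<^bsub>G\<^esub> = \<one>\<^bsub>H\<^esub>"
    and m: "set_mset m \<subseteq> carrier G"
  shows "f (mset_prod G m) = mset_prod H (image_mset f m)"
proof -
  interpret G: grading_monoid G using G ..
  interpret H: grading_monoid H using H ..
  show ?thesis using m
  proof (induction m)
    case (add x m)
    then have "set_mset (image_mset f m) \<subseteq> carrier H" "f x \<in> carrier H"
      using hom_in_carrier[OF f(1)] by auto
    with add show ?case
      by (simp add: G.mset_prod_add_mset H.mset_prod_add_mset hom_mult[OF f(1)] G.mset_prod_closed)
  qed (simp add: f)
qed

lemma mset_prod_prod_mset:
  fixes w :: "'a \<Rightarrow> 'r::comm_monoid_mult"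
  assumes G: "comm_monoid G" and w: "w \<one>\<^bsub>G\<^esub> = 1"
    "\<And>a b. a \<in> carrier G \<Longrightarrow> b \<in> carrier G \<Longrightarrow> w (a \<otimes>\<^bsub>G\<^esub> b) = w a * w b"
    and m: "set_mset m \<subseteq> carrier G"
  shows "w (mset_prod G m) = (\<Prod>v\<in>#m. w v)"
proof -
  interpret G: grading_monoid G using G ..
  show ?thesis using m
    by (induction m) (simp_all add: w G.mset_prod_add_mset G.mset_prod_closed)
qed

lemma mset_prod_sum_mset:
  fixes w :: "'a \<Rightarrow> 'r::comm_monoid_add"
  assumes G: "comm_monoid G" and w: "w \<one>\<^bsub>G\<^esub> = 0"
    "\<And>a b. a \<in> carrier G \<Longrightarrow> b \<in> carrier G \<Longrightarrow> w (a \<otimes>\<^bsub>G\<^esub> b) = w a + w b"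
    and m: "set_mset m \<subseteq> carrier G"
  shows "w (mset_prod G m) = (\<Sum>v\<in>#m. w v)"
proof -
  interpret G: grading_monoid G using G ..
  show ?thesis using m
    by (induction m) (simp_all add: w G.mset_prod_add_mset G.mset_prod_closed)
qed

section \<open>Homogeneous polynomials\<close>

definition homog_monos :: "'x monoid \<Rightarrow> 'v set \<Rightarrow> ('v \<Rightarrow> 'x) \<Rightarrow> 'x \<Rightarrow> 'v multiset set" where
  "homog_monos X W d x = {m. set_mset m \<subseteq> W \<and> mset_prod X (image_mset d m) = x}"

definition homog_polys :: "'x monoid \<Rightarrow> 'v set \<Rightarrow> ('v \<Rightarrow> 'x) \<Rightarrow> 'x \<Rightarrow> ('v multiset \<Rightarrow>\<^sub>0 int) set" where
  "homog_polys X W d x = {p. Poly_Mapping.keys p \<subseteq> homog_monos X W d x}"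

lemma homog_polys_zero [simp]: "0 \<in> homog_polys X W d x"
  by (simp add: homog_polys_def)

lemma homog_polys_diff: "p \<in> homog_polys X W d x \<Longrightarrow> q \<in> homog_polys X W d x \<Longrightarrow> p - q \<in> homog_polys X W d x"
  using keys_diff[of p q] by (auto simp: homog_polys_def)

lemma homog_polys_add: "p \<in> homog_polys X W d x \<Longrightarrow> q \<in> homog_polys X W d x \<Longrightarrow> p + q \<in> homog_polys X W d x"
  using keys_add[of p q] by (auto simp: homog_polys_def)

lemma homog_polys_uminus: "p \<in> homog_polys X W d x \<Longrightarrow> - p \<in> homog_polys X W d x"
  by (auto simp: homog_polys_def)

lemma homog_polys_cmul: "p \<in> homog_polys X W d x \<Longrightarrow> frag_cmul k p \<in> homog_polys X W d x"
  using keys_cmul[of k p] by (auto simp: homog_polys_def)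

lemma homog_polys_frag_of: "frag_of m \<in> homog_polys X W d x \<longleftrightarrow> m \<in> homog_monos X W d x"
  by (simp add: homog_polys_def)

lemma homog_polys_frag_extend:
  assumes "p \<in> homog_polys X W d x" "\<And>m. m \<in> homog_monos X W d x \<Longrightarrow> f m \<in> homog_polys X W' d' x'"
  shows "frag_extend f p \<in> homog_polys X W' d' x'"
  using keys_frag_extend[of f p] assms unfolding homog_polys_def by blast

context grading_monoid
begin

lemma homog_monos_degree: "m \<in> homog_monos G W d x \<Longrightarrow> d ` W \<subseteq> carrier G \<Longrightarrow> x \<in> carrier G"
  using mset_prod_closed[of "image_mset d m"] by (auto simp: homog_monos_def)

lemma homog_monos_single: "v \<in> W \<Longrightarrow> d v \<in> carrier G \<Longrightarrow> {#v#} \<in> homog_monos G W d (d v)"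
  by (simp add: homog_monos_def mset_prod_single)

lemma homog_polys_var: "v \<in> W \<Longrightarrow> d v \<in> carrier G \<Longrightarrow> var v \<in> homog_polys G W d (d v)"
  by (simp add: homog_polys_frag_of homog_monos_single)

lemma homog_monos_add:
  assumes "d ` W \<subseteq> carrier G" "m \<in> homog_monos G W d x" "m' \<in> homog_monos G W d y"
  shows "m + m' \<in> homog_monos G W d (x \<otimes> y)"
proof -
  have "set_mset (image_mset d m) \<subseteq> carrier G" "set_mset (image_mset d m') \<subseteq> carrier G"
    using assms by (auto simp: homog_monos_def)
  from mset_prod_union[OF this] show ?thesis
    using assms(2,3) by (auto simp: homog_monos_def)
qed

lemma homog_polys_one: "1 \<in> homog_polys G W d \<one>"
  using homog_polys_frag_of[of "{#}" G W d \<one>] by (simp add: homog_monos_def single_one)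

lemma homog_polys_mult:
  assumes "d ` W \<subseteq> carrier G" "p \<in> homog_polys G W d x" "q \<in> homog_polys G W d y"
  shows "p * q \<in> homog_polys G W d (x \<otimes> y)"
  using keys_mult[of p q] homog_monos_add[OF assms(1)] assms(2,3) unfolding homog_polys_def by blast

end

text \<open>
  The homomorphism \<open>\<phi>\<close> of grading monoids is there for naturality in the monoid. With \<open>\<phi>\<close> the
  identity, the lemma says that the ring homomorphisms used below are graded.
\<close>

lemma homog_polys_subst:
  assumes G: "comm_monoid G" and G': "comm_monoid G'" and \<phi>: "\<phi> \<in> hom G G'" "\<phi> \<one>\<^bsub>G\<^esub> = \<one>\<^bsub>G'\<^esub>"
    and W: "d ` W \<subseteq> carrier G" and W': "d' ` W' \<subseteq> carrier G'"
    and g: "\<And>v. v \<in> W \<Longrightarrow> g v \<in> homog_polys G' W' d' (\<phi> (d v))"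
    and p: "p \<in> homog_polys G W d x"
  shows "poly_subst g p \<in> homog_polys G' W' d' (\<phi> x)"
proof -
  interpret G: grading_monoid G using G ..
  interpret G': grading_monoid G' using G' ..
  have mono: "(\<Prod>v\<in>#m. g v) \<in> homog_polys G' W' d' (\<phi> (mset_prod G (image_mset d m)))" if "set_mset m \<subseteq> W" for m
    using that
  proof (induction m)
    case empty
    then show ?case by (simp add: G'.homog_polys_one \<phi>)
  next
    case (add v m)
    then have dm: "set_mset (image_mset d m) \<subseteq> carrier G" "d v \<in> carrier G"
      using W by auto
    then have "\<phi> (mset_prod G (image_mset d (add_mset v m))) = \<phi> (d v) \<otimes>\<^bsub>G'\<^esub> \<phi> (mset_prod G (image_mset d m))"
      by (simp add: G.mset_prod_add_mset[OF dm(2,1)] hom_mult[OF \<phi>(1)] G.mset_prod_closed)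
    with add show ?case by (simp add: G'.homog_polys_mult[OF W'] g)
  qed
  have "Poly_Mapping.keys p \<subseteq> homog_monos G W d x" using p by (simp add: homog_polys_def)
  then show ?thesis
  proof (induction p rule: frag_induction)
    case (one m)
    then show ?case using mono[of m] by (simp add: homog_monos_def)
  qed (simp_all add: poly_subst_diff homog_polys_diff)
qed

section \<open>The iterated free commutative monoids\<close>

text \<open>
  The augmentation of the resolution: nested multisets are multiplied out, from the innermost level
  outwards.
\<close>

primrec nested_degree :: "'x monoid \<Rightarrow> 'x nested \<Rightarrow> 'x" where
  "nested_degree X (Base x) = x"
| "nested_degree X (Node m) = mset_prod X (image_mset (nested_degree X) m)"

lemma comm_monoid_free_cmon: "comm_monoid (free_cmon S)"
  by (rule comm_monoidI) (auto simp: free_cmon_def add.assoc add.commute)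

lemma comm_monoid_cm_iter:
  assumes "comm_monoid X"
  shows "comm_monoid (cm_iter X k)"
proof -
  interpret comm_monoid X by fact
  show ?thesis
    by (cases k) (auto simp: comm_monoid_free_cmon m_ac intro!: comm_monoidI)
qed

lemma carrier_cm_iter_Suc: "carrier (cm_iter X (Suc k)) = {Node m |m. set_mset m \<subseteq> carrier (cm_iter X k)}"
  by (simp add: free_cmon_def)

lemma cm_counit_closed:
  assumes X: "comm_monoid X" and t: "t \<in> carrier (cm_iter X (Suc k))"
  shows "cm_counit X k t \<in> carrier (cm_iter X k)"
proof -
  interpret I: grading_monoid "cm_iter X k" using comm_monoid_cm_iter[OF X] ..
  show ?thesis using t
    by (auto simp: cm_counit_def carrier_cm_iter_Suc simp del: cm_iter.simps intro!: I.mset_prod_closed)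
qed

text \<open>
  The outermost face removes one level of nesting: it takes the product of a multiset of elements in
  the monoid of level \<open>k\<close>. For \<open>k = 0\<close> this is a product in \<open>X\<close>, and otherwise a union of multisets.
\<close>

lemma cm_counit_0:
  assumes X: "comm_monoid X" and m: "set_mset m \<subseteq> carrier (cm_iter X 0)"
  shows "cm_counit X 0 (Node m) = Base (mset_prod X (image_mset unBase m))"
proof -
  have "unBase (mset_prod (cm_iter X 0) m) = mset_prod X (image_mset unBase m)"
    by (rule mset_prod_hom[OF comm_monoid_cm_iter[OF X] X _ _ m]) (auto intro!: homI)
  moreover have "mset_prod (cm_iter X 0) m \<in> range Base"
    using cm_counit_closed[OF X, of "Node m" 0] m
    by (auto simp: cm_counit_def carrier_cm_iter_Suc simp del: cm_iter.simps(2))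
  ultimately show ?thesis by (auto simp: cm_counit_def)
qed

lemma cm_counit_Suc:
  assumes X: "comm_monoid X" and m: "set_mset m \<subseteq> carrier (cm_iter X (Suc k))"
  shows "cm_counit X (Suc k) (Node m) = Node (\<Sum>z\<in>#m. children z)"
proof -
  have "children (mset_prod (cm_iter X (Suc k)) m) = (\<Sum>z\<in>#m. children z)"
    by (rule mset_prod_sum_mset[OF comm_monoid_cm_iter[OF X] _ _ m]) (auto simp: free_cmon_def)
  moreover have "mset_prod (cm_iter X (Suc k)) m \<in> range Node"
    using cm_counit_closed[OF X, of "Node m" "Suc k"] m
    by (auto simp: cm_counit_def carrier_cm_iter_Suc simp del: cm_iter.simps)
  ultimately show ?thesis by (auto simp: cm_counit_def)
qed

context grading_monoid
begin

lemma nested_degree_closed: "t \<in> carrier (cm_iter G k) \<Longrightarrow> nested_degree G t \<in> carrier G"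
proof (induction k arbitrary: t)
  case (Suc k)
  then obtain m where "t = Node m" "set_mset m \<subseteq> carrier (cm_iter G k)"
    by (auto simp: carrier_cm_iter_Suc simp del: cm_iter.simps)
  then show ?case using Suc.IH mset_prod_closed[of "image_mset (nested_degree G) m"] by auto
qed auto

lemma nested_degree_hom: "nested_degree G \<in> hom (cm_iter G k) G" "nested_degree G \<one>\<^bsub>cm_iter G k\<^esub> = \<one>"
proof -
  have *: "set_mset (image_mset (nested_degree G) m) \<subseteq> carrier G" if "set_mset m \<subseteq> carrier (cm_iter G j)" for m j
    using that nested_degree_closed[of _ j] by auto
  show "nested_degree G \<in> hom (cm_iter G k) G"
  proof (cases k)
    case 0
    then show ?thesis by (auto intro!: homI)
  next
    case (Suc j)
    show ?thesis
      by (rule homI) (use nested_degree_closed[of _ k] in \<open>auto simp: Suc free_cmon_def mset_prod_union[OF * *]\<close>)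
  qed
  show "nested_degree G \<one>\<^bsub>cm_iter G k\<^esub> = \<one>"
    by (cases k) (simp_all add: free_cmon_def)
qed

lemma nested_degree_counit:
  assumes t: "t \<in> carrier (cm_iter G (Suc k))"
  shows "nested_degree G (cm_counit G k t) = nested_degree G t"
proof -
  obtain m where m: "t = Node m" "set_mset m \<subseteq> carrier (cm_iter G k)"
    using t by (auto simp: carrier_cm_iter_Suc simp del: cm_iter.simps)
  show ?thesis
    unfolding cm_counit_def m(1)
    using mset_prod_hom[OF comm_monoid_cm_iter[OF comm_monoid_axioms] comm_monoid_axioms nested_degree_hom m(2)] by simp
qed

lemma cm_aug_eq: "t \<in> carrier (cm_iter G k) \<Longrightarrow> cm_aug G k t = nested_degree G t"
proof (induction k arbitrary: t)
  case (Suc k)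
  then show ?case
    using cm_counit_closed[OF comm_monoid_axioms] nested_degree_counit by (simp del: cm_iter.simps)
qed auto

lemma cm_face_closed:
  "i \<le> k \<Longrightarrow> t \<in> carrier (cm_iter G (Suc k)) \<Longrightarrow> cm_face G i k t \<in> carrier (cm_iter G k)"
  and nested_degree_face:
  "i \<le> k \<Longrightarrow> t \<in> carrier (cm_iter G (Suc k)) \<Longrightarrow> nested_degree G (cm_face G i k t) = nested_degree G t"
proof (induction i arbitrary: k t)
  case 0
  {
    case 1 then show ?case using cm_counit_closed[OF comm_monoid_axioms] by (simp del: cm_iter.simps)
  next
    case 2 then show ?case using nested_degree_counit by (simp del: cm_iter.simps)
  }
next
  case (Suc i)
  {
    case 1
    then obtain m j where m: "t = Node m" "set_mset m \<subseteq> carrier (cm_iter G k)" "k = Suc j" "i \<le> j"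
      by (cases k) (auto simp: carrier_cm_iter_Suc simp del: cm_iter.simps)
    then have "cm_face G i j ` set_mset m \<subseteq> carrier (cm_iter G j)"
      using Suc.IH(1)[of j] by blast
    then show ?case
      unfolding m(1,3) carrier_cm_iter_Suc by simp
  next
    case 2
    then obtain m j where m: "t = Node m" "set_mset m \<subseteq> carrier (cm_iter G k)" "k = Suc j" "i \<le> j"
      by (cases k) (auto simp: carrier_cm_iter_Suc simp del: cm_iter.simps)
    then have "image_mset (nested_degree G) (image_mset (cm_face G i j) m) = image_mset (nested_degree G) m"
      unfolding image_mset.compositionality o_def using Suc.IH(2)[of j] by (intro image_mset_cong) blast
    then show ?case
      by (simp add: m)
  }
qed

end

section \<open>The iterated free commutative graded rings\<close>

abbreviation gel :: "'x monoid \<Rightarrow> nat \<Rightarrow> 'x \<Rightarrow> ('x, int) gnested set" where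
  "gel X k x \<equiv> carrier (part (ca_iter X (graded_monoid_ring X) k) x)"

text \<open>
  These pairs are the variables of the next level.
\<close>

definition gvars :: "'x monoid \<Rightarrow> nat \<Rightarrow> ('x \<times> ('x, int) gnested) set" where
  "gvars X k = {(y, s). y \<in> carrier X \<and> s \<in> gel X k y}"

lemma gel_0: "gel X 0 x = range GBase"
  by (simp add: graded_monoid_ring_def)

lemma carrier_free_gring:
  "carrier (part (free_gring X S) x) = GPoly ` homog_polys X {(y, s). y \<in> carrier X \<and> s \<in> S y} fst x"
proof -
  have "monomials X S x = homog_monos X {(y, s). y \<in> carrier X \<and> s \<in> S y} fst x"
    unfolding monomials_def homog_monos_def by blast
  then show ?thesis
    by (auto simp: free_gring_def homog_polys_def)
qed

lemma free_gring_simps: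
  "a \<otimes>\<^bsub>part (free_gring X S) x\<^esub> b = GPoly (unGPoly a + unGPoly b)"
  "\<one>\<^bsub>part (free_gring X S) x\<^esub> = GPoly 0"
  "gmul (free_gring X S) x y a b = GPoly (unGPoly a * unGPoly b)"
  "gone (free_gring X S) = GPoly 1"
  by (simp_all add: free_gring_def)

lemma gel_Suc: "gel X (Suc k) x = GPoly ` homog_polys X (gvars X k) fst x"
  by (simp add: carrier_free_gring gvars_def)

lemma fst_gvars: "fst ` gvars X k \<subseteq> carrier X"
  by (auto simp: gvars_def)

text \<open>
  Every graded ring homomorphism that occurs here between levels of polynomials, faces and homotopies
  included, is a substitution for the variables. The following operations do not mention degrees or carriers,
  so that identities between them reduce to identities of substitutions.
\<close>

definition poly_map ::
    "('x \<times> ('x, int) gnested \<Rightarrow> (('w \<times> ('w, int) gnested) multiset \<Rightarrow>\<^sub>0 int)) \<Rightarrow>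
     ('x, int) gnested \<Rightarrow> ('w, int) gnested" where
  "poly_map g t = GPoly (poly_subst g (unGPoly t))"

lemma unGPoly_poly_map [simp]: "unGPoly (poly_map g t) = poly_subst g (unGPoly t)"
  by (simp add: poly_map_def)

lemma gpoly_map_eq: "gpoly_map f h = poly_map (\<lambda>(y, s). var (f y, h y s))"
  using poly_subst_vars[of "\<lambda>(y, s). (f y, h y s)"]
  by (simp add: gpoly_map_def poly_map_def fun_eq_iff case_prod_unfold)

primrec gcounit :: "nat \<Rightarrow> ('x, int) gnested \<Rightarrow> ('x, int) gnested" where
  "gcounit 0 t = GBase (poly_subst (\<lambda>(y, s). unGBase s) (unGPoly t))"
| "gcounit (Suc k) t = poly_map (\<lambda>(y, s). unGPoly s) t"

text \<open>
  The face \<open>i\<close> applies the evaluation \<open>gcounit\<close> below \<open>i\<close> levels of variables. Each descent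
  into the variables lowers the level by one, hence \<open>k - 1\<close>.
\<close>

primrec gface :: "nat \<Rightarrow> nat \<Rightarrow> ('x, int) gnested \<Rightarrow> ('x, int) gnested" where
  "gface 0 k t = gcounit k t"
| "gface (Suc i) k t = poly_map (\<lambda>(y, s). var (y, gface i (k - 1) s)) t"

primrec gaug :: "nat \<Rightarrow> ('x, int) gnested \<Rightarrow> int" where
  "gaug 0 t = unGBase t"
| "gaug (Suc k) t = poly_subst (\<lambda>(y, s). gaug k s) (unGPoly t)"

lemma gaug_gcounit: "gaug k (gcounit k t) = gaug (Suc k) t"
  by (cases k) (simp_all add: poly_subst_subst case_prod_unfold)

lemma comm_gring_free_gring:
  assumes "comm_monoid X"
  shows "comm_gring X (free_gring X S)"
proof -
  interpret grading_monoid X using assms ..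
  define W where "W = {(y, s). y \<in> carrier X \<and> s \<in> S y}"
  have W: "fst ` W \<subseteq> carrier X" by (auto simp: W_def)
  note C = carrier_free_gring[of X S, folded W_def]
  have grp: "comm_group (part (free_gring X S) x)" for x
  proof (rule comm_groupI)
    fix t assume "t \<in> carrier (part (free_gring X S) x)"
    then obtain p where p: "t = GPoly p" "p \<in> homog_polys X W fst x"
      unfolding C by blast
    then show "\<exists>s\<in>carrier (part (free_gring X S) x). s \<otimes>\<^bsub>part (free_gring X S) x\<^esub> t = \<one>\<^bsub>part (free_gring X S) x\<^esub>"
      unfolding C by (intro bexI[of _ "GPoly (- p)"]) (simp_all add: free_gring_simps homog_polys_uminus)
  qed (auto simp: free_gring_simps C homog_polys_add GPoly_inject algebra_simps)
  have mult: "gmul (free_gring X S) x y a b \<in> carrier (part (free_gring X S) (x \<otimes>\<^bsub>X\<^esub> y))"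
    if "a \<in> carrier (part (free_gring X S) x)" "b \<in> carrier (part (free_gring X S) y)" for x y a b
    using that homog_polys_mult[OF W] unfolding C by (auto simp: free_gring_simps)
  have one: "gone (free_gring X S) \<in> carrier (part (free_gring X S) \<one>\<^bsub>X\<^esub>)"
    by (simp add: C free_gring_simps homog_polys_one)
  have norm: "GPoly (unGPoly a) = a" if "a \<in> carrier (part (free_gring X S) x)" for a x
    using that unfolding C by auto
  have "gmul (free_gring X S) x y a \<in> hom (part (free_gring X S) y) (part (free_gring X S) (x \<otimes>\<^bsub>X\<^esub> y))"
    "(\<lambda>c. gmul (free_gring X S) y x c a) \<in> hom (part (free_gring X S) y) (part (free_gring X S) (y \<otimes>\<^bsub>X\<^esub> x))"
    if "a \<in> carrier (part (free_gring X S) x)" for x y a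
    using mult that by (auto intro!: homI simp: free_gring_simps ring_distribs)
  moreover have "gmul (free_gring X S) x y a b = gmul (free_gring X S) y x b a" for x y a b
    by (simp add: free_gring_simps mult.commute)
  ultimately show ?thesis
    unfolding comm_gring_def using grp one norm by (simp add: free_gring_simps mult.assoc)
qed

lemma comm_gring_ca_iter:
  assumes X: "comm_monoid X" and A: "comm_gring X A"
  shows "comm_gring X (ca_iter X A k)"
proof (cases k)
  case 0
  have grp: "comm_group (part (ca_iter X A 0) x)" if x: "x \<in> carrier X" for x
  proof -
    interpret comm_group "part A x" by (rule comm_gringD(1)[OF A x])
    show ?thesis
    proof (rule comm_groupI)
      fix t assume "t \<in> carrier (part (ca_iter X A 0) x)"
      then show "\<exists>s\<in>carrier (part (ca_iter X A 0) x). s \<otimes>\<^bsub>part (ca_iter X A 0) x\<^esub> t = \<one>\<^bsub>part (ca_iter X A 0) x\<^esub>"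
        by (auto intro!: bexI[of _ "GBase (inv\<^bsub>part A x\<^esub> unGBase t)"])
    qed (auto simp: m_ac)
  qed
  have "gmul (ca_iter X A 0) x y a \<in> hom (part (ca_iter X A 0) y) (part (ca_iter X A 0) (x \<otimes>\<^bsub>X\<^esub> y))"
    "(\<lambda>c. gmul (ca_iter X A 0) y x c a) \<in> hom (part (ca_iter X A 0) y) (part (ca_iter X A 0) (y \<otimes>\<^bsub>X\<^esub> x))"
    if x: "x \<in> carrier X" "y \<in> carrier X" "a \<in> carrier (part (ca_iter X A 0) x)" for x y a
  proof -
    obtain b where b: "a = GBase b" "b \<in> carrier (part A x)" using x by auto
    show "gmul (ca_iter X A 0) x y a \<in> hom (part (ca_iter X A 0) y) (part (ca_iter X A 0) (x \<otimes>\<^bsub>X\<^esub> y))"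
      "(\<lambda>c. gmul (ca_iter X A 0) y x c a) \<in> hom (part (ca_iter X A 0) y) (part (ca_iter X A 0) (y \<otimes>\<^bsub>X\<^esub> x))"
      using hom_mult[OF comm_gringD(3)[OF A x(1,2) b(2)]] hom_mult[OF comm_gringD(4)[OF A x(2,1) b(2)]]
        comm_gring_mult_closed[OF A x(1,2) b(2)] comm_gring_mult_closed[OF A x(2,1) _ b(2)]
      by (auto intro!: homI simp: b(1))
  qed
  moreover have "\<forall>x\<in>carrier X. \<forall>y\<in>carrier X. \<forall>z\<in>carrier X. \<forall>a\<in>carrier (part (ca_iter X A 0) x).
      \<forall>b\<in>carrier (part (ca_iter X A 0) y). \<forall>c\<in>carrier (part (ca_iter X A 0) z).
      gmul (ca_iter X A 0) (x \<otimes>\<^bsub>X\<^esub> y) z (gmul (ca_iter X A 0) x y a b) c =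
      gmul (ca_iter X A 0) x (y \<otimes>\<^bsub>X\<^esub> z) a (gmul (ca_iter X A 0) y z b c)"
    using comm_gringD(7)[OF A] by simp
  moreover have "\<forall>x\<in>carrier X. \<forall>y\<in>carrier X. \<forall>a\<in>carrier (part (ca_iter X A 0) x). \<forall>b\<in>carrier (part (ca_iter X A 0) y).
      gmul (ca_iter X A 0) x y a b = gmul (ca_iter X A 0) y x b a"
    using comm_gringD(6)[OF A] by simp
  ultimately show ?thesis
    unfolding comm_gring_def 0 using grp comm_gringD(2,5)[OF A] by (simp del: One_nat_def)
next
  case (Suc j)
  then show ?thesis by (simp add: comm_gring_free_gring[OF X])
qed

text \<open>
  The groups of a graded ring are abstract groups with carriers, whereas \<open>poly_subst\<close> computes in a
  type of class \<open>comm_ring_1\<close>. The next lemmas carry powers and products over to the latter.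
\<close>

lemma int_pow_additive:
  fixes u :: "'b \<Rightarrow> 'r::comm_ring_1" and k :: int
  assumes G: "group G" and u: "u \<one>\<^bsub>G\<^esub> = 0"
    "\<And>a b. a \<in> carrier G \<Longrightarrow> b \<in> carrier G \<Longrightarrow> u (a \<otimes>\<^bsub>G\<^esub> b) = u a + u b"
    and a: "a \<in> carrier G"
  shows "u (a [^]\<^bsub>G\<^esub> k) = of_int k * u a"
proof -
  interpret group G by fact
  have nat: "u (a [^]\<^bsub>G\<^esub> n) = of_nat n * u a" for n :: nat
    by (induction n) (simp_all add: u a algebra_simps)
  have inv: "u (inv\<^bsub>G\<^esub> b) = - u b" if "b \<in> carrier G" for b
    using u(2)[OF inv_closed[OF that] that] that by (simp add: u(1) eq_neg_iff_add_eq_0)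
  show ?thesis
    using a by (cases k rule: int_cases2) (simp_all add: int_pow_int int_pow_neg_int nat inv)
qed

lemma finprod_additive:
  fixes u :: "'b \<Rightarrow> 'r::comm_monoid_add"
  assumes G: "comm_monoid G" and u: "u \<one>\<^bsub>G\<^esub> = 0"
    "\<And>a b. a \<in> carrier G \<Longrightarrow> b \<in> carrier G \<Longrightarrow> u (a \<otimes>\<^bsub>G\<^esub> b) = u a + u b"
    and I: "finite I" "f \<in> I \<rightarrow> carrier G"
  shows "u (finprod G f I) = (\<Sum>i\<in>I. u (f i))"
proof -
  interpret comm_monoid G by fact
  show ?thesis using I
    by (induction I rule: finite_induct) (simp_all add: u)
qed

lemma comm_monoid_homogeneous:
  assumes X: "comm_monoid X" and B: "comm_gring X B"
  shows "comm_monoid (homogeneous X B)"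
proof -
  interpret comm_monoid X by fact
  show ?thesis
    unfolding homogeneous_def
    by (rule comm_monoidI)
      (auto simp: m_assoc comm_gringD(2,5,7)[OF B] comm_gring_mult_closed[OF B] intro: m_comm comm_gringD(6)[OF B])
qed

text \<open>
  The elements of the iterated graded rings are wrapped integers or wrapped polynomials, and \<open>u\<close> is
  there to unwrap them. Evaluation in the graded ring, a product of powers in one of its parts, thereby
  becomes evaluation in a single ring.
\<close>

lemma homogeneous_eval:
  fixes u :: "'b \<Rightarrow> 'r::comm_ring_1"
  assumes X: "comm_monoid X" and B: "comm_gring X B" and x: "x \<in> carrier X"
    and u_one: "\<And>y. y \<in> carrier X \<Longrightarrow> u \<one>\<^bsub>part B y\<^esub> = 0"
    and u_add: "\<And>y a b. y \<in> carrier X \<Longrightarrow> a \<in> carrier (part B y) \<Longrightarrow> b \<in> carrier (part B y) \<Longrightarrow>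
        u (a \<otimes>\<^bsub>part B y\<^esub> b) = u a + u b"
    and u_gone: "u (gone B) = 1"
    and u_mul: "\<And>y z a b. y \<in> carrier X \<Longrightarrow> z \<in> carrier X \<Longrightarrow> a \<in> carrier (part B y) \<Longrightarrow> b \<in> carrier (part B z) \<Longrightarrow>
        u (gmul B y z a b) = u a * u b"
    and p: "Poly_Mapping.keys p \<subseteq> homog_monos X {(y, s). y \<in> carrier X \<and> s \<in> carrier (part B y)} fst x"
  defines "v \<equiv> \<Otimes>\<^bsub>part B x\<^esub>m\<in>Poly_Mapping.keys p.
      snd (mset_prod (homogeneous X B) m) [^]\<^bsub>part B x\<^esub> Poly_Mapping.lookup p m"
  shows "v \<in> carrier (part B x)" and "u v = poly_subst (\<lambda>(y, s). u s) p"
proof -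
  interpret G: comm_group "part B x" by (rule comm_gringD(1)[OF B x])
  interpret H: grading_monoid "homogeneous X B" using comm_monoid_homogeneous[OF X B] ..
  let ?e = "\<lambda>m. snd (mset_prod (homogeneous X B) m)"
  have e: "?e m \<in> carrier (part B x)" "u (?e m) = (\<Prod>(y, s)\<in>#m. u s)" if m: "m \<in> Poly_Mapping.keys p" for m
  proof -
    have m': "set_mset m \<subseteq> carrier (homogeneous X B)" "mset_prod X (image_mset fst m) = x"
      using m p by (auto simp: homog_monos_def homogeneous_def)
    have "fst (mset_prod (homogeneous X B) m) = x"
      unfolding m'(2)[symmetric]
      by (rule mset_prod_hom[OF H.comm_monoid_axioms X _ _ m'(1)]) (auto simp: homogeneous_def intro!: homI)
    then show "?e m \<in> carrier (part B x)"
      using H.mset_prod_closed[OF m'(1)] by (auto simp: homogeneous_def)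
    have "(u \<circ> snd) (mset_prod (homogeneous X B) m) = (\<Prod>v\<in>#m. (u \<circ> snd) v)"
      by (rule mset_prod_prod_mset[OF H.comm_monoid_axioms _ _ m'(1)])
        (auto simp: homogeneous_def u_gone u_mul)
    then show "u (?e m) = (\<Prod>(y, s)\<in>#m. u s)" by (simp add: o_def case_prod_unfold)
  qed
  have f: "(\<lambda>m. ?e m [^]\<^bsub>part B x\<^esub> Poly_Mapping.lookup p m) \<in> Poly_Mapping.keys p \<rightarrow> carrier (part B x)"
    using e(1) by auto
  then show "v \<in> carrier (part B x)" unfolding v_def by (rule G.finprod_closed)
  show "u v = poly_subst (\<lambda>(y, s). u s) p"
  proof -
    have "u v = (\<Sum>m\<in>Poly_Mapping.keys p. u (?e m [^]\<^bsub>part B x\<^esub> Poly_Mapping.lookup p m))"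
      unfolding v_def by (rule finprod_additive[OF G.comm_monoid_axioms u_one[OF x] u_add[OF x] finite_keys f])
    also have "\<dots> = poly_subst (\<lambda>(y, s). u s) p"
      unfolding poly_subst_def
    proof (rule sum.cong[OF refl])
      fix m assume m: "m \<in> Poly_Mapping.keys p"
      show "u (?e m [^]\<^bsub>part B x\<^esub> Poly_Mapping.lookup p m) =
          of_int (Poly_Mapping.lookup p m) * (\<Prod>(y, s)\<in>#m. u s)"
        using int_pow_additive[where u = u, OF G.is_group u_one[OF x] u_add[OF x] e(1)[OF m]] e(2)[OF m] by simp
    qed
    finally show ?thesis .
  qed
qed

context grading_monoid
begin

lemma comm_gring_graded: "comm_gring G (graded_monoid_ring G)"
  by (rule comm_gring_graded_monoid_ring[OF comm_monoid_axioms])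

lemma comm_gring_gel: "comm_gring G (ca_iter G (graded_monoid_ring G) k)"
  by (rule comm_gring_ca_iter[OF comm_monoid_axioms comm_gring_graded])

lemma ca_counit_closed:
  assumes "x \<in> carrier G" "t \<in> gel G (Suc k) x"
  shows "ca_counit G (graded_monoid_ring G) k x t \<in> gel G k x"
    and "ca_counit G (graded_monoid_ring G) k x t = gcounit k t"
proof -
  obtain p where p: "t = GPoly p" "Poly_Mapping.keys p \<subseteq> homog_monos G {(y, s). y \<in> carrier G \<and> s \<in> gel G k y} fst x"
    using assms(2) by (auto simp: gel_Suc homog_polys_def gvars_def simp del: ca_iter.simps)
  have one: "(1 :: int) = \<one>\<^bsub>integer_group\<^esub> + 1" by simp
  have *: "ca_counit G (graded_monoid_ring G) k x t \<in> gel G k x \<and>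
      ca_counit G (graded_monoid_ring G) k x t = gcounit k t"
  proof (cases k)
    case 0
    note ev = homogeneous_eval[OF comm_monoid_axioms comm_gring_gel assms(1) _ _ _ _ p(2), of unGBase]
    have cl: "ca_counit G (graded_monoid_ring G) k x t \<in> gel G k x"
      unfolding ca_counit_def p(1) unGPoly_GPoly
      by (rule ev(1)) (auto simp: 0 graded_monoid_ring_def)
    have "unGBase (ca_counit G (graded_monoid_ring G) k x t) = poly_subst (\<lambda>(y, s). unGBase s) (unGPoly t)"
      unfolding ca_counit_def p(1) unGPoly_GPoly
      by (rule ev(2)) (auto simp: 0 graded_monoid_ring_def)
    moreover obtain c where "ca_counit G (graded_monoid_ring G) k x t = GBase c"
      using cl by (auto simp: 0)
    ultimately show ?thesis using cl by (simp add: 0 del: ca_iter.simps)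
  next
    case (Suc j)
    note ev = homogeneous_eval[OF comm_monoid_axioms comm_gring_gel assms(1) _ _ _ _ p(2), of unGPoly]
    have cl: "ca_counit G (graded_monoid_ring G) k x t \<in> gel G k x"
      unfolding ca_counit_def p(1) unGPoly_GPoly
      by (rule ev(1)) (auto simp: Suc free_gring_simps)
    have "unGPoly (ca_counit G (graded_monoid_ring G) k x t) = poly_subst (\<lambda>(y, s). unGPoly s) (unGPoly t)"
      unfolding ca_counit_def p(1) unGPoly_GPoly
      by (rule ev(2)) (auto simp: Suc free_gring_simps)
    moreover obtain c where "ca_counit G (graded_monoid_ring G) k x t = GPoly c"
      using cl by (auto simp: Suc carrier_free_gring)
    ultimately show ?thesis using cl by (simp add: Suc poly_map_def del: ca_iter.simps)
  qed
  then show "ca_counit G (graded_monoid_ring G) k x t \<in> gel G k x"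
    and "ca_counit G (graded_monoid_ring G) k x t = gcounit k t" by auto
qed

lemma ca_aug_eq: "x \<in> carrier G \<Longrightarrow> t \<in> gel G k x \<Longrightarrow> ca_aug G (graded_monoid_ring G) k x t = gaug k t"
proof (induction k arbitrary: t)
  case (Suc k)
  then show ?case
    using ca_counit_closed[OF Suc.prems] gaug_gcounit[of k t] by (simp del: ca_iter.simps gaug.simps)
qed simp

lemma gelE:
  assumes "t \<in> gel G (Suc k) x"
  obtains p where "t = GPoly p" "p \<in> homog_polys G (gvars G k) fst x"
  using assms by (auto simp: gel_Suc simp del: ca_iter.simps)

lemma gel_varD:
  assumes "t \<in> gel G (Suc k) x" "m \<in> Poly_Mapping.keys (unGPoly t)" "(y, s) \<in># m"
  shows "y \<in> carrier G" "s \<in> gel G k y"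
proof -
  have "m \<in> homog_monos G (gvars G k) fst x"
    using assms by (auto simp: gel_Suc homog_polys_def simp del: ca_iter.simps)
  then show "y \<in> carrier G" "s \<in> gel G k y"
    using assms(3) by (auto simp: gvars_def homog_monos_def simp del: ca_iter.simps)
qed

lemma poly_map_cong:
  assumes "t \<in> gel G (Suc k) x" "\<And>y s. y \<in> carrier G \<Longrightarrow> s \<in> gel G k y \<Longrightarrow> g (y, s) = h (y, s)"
  shows "poly_map g t = poly_map h t"
  unfolding poly_map_def
  by (rule arg_cong[where f = GPoly], rule poly_subst_cong) (use gel_varD[OF assms(1)] assms(2) in auto)

end

lemma gvars_poly_map_closed:
  assumes X: "comm_monoid X" "comm_monoid X'" and \<phi>: "\<phi> \<in> hom X X'" "\<phi> \<one>\<^bsub>X\<^esub> = \<one>\<^bsub>X'\<^esub>"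
    and t: "t \<in> gel X (Suc k) x"
    and g: "\<And>y s. y \<in> carrier X \<Longrightarrow> s \<in> gel X k y \<Longrightarrow> g (y, s) \<in> homog_polys X' (gvars X' k') fst (\<phi> y)"
  shows "poly_map g t \<in> gel X' (Suc k') (\<phi> x)"
proof -
  obtain p where p: "t = GPoly p" "p \<in> homog_polys X (gvars X k) fst x"
    using t by (auto simp: gel_Suc simp del: ca_iter.simps)
  have "poly_subst g p \<in> homog_polys X' (gvars X' k') fst (\<phi> x)"
    by (rule homog_polys_subst[OF X \<phi> fst_gvars fst_gvars _ p(2)])
      (use g in \<open>auto simp: gvars_def simp del: ca_iter.simps\<close>)
  then show ?thesis by (simp add: p gel_Suc poly_map_def del: ca_iter.simps)
qed

context grading_monoid
begin

lemma poly_map_closed: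
  assumes "t \<in> gel G (Suc k) x"
    and "\<And>y s. y \<in> carrier G \<Longrightarrow> s \<in> gel G k y \<Longrightarrow> g (y, s) \<in> homog_polys G (gvars G k') fst y"
  shows "poly_map g t \<in> gel G (Suc k') x"
  using gvars_poly_map_closed[OF comm_monoid_axioms comm_monoid_axioms, of id t k x g k'] assms
  by (simp add: hom_def)

lemma gvar_homog: "y \<in> carrier G \<Longrightarrow> s \<in> gel G k y \<Longrightarrow> var (y, s) \<in> homog_polys G (gvars G k) fst y"
  using homog_polys_var[of "(y, s)" "gvars G k" fst] by (simp add: gvars_def del: ca_iter.simps)

lemma gcounit_closed: "x \<in> carrier G \<Longrightarrow> t \<in> gel G (Suc k) x \<Longrightarrow> gcounit k t \<in> gel G k x"
  using ca_counit_closed by metis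

lemma gface_closed: "i \<le> k \<Longrightarrow> x \<in> carrier G \<Longrightarrow> t \<in> gel G (Suc k) x \<Longrightarrow> gface i k t \<in> gel G k x"
proof (induction i arbitrary: k t x)
  case 0
  then show ?case using gcounit_closed by (simp del: ca_iter.simps)
next
  case (Suc i)
  then obtain j where j: "k = Suc j" "i \<le> j" by (cases k) auto
  have "poly_map (\<lambda>(y, s). var (y, gface i j s)) t \<in> gel G (Suc j) x"
    by (rule poly_map_closed[OF Suc.prems(3)]) (use Suc.IH[OF j(2)] gvar_homog j(1) in auto)
  then show ?case by (simp add: j(1) del: ca_iter.simps)
qed

lemma ca_face_eq:
  "i \<le> k \<Longrightarrow> x \<in> carrier G \<Longrightarrow> t \<in> gel G (Suc k) x \<Longrightarrow> ca_face G (graded_monoid_ring G) i k x t = gface i k t"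
proof (induction i arbitrary: k t x)
  case 0
  then show ?case using ca_counit_closed by (simp del: ca_iter.simps)
next
  case (Suc i)
  then obtain j where j: "k = Suc j" "i \<le> j" by (cases k) auto
  have "poly_map (\<lambda>(y, s). var (y, ca_face G (graded_monoid_ring G) i j y s)) t =
      poly_map (\<lambda>(y, s). var (y, gface i j s)) t"
    by (rule poly_map_cong[OF Suc.prems(3)]) (use Suc.IH[OF j(2)] j(1) in auto)
  then show ?case by (simp add: j(1) gpoly_map_eq del: ca_iter.simps)
qed

lemma gaug_poly_map:
  assumes "t \<in> gel G (Suc k) x"
    and "\<And>y s. y \<in> carrier G \<Longrightarrow> s \<in> gel G k y \<Longrightarrow> poly_subst (\<lambda>(y, s). gaug k' s) (g (y, s)) = gaug k s"
  shows "gaug (Suc k') (poly_map g t) = gaug (Suc k) t"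
proof -
  have "poly_subst (\<lambda>(y, s). gaug k' s) (poly_subst g (unGPoly t)) = poly_subst (\<lambda>(y, s). gaug k s) (unGPoly t)"
    unfolding poly_subst_subst
    by (rule poly_subst_cong) (use gel_varD[OF assms(1)] assms(2) in auto)
  then show ?thesis by simp
qed

lemma gaug_gface: "i \<le> k \<Longrightarrow> t \<in> gel G (Suc k) x \<Longrightarrow> gaug k (gface i k t) = gaug (Suc k) t"
proof (induction i arbitrary: k t x)
  case 0
  then show ?case using gaug_gcounit[of k t] by simp
next
  case (Suc i)
  then obtain j where j: "k = Suc j" "i \<le> j" by (cases k) auto
  have "gaug (Suc j) (poly_map (\<lambda>(y, s). var (y, gface i j s)) t) = gaug (Suc (Suc j)) t"
    by (rule gaug_poly_map) (use Suc.IH[OF j(2)] Suc.prems j(1) in \<open>auto simp del: ca_iter.simps gaug.simps\<close>)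
  then show ?case by (simp add: j(1) del: ca_iter.simps gaug.simps)
qed

end

section \<open>The comparison of the two resolutions\<close>

lemma poly_map_poly_map: "poly_map g (poly_map f t) = poly_map (\<lambda>v. poly_subst g (f v)) t"
  by (simp add: poly_map_def poly_subst_subst)

text \<open>
  The inclusion of the iterated free monoids into the iterated free graded rings. All \<open>x\<close> are represented
  by the integer 1: degrees are not part of the elements, but are recorded next to them in the variables.
\<close>

primrec embed :: "'x monoid \<Rightarrow> 'x nested \<Rightarrow> ('x, int) gnested" where
  "embed X (Base x) = GBase 1"
| "embed X (Node m) = GPoly (frag_of (image_mset (\<lambda>t. (nested_degree X t, embed X t)) m))"

definition embed_poly ::
    "'x monoid \<Rightarrow> ('x nested multiset \<Rightarrow>\<^sub>0 int) \<Rightarrow> (('x \<times> ('x, int) gnested) multiset \<Rightarrow>\<^sub>0 int)" where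
  "embed_poly X = poly_subst (\<lambda>z. var (nested_degree X z, embed X z))"

lemma embed_Node: "embed X (Node m) = GPoly (embed_poly X (frag_of m))"
  by (simp add: embed_poly_def prod_mset_var)

text \<open>
  A polynomial is an integral combination of monomials. Here each monomial becomes one variable, so
  that the result is the same combination, now read as a linear polynomial one level higher.
\<close>

definition node_vars :: "('x nested multiset \<Rightarrow>\<^sub>0 int) \<Rightarrow> ('x nested multiset \<Rightarrow>\<^sub>0 int)" where
  "node_vars = frag_extend (\<lambda>m. var (Node m))"

text \<open>
  The linearization. The free commutative graded ring on a graded set is, additively, the free abelian
  group on the free commutative monoid on that set. Suppose that every element \<open>s\<close> of level
  \<open>k\<close> has been assigned a combination of elements of level \<open>k\<close> of the monoid resolution. The assignment
  extends multiplicatively to polynomials in the \<open>s\<close>, which gives \<open>lin_poly\<close>, with values in the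
  combinations of multisets of such elements, that is, of elements of level \<open>k + 1\<close>. The
  recursion starts with the integer \<open>c\<close> of degree \<open>y\<close>, which goes to \<open>c\<close> times the element \<open>y\<close>.
  The values of \<open>lin\<close> are linear polynomials in the elements of level \<open>k\<close>, those of \<open>lin_poly\<close>
  arbitrary polynomials in them.
\<close>

primrec lin :: "nat \<Rightarrow> 'x \<Rightarrow> ('x, int) gnested \<Rightarrow> ('x nested multiset \<Rightarrow>\<^sub>0 int)" where
  "lin 0 y s = frag_cmul (unGBase s) (var (Base y))"
| "lin (Suc k) y s = node_vars (poly_subst (\<lambda>(y, s). lin k y s) (unGPoly s))"

definition lin_poly :: "nat \<Rightarrow> ('x, int) gnested \<Rightarrow> ('x nested multiset \<Rightarrow>\<^sub>0 int)" where
  "lin_poly k t = poly_subst (\<lambda>(y, s). lin k y s) (unGPoly t)"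

lemma lin_Suc: "lin (Suc k) y s = node_vars (lin_poly k s)"
  by (simp add: lin_poly_def)

lemma poly_subst_node_vars:
  "poly_subst (\<lambda>z. frag_of (g z)) (node_vars q) = frag_extend (\<lambda>m. frag_of (g (Node m))) q"
  using subset_UNIV
  by (induction q rule: frag_induction) (simp_all add: node_vars_def poly_subst_diff frag_extend_diff)

lemma poly_subst_one_node_vars: "poly_subst (\<lambda>_. 1) (node_vars q) = poly_subst (\<lambda>_. 1) q"
  using subset_UNIV
  by (induction q rule: frag_induction) (simp_all add: node_vars_def poly_subst_diff frag_extend_diff)

lemma poly_subst_frag_cmul: "poly_subst g (frag_cmul k p) = of_int k * poly_subst g p"
  by (simp add: poly_subst_mult poly_subst_of_int flip: of_int_mult_frag)

lemma frag_extend_const: "frag_extend (\<lambda>_. c) q = frag_cmul (poly_subst (\<lambda>_. 1) q) c"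
  using subset_UNIV
  by (induction q rule: frag_induction) (simp_all add: poly_subst_diff frag_extend_diff frag_cmul_diff_distrib)

text \<open>
  Substituting 1 for every variable sums the coefficients. The Leibniz rule of a graded ring
  multiplies by integer augmentations, that of a monoid only translates by degrees; this identity
  reconciles the two.
\<close>

lemma coeff_sum_lin: "poly_subst (\<lambda>_. 1) (lin k y s) = gaug k s"
  by (induction k arbitrary: y s)
    (simp_all add: poly_subst_frag_cmul poly_subst_one_node_vars poly_subst_subst case_prod_unfold)

lemma coeff_sum_lin_poly: "poly_subst (\<lambda>_. 1) (lin_poly k t) = gaug (Suc k) t"
  by (simp add: lin_poly_def poly_subst_subst coeff_sum_lin case_prod_unfold)

lemma gaug_embed: "gaug k (embed X t) = 1" if "t \<in> carrier (cm_iter X k)"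
  using that
proof (induction k arbitrary: t)
  case (Suc k)
  then obtain m where m: "t = Node m" "set_mset m \<subseteq> carrier (cm_iter X k)"
    by (auto simp: carrier_cm_iter_Suc simp del: cm_iter.simps)
  then have "(\<Prod>z\<in>#m. gaug k (embed X z)) = (\<Prod>z\<in>#m. 1)"
    using Suc.IH by (intro arg_cong[where f = prod_mset] image_mset_cong) auto
  then show ?case by (simp add: m image_mset.compositionality o_def)
qed auto

text \<open>
  The embedding of a nested multiset is built from single monomials with coefficient 1, and
  linearization leaves these alone.
\<close>

lemma lin_poly_embed: "set_mset m \<subseteq> carrier (cm_iter X k) \<Longrightarrow> lin_poly k (embed X (Node m)) = frag_of m"
proof -
  have *: "lin_poly k (embed X (Node m)) = frag_of m"
    if "\<And>z. z \<in># m \<Longrightarrow> lin k (nested_degree X z) (embed X z) = var z" for m k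
  proof -
    have "lin_poly k (embed X (Node m)) = (\<Prod>z\<in>#m. lin k (nested_degree X z) (embed X z))"
      by (simp add: lin_poly_def image_mset.compositionality o_def)
    also have "\<dots> = (\<Prod>z\<in>#m. var z)"
      by (intro arg_cong[where f = prod_mset] image_mset_cong that)
    also have "\<dots> = frag_of m" using prod_mset_var[of "\<lambda>z. z" m] by simp
    finally show ?thesis .
  qed
  have **: "lin k (nested_degree X t) (embed X t) = var t" if "t \<in> carrier (cm_iter X k)" for t k
    using that
  proof (induction k arbitrary: t)
    case (Suc k)
    then obtain m where m: "t = Node m" "set_mset m \<subseteq> carrier (cm_iter X k)"
      by (auto simp: carrier_cm_iter_Suc simp del: cm_iter.simps)
    then have "lin_poly k (embed X (Node m)) = frag_of m"
      using Suc.IH by (intro *) auto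
    then show ?case by (simp only: lin_Suc m) (simp add: node_vars_def)
  qed auto
  show "lin_poly k (embed X (Node m)) = frag_of m" if "set_mset m \<subseteq> carrier (cm_iter X k)"
    using * ** that by blast
qed

abbreviation nested_polys :: "'x monoid \<Rightarrow> nat \<Rightarrow> 'x \<Rightarrow> ('x nested multiset \<Rightarrow>\<^sub>0 int) set" where
  "nested_polys X k \<equiv> homog_polys X (carrier (cm_iter X k)) (nested_degree X)"

context grading_monoid
begin

lemma nested_degree_image: "nested_degree G ` carrier (cm_iter G k) \<subseteq> carrier G"
  using nested_degree_closed by blast

lemma poly_subst_homog:
  assumes "d ` W \<subseteq> carrier G" "d' ` W' \<subseteq> carrier G" "p \<in> homog_polys G W d x"
    "\<And>v. v \<in> W \<Longrightarrow> g v \<in> homog_polys G W' d' (d v)"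
  shows "poly_subst g p \<in> homog_polys G W' d' x"
  using homog_polys_subst[OF comm_monoid_axioms comm_monoid_axioms, of id, OF _ _ assms(1,2) _ assms(3)] assms(4)
  by (simp add: hom_def)

lemma lin_closed: "y \<in> carrier G \<Longrightarrow> s \<in> gel G k y \<Longrightarrow> lin k y s \<in> nested_polys G k y"
  and lin_poly_closed: "t \<in> gel G (Suc k) x \<Longrightarrow> lin_poly k t \<in> nested_polys G k x"
proof -
  have *: "lin_poly k t \<in> nested_polys G k x"
    if t: "t \<in> gel G (Suc k) x"
      and IH: "\<And>y s. y \<in> carrier G \<Longrightarrow> s \<in> gel G k y \<Longrightarrow> lin k y s \<in> nested_polys G k y" for k x t
  proof -
    obtain p where p: "t = GPoly p" "p \<in> homog_polys G (gvars G k) fst x"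
      using gelE[OF t] .
    have "poly_subst (\<lambda>(y, s). lin k y s) p \<in> nested_polys G k x"
      by (rule poly_subst_homog[OF fst_gvars nested_degree_image p(2)])
        (use IH in \<open>auto simp: gvars_def simp del: ca_iter.simps cm_iter.simps\<close>)
    then show ?thesis by (simp only: lin_poly_def p unGPoly_GPoly)
  qed
  have **: "lin k y s \<in> nested_polys G k y" if "y \<in> carrier G" "s \<in> gel G k y" for k y s
    using that
  proof (induction k arbitrary: y s)
    case 0
    then show ?case
      using homog_polys_var[of "Base y" "carrier (cm_iter G 0)" "nested_degree G"]
      by (auto intro!: homog_polys_cmul)
  next
    case (Suc k)
    have "var (Node m) \<in> nested_polys G (Suc k) y" if "m \<in> homog_monos G (carrier (cm_iter G k)) (nested_degree G) y" for m
      using homog_polys_var[of "Node m" "carrier (cm_iter G (Suc k))" "nested_degree G"]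
        homog_monos_degree[OF that nested_degree_image] that
      by (auto simp: homog_monos_def carrier_cm_iter_Suc simp del: cm_iter.simps)
    then show ?case
      using *[OF Suc.prems(2) Suc.IH] unfolding lin_Suc node_vars_def
      by (rule homog_polys_frag_extend[rotated])
  qed
  show "y \<in> carrier G \<Longrightarrow> s \<in> gel G k y \<Longrightarrow> lin k y s \<in> nested_polys G k y"
    using ** .
  show "t \<in> gel G (Suc k) x \<Longrightarrow> lin_poly k t \<in> nested_polys G k x"
    using * ** by blast
qed

lemma embed_closed: "t \<in> carrier (cm_iter G k) \<Longrightarrow> embed G t \<in> gel G k (nested_degree G t)"
  and embed_poly_closed: "q \<in> nested_polys G k x \<Longrightarrow> embed_poly G q \<in> homog_polys G (gvars G k) fst x"
proof -
  have *: "embed_poly G q \<in> homog_polys G (gvars G k) fst x"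
    if q: "q \<in> nested_polys G k x"
      and IH: "\<And>t. t \<in> carrier (cm_iter G k) \<Longrightarrow> embed G t \<in> gel G k (nested_degree G t)" for q x k
    unfolding embed_poly_def
    by (rule poly_subst_homog[OF nested_degree_image fst_gvars q]) (use gvar_homog IH nested_degree_closed in blast)
  have **: "embed G t \<in> gel G k (nested_degree G t)" if "t \<in> carrier (cm_iter G k)" for t k
    using that
  proof (induction k arbitrary: t)
    case (Suc k)
    then obtain m where m: "t = Node m" "set_mset m \<subseteq> carrier (cm_iter G k)"
      by (auto simp: carrier_cm_iter_Suc simp del: cm_iter.simps)
    have "embed_poly G (frag_of m) \<in> homog_polys G (gvars G k) fst (nested_degree G t)"
      by (rule *[OF _ Suc.IH]) (use m in \<open>simp_all add: homog_polys_frag_of homog_monos_def\<close>)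
    then show ?case unfolding m(1) embed_Node gel_Suc by simp
  qed (auto simp: graded_monoid_ring_def)
  show "t \<in> carrier (cm_iter G k) \<Longrightarrow> embed G t \<in> gel G k (nested_degree G t)"
    using ** .
  show "q \<in> nested_polys G k x \<Longrightarrow> embed_poly G q \<in> homog_polys G (gvars G k) fst x"
    using * ** by blast
qed

text \<open>
  A product of monomials is the monomial of the union, so that embedding and evaluation commute.
  At the bottom level all factors are the integer 1, and the product in the monoid is remembered only
  by the degree.
\<close>

lemma embed_face:
  "i \<le> k \<Longrightarrow> t \<in> carrier (cm_iter G (Suc k)) \<Longrightarrow> embed G (cm_face G i k t) = gface i k (embed G t)"
proof (induction i arbitrary: k t)
  case 0
  then obtain m where m: "t = Node m" "set_mset m \<subseteq> carrier (cm_iter G k)"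
    by (auto simp: carrier_cm_iter_Suc simp del: cm_iter.simps)
  show ?case
  proof (cases k)
    case k: 0
    have "(\<Prod>z\<in>#m. unGBase (embed G z)) = (\<Prod>z\<in>#m. 1)"
      using m(2) k by (intro arg_cong[where f = prod_mset] image_mset_cong) auto
    then show ?thesis
      using m cm_counit_0[OF comm_monoid_axioms, of m]
      by (simp add: k image_mset.compositionality o_def)
  next
    case k: (Suc j)
    have "(\<Prod>z\<in>#m. unGPoly (embed G z)) =
        (\<Prod>z\<in>#m. frag_of (image_mset (\<lambda>t. (nested_degree G t, embed G t)) (children z)))"
      using m(2) unfolding k
      by (intro arg_cong[where f = prod_mset] image_mset_cong)
        (auto simp: carrier_cm_iter_Suc simp del: cm_iter.simps)
    also have "\<dots> = frag_of (image_mset (\<lambda>t. (nested_degree G t, embed G t)) (\<Sum>z\<in>#m. children z))"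
      unfolding prod_mset_frag_of by (rule arg_cong[where f = frag_of]) (induction m; simp)
    finally show ?thesis
      using m cm_counit_Suc[OF comm_monoid_axioms, of m j]
      by (simp add: k poly_map_def image_mset.compositionality o_def del: cm_iter.simps)
  qed
next
  case (Suc i)
  then obtain m j where m: "t = Node m" "set_mset m \<subseteq> carrier (cm_iter G k)" "k = Suc j" "i \<le> j"
    by (cases k) (auto simp: carrier_cm_iter_Suc simp del: cm_iter.simps)
  have "image_mset (\<lambda>z. (nested_degree G (cm_face G i j z), embed G (cm_face G i j z))) m =
      image_mset (\<lambda>z. (nested_degree G z, gface i j (embed G z))) m"
    by (rule image_mset_cong) (use m Suc.IH[OF m(4)] nested_degree_face[OF m(4)] in auto)
  then show ?case
    by (simp add: m poly_map_def image_mset.compositionality o_def prod_mset_var)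
qed

lemma frag_extend_nested_cong:
  assumes "q \<in> nested_polys G k x"
    "\<And>m. set_mset m \<subseteq> carrier (cm_iter G k) \<Longrightarrow> mset_prod G (image_mset (nested_degree G) m) = x \<Longrightarrow> f m = g m"
  shows "frag_extend f q = frag_extend g q"
  by (rule frag_extend_eq) (use assms in \<open>auto simp: homog_polys_def homog_monos_def\<close>)

text \<open>
  Removing brackets commutes with linearization because \<open>lin_poly\<close> is multiplicative. The bottom face is
  where the grading enters: all monomials of a homogeneous polynomial of degree \<open>y\<close> have the
  same product \<open>y\<close> in the monoid, so that the image of the polynomial is \<open>y\<close> times the sum of the coefficients,
  which is the augmentation. The two statements feed each other: the second one for face \<open>i + 1\<close>
  uses the first one for face \<open>i\<close> inside the variables, and the first one follows from the second one
  at the same level.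
\<close>

lemma lin_face:
  "i \<le> k \<Longrightarrow> y \<in> carrier G \<Longrightarrow> s \<in> gel G (Suc k) y \<Longrightarrow>
    lin k y (gface i k s) = frag_extend (\<lambda>m. var (cm_face G i k (Node m))) (lin_poly k s)"
  and lin_poly_face:
  "i \<le> Suc k \<Longrightarrow> x \<in> carrier G \<Longrightarrow> t \<in> gel G (Suc (Suc k)) x \<Longrightarrow>
    lin_poly k (gface i (Suc k) t) =
    frag_extend (\<lambda>m. frag_of (children (cm_face G i (Suc k) (Node m)))) (lin_poly (Suc k) t)"
proof -
  have step: "lin (Suc k) y (gface i (Suc k) s) =
      frag_extend (\<lambda>m. var (cm_face G i (Suc k) (Node m))) (lin_poly (Suc k) s)"
    if "i \<le> Suc k" "y \<in> carrier G" "s \<in> gel G (Suc (Suc k)) y"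
      and "lin_poly k (gface i (Suc k) s) =
        frag_extend (\<lambda>m. frag_of (children (cm_face G i (Suc k) (Node m)))) (lin_poly (Suc k) s)"
    for i k y s
  proof -
    have "lin (Suc k) y (gface i (Suc k) s) =
        frag_extend (\<lambda>m. var (Node (children (cm_face G i (Suc k) (Node m))))) (lin_poly (Suc k) s)"
      unfolding lin_Suc that(4) node_vars_def
      using frag_extend_compose[of "\<lambda>m. var (Node m)"] by (simp add: o_def)
    also have "\<dots> = frag_extend (\<lambda>m. var (cm_face G i (Suc k) (Node m))) (lin_poly (Suc k) s)"
    proof (rule frag_extend_nested_cong[OF lin_poly_closed[OF that(3)]])
      fix m assume "set_mset m \<subseteq> carrier (cm_iter G (Suc k))"
      then have "Node m \<in> carrier (cm_iter G (Suc (Suc k)))"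
        by (simp add: carrier_cm_iter_Suc[of G "Suc k"] del: cm_iter.simps)
      from cm_face_closed[OF that(1) this]
      show "var (Node (children (cm_face G i (Suc k) (Node m)))) = var (cm_face G i (Suc k) (Node m))"
        by (auto simp: carrier_cm_iter_Suc simp del: cm_iter.simps)
    qed
    finally show ?thesis .
  qed
  have P: "lin_poly k (gface i (Suc k) t) =
      frag_extend (\<lambda>m. frag_of (children (cm_face G i (Suc k) (Node m)))) (lin_poly (Suc k) t)"
    if t: "i \<le> Suc k" "x \<in> carrier G" "t \<in> gel G (Suc (Suc k)) x"
      and IH: "\<And>j y s. i = Suc j \<Longrightarrow> y \<in> carrier G \<Longrightarrow> s \<in> gel G (Suc k) y \<Longrightarrow>
        lin k y (gface j k s) = frag_extend (\<lambda>m. var (cm_face G j k (Node m))) (lin_poly k s)" for i k x t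
  proof (cases i)
    case 0
    have "frag_extend (\<lambda>m. frag_of (children (cm_face G i (Suc k) (Node m)))) (lin_poly (Suc k) t) =
        poly_subst (\<lambda>z. frag_of (children z)) (lin_poly (Suc k) t)"
      unfolding poly_subst_monomials
      by (rule frag_extend_nested_cong[OF lin_poly_closed[OF t(3)]])
        (simp add: 0 cm_counit_Suc[OF comm_monoid_axioms] del: cm_iter.simps)
    also have "\<dots> = poly_subst (\<lambda>(y, s). lin_poly k s) (unGPoly t)"
      unfolding lin_poly_def[of "Suc k"] lin_Suc poly_subst_subst
      by (simp add: case_prod_unfold poly_subst_node_vars flip: frag_expansion)
    also have "\<dots> = lin_poly k (gface i (Suc k) t)"
      by (simp add: 0 lin_poly_def poly_subst_subst case_prod_unfold)
    finally show ?thesis by simp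
  next
    case (Suc j)
    have "frag_extend (\<lambda>m. frag_of (children (cm_face G i (Suc k) (Node m)))) (lin_poly (Suc k) t) =
        poly_subst (\<lambda>z. var (cm_face G j k z)) (lin_poly (Suc k) t)"
      unfolding poly_subst_vars by (simp add: Suc)
    also have "\<dots> = poly_subst (\<lambda>(y, s). frag_extend (\<lambda>m. var (cm_face G j k (Node m))) (lin_poly k s)) (unGPoly t)"
      unfolding lin_poly_def[of "Suc k"] lin_Suc poly_subst_subst
      by (simp add: case_prod_unfold poly_subst_node_vars)
    also have "\<dots> = poly_subst (\<lambda>(y, s). lin k y (gface j k s)) (unGPoly t)"
      by (rule poly_subst_cong) (use gel_varD[OF t(3)] IH[OF Suc] in auto)
    also have "\<dots> = lin_poly k (gface i (Suc k) t)"
      by (simp add: Suc lin_poly_def poly_subst_subst case_prod_unfold)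
    finally show ?thesis by simp
  qed
  have L: "lin k y (gface i k s) = frag_extend (\<lambda>m. var (cm_face G i k (Node m))) (lin_poly k s)"
    if "i \<le> k" "y \<in> carrier G" "s \<in> gel G (Suc k) y" for i k y s
    using that
  proof (induction i arbitrary: k y s)
    case 0
    show ?case
    proof (cases k)
      case k: 0
      have "frag_extend (\<lambda>m. var (cm_face G 0 0 (Node m))) (lin_poly 0 s) = frag_extend (\<lambda>_. var (Base y)) (lin_poly 0 s)"
      proof (rule frag_extend_nested_cong)
        show "lin_poly 0 s \<in> nested_polys G 0 y" using lin_poly_closed 0(3) k by blast
        fix m assume m: "set_mset m \<subseteq> carrier (cm_iter G 0)" "mset_prod G (image_mset (nested_degree G) m) = y"
        have "image_mset unBase m = image_mset (nested_degree G) m"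
          using m(1) by (intro image_mset_cong) auto
        then show "var (cm_face G 0 0 (Node m)) = var (Base y)"
          using cm_counit_0[OF comm_monoid_axioms m(1)] m(2) by simp
      qed
      then show ?thesis
        using gaug_gcounit[of 0 s] by (simp add: k frag_extend_const coeff_sum_lin_poly)
    next
      case (Suc j)
      show ?thesis using 0 unfolding Suc by (intro step P) auto
    qed
  next
    case (Suc i)
    then obtain j where j: "k = Suc j" "i \<le> j" by (cases k) auto
    show ?case using Suc.prems Suc.IH[OF j(2)] unfolding j by (intro step P) auto
  qed
  show "i \<le> k \<Longrightarrow> y \<in> carrier G \<Longrightarrow> s \<in> gel G (Suc k) y \<Longrightarrow>
      lin k y (gface i k s) = frag_extend (\<lambda>m. var (cm_face G i k (Node m))) (lin_poly k s)"
    using L .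
  show "i \<le> Suc k \<Longrightarrow> x \<in> carrier G \<Longrightarrow> t \<in> gel G (Suc (Suc k)) x \<Longrightarrow>
      lin_poly k (gface i (Suc k) t) =
      frag_extend (\<lambda>m. frag_of (children (cm_face G i (Suc k) (Node m)))) (lin_poly (Suc k) t)"
    using P L by auto
qed

end

section \<open>The simplicial homotopy\<close>

definition relin :: "'x monoid \<Rightarrow> nat \<Rightarrow> ('x, int) gnested \<Rightarrow> ('x, int) gnested" where
  "relin X n t = GPoly (embed_poly X (lin_poly n t))"

text \<open>
  The simplicial homotopy from \<open>relin\<close> to the identity. The linearization of a variable \<open>s\<close> is a
  linear polynomial and hence, after embedding, an element of the next level. The map \<open>htpy X 0 n\<close> replaces
  \<open>s\<close> by the variable named after this element. Removing the outermost brackets then leaves the linearization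
  itself in place of \<open>s\<close>, which is \<open>relin\<close>. The other maps do the same \<open>j\<close> levels deeper; at
  the deepest level the variables are integers, and evaluating undoes the replacement.
\<close>

primrec htpy :: "'x monoid \<Rightarrow> nat \<Rightarrow> nat \<Rightarrow> ('x, int) gnested \<Rightarrow> ('x, int) gnested" where
  "htpy X 0 n t = poly_map (\<lambda>(y, s). var (y, GPoly (embed_poly X (lin n y s)))) t"
| "htpy X (Suc j) n t = poly_map (\<lambda>(y, s). var (y, htpy X j (n - 1) s)) t"

lemma embed_poly_frag_extend: "embed_poly X (frag_extend f q) = frag_extend (\<lambda>m. embed_poly X (f m)) q"
  using subset_UNIV
  by (induction q rule: frag_induction) (simp_all add: embed_poly_def poly_subst_diff frag_extend_diff)

lemma relin_eq: "relin X n t = poly_map (\<lambda>(y, s). embed_poly X (lin n y s)) t"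
  by (simp add: relin_def lin_poly_def embed_poly_def poly_map_def poly_subst_subst case_prod_unfold)

lemma gface_0_htpy: "gface 0 (Suc n) (htpy X 0 n t) = relin X n t"
  by (simp add: relin_eq poly_map_poly_map case_prod_unfold)

context grading_monoid
begin

lemma relin_var_closed:
  "y \<in> carrier G \<Longrightarrow> s \<in> gel G k y \<Longrightarrow> GPoly (embed_poly G (lin k y s)) \<in> gel G (Suc k) y"
  using embed_poly_closed[OF lin_closed] by (auto simp: gel_Suc simp del: ca_iter.simps)

lemma htpy_closed: "j \<le> n \<Longrightarrow> x \<in> carrier G \<Longrightarrow> t \<in> gel G (Suc n) x \<Longrightarrow> htpy G j n t \<in> gel G (Suc (Suc n)) x"
proof (induction j arbitrary: n t x)
  case 0
  then show ?case
    unfolding htpy.simps by (intro poly_map_closed[OF 0(3)]) (use relin_var_closed gvar_homog in auto)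
next
  case (Suc j)
  then obtain k where k: "n = Suc k" "j \<le> k" by (cases n) auto
  have "poly_map (\<lambda>(y, s). var (y, htpy G j k s)) t \<in> gel G (Suc (Suc n)) x"
    by (rule poly_map_closed[OF Suc.prems(3)]) (use Suc.IH[OF k(2)] gvar_homog k(1) in auto)
  then show ?case by (simp add: k(1) del: ca_iter.simps)
qed

lemma gaug_embed_poly:
  assumes "q \<in> nested_polys G k x"
  shows "poly_subst (\<lambda>(y, s). gaug k s) (embed_poly G q) = poly_subst (\<lambda>_. 1) q"
  unfolding embed_poly_def poly_subst_subst
proof (rule poly_subst_cong)
  fix m v assume "m \<in> Poly_Mapping.keys q" "v \<in># m"
  then have "v \<in> carrier (cm_iter G k)"
    using assms by (auto simp: homog_polys_def homog_monos_def)
  then show "poly_subst (\<lambda>(y, s). gaug k s) (var (nested_degree G v, embed G v)) = 1"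
    by (simp add: gaug_embed)
qed

lemma gaug_htpy: "j \<le> n \<Longrightarrow> t \<in> gel G (Suc n) x \<Longrightarrow> gaug (Suc (Suc n)) (htpy G j n t) = gaug (Suc n) t"
proof (induction j arbitrary: n t x)
  case 0
  then show ?case
    unfolding htpy.simps
    by (intro gaug_poly_map[OF 0(2)])
      (use gaug_embed_poly[OF lin_closed] coeff_sum_lin in \<open>auto simp del: ca_iter.simps\<close>)
next
  case (Suc j)
  then obtain k where k: "n = Suc k" "j \<le> k" by (cases n) auto
  have "gaug (Suc (Suc n)) (poly_map (\<lambda>(y, s). var (y, htpy G j k s)) t) = gaug (Suc n) t"
    by (rule gaug_poly_map[OF Suc.prems(2)])
      (use Suc.IH[OF k(2)] k(1) in \<open>auto simp del: ca_iter.simps gaug.simps\<close>)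
  then show ?case by (simp add: k(1) del: ca_iter.simps gaug.simps)
qed

text \<open>
  The innermost variables carry integers. There linearization yields \<open>c\<close> times a single variable of
  value 1, and the evaluation of this is \<open>c\<close>.
\<close>

lemma gface_last_htpy:
  "x \<in> carrier G \<Longrightarrow> t \<in> gel G (Suc n) x \<Longrightarrow> gface (Suc n) (Suc n) (htpy G n n t) = t"
proof (induction n arbitrary: t x)
  have poly_map_var: "poly_map var t = t" if "t \<in> gel G (Suc n) x" for t n x
    using that by (auto simp: gel_Suc poly_map_def poly_subst_var simp del: ca_iter.simps)
  case 0
  have "poly_map (\<lambda>(y, s). var (y, gface 0 0 (GPoly (embed_poly G (lin 0 y s))))) t = poly_map var t"
    by (rule poly_map_cong[OF 0(2)])
      (auto simp: embed_poly_def poly_subst_frag_cmul graded_monoid_ring_def poly_subst_mult poly_subst_of_int)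
  then show ?case
    using poly_map_var[OF 0(2)] by (simp add: poly_map_poly_map case_prod_unfold del: ca_iter.simps)
next
  case (Suc n)
  have poly_map_var: "poly_map var t = t" if "t \<in> gel G (Suc n) x" for t n x
    using that by (auto simp: gel_Suc poly_map_def poly_subst_var simp del: ca_iter.simps)
  have "poly_map (\<lambda>(y, s). var (y, gface (Suc n) (Suc n) (htpy G n n s))) t = poly_map var t"
    by (rule poly_map_cong[OF Suc.prems(2)]) (use Suc.IH in auto)
  then show ?case
    using poly_map_var[OF Suc.prems(2)] by (simp add: poly_map_poly_map case_prod_unfold del: ca_iter.simps)
qed

lemma gface_htpy_less:
  "i < j \<Longrightarrow> j \<le> n \<Longrightarrow> x \<in> carrier G \<Longrightarrow> t \<in> gel G (Suc n) x \<Longrightarrow>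
    gface i (Suc n) (htpy G j n t) = htpy G (j - 1) (n - 1) (gface i n t)"
proof (induction i arbitrary: j n t x)
  case 0
  then obtain j' k where jk: "j = Suc j'" "n = Suc k" "j' \<le> k" by (cases j; cases n) auto
  obtain g where g: "htpy G j' k = poly_map g"
    by (cases j') (auto simp: fun_eq_iff)
  show ?case
    unfolding jk by (simp add: g poly_map_poly_map poly_subst_subst case_prod_unfold)
next
  case (Suc i)
  then obtain j' k where jk: "j = Suc j'" "n = Suc k" "i < j'" "j' \<le> k" by (cases j; cases n) auto
  have eq: "poly_map (\<lambda>(y, s). var (y, gface i (Suc k) (htpy G j' k s))) t =
      poly_map (\<lambda>(y, s). var (y, htpy G (j' - 1) (k - 1) (gface i k s))) t"
    by (rule poly_map_cong[OF Suc.prems(4)]) (use Suc.IH[OF jk(3,4)] jk(2) in auto)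
  obtain j'' where j'': "j' = Suc j''" using jk by (cases j') auto
  show ?case using eq
    unfolding jk by (simp add: poly_map_poly_map case_prod_unfold j'' del: ca_iter.simps)
qed

lemma embed_poly_node_vars:
  assumes "q \<in> nested_polys G k x"
  shows "poly_subst (\<lambda>(y, s). unGPoly s) (embed_poly G (node_vars q)) = embed_poly G q"
  unfolding node_vars_def embed_poly_frag_extend
proof -
  have "poly_subst (\<lambda>(y, s). unGPoly s) (frag_extend (\<lambda>m. embed_poly G (var (Node m))) q) =
      poly_subst (\<lambda>v. v) (frag_extend (\<lambda>m. var (embed_poly G (frag_of m))) q)"
    using subset_UNIV
    by (induction q rule: frag_induction)
      (simp_all add: frag_extend_diff poly_subst_diff embed_poly_def prod_mset_var)
  also have "\<dots> = embed_poly G q"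
    using subset_UNIV
    by (induction q rule: frag_induction) (simp_all add: frag_extend_diff poly_subst_diff embed_poly_def)
  finally show "poly_subst (\<lambda>(y, s). unGPoly s) (frag_extend (\<lambda>m. embed_poly G (var (Node m))) q) = embed_poly G q" .
qed

lemma gface_0_relin_var:
  assumes "y \<in> carrier G" "s \<in> gel G (Suc k) y"
  shows "gface 0 (Suc k) (GPoly (embed_poly G (lin (Suc k) y s))) = relin G k s"
  unfolding lin_Suc
  using embed_poly_node_vars[OF lin_poly_closed[OF assms(2)]] by (simp add: relin_def poly_map_def)

text \<open>
  On the variables of \<open>htpy X 0 n\<close> the face removes the brackets of a linear polynomial in monomials,
  which leaves the polynomial itself, that is \<open>relin\<close>. By \<open>gface_0_htpy\<close> this is also what the
  next homotopy produces there.
\<close>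

lemma gface_htpy_middle:
  "Suc j \<le> n \<Longrightarrow> x \<in> carrier G \<Longrightarrow> t \<in> gel G (Suc n) x \<Longrightarrow>
    gface (Suc j) (Suc n) (htpy G j n t) = gface (Suc j) (Suc n) (htpy G (Suc j) n t)"
proof (induction j arbitrary: n t x)
  case 0
  then obtain k where k: "n = Suc k" by (cases n) auto
  have "poly_map (\<lambda>(y, s). var (y, gface 0 n (GPoly (embed_poly G (lin n y s))))) t =
      poly_map (\<lambda>(y, s). var (y, gface 0 n (htpy G 0 k s))) t"
  proof (rule poly_map_cong[OF 0(3)])
    fix y s assume "y \<in> carrier G" "s \<in> gel G n y"
    then show "(\<lambda>(y, s). var (y, gface 0 n (GPoly (embed_poly G (lin n y s))))) (y, s) =
        (\<lambda>(y, s). var (y, gface 0 n (htpy G 0 k s))) (y, s)"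
      unfolding k prod.case gface_0_htpy by (subst gface_0_relin_var) simp_all
  qed
  then show ?case
    by (simp add: k poly_map_poly_map case_prod_unfold del: ca_iter.simps gface.simps(1) htpy.simps(1) lin.simps)
      (simp add: poly_map_poly_map case_prod_unfold del: ca_iter.simps gface.simps(1) lin.simps)
next
  case (Suc j)
  then obtain k where k: "n = Suc k" "Suc j \<le> k" by (cases n) auto
  have "poly_map (\<lambda>(y, s). var (y, gface (Suc j) (Suc k) (htpy G j k s))) t =
      poly_map (\<lambda>(y, s). var (y, gface (Suc j) (Suc k) (htpy G (Suc j) k s))) t"
    by (rule poly_map_cong[OF Suc.prems(3)]) (use Suc.IH[OF k(2)] k(1) in auto)
  then show ?case
    by (simp add: k(1) gface.simps(2)[of "Suc j"] htpy.simps(2)[of _ j] htpy.simps(2)[of _ "Suc j"]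
        poly_map_poly_map case_prod_unfold del: ca_iter.simps gface.simps htpy.simps)
qed

text \<open>
  Both \<open>embed\<close> and \<open>lin\<close> commute with faces, by \<open>embed_face\<close> and \<open>lin_face\<close>; hence so does their
  composite, which is what \<open>htpy\<close> puts into the variables.
\<close>

lemma gface_relin_var:
  assumes "Suc i \<le> Suc k" "y \<in> carrier G" "s \<in> gel G (Suc k) y"
  shows "gface (Suc i) (Suc k) (GPoly (embed_poly G (lin (Suc k) y s))) =
    GPoly (embed_poly G (lin k y (gface i k s)))"
proof -
  have "embed_poly G (lin k y (gface i k s)) = embed_poly G (poly_subst (\<lambda>z. var (cm_face G i k z)) (lin (Suc k) y s))"
    using lin_face[of i k y s] assms unfolding lin_Suc poly_subst_node_vars by simp
  also have "\<dots> = poly_subst (\<lambda>z. var (nested_degree G (cm_face G i k z), embed G (cm_face G i k z))) (lin (Suc k) y s)"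
    by (simp add: embed_poly_def poly_subst_subst)
  also have "\<dots> = poly_subst (\<lambda>z. var (nested_degree G z, gface i k (embed G z))) (lin (Suc k) y s)"
  proof (rule poly_subst_cong)
    fix m z assume "m \<in> Poly_Mapping.keys (lin (Suc k) y s)" "z \<in># m"
    then have "z \<in> carrier (cm_iter G (Suc k))"
      using lin_closed[OF assms(2,3)] by (auto simp: homog_polys_def homog_monos_def simp del: cm_iter.simps)
    then show "var (nested_degree G (cm_face G i k z), embed G (cm_face G i k z)) =
        var (nested_degree G z, gface i k (embed G z))"
      using embed_face nested_degree_face assms(1) by (simp del: cm_iter.simps)
  qed
  also have "\<dots> = poly_subst (\<lambda>(y, s). var (y, gface i k s)) (embed_poly G (lin (Suc k) y s))"
    by (simp add: embed_poly_def poly_subst_subst)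
  finally show ?thesis by (simp add: poly_map_def)
qed

lemma gface_htpy_greater:
  "Suc j < i \<Longrightarrow> i \<le> Suc n \<Longrightarrow> x \<in> carrier G \<Longrightarrow> t \<in> gel G (Suc n) x \<Longrightarrow>
    gface i (Suc n) (htpy G j n t) = htpy G j (n - 1) (gface (i - 1) n t)"
proof (induction j arbitrary: i n t x)
  case 0
  then obtain i' k where ik: "i = Suc (Suc i')" "n = Suc k" "i' \<le> k"
    by (cases i; cases n; cases "i - 1") auto
  have "poly_map (\<lambda>(y, s). var (y, gface (Suc i') n (GPoly (embed_poly G (lin n y s))))) t =
      poly_map (\<lambda>(y, s). var (y, GPoly (embed_poly G (lin k y (gface i' k s))))) t"
  proof (rule poly_map_cong[OF 0(4)])
    fix y s assume "y \<in> carrier G" "s \<in> gel G n y"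
    then show "(\<lambda>(y, s). var (y, gface (Suc i') n (GPoly (embed_poly G (lin n y s))))) (y, s) =
        (\<lambda>(y, s). var (y, GPoly (embed_poly G (lin k y (gface i' k s))))) (y, s)"
      unfolding ik prod.case by (subst gface_relin_var) (use ik in simp_all)
  qed
  then show ?case
    by (simp add: ik gface.simps(2)[of "Suc i'"] gface.simps(2)[of i'] poly_map_poly_map case_prod_unfold
        del: ca_iter.simps gface.simps lin.simps)
next
  case (Suc j)
  then obtain i' k where ik: "i = Suc (Suc i')" "n = Suc k" "Suc j < Suc i'" "Suc i' \<le> Suc k"
    by (cases i; cases n; cases "i - 1") auto
  have "poly_map (\<lambda>(y, s). var (y, gface (Suc i') (Suc k) (htpy G j k s))) t =
      poly_map (\<lambda>(y, s). var (y, htpy G j (k - 1) (gface i' k s))) t"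
    by (rule poly_map_cong[OF Suc.prems(4)]) (use Suc.IH[OF ik(3,4)] ik(2) in auto)
  then show ?case
    by (simp add: ik gface.simps(2)[of "Suc i'"] gface.simps(2)[of i'] htpy.simps(2)[of _ j] poly_map_poly_map
        case_prod_unfold del: ca_iter.simps gface.simps htpy.simps)
qed

end

section \<open>Quotients of abelian groups and their maps\<close>

lemma coset_map_coset:
  assumes G: "group G" and G': "group G'" and B: "subgroup B G" and B': "subgroup B' G'"
    and \<phi>: "\<phi> \<in> hom G G'" "\<phi> ` B \<subseteq> B'" and z: "z \<in> carrier G"
  shows "coset_map G' B' \<phi> (B #>\<^bsub>G\<^esub> z) = B' #>\<^bsub>G'\<^esub> \<phi> z"
proof -
  interpret G: group G by fact
  interpret G': group G' by fact
  have "B' #>\<^bsub>G'\<^esub> \<phi> c = B' #>\<^bsub>G'\<^esub> \<phi> z" if c: "c \<in> B #>\<^bsub>G\<^esub> z" for c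
  proof -
    obtain b where b: "b \<in> B" "c = b \<otimes>\<^bsub>G\<^esub> z" using c by (auto simp: r_coset_def)
    then have "\<phi> c = \<phi> b \<otimes>\<^bsub>G'\<^esub> \<phi> z"
      using subgroup.mem_carrier[OF B] z hom_mult[OF \<phi>(1)] by blast
    moreover have "\<phi> b \<in> B'" using b \<phi>(2) by blast
    ultimately have "\<phi> c \<in> B' #>\<^bsub>G'\<^esub> \<phi> z" by (auto simp: r_coset_def)
    then show ?thesis
      using G'.repr_independence[OF _ hom_in_carrier[OF \<phi>(1) z] B'] by simp
  qed
  moreover have "z \<in> B #>\<^bsub>G\<^esub> z" using G.rcos_self[OF z B] .
  ultimately show ?thesis unfolding coset_map_def by (intro SUP_eq_const; blast)
qed

lemma carrier_update_Mod:
  "carrier (G\<lparr>carrier := Z\<rparr> Mod B) = (\<lambda>z. B #>\<^bsub>G\<^esub> z) ` Z"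
  by (auto simp: carrier_FactGroup r_coset_def)

lemma mult_update_Mod: "C \<otimes>\<^bsub>G\<lparr>carrier := Z\<rparr> Mod B\<^esub> D = C <#>\<^bsub>G\<^esub> D"
  by (simp add: FactGroup_def set_mult_def)

lemma (in comm_group) coset_set_mult:
  assumes B: "subgroup B G" and "z \<in> carrier G" "w \<in> carrier G"
  shows "(B #> z) <#> (B #> w) = B #> (z \<otimes> w)"
  using normal.rcos_sum[OF subgroup_imp_normal[OF B]] assms by simp

text \<open>
  A criterion for maps of subquotients \<open>Z / B\<close>. It serves for homology, with cycles modulo
  boundaries, and for cohomology, with cocycles modulo coboundaries.
\<close>

lemma coset_map_iso:
  assumes G: "comm_group G" and G': "comm_group G'"
    and Z: "subgroup Z G" and Z': "subgroup Z' G'" and B: "subgroup B G" and B': "subgroup B' G'"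
    and \<phi>: "\<phi> \<in> hom G G'" "\<phi> ` B \<subseteq> B'" "\<phi> ` Z \<subseteq> Z'"
    and inj: "\<And>z. z \<in> Z \<Longrightarrow> \<phi> z \<in> B' \<Longrightarrow> z \<in> B"
    and surj: "\<And>w. w \<in> Z' \<Longrightarrow> \<exists>z\<in>Z. \<phi> z \<otimes>\<^bsub>G'\<^esub> inv\<^bsub>G'\<^esub> w \<in> B'"
  shows "coset_map G' B' \<phi> \<in> iso (G\<lparr>carrier := Z\<rparr> Mod B) (G'\<lparr>carrier := Z'\<rparr> Mod B')"
proof -
  interpret G: comm_group G by fact
  interpret G': comm_group G' by fact
  interpret \<phi>: group_hom G G' \<phi> by (intro group_hom.intro group_hom_axioms.intro \<phi>(1) G.is_group G'.is_group)
  note Zc = subgroup.mem_carrier[OF Z] and Zc' = subgroup.mem_carrier[OF Z']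
  have cm: "coset_map G' B' \<phi> (B #>\<^bsub>G\<^esub> z) = B' #>\<^bsub>G'\<^esub> \<phi> z" if "z \<in> carrier G" for z
    by (rule coset_map_coset[OF G.is_group G'.is_group B B' \<phi>(1,2) that])
  show ?thesis
  proof (rule isoI)
    show "coset_map G' B' \<phi> \<in> hom (G\<lparr>carrier := Z\<rparr> Mod B) (G'\<lparr>carrier := Z'\<rparr> Mod B')"
    proof (rule homI)
      fix C assume "C \<in> carrier (G\<lparr>carrier := Z\<rparr> Mod B)"
      then show "coset_map G' B' \<phi> C \<in> carrier (G'\<lparr>carrier := Z'\<rparr> Mod B')"
        using \<phi>(3) Zc unfolding carrier_update_Mod by (auto simp: cm)
    next
      fix C D assume "C \<in> carrier (G\<lparr>carrier := Z\<rparr> Mod B)" "D \<in> carrier (G\<lparr>carrier := Z\<rparr> Mod B)"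
      then obtain z w where "z \<in> Z" "w \<in> Z" "C = B #>\<^bsub>G\<^esub> z" "D = B #>\<^bsub>G\<^esub> w"
        unfolding carrier_update_Mod by blast
      then show "coset_map G' B' \<phi> (C \<otimes>\<^bsub>G\<lparr>carrier := Z\<rparr> Mod B\<^esub> D) =
          coset_map G' B' \<phi> C \<otimes>\<^bsub>G'\<lparr>carrier := Z'\<rparr> Mod B'\<^esub> coset_map G' B' \<phi> D"
        unfolding mult_update_Mod
        by (simp add: Zc G.coset_set_mult[OF B] G'.coset_set_mult[OF B'] cm)
    qed
    show "bij_betw (coset_map G' B' \<phi>) (carrier (G\<lparr>carrier := Z\<rparr> Mod B)) (carrier (G'\<lparr>carrier := Z'\<rparr> Mod B'))"
    proof (rule bij_betw_imageI)
      show "inj_on (coset_map G' B' \<phi>) (carrier (G\<lparr>carrier := Z\<rparr> Mod B))"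
      proof (rule inj_onI)
        fix C D assume "C \<in> carrier (G\<lparr>carrier := Z\<rparr> Mod B)" "D \<in> carrier (G\<lparr>carrier := Z\<rparr> Mod B)"
          and eq: "coset_map G' B' \<phi> C = coset_map G' B' \<phi> D"
        then obtain z w where zw: "z \<in> Z" "w \<in> Z" "C = B #>\<^bsub>G\<^esub> z" "D = B #>\<^bsub>G\<^esub> w"
          unfolding carrier_update_Mod by blast
        then have "\<phi> z \<in> B' #>\<^bsub>G'\<^esub> \<phi> w"
          using eq G'.rcos_self[OF _ B', of "\<phi> z"] Zc by (simp add: cm)
        then have "\<phi> z \<otimes>\<^bsub>G'\<^esub> inv\<^bsub>G'\<^esub> \<phi> w \<in> B'"
          using subgroup.rcos_module_imp[OF B' G'.is_group, of "\<phi> w" "\<phi> z"] Zc zw by simp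
        then have "\<phi> (z \<otimes>\<^bsub>G\<^esub> inv\<^bsub>G\<^esub> w) \<in> B'" using zw Zc by simp
        then have "z \<otimes>\<^bsub>G\<^esub> inv\<^bsub>G\<^esub> w \<in> B"
          using inj zw subgroup.m_closed[OF Z] subgroup.m_inv_closed[OF Z] by blast
        then have "z \<in> B #>\<^bsub>G\<^esub> w"
          using subgroup.rcos_module_rev[OF B G.is_group] Zc zw by blast
        then show "C = D"
          using G.repr_independence[OF _ _ B] zw Zc by metis
      qed
      show "coset_map G' B' \<phi> ` carrier (G\<lparr>carrier := Z\<rparr> Mod B) = carrier (G'\<lparr>carrier := Z'\<rparr> Mod B')"
      proof (intro equalityI subsetI)
        fix D assume "D \<in> coset_map G' B' \<phi> ` carrier (G\<lparr>carrier := Z\<rparr> Mod B)"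
        then show "D \<in> carrier (G'\<lparr>carrier := Z'\<rparr> Mod B')"
          using \<phi>(3) Zc unfolding carrier_update_Mod by (auto simp: cm)
      next
        fix D assume "D \<in> carrier (G'\<lparr>carrier := Z'\<rparr> Mod B')"
        then obtain w where w: "w \<in> Z'" "D = B' #>\<^bsub>G'\<^esub> w"
          unfolding carrier_update_Mod by blast
        obtain z where z: "z \<in> Z" "\<phi> z \<otimes>\<^bsub>G'\<^esub> inv\<^bsub>G'\<^esub> w \<in> B'"
          using surj[OF w(1)] by blast
        then have "\<phi> z \<in> B' #>\<^bsub>G'\<^esub> w"
          using subgroup.rcos_module_rev[OF B' G'.is_group, of w "\<phi> z"] Zc Zc' w(1) by simp
        then have "D = coset_map G' B' \<phi> (B #>\<^bsub>G\<^esub> z)"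
          using G'.repr_independence[OF _ _ B'] w z(1) Zc Zc' by (metis cm)
        then show "D \<in> coset_map G' B' \<phi> ` carrier (G\<lparr>carrier := Z\<rparr> Mod B)"
          using z(1) unfolding carrier_update_Mod by blast
      qed
    qed
  qed
qed

section \<open>Simplicial homotopies\<close>

lemma (in comm_group) int_pow_sign_hom:
  "h \<in> hom H G \<Longrightarrow> comm_group H \<Longrightarrow> (\<lambda>c. h c [^] (k::int)) \<in> hom H G"
  by (rule int_pow_hom(1)) unfold_locales

lemma (in comm_group) hom_finprod_pointwise:
  assumes "finite I" "\<And>i. i \<in> I \<Longrightarrow> f i \<in> hom H G"
  shows "(\<lambda>c. \<Otimes>i\<in>I. f i c) \<in> hom H G"
proof (rule homI)
  have cl: "f i c \<in> carrier G" if "i \<in> I" "c \<in> carrier H" for i c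
    using hom_in_carrier[OF assms(2)] that by blast
  show "(\<Otimes>i\<in>I. f i c) \<in> carrier G" if "c \<in> carrier H" for c
    using cl that by auto
  show "(\<Otimes>i\<in>I. f i (c \<otimes>\<^bsub>H\<^esub> c')) = (\<Otimes>i\<in>I. f i c) \<otimes> (\<Otimes>i\<in>I. f i c')"
    if "c \<in> carrier H" "c' \<in> carrier H" for c c'
  proof -
    have "(\<Otimes>i\<in>I. f i (c \<otimes>\<^bsub>H\<^esub> c')) = (\<Otimes>i\<in>I. f i c \<otimes> f i c')"
      by (rule finprod_cong') (use cl that hom_mult[OF assms(2)] in auto)
    also have "\<dots> = (\<Otimes>i\<in>I. f i c) \<otimes> (\<Otimes>i\<in>I. f i c')"
      by (rule finprod_multf) (use cl that in auto)
    finally show ?thesis .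
  qed
qed

lemma hom_finprod:
  assumes "comm_group G" "comm_group H" "\<phi> \<in> hom G H" "finite I" "f \<in> I \<rightarrow> carrier G"
  shows "\<phi> (finprod G f I) = finprod H (\<lambda>i. \<phi> (f i)) I"
proof -
  interpret G: comm_group G by fact
  interpret H: comm_group H by fact
  interpret \<phi>: group_hom G H \<phi> by (intro group_hom.intro group_hom_axioms.intro assms G.is_group H.is_group)
  show ?thesis using assms(4,5)
  proof (induction I rule: finite_induct)
    case (insert i I)
    have "\<phi> (f j) \<in> carrier H" if "j \<in> insert i I" for j
      by (rule hom_in_carrier[OF assms(3) funcset_mem[OF insert.prems that]])
    with insert show ?case by (simp add: H.finprod_insert)
  qed simp
qed

lemma hom_signed_finprod:
  assumes G: "comm_group G" and H: "comm_group H" and \<phi>: "\<phi> \<in> hom G H" and I: "finite I" "f \<in> I \<rightarrow> carrier G"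
  shows "\<phi> (finprod G (\<lambda>i. f i [^]\<^bsub>G\<^esub> (k i :: int)) I) = finprod H (\<lambda>i. \<phi> (f i) [^]\<^bsub>H\<^esub> k i) I"
proof -
  interpret G: comm_group G by fact
  interpret H: comm_group H by fact
  have "\<phi> (finprod G (\<lambda>i. f i [^]\<^bsub>G\<^esub> k i) I) = finprod H (\<lambda>i. \<phi> (f i [^]\<^bsub>G\<^esub> k i)) I"
    by (rule hom_finprod[OF G H \<phi> I(1)]) (use I in auto)
  also have "\<dots> = finprod H (\<lambda>i. \<phi> (f i) [^]\<^bsub>H\<^esub> k i) I"
    by (rule H.finprod_cong')
      (use I hom_in_carrier[OF \<phi>] hom_int_pow[OF \<phi> _ G.is_group H.is_group] in auto)
  finally show ?thesis .
qed

text \<open>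
  The cancellation behind every simplicial homotopy. The term \<open>A i j\<close> stands for the face \<open>i\<close> of
  the homotopy \<open>j\<close>, and \<open>B j i\<close> for the homotopy \<open>j\<close> of the face \<open>i\<close>. The terms of \<open>A\<close> off the two
  diagonals are terms of \<open>B\<close> and cancel against the second sum by their signs. The two diagonals have
  the values \<open>D i\<close> with opposite signs and telescope. Working with formal sums avoids reindexing
  products in an abstract abelian group.
\<close>

lemma formal_simplicial_homotopy:
  fixes B :: "nat \<Rightarrow> nat \<Rightarrow> ('a \<Rightarrow>\<^sub>0 int)" and D :: "nat \<Rightarrow> ('a \<Rightarrow>\<^sub>0 int)"
  defines "A \<equiv> \<lambda>i j. if i < j then B (j - 1) i else if Suc j < i then B j (i - 1) else D i"
  shows "(\<Sum>i\<le>Suc m. frag_cmul ((-1) ^ i) (\<Sum>j\<le>m. frag_cmul ((-1) ^ j) (A i j))) +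
     (\<Sum>j<m. frag_cmul ((-1) ^ j) (\<Sum>i\<le>m. frag_cmul ((-1) ^ i) (B j i))) = D 0 - D (Suc m)"
proof (induction m)
  case 0
  then show ?case by (simp add: A_def)
next
  case (Suc m)
  have row: "(\<Sum>j\<le>m. frag_cmul ((-1) ^ j) (A (Suc (Suc m)) j)) = (\<Sum>j\<le>m. frag_cmul ((-1) ^ j) (B j (Suc m)))"
    by (intro sum.cong refl) (auto simp: A_def)
  have col: "(\<Sum>i\<le>m. frag_cmul (- ((-1) ^ i * (-1) ^ m)) (A i (Suc m))) =
      frag_cmul (- ((-1) ^ m)) (\<Sum>i\<le>m. frag_cmul ((-1) ^ i) (B m i))"
    by (subst frag_cmul_sum) (auto intro!: sum.cong simp: A_def mult.commute)
  have diag: "A (Suc m) (Suc m) = D (Suc m)" "A (Suc (Suc m)) (Suc m) = D (Suc (Suc m))"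
    by (simp_all add: A_def)
  have sq: "(-1) ^ m * (-1) ^ m = (1::int)" by (simp flip: power_mult_distrib)
  have pull: "(\<Sum>i\<le>n. frag_cmul ((-1) ^ i) (frag_cmul k (f i))) = frag_cmul k (\<Sum>i\<le>n. frag_cmul ((-1) ^ i) (f i))"
    for k :: int and n and f :: "nat \<Rightarrow> ('a \<Rightarrow>\<^sub>0 int)"
    by (subst frag_cmul_sum) (auto intro!: sum.cong simp: mult.commute)
  have pull': "(\<Sum>j<m. frag_cmul (- ((-1) ^ j * (-1) ^ m)) (B j (Suc m))) =
      frag_cmul (- ((-1) ^ m)) (\<Sum>j<m. frag_cmul ((-1) ^ j) (B j (Suc m)))"
    by (subst frag_cmul_sum) (auto intro!: sum.cong simp: mult.commute)
  have "(\<Sum>i\<le>Suc (Suc m). frag_cmul ((-1) ^ i) (\<Sum>j\<le>Suc m. frag_cmul ((-1) ^ j) (A i j))) =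
      (\<Sum>i\<le>Suc m. frag_cmul ((-1) ^ i) (\<Sum>j\<le>m. frag_cmul ((-1) ^ j) (A i j))) +
      frag_cmul ((-1) ^ m) (\<Sum>j\<le>m. frag_cmul ((-1) ^ j) (B j (Suc m))) -
      frag_cmul ((-1) ^ m) (\<Sum>i\<le>m. frag_cmul ((-1) ^ i) (B m i)) + D (Suc m) - D (Suc (Suc m))"
    by (simp add: frag_cmul_distrib2 sum.distrib pull row col diag sq)
  moreover have "(\<Sum>j<Suc m. frag_cmul ((-1) ^ j) (\<Sum>i\<le>Suc m. frag_cmul ((-1) ^ i) (B j i))) =
      (\<Sum>j<m. frag_cmul ((-1) ^ j) (\<Sum>i\<le>m. frag_cmul ((-1) ^ i) (B j i))) +
      frag_cmul ((-1) ^ m) (\<Sum>i\<le>m. frag_cmul ((-1) ^ i) (B m i)) -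
      frag_cmul ((-1) ^ m) (\<Sum>j\<le>m. frag_cmul ((-1) ^ j) (B j (Suc m)))"
    by (simp add: frag_cmul_distrib2 sum.distrib pull pull' flip: lessThan_Suc_atMost)
  moreover have "s' + u' = d - d2" if "s' = s + r - t + d1 - d2" "u' = u + t - r" "s + u = d - d1"
    for s s' u u' r t d d1 d2 :: "'a \<Rightarrow>\<^sub>0 int"
  proof -
    have "s' + u' = (s + u) + d1 - d2" by (simp add: that(1,2))
    then show ?thesis by (simp add: that(3))
  qed
  ultimately show ?case using Suc.IH by blast
qed

lemma frag_hom_signed_sum:
  assumes G: "comm_group G" and E: "E \<in> hom (free_Abelian_group UNIV) G" and I: "finite I"
  shows "E (\<Sum>i\<in>I. frag_cmul (k i) (p i)) = finprod G (\<lambda>i. E (p i) [^]\<^bsub>G\<^esub> k i) I"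
proof -
  interpret G: comm_group G by fact
  interpret E: group_hom "free_Abelian_group UNIV" G E
    by (intro group_hom.intro group_hom_axioms.intro E G.is_group) simp
  have cl: "E q \<in> carrier G" for q using E.hom_closed[of q] by simp
  have add: "E (q + q') = E q \<otimes>\<^bsub>G\<^esub> E q'" for q q' using E.hom_mult[of q q'] by simp
  have cmul: "E (frag_cmul c q) = E q [^]\<^bsub>G\<^esub> c" for c q
    using E.hom_int_pow[of q c] by simp
  show ?thesis using I
    by (induction I rule: finite_induct) (use E.hom_one in \<open>simp_all add: add cmul cl\<close>)
qed

locale simplicial_group =
  fixes C :: "nat \<Rightarrow> 'c monoid" and d :: "nat \<Rightarrow> nat \<Rightarrow> 'c \<Rightarrow> 'c"
  assumes comm_group: "comm_group (C n)"
    and face_hom: "i \<le> Suc n \<Longrightarrow> d n i \<in> hom (C (Suc n)) (C n)"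
begin

lemma is_group: "group (C n)"
  using comm_group by (simp add: comm_group_def)

lemma simp_diff_hom: "simp_diff C d n \<in> hom (C (Suc n)) (C n)"
proof -
  interpret comm_group "C n" by (rule comm_group)
  show ?thesis
    unfolding simp_diff_def
    by (rule hom_finprod_pointwise) (use int_pow_sign_hom[OF face_hom comm_group] in auto)
qed

lemma subgroup_cycles: "subgroup (simp_cycles C d n) (C n)"
proof (cases n)
  case 0
  then show ?thesis using group.subgroup_self[OF is_group] by (simp add: simp_cycles_def)
next
  case (Suc k)
  interpret group_hom "C n" "C k" "simp_diff C d k"
    using simp_diff_hom[of k] is_group Suc by (simp add: group_hom_def group_hom_axioms_def)
  show ?thesis using subgroup_kernel by (simp add: Suc simp_cycles_def)
qed

lemma subgroup_boundaries: "subgroup (simp_boundaries C d n) (C n)"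
proof -
  interpret group_hom "C (Suc n)" "C n" "simp_diff C d n"
    using simp_diff_hom is_group by (simp add: group_hom_def group_hom_axioms_def)
  show ?thesis using img_is_subgroup by (simp add: simp_boundaries_def)
qed

end

locale simplicial_map = C: simplicial_group C d + D: simplicial_group D e
  for C :: "nat \<Rightarrow> 'c monoid" and d and D :: "nat \<Rightarrow> 'd monoid" and e +
  fixes \<phi> :: "nat \<Rightarrow> 'c \<Rightarrow> 'd"
  assumes \<phi>_hom: "\<phi> n \<in> hom (C n) (D n)"
    and \<phi>_face: "i \<le> Suc n \<Longrightarrow> c \<in> carrier (C (Suc n)) \<Longrightarrow> \<phi> n (d n i c) = e n i (\<phi> (Suc n) c)"
begin

lemma \<phi>_diff: "c \<in> carrier (C (Suc n)) \<Longrightarrow> \<phi> n (simp_diff C d n c) = simp_diff D e n (\<phi> (Suc n) c)"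
proof -
  assume c: "c \<in> carrier (C (Suc n))"
  interpret D': comm_group "D n" by (rule D.comm_group)
  have "\<phi> n (simp_diff C d n c) = (\<Otimes>\<^bsub>D n\<^esub>i\<in>{..Suc n}. \<phi> n (d n i c) [^]\<^bsub>D n\<^esub> ((-1) ^ i :: int))"
    unfolding simp_diff_def
    by (rule hom_signed_finprod[OF C.comm_group D.comm_group \<phi>_hom])
      (use hom_in_carrier[OF C.face_hom c] in auto)
  also have "\<dots> = simp_diff D e n (\<phi> (Suc n) c)"
    unfolding simp_diff_def
    by (rule D'.finprod_cong')
      (use \<phi>_face c hom_in_carrier[OF D.face_hom hom_in_carrier[OF \<phi>_hom c]] in auto)
  finally show ?thesis .
qed

lemma \<phi>_cycles: "\<phi> n ` simp_cycles C d n \<subseteq> simp_cycles D e n"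
proof (cases n)
  case 0
  then show ?thesis using hom_in_carrier[OF \<phi>_hom[of 0]] by (auto simp: simp_cycles_def)
next
  case (Suc k)
  have "\<phi> k \<one>\<^bsub>C k\<^esub> = \<one>\<^bsub>D k\<^esub>" by (rule hom_one[OF \<phi>_hom C.is_group D.is_group])
  then have "\<phi> n c \<in> simp_cycles D e n" if "c \<in> simp_cycles C d n" for c
    using that hom_in_carrier[OF \<phi>_hom[of n]] \<phi>_diff[of c k, symmetric] by (simp add: Suc simp_cycles_def kernel_def)
  then show ?thesis by blast
qed

lemma \<phi>_boundaries: "\<phi> n ` simp_boundaries C d n \<subseteq> simp_boundaries D e n"
  using \<phi>_diff[of _ n] hom_in_carrier[OF \<phi>_hom[of "Suc n"]] by (auto simp: simp_boundaries_def)

lemma simp_pi_map_coset: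
  "c \<in> carrier (C n) \<Longrightarrow> simp_pi_map D e n (\<phi> n) (simp_boundaries C d n #>\<^bsub>C n\<^esub> c) =
    simp_boundaries D e n #>\<^bsub>D n\<^esub> \<phi> n c"
  unfolding simp_pi_map_def
  by (rule coset_map_coset[OF C.is_group D.is_group C.subgroup_boundaries D.subgroup_boundaries \<phi>_hom \<phi>_boundaries])

end

lemma carrier_simp_pi:
  "carrier (simp_pi C d n) = (\<lambda>c. simp_boundaries C d n #>\<^bsub>C n\<^esub> c) ` simp_cycles C d n"
  by (simp add: simp_pi_def carrier_update_Mod)

text \<open>
  The maps \<open>h n j\<close> form a simplicial homotopy from \<open>\<iota> n \<circ> r n\<close> to the identity. The predecessors
  in the identities are proper ones, since \<open>i < j \<le> n\<close> and \<open>j + 1 < i \<le> n + 1\<close> both imply \<open>n > 0\<close>.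
\<close>

locale simplicial_retract =
  I: simplicial_map C d D e \<iota> + R: simplicial_map D e C d r
  for C :: "nat \<Rightarrow> 'c monoid" and d and D :: "nat \<Rightarrow> 'd monoid" and e and \<iota> and r +
  fixes h :: "nat \<Rightarrow> nat \<Rightarrow> 'd \<Rightarrow> 'd"
  assumes retract: "b \<in> carrier (C n) \<Longrightarrow> r n (\<iota> n b) = b"
    and h_hom: "j \<le> n \<Longrightarrow> h n j \<in> hom (D n) (D (Suc n))"
    and h_first: "c \<in> carrier (D n) \<Longrightarrow> e n 0 (h n 0 c) = \<iota> n (r n c)"
    and h_last: "c \<in> carrier (D n) \<Longrightarrow> e n (Suc n) (h n n c) = c"
    and h_less: "i < j \<Longrightarrow> j \<le> n \<Longrightarrow> c \<in> carrier (D n) \<Longrightarrow>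
      e n i (h n j c) = h (n - 1) (j - 1) (e (n - 1) i c)"
    and h_middle: "Suc j \<le> n \<Longrightarrow> c \<in> carrier (D n) \<Longrightarrow> e n (Suc j) (h n j c) = e n (Suc j) (h n (Suc j) c)"
    and h_greater: "Suc j < i \<Longrightarrow> i \<le> Suc n \<Longrightarrow> c \<in> carrier (D n) \<Longrightarrow>
      e n i (h n j c) = h (n - 1) j (e (n - 1) (i - 1) c)"
begin

definition chain_htpy :: "nat \<Rightarrow> 'd \<Rightarrow> 'd" where
  "chain_htpy n c = (\<Otimes>\<^bsub>D (Suc n)\<^esub>j\<in>{..n}. h n j c [^]\<^bsub>D (Suc n)\<^esub> ((-1) ^ j :: int))"

lemma chain_htpy_hom: "chain_htpy n \<in> hom (D n) (D (Suc n))"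
proof -
  interpret comm_group "D (Suc n)" by (rule I.D.comm_group)
  show ?thesis
    unfolding chain_htpy_def
    by (rule hom_finprod_pointwise) (use int_pow_sign_hom[OF h_hom I.D.comm_group] in auto)
qed

lemma chain_htpy:
  assumes c: "c \<in> carrier (D n)"
  shows "simp_diff D e n (chain_htpy n c) \<otimes>\<^bsub>D n\<^esub>
      (if n = 0 then \<one>\<^bsub>D n\<^esub> else chain_htpy (n - 1) (simp_diff D e (n - 1) c)) =
    \<iota> n (r n c) \<otimes>\<^bsub>D n\<^esub> inv\<^bsub>D n\<^esub> c"
proof -
  interpret G: comm_group "D n" by (rule I.D.comm_group)
  define a where "a i j = e n i (h n j c)" for i j
  define b where "b j i = h (n - 1) j (e (n - 1) i c)" for j i
  have h_cl: "h n j c \<in> carrier (D (Suc n))" if "j \<le> n" for j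
    using hom_in_carrier[OF h_hom c] that by blast
  have a_cl: "a i j \<in> carrier (D n)" if "i \<le> Suc n" "j \<le> n" for i j
    unfolding a_def using hom_in_carrier[OF I.D.face_hom h_cl] that by blast
  have e_cl: "e (n - 1) i c \<in> carrier (D (n - 1))" if "0 < n" "i \<le> n" for i
    using hom_in_carrier[OF I.D.face_hom, of i "n - 1" c] that c by simp
  have b_cl: "b j i \<in> carrier (D n)" if "j < n" "i \<le> n" for i j
    using hom_in_carrier[OF h_hom e_cl, of j i] that by (simp add: b_def)
  \<comment> \<open>The formal symbols are evaluated at the terms that they stand for, and symbols out of range at the unit.\<close>
  define v where "v = (\<lambda>s. case s of Inl (j, i) \<Rightarrow> if j < n \<and> i \<le> n then b j i else \<one>\<^bsub>D n\<^esub>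
    | Inr i \<Rightarrow> if i = 0 then a 0 0 else if i \<le> Suc n then a i (i - 1) else \<one>\<^bsub>D n\<^esub>)"
  have "v ` UNIV \<subseteq> carrier (D n)"
    using a_cl b_cl by (auto simp: v_def split: sum.split)
  then obtain E where E: "E \<in> hom (free_Abelian_group UNIV) (D n)" "\<And>s. E (frag_of s) = v s"
    using G.free_Abelian_group_universal[of v UNIV] by auto
  interpret E: group_hom "free_Abelian_group UNIV" "D n" E
    by (intro group_hom.intro group_hom_axioms.intro E(1) G.is_group) simp
  \<comment> \<open>The left summands name the terms off the diagonals, the right summands those on the diagonals.\<close>
  define B :: "nat \<Rightarrow> nat \<Rightarrow> (nat \<times> nat + nat \<Rightarrow>\<^sub>0 int)" where "B j i = frag_of (Inl (j, i))" for j i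
  define \<Delta> :: "nat \<Rightarrow> (nat \<times> nat + nat \<Rightarrow>\<^sub>0 int)" where "\<Delta> i = frag_of (Inr i)" for i
  define A where "A i j = (if i < j then B (j - 1) i else if Suc j < i then B j (i - 1) else \<Delta> i)" for i j
  have EB: "E (B j i) = b j i" if "j < n" "i \<le> n" for j i
    using that by (simp add: B_def E(2) v_def)
  have E\<Delta>: "E (\<Delta> 0) = \<iota> n (r n c)" "E (\<Delta> (Suc n)) = c"
    by (simp_all add: \<Delta>_def E(2) v_def a_def h_first[OF c] h_last[OF c])
  have EA: "E (A i j) = a i j" if ij: "i \<le> Suc n" "j \<le> n" for i j
  proof -
    consider "i < j" | "Suc j < i" | "i = j" | "i = Suc j" by linarith
    then show ?thesis
    proof cases
      case 1
      then show ?thesis using ij EB[of "j - 1" i] h_less[OF 1 ij(2) c] by (simp add: A_def a_def b_def)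
    next
      case 2
      then show ?thesis using ij EB[of j "i - 1"] h_greater[OF 2 ij(1) c] by (simp add: A_def a_def b_def)
    next
      case 3
      then show ?thesis using ij h_middle[of "i - 1" n c] c by (cases i) (auto simp: A_def \<Delta>_def E(2) v_def a_def)
    next
      case 4
      then show ?thesis using ij by (simp add: A_def \<Delta>_def E(2) v_def)
    qed
  qed
  have first: "simp_diff D e n (chain_htpy n c) =
      E (\<Sum>i\<le>Suc n. frag_cmul ((-1) ^ i) (\<Sum>j\<le>n. frag_cmul ((-1) ^ j) (A i j)))"
  proof -
    have "e n i (chain_htpy n c) = E (\<Sum>j\<le>n. frag_cmul ((-1) ^ j) (A i j))" if i: "i \<le> Suc n" for i
    proof -
      have "e n i (chain_htpy n c) = (\<Otimes>\<^bsub>D n\<^esub>j\<in>{..n}. a i j [^]\<^bsub>D n\<^esub> ((-1) ^ j :: int))"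
        unfolding chain_htpy_def a_def
        by (rule hom_signed_finprod[OF I.D.comm_group I.D.comm_group I.D.face_hom[OF i]]) (use h_cl in auto)
      also have "\<dots> = (\<Otimes>\<^bsub>D n\<^esub>j\<in>{..n}. E (A i j) [^]\<^bsub>D n\<^esub> ((-1) ^ j :: int))"
        by (rule G.finprod_cong') (use i a_cl in \<open>auto simp: EA\<close>)
      finally show ?thesis by (simp add: frag_hom_signed_sum[OF G.comm_group_axioms E(1)])
    qed
    moreover have "E p \<in> carrier (D n)" for p using E.hom_closed[of p] by simp
    ultimately show ?thesis
      unfolding simp_diff_def frag_hom_signed_sum[OF G.comm_group_axioms E(1) finite_atMost]
      by (intro G.finprod_cong') auto
  qed
  have second: "(if n = 0 then \<one>\<^bsub>D n\<^esub> else chain_htpy (n - 1) (simp_diff D e (n - 1) c)) =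
      E (\<Sum>j<n. frag_cmul ((-1) ^ j) (\<Sum>i\<le>n. frag_cmul ((-1) ^ i) (B j i)))"
  proof (cases n)
    case 0
    then show ?thesis using E.hom_one by simp
  next
    case (Suc k)
    have "h k j (simp_diff D e k c) = E (\<Sum>i\<le>n. frag_cmul ((-1) ^ i) (B j i))" if j: "j \<le> k" for j
    proof -
      have jn: "j < n" using j Suc by simp
      have "h k j (simp_diff D e k c) = (\<Otimes>\<^bsub>D n\<^esub>i\<in>{..n}. b j i [^]\<^bsub>D n\<^esub> ((-1) ^ i :: int))"
        unfolding simp_diff_def b_def Suc diff_Suc_1
        by (rule hom_signed_finprod[OF I.D.comm_group I.D.comm_group h_hom[OF j]]) (use e_cl Suc in auto)
      also have "\<dots> = (\<Otimes>\<^bsub>D n\<^esub>i\<in>{..n}. E (B j i) [^]\<^bsub>D n\<^esub> ((-1) ^ i :: int))"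
        by (rule G.finprod_cong') (use jn in \<open>auto simp: EB intro!: G.int_pow_closed b_cl\<close>)
      finally show ?thesis by (simp add: frag_hom_signed_sum[OF G.comm_group_axioms E(1)])
    qed
    moreover have "E p \<in> carrier (D n)" for p using E.hom_closed[of p] by simp
    ultimately have "chain_htpy k (simp_diff D e k c) =
        (\<Otimes>\<^bsub>D n\<^esub>j\<in>{..k}. E (\<Sum>i\<le>n. frag_cmul ((-1) ^ i) (B j i)) [^]\<^bsub>D n\<^esub> ((-1) ^ j :: int))"
      unfolding chain_htpy_def Suc[symmetric] by (intro G.finprod_cong') auto
    also have "\<dots> = E (\<Sum>j\<le>k. frag_cmul ((-1) ^ j) (\<Sum>i\<le>n. frag_cmul ((-1) ^ i) (B j i)))"
      by (rule frag_hom_signed_sum[OF G.comm_group_axioms E(1) finite_atMost, symmetric])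
    finally show ?thesis unfolding Suc lessThan_Suc_atMost by simp
  qed
  have "simp_diff D e n (chain_htpy n c) \<otimes>\<^bsub>D n\<^esub>
      (if n = 0 then \<one>\<^bsub>D n\<^esub> else chain_htpy (n - 1) (simp_diff D e (n - 1) c)) = E (\<Delta> 0 - \<Delta> (Suc n))"
    unfolding first second formal_simplicial_homotopy[where m = n and B = B and D = \<Delta>, folded A_def, symmetric]
    using E.hom_mult by simp
  also have "\<dots> = \<iota> n (r n c) \<otimes>\<^bsub>D n\<^esub> inv\<^bsub>D n\<^esub> c"
    using E.hom_mult[of "\<Delta> 0" "- \<Delta> (Suc n)"] E.hom_inv[of "\<Delta> (Suc n)"] by (simp add: E\<Delta>)
  finally show ?thesis .
qed

text \<open>
  Injectivity comes from \<open>r\<close>, and surjectivity from the chain homotopy: a cycle \<open>w\<close> differs from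
  \<open>\<iota> n (r n w)\<close> by a boundary.
\<close>

theorem simp_pi_iso: "simp_pi_map D e n (\<iota> n) \<in> iso (simp_pi C d n) (simp_pi D e n)"
  unfolding simp_pi_map_def simp_pi_def
proof (rule coset_map_iso[OF I.C.comm_group I.D.comm_group I.C.subgroup_cycles I.D.subgroup_cycles
      I.C.subgroup_boundaries I.D.subgroup_boundaries I.\<phi>_hom I.\<phi>_boundaries I.\<phi>_cycles])
  fix z assume z: "z \<in> simp_cycles C d n" "\<iota> n z \<in> simp_boundaries D e n"
  then have "r n (\<iota> n z) \<in> simp_boundaries C d n" using R.\<phi>_boundaries[of n] by blast
  then show "z \<in> simp_boundaries C d n"
    using retract subgroup.mem_carrier[OF I.C.subgroup_cycles z(1)] by simp
next
  interpret G: comm_group "D n" by (rule I.D.comm_group)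
  fix w assume w: "w \<in> simp_cycles D e n"
  then have wc: "w \<in> carrier (D n)" using subgroup.mem_carrier[OF I.D.subgroup_cycles] by blast
  have "chain_htpy (n - 1) (simp_diff D e (n - 1) w) = \<one>\<^bsub>D n\<^esub>" if n: "n \<noteq> 0"
  proof -
    have "simp_diff D e (n - 1) w = \<one>\<^bsub>D (n - 1)\<^esub>" using w n by (simp add: simp_cycles_def kernel_def)
    then show ?thesis
      using hom_one[OF chain_htpy_hom[of "n - 1"] I.D.is_group I.D.is_group] n by simp
  qed
  then have "\<iota> n (r n w) \<otimes>\<^bsub>D n\<^esub> inv\<^bsub>D n\<^esub> w = simp_diff D e n (chain_htpy n w)"
    using chain_htpy[OF wc] G.r_one[OF hom_in_carrier[OF I.D.simp_diff_hom hom_in_carrier[OF chain_htpy_hom wc]]]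
    by (simp split: if_splits)
  moreover have "chain_htpy n w \<in> carrier (D (Suc n))" by (rule hom_in_carrier[OF chain_htpy_hom wc])
  ultimately have "\<iota> n (r n w) \<otimes>\<^bsub>D n\<^esub> inv\<^bsub>D n\<^esub> w \<in> simp_boundaries D e n"
    by (simp add: simp_boundaries_def)
  then show "\<exists>z\<in>simp_cycles C d n. \<iota> n z \<otimes>\<^bsub>D n\<^esub> inv\<^bsub>D n\<^esub> w \<in> simp_boundaries D e n"
    using w R.\<phi>_cycles[of n] by blast
qed

end

section \<open>Groups given by generators and relations\<close>

definition presented_elt :: "'g set \<Rightarrow> ('g \<Rightarrow>\<^sub>0 int) set \<Rightarrow> ('g \<Rightarrow>\<^sub>0 int) \<Rightarrow> ('g \<Rightarrow>\<^sub>0 int) set" where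
  "presented_elt S R p = generate (free_Abelian_group S) R #>\<^bsub>free_Abelian_group S\<^esub> p"

lemma presented_class_eq_elt: "presented_class S R s = presented_elt S R (frag_of s)"
  by (simp add: presented_class_def presented_elt_def)

lemma presented_elt_hom:
  assumes "R \<subseteq> carrier (free_Abelian_group S)"
  shows "presented_elt S R \<in> hom (free_Abelian_group S) (presented S R)"
proof -
  interpret normal "generate (free_Abelian_group S) R" "free_Abelian_group S"
    using assms by (rule presented_normal)
  show ?thesis using r_coset_hom_Mod by (simp add: presented_elt_def[abs_def] presented_def)
qed

context
  fixes S :: "'g set" and R :: "('g \<Rightarrow>\<^sub>0 int) set"
  assumes R: "R \<subseteq> carrier (free_Abelian_group S)"
begin

interpretation presented_group: comm_group "presented S R"
  using R by (rule comm_group_presented)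

interpretation elt: group_hom "free_Abelian_group S" "presented S R" "presented_elt S R"
  by (intro group_hom.intro group_hom_axioms.intro presented_elt_hom R presented_group.is_group) simp

lemma presented_elt_closed: "Poly_Mapping.keys p \<subseteq> S \<Longrightarrow> presented_elt S R p \<in> carrier (presented S R)"
  using elt.hom_closed[of p] by simp

lemma presented_elt_zero: "presented_elt S R 0 = \<one>\<^bsub>presented S R\<^esub>"
  using elt.hom_one by simp

lemma presented_elt_add:
  "Poly_Mapping.keys p \<subseteq> S \<Longrightarrow> Poly_Mapping.keys q \<subseteq> S \<Longrightarrow>
    presented_elt S R (p + q) = presented_elt S R p \<otimes>\<^bsub>presented S R\<^esub> presented_elt S R q"
  using elt.hom_mult[of p q] by simp

lemma presented_elt_uminus:
  "Poly_Mapping.keys p \<subseteq> S \<Longrightarrow> presented_elt S R (- p) = inv\<^bsub>presented S R\<^esub> presented_elt S R p"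
  using elt.hom_inv[of p] by simp

lemma presented_elt_diff:
  "Poly_Mapping.keys p \<subseteq> S \<Longrightarrow> Poly_Mapping.keys q \<subseteq> S \<Longrightarrow>
    presented_elt S R (p - q) = presented_elt S R p \<otimes>\<^bsub>presented S R\<^esub> inv\<^bsub>presented S R\<^esub> presented_elt S R q"
  using presented_elt_add[of p "- q"] by (simp add: presented_elt_uminus)

lemma presented_elt_cmul:
  "Poly_Mapping.keys p \<subseteq> S \<Longrightarrow> presented_elt S R (frag_cmul k p) = presented_elt S R p [^]\<^bsub>presented S R\<^esub> (k::int)"
  using elt.hom_int_pow[of p k] by simp

lemma presented_elt_diff_one_iff:
  "Poly_Mapping.keys p \<subseteq> S \<Longrightarrow> Poly_Mapping.keys q \<subseteq> S \<Longrightarrow>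
    presented_elt S R (p - q) = \<one>\<^bsub>presented S R\<^esub> \<longleftrightarrow> presented_elt S R p = presented_elt S R q"
  using presented_elt_closed[of p] presented_elt_closed[of q]
    presented_group.inv_equality[of "presented_elt S R p" "inv\<^bsub>presented S R\<^esub> presented_elt S R q"]
  by (auto simp: presented_elt_diff)

lemma presented_elt_one_iff:
  assumes "Poly_Mapping.keys p \<subseteq> S"
  shows "presented_elt S R p = \<one>\<^bsub>presented S R\<^esub> \<longleftrightarrow> p \<in> generate (free_Abelian_group S) R"
proof -
  have sg: "subgroup (generate (free_Abelian_group S) R) (free_Abelian_group S)"
    using presented_normal[OF R] by (simp add: normal_def)
  show ?thesis
    using group.coset_join1[OF group_free_Abelian_group _ _ sg, of p]
      group.coset_join2[OF group_free_Abelian_group _ sg, of p] subgroup.subset[OF sg] assms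
    by (auto simp: presented_elt_def presented_def)
qed

lemma presented_elt_rel: "r \<in> R \<Longrightarrow> presented_elt S R r = \<one>\<^bsub>presented S R\<^esub>"
  using presented_elt_one_iff[of r] R generate.incl[of r R "free_Abelian_group S"]
  by (auto simp del: carrier_free_Abelian_group_iff simp: carrier_free_Abelian_group_iff[symmetric])

lemma carrier_presented_elt:
  "carrier (presented S R) = presented_elt S R ` {p. Poly_Mapping.keys p \<subseteq> S}"
proof -
  have "carrier (free_Abelian_group S) = {p. Poly_Mapping.keys p \<subseteq> S}" by auto
  then show ?thesis by (simp only: presented_def presented_elt_def[abs_def] carrier_FactGroup)
qed

end

text \<open>
  Generators may go to combinations of generators, as they do under linearization.
\<close>

definition presented_extend ::
    "'h set \<Rightarrow> ('h \<Rightarrow>\<^sub>0 int) set \<Rightarrow> ('g \<Rightarrow> ('h \<Rightarrow>\<^sub>0 int)) \<Rightarrow> ('g \<Rightarrow>\<^sub>0 int) set \<Rightarrow> ('h \<Rightarrow>\<^sub>0 int) set" where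
  "presented_extend S R f =
    coset_map (free_Abelian_group S) (generate (free_Abelian_group S) R) (frag_extend f)"

lemma presented_map_eq_extend: "presented_map S R f = presented_extend S R (\<lambda>g. frag_of (f g))"
  by (simp add: presented_map_def presented_extend_def)

lemma presented_extend:
  assumes R: "R \<subseteq> carrier (free_Abelian_group S)" and R': "R' \<subseteq> carrier (free_Abelian_group S')"
    and f: "\<And>s. s \<in> S \<Longrightarrow> Poly_Mapping.keys (f s) \<subseteq> S'"
    and fR: "\<And>r. r \<in> R \<Longrightarrow> presented_elt S' R' (frag_extend f r) = \<one>\<^bsub>presented S' R'\<^esub>"
  shows presented_extend_hom: "presented_extend S' R' f \<in> hom (presented S R) (presented S' R')"
    and presented_extend_elt: "\<And>p. Poly_Mapping.keys p \<subseteq> S \<Longrightarrow>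
      presented_extend S' R' f (presented_elt S R p) = presented_elt S' R' (frag_extend f p)"
    and presented_extend_class: "\<And>s. s \<in> S \<Longrightarrow>
      presented_extend S' R' f (presented_class S R s) = presented_elt S' R' (f s)"
proof -
  let ?F = "free_Abelian_group S" and ?F' = "free_Abelian_group S'"
  interpret G: comm_group "presented S R" using R by (rule comm_group_presented)
  have keys: "Poly_Mapping.keys (frag_extend f p) \<subseteq> S'" if "Poly_Mapping.keys p \<subseteq> S" for p
    using keys_frag_extend[of f p] f that by blast
  have hom: "frag_extend f \<in> hom ?F ?F'"
    by (rule homI) (use keys in \<open>auto simp: frag_extend_add\<close>)
  have sg: "subgroup (generate ?F R) ?F" "subgroup (generate ?F' R') ?F'"
    using presented_normal[OF R] presented_normal[OF R'] by (simp_all add: normal_def)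
  interpret E: group_hom ?F "presented S' R'" "\<lambda>p. presented_elt S' R' (frag_extend f p)"
  proof (intro group_hom.intro group_hom_axioms.intro)
    show "group (presented S' R')" using comm_group_presented[OF R'] by (simp add: comm_group_def)
    show "(\<lambda>p. presented_elt S' R' (frag_extend f p)) \<in> hom ?F (presented S' R')"
      using Group.hom_compose[OF hom presented_elt_hom[OF R']] by (simp add: o_def)
  qed simp
  have "generate ?F R \<subseteq> kernel ?F (presented S' R') (\<lambda>p. presented_elt S' R' (frag_extend f p))"
    by (rule group.generate_subgroup_incl[OF group_free_Abelian_group _ E.subgroup_kernel])
      (use R fR in \<open>simp add: kernel_def subset_iff\<close>)
  then have "frag_extend f ` generate ?F R \<subseteq> generate ?F' R'"
    using presented_elt_one_iff[OF R'] keys by (auto simp: kernel_def)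
  from coset_map_coset[OF group_free_Abelian_group group_free_Abelian_group sg hom this]
  show elt: "presented_extend S' R' f (presented_elt S R p) = presented_elt S' R' (frag_extend f p)"
    if "Poly_Mapping.keys p \<subseteq> S" for p
    using that by (simp add: presented_extend_def presented_elt_def)
  show "presented_extend S' R' f (presented_class S R s) = presented_elt S' R' (f s)" if "s \<in> S" for s
    using elt[of "frag_of s"] that by (simp add: presented_class_eq_elt)
  show "presented_extend S' R' f \<in> hom (presented S R) (presented S' R')"
  proof (rule homI)
    fix C assume "C \<in> carrier (presented S R)"
    then show "presented_extend S' R' f C \<in> carrier (presented S' R')"
      using E.hom_closed by (auto simp: carrier_presented_elt[OF R] elt)
  next
    fix C D assume "C \<in> carrier (presented S R)" "D \<in> carrier (presented S R)"
    then obtain p q where pq: "Poly_Mapping.keys p \<subseteq> S" "Poly_Mapping.keys q \<subseteq> S"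
        "C = presented_elt S R p" "D = presented_elt S R q"
      by (auto simp: carrier_presented_elt[OF R])
    have "Poly_Mapping.keys (p + q) \<subseteq> S" using pq keys_add[of p q] by blast
    then show "presented_extend S' R' f (C \<otimes>\<^bsub>presented S R\<^esub> D) =
        presented_extend S' R' f C \<otimes>\<^bsub>presented S' R'\<^esub> presented_extend S' R' f D"
      using E.hom_mult[of p q] pq by (simp add: elt flip: presented_elt_add[OF R])
  qed
qed

text \<open>
  This serves to compare the tensor product of Beck modules with that of modules over the graded monoid
  ring, which are defined by different relations.
\<close>

lemma presented_eqI:
  assumes "generate (free_Abelian_group S) R = generate (free_Abelian_group S) R'"
  shows "presented S R = presented S R'" and "presented_map S R = presented_map S R'"
  using assms by (simp_all add: presented_def presented_map_def fun_eq_iff)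

section \<open>Modules over the graded monoid ring\<close>

lemma carrier_graded_monoid_ring [simp]: "carrier (part (graded_monoid_ring X) x) = UNIV"
  by (simp add: graded_monoid_ring_def)

text \<open>The part of the structure of a left module that tensor products and groups of homomorphisms refer to.\<close>

definition pre_gmod :: "'x monoid \<Rightarrow> ('x, int, 'c) gmod \<Rightarrow> bool" where
  "pre_gmod X P \<longleftrightarrow> (\<forall>x\<in>carrier X. comm_group (part P x)) \<and>
    (\<forall>x\<in>carrier X. \<forall>y\<in>carrier X. \<forall>a. act P y x a \<in> hom (part P x) (part P (x \<otimes>\<^bsub>X\<^esub> y)))"

text \<open>Maps of modules over a homomorphism \<open>g\<close> of the grading monoids.\<close>

definition gmod_map :: "'x monoid \<Rightarrow> ('x \<Rightarrow> 'y) \<Rightarrow> ('x, int, 'c) gmod \<Rightarrow> ('y, int, 'd) gmod \<Rightarrow>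
    ('x \<Rightarrow> 'c \<Rightarrow> 'd) \<Rightarrow> bool" where
  "gmod_map X g P P' \<phi> \<longleftrightarrow> (\<forall>x\<in>carrier X. \<phi> x \<in> hom (part P x) (part P' (g x))) \<and>
    (\<forall>x\<in>carrier X. \<forall>y\<in>carrier X. \<forall>a. \<forall>c\<in>carrier (part P x).
      \<phi> (x \<otimes>\<^bsub>X\<^esub> y) (act P y x a c) = act P' (g y) (g x) a (\<phi> x c))"

lemma pre_gmodD:
  assumes "pre_gmod X P"
  shows "x \<in> carrier X \<Longrightarrow> comm_group (part P x)"
    and "x \<in> carrier X \<Longrightarrow> y \<in> carrier X \<Longrightarrow> c \<in> carrier (part P x) \<Longrightarrow> act P y x a c \<in> carrier (part P (x \<otimes>\<^bsub>X\<^esub> y))"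
    and "x \<in> carrier X \<Longrightarrow> y \<in> carrier X \<Longrightarrow> act P y x a \<in> hom (part P x) (part P (x \<otimes>\<^bsub>X\<^esub> y))"
proof -
  show "x \<in> carrier X \<Longrightarrow> comm_group (part P x)"
    using assms by (simp add: pre_gmod_def)
  show hom: "x \<in> carrier X \<Longrightarrow> y \<in> carrier X \<Longrightarrow> act P y x a \<in> hom (part P x) (part P (x \<otimes>\<^bsub>X\<^esub> y))"
    using assms by (simp add: pre_gmod_def)
  show "x \<in> carrier X \<Longrightarrow> y \<in> carrier X \<Longrightarrow> c \<in> carrier (part P x) \<Longrightarrow> act P y x a c \<in> carrier (part P (x \<otimes>\<^bsub>X\<^esub> y))"
    using hom_in_carrier[OF hom] .
qed

lemma gmod_mapD:
  assumes "gmod_map X g P P' \<phi>"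
  shows "x \<in> carrier X \<Longrightarrow> \<phi> x \<in> hom (part P x) (part P' (g x))"
    and "x \<in> carrier X \<Longrightarrow> c \<in> carrier (part P x) \<Longrightarrow> \<phi> x c \<in> carrier (part P' (g x))"
    and "x \<in> carrier X \<Longrightarrow> y \<in> carrier X \<Longrightarrow> c \<in> carrier (part P x) \<Longrightarrow>
      \<phi> (x \<otimes>\<^bsub>X\<^esub> y) (act P y x a c) = act P' (g y) (g x) a (\<phi> x c)"
  using assms by (auto simp: gmod_map_def intro: hom_in_carrier)

lemma right_gmodD:
  assumes "right_gmod X (graded_monoid_ring X) M"
  shows "x \<in> carrier X \<Longrightarrow> comm_group (part M x)"
    and "x \<in> carrier X \<Longrightarrow> y \<in> carrier X \<Longrightarrow> m \<in> carrier (part M (x \<otimes>\<^bsub>X\<^esub> y)) \<Longrightarrow> act M y x a m \<in> carrier (part M x)"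
proof -
  show "x \<in> carrier X \<Longrightarrow> comm_group (part M x)"
    using assms by (simp add: right_gmod_def)
  have "x \<in> carrier X \<Longrightarrow> y \<in> carrier X \<Longrightarrow> act M y x a \<in> hom (part M (x \<otimes>\<^bsub>X\<^esub> y)) (part M x)"
    using assms by (simp add: right_gmod_def)
  then show "x \<in> carrier X \<Longrightarrow> y \<in> carrier X \<Longrightarrow> m \<in> carrier (part M (x \<otimes>\<^bsub>X\<^esub> y)) \<Longrightarrow> act M y x a m \<in> carrier (part M x)"
    by (blast intro: hom_in_carrier)
qed

subsection \<open>Tensor products\<close>

abbreviation ztensor_rels where
  "ztensor_rels X M P \<equiv> gmod_tensor_rels X (graded_monoid_ring X) M P"

lemma ztensor_rels_cases:
  assumes "r \<in> ztensor_rels X M P"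
  obtains
    (left) z m m' n where "r = frag_of (z, m \<otimes>\<^bsub>part M z\<^esub> m', n) - frag_of (z, m, n) - frag_of (z, m', n)"
      "z \<in> carrier X" "m \<in> carrier (part M z)" "m' \<in> carrier (part M z)" "n \<in> carrier (part P z)"
  | (right) z m n n' where "r = frag_of (z, m, n \<otimes>\<^bsub>part P z\<^esub> n') - frag_of (z, m, n) - frag_of (z, m, n')"
      "z \<in> carrier X" "m \<in> carrier (part M z)" "n \<in> carrier (part P z)" "n' \<in> carrier (part P z)"
  | (balanced) x y m a n where "r = frag_of (x \<otimes>\<^bsub>X\<^esub> y, m, act P y x a n) - frag_of (x, act M y x a m, n)"
      "x \<in> carrier X" "y \<in> carrier X" "m \<in> carrier (part M (x \<otimes>\<^bsub>X\<^esub> y))" "n \<in> carrier (part P x)"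
  using assms unfolding gmod_tensor_rels_def bilinear_rels_def by blast

lemma ztensor_rels_intros:
  "z \<in> carrier X \<Longrightarrow> m \<in> carrier (part M z) \<Longrightarrow> m' \<in> carrier (part M z) \<Longrightarrow> n \<in> carrier (part P z) \<Longrightarrow>
    frag_of (z, m \<otimes>\<^bsub>part M z\<^esub> m', n) - frag_of (z, m, n) - frag_of (z, m', n) \<in> ztensor_rels X M P"
  "z \<in> carrier X \<Longrightarrow> m \<in> carrier (part M z) \<Longrightarrow> n \<in> carrier (part P z) \<Longrightarrow> n' \<in> carrier (part P z) \<Longrightarrow>
    frag_of (z, m, n \<otimes>\<^bsub>part P z\<^esub> n') - frag_of (z, m, n) - frag_of (z, m, n') \<in> ztensor_rels X M P"
  "x \<in> carrier X \<Longrightarrow> y \<in> carrier X \<Longrightarrow> m \<in> carrier (part M (x \<otimes>\<^bsub>X\<^esub> y)) \<Longrightarrow> n \<in> carrier (part P x) \<Longrightarrow>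
    frag_of (x \<otimes>\<^bsub>X\<^esub> y, m, act P y x a n) - frag_of (x, act M y x a m, n) \<in> ztensor_rels X M P"
  unfolding gmod_tensor_rels_def bilinear_rels_def carrier_graded_monoid_ring by blast+

lemma ztensor_rels_closed:
  assumes X: "comm_monoid X" and M: "right_gmod X (graded_monoid_ring X) M" and P: "pre_gmod X P"
  shows "ztensor_rels X M P \<subseteq> carrier (free_Abelian_group (tensor_gens X M P))"
proof
  interpret comm_monoid X by fact
  have mc: "a \<otimes>\<^bsub>part M x\<^esub> b \<in> carrier (part M x)" if "x \<in> carrier X" "a \<in> carrier (part M x)" "b \<in> carrier (part M x)" for x a b
    using right_gmodD(1)[OF M that(1)] that(2,3) by (simp add: comm_group_def group_def monoid.m_closed)
  have pc: "a \<otimes>\<^bsub>part P x\<^esub> b \<in> carrier (part P x)" if "x \<in> carrier X" "a \<in> carrier (part P x)" "b \<in> carrier (part P x)" for x a b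
    using pre_gmodD(1)[OF P that(1)] that(2,3) by (simp add: comm_group_def group_def monoid.m_closed)
  fix r assume "r \<in> ztensor_rels X M P"
  then show "r \<in> carrier (free_Abelian_group (tensor_gens X M P))"
  proof (cases rule: ztensor_rels_cases)
    case left
    show ?thesis unfolding left(1)
      by (rule frag_of_diff3_closed) (use left mc in \<open>auto simp: tensor_gens_def\<close>)
  next
    case right
    show ?thesis unfolding right(1)
      by (rule frag_of_diff3_closed) (use right pc in \<open>auto simp: tensor_gens_def\<close>)
  next
    case (balanced x y m a n)
    have "(x \<otimes>\<^bsub>X\<^esub> y, m, act P y x a n) \<in> tensor_gens X M P" "(x, act M y x a m, n) \<in> tensor_gens X M P"
      using balanced pre_gmodD(2)[OF P] right_gmodD(2)[OF M] by (auto simp: tensor_gens_def)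
    then show ?thesis
      using keys_diff[of "frag_of (x \<otimes>\<^bsub>X\<^esub> y, m, act P y x a n)" "frag_of (x, act M y x a m, n)"]
      by (auto simp: balanced(1))
  qed
qed

text \<open>The map of tensor products induced by a map of modules over \<open>g\<close>, with coefficients pulled back along \<open>g\<close>.\<close>

definition ztensor_map ::
    "'y monoid \<Rightarrow> ('y, int, 'm) gmod \<Rightarrow> ('y, int, 'd) gmod \<Rightarrow> ('x \<Rightarrow> 'y) \<Rightarrow> ('x \<Rightarrow> 'c \<Rightarrow> 'd) \<Rightarrow>
     ('x \<times> 'm \<times> 'c \<Rightarrow>\<^sub>0 int) set \<Rightarrow> ('y \<times> 'm \<times> 'd \<Rightarrow>\<^sub>0 int) set" where
  "ztensor_map X' M P' g \<phi> =
    presented_map (tensor_gens X' M P') (ztensor_rels X' M P') (\<lambda>(z, m, c). (g z, m, \<phi> z c))"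

abbreviation ztensor_class where
  "ztensor_class X M P \<equiv> presented_class (tensor_gens X M P) (ztensor_rels X M P)"

text \<open>
  Pulling the coefficients back along \<open>g\<close> does not change their groups or their elements, so that the
  second entry of a generator is kept.
\<close>

lemma ztensor_map:
  assumes X: "comm_monoid X" and X': "comm_monoid X'" and g: "g \<in> hom X X'"
    and M': "right_gmod X' (graded_monoid_ring X') M'" and M: "right_gmod X (graded_monoid_ring X) M"
    and part: "\<And>x. x \<in> carrier X \<Longrightarrow> part M x = part M' (g x)"
    and act: "\<And>x y a m. x \<in> carrier X \<Longrightarrow> y \<in> carrier X \<Longrightarrow> act M y x a m = act M' (g y) (g x) a m"
    and P: "pre_gmod X P" and P': "pre_gmod X' P'" and \<phi>: "gmod_map X g P P' \<phi>"
  shows ztensor_map_hom: "ztensor_map X' M' P' g \<phi> \<in>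
      hom (gmod_tensor X (graded_monoid_ring X) M P) (gmod_tensor X' (graded_monoid_ring X') M' P')"
    and ztensor_map_class: "z \<in> carrier X \<Longrightarrow> m \<in> carrier (part M z) \<Longrightarrow> c \<in> carrier (part P z) \<Longrightarrow>
      ztensor_map X' M' P' g \<phi> (ztensor_class X M P (z, m, c)) = ztensor_class X' M' P' (g z, m, \<phi> z c)"
proof -
  interpret X: comm_monoid X by fact
  let ?f = "\<lambda>(z, m, c). (g z, m, \<phi> z c)"
  note gc = hom_in_carrier[OF g]
  have gens: "?f s \<in> tensor_gens X' M' P'" if "s \<in> tensor_gens X M P" for s
    using that gmod_mapD(2)[OF \<phi>] gc part by (auto simp: tensor_gens_def)
  have rels: "frag_extend (\<lambda>s. frag_of (?f s)) r \<in> ztensor_rels X' M' P'" if "r \<in> ztensor_rels X M P" for r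
    using that
  proof (cases rule: ztensor_rels_cases)
    case (left z m m' n)
    then show ?thesis
      using ztensor_rels_intros(1)[of "g z" X' m M' m' "\<phi> z n" P'] gmod_mapD(2)[OF \<phi>] gc
      by (simp add: frag_extend_diff part)
  next
    case (right z m n n')
    then show ?thesis
      using ztensor_rels_intros(2)[of "g z" X' m M' "\<phi> z n" P' "\<phi> z n'"] gmod_mapD(2)[OF \<phi>] gc
        hom_mult[OF gmod_mapD(1)[OF \<phi>]]
      by (simp add: frag_extend_diff part)
  next
    case (balanced x y m a n)
    then show ?thesis
      using ztensor_rels_intros(3)[of "g x" X' "g y" m M' "\<phi> x n" P' a] gmod_mapD(2,3)[OF \<phi>] gc
      by (simp add: frag_extend_diff part act hom_mult[OF g])
  qed
  note R = ztensor_rels_closed[OF X M P] ztensor_rels_closed[OF X' M' P']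
  show "ztensor_map X' M' P' g \<phi> \<in>
      hom (gmod_tensor X (graded_monoid_ring X) M P) (gmod_tensor X' (graded_monoid_ring X') M' P')"
    unfolding ztensor_map_def gmod_tensor_def by (rule presented_map_hom[OF R gens rels])
  show "ztensor_map X' M' P' g \<phi> (ztensor_class X M P (z, m, c)) = ztensor_class X' M' P' (g z, m, \<phi> z c)"
    if "z \<in> carrier X" "m \<in> carrier (part M z)" "c \<in> carrier (part P z)"
    using presented_map_class[OF R gens rels, of "(z, m, c)"] that
    by (simp add: ztensor_map_def tensor_gens_def)
qed

lemma ztensor_map_id:
  assumes "comm_monoid X" "right_gmod X (graded_monoid_ring X) M" "pre_gmod X P" "pre_gmod X P'" "gmod_map X id P P' \<phi>"
  shows ztensor_map_id_hom: "ztensor_map X M P' id \<phi> \<in>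
      hom (gmod_tensor X (graded_monoid_ring X) M P) (gmod_tensor X (graded_monoid_ring X) M P')"
    and ztensor_map_id_class: "z \<in> carrier X \<Longrightarrow> m \<in> carrier (part M z) \<Longrightarrow> c \<in> carrier (part P z) \<Longrightarrow>
      ztensor_map X M P' id \<phi> (ztensor_class X M P (z, m, c)) = ztensor_class X M P' (z, m, \<phi> z c)"
  using ztensor_map[of X X id M M P P' \<phi>] assms by (simp_all add: hom_def)

lemma ztensor_hom_eqI:
  assumes X: "comm_monoid X" and M: "right_gmod X (graded_monoid_ring X) M" and P: "pre_gmod X P"
    and G: "group G" and k: "k \<in> hom (gmod_tensor X (graded_monoid_ring X) M P) G"
      "k' \<in> hom (gmod_tensor X (graded_monoid_ring X) M P) G"
    and eq: "\<And>z m c. z \<in> carrier X \<Longrightarrow> m \<in> carrier (part M z) \<Longrightarrow> c \<in> carrier (part P z) \<Longrightarrow>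
      k (ztensor_class X M P (z, m, c)) = k' (ztensor_class X M P (z, m, c))"
    and t: "t \<in> carrier (gmod_tensor X (graded_monoid_ring X) M P)"
  shows "k t = k' t"
  using presented_hom_eqI[OF ztensor_rels_closed[OF X M P] G, of k k' t] k eq t
  unfolding gmod_tensor_def tensor_gens_def by blast

lemma comm_group_ztensor:
  assumes "comm_monoid X" "right_gmod X (graded_monoid_ring X) M" "pre_gmod X P"
  shows "comm_group (gmod_tensor X (graded_monoid_ring X) M P)"
  unfolding gmod_tensor_def by (rule comm_group_presented[OF ztensor_rels_closed[OF assms]])

subsection \<open>Groups of homomorphisms\<close>

lemma left_gmodD:
  assumes "left_gmod X (graded_monoid_ring X) N"
  shows "x \<in> carrier X \<Longrightarrow> comm_group (part N x)"
    and "x \<in> carrier X \<Longrightarrow> y \<in> carrier X \<Longrightarrow> act N y x a \<in> hom (part N x) (part N (x \<otimes>\<^bsub>X\<^esub> y))"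
  using assms by (simp_all add: left_gmod_def)

abbreviation zHom where
  "zHom X P N \<equiv> gmod_Hom X (graded_monoid_ring X) P N"

lemma carrier_zHom:
  "\<theta> \<in> carrier (zHom X P N) \<longleftrightarrow> \<theta> \<in> extensional (carrier X) \<and>
    (\<forall>x\<in>carrier X. \<theta> x \<in> extensional (carrier (part P x)) \<and> \<theta> x \<in> hom (part P x) (part N x)) \<and>
    (\<forall>x\<in>carrier X. \<forall>y\<in>carrier X. \<forall>a. \<forall>c\<in>carrier (part P x). \<theta> (x \<otimes>\<^bsub>X\<^esub> y) (act P y x a c) = act N y x a (\<theta> x c))"
  by (simp add: gmod_Hom_def)

lemma zHomD:
  assumes "\<theta> \<in> carrier (zHom X P N)"
  shows "x \<in> carrier X \<Longrightarrow> \<theta> x \<in> hom (part P x) (part N x)"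
    and "x \<in> carrier X \<Longrightarrow> c \<in> carrier (part P x) \<Longrightarrow> \<theta> x c \<in> carrier (part N x)"
    and "x \<in> carrier X \<Longrightarrow> y \<in> carrier X \<Longrightarrow> c \<in> carrier (part P x) \<Longrightarrow>
      \<theta> (x \<otimes>\<^bsub>X\<^esub> y) (act P y x a c) = act N y x a (\<theta> x c)"
proof -
  show h: "x \<in> carrier X \<Longrightarrow> \<theta> x \<in> hom (part P x) (part N x)"
    using assms by (simp add: carrier_zHom)
  show "x \<in> carrier X \<Longrightarrow> c \<in> carrier (part P x) \<Longrightarrow> \<theta> x c \<in> carrier (part N x)"
    using hom_in_carrier[OF h] .
  show "x \<in> carrier X \<Longrightarrow> y \<in> carrier X \<Longrightarrow> c \<in> carrier (part P x) \<Longrightarrow>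
      \<theta> (x \<otimes>\<^bsub>X\<^esub> y) (act P y x a c) = act N y x a (\<theta> x c)"
    using assms by (simp add: carrier_zHom)
qed

text \<open>
  The members of a group of homomorphisms are extensional functions: equality has to be tested on the
  carriers only, and a family of homomorphisms has to be restricted to them.
\<close>

lemma zHom_eqI:
  assumes "\<theta> \<in> carrier (zHom X P N)" "\<kappa> \<in> carrier (zHom X P N)"
    and "\<And>x c. x \<in> carrier X \<Longrightarrow> c \<in> carrier (part P x) \<Longrightarrow> \<theta> x c = \<kappa> x c"
  shows "\<theta> = \<kappa>"
proof (rule extensionalityI[of _ "carrier X"])
  fix x assume x: "x \<in> carrier X"
  show "\<theta> x = \<kappa> x"
    by (rule extensionalityI[of _ "carrier (part P x)"]) (use assms x in \<open>auto simp: carrier_zHom\<close>)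
qed (use assms in \<open>auto simp: carrier_zHom\<close>)

lemma zHom_restrictI:
  assumes X: "comm_monoid X" and P: "pre_gmod X P"
    and hom: "\<And>x. x \<in> carrier X \<Longrightarrow> f x \<in> hom (part P x) (part N x)"
    and act: "\<And>x y a c. x \<in> carrier X \<Longrightarrow> y \<in> carrier X \<Longrightarrow> c \<in> carrier (part P x) \<Longrightarrow>
      f (x \<otimes>\<^bsub>X\<^esub> y) (act P y x a c) = act N y x a (f x c)"
  shows "(\<lambda>x\<in>carrier X. \<lambda>c\<in>carrier (part P x). f x c) \<in> carrier (zHom X P N)"
proof -
  interpret comm_monoid X by fact
  have "restrict (f x) (carrier (part P x)) \<in> hom (part P x) (part N x)" if x: "x \<in> carrier X" for x
  proof (rule homI)
    fix c d assume "c \<in> carrier (part P x)" "d \<in> carrier (part P x)"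
    moreover from this have "c \<otimes>\<^bsub>part P x\<^esub> d \<in> carrier (part P x)"
      using pre_gmodD(1)[OF P x] by (simp add: comm_group_def group_def monoid.m_closed)
    ultimately show "restrict (f x) (carrier (part P x)) (c \<otimes>\<^bsub>part P x\<^esub> d) =
        restrict (f x) (carrier (part P x)) c \<otimes>\<^bsub>part N x\<^esub> restrict (f x) (carrier (part P x)) d"
      using hom_mult[OF hom[OF x]] by simp
  qed (use hom_in_carrier[OF hom[OF x]] in simp)
  then show ?thesis
    unfolding carrier_zHom by (auto simp: act pre_gmodD(2)[OF P])
qed

lemma comm_group_zHom:
  assumes X: "comm_monoid X" and P: "pre_gmod X P" and N: "left_gmod X (graded_monoid_ring X) N"
  shows "comm_group (zHom X P N)"
proof -
  interpret X: comm_monoid X by fact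
  note grN = left_gmodD(1)[OF N] and actN = left_gmodD(2)[OF N]
  note grP = pre_gmodD(1)[OF P]
  have mN: "monoid (part N x)" "group (part N x)" if "x \<in> carrier X" for x
    using grN[OF that] by (simp_all add: comm_group_def group_def)
  have mult: "\<theta> \<otimes>\<^bsub>zHom X P N\<^esub> \<kappa> = (\<lambda>x\<in>carrier X. \<lambda>c\<in>carrier (part P x). \<theta> x c \<otimes>\<^bsub>part N x\<^esub> \<kappa> x c)" for \<theta> \<kappa>
    by (simp add: gmod_Hom_def)
  have one: "\<one>\<^bsub>zHom X P N\<^esub> = (\<lambda>x\<in>carrier X. \<lambda>c\<in>carrier (part P x). \<one>\<^bsub>part N x\<^esub>)"
    by (simp add: gmod_Hom_def)
  have mult_closed: "\<theta> \<otimes>\<^bsub>zHom X P N\<^esub> \<kappa> \<in> carrier (zHom X P N)"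
    if t: "\<theta> \<in> carrier (zHom X P N)" "\<kappa> \<in> carrier (zHom X P N)" for \<theta> \<kappa>
    unfolding mult
  proof (rule zHom_restrictI[OF X P])
    fix x assume x: "x \<in> carrier X"
    interpret Nx: comm_group "part N x" by (rule grN[OF x])
    show "(\<lambda>c. \<theta> x c \<otimes>\<^bsub>part N x\<^esub> \<kappa> x c) \<in> hom (part P x) (part N x)"
      by (rule homI) (simp_all add: hom_mult[OF zHomD(1)[OF t(1) x]] hom_mult[OF zHomD(1)[OF t(2) x]]
          zHomD(2)[OF t(1) x] zHomD(2)[OF t(2) x] Nx.m_ac)
  next
    fix x y a c assume "x \<in> carrier X" "y \<in> carrier X" "c \<in> carrier (part P x)"
    then show "\<theta> (x \<otimes>\<^bsub>X\<^esub> y) (act P y x a c) \<otimes>\<^bsub>part N (x \<otimes>\<^bsub>X\<^esub> y)\<^esub> \<kappa> (x \<otimes>\<^bsub>X\<^esub> y) (act P y x a c) =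
        act N y x a (\<theta> x c \<otimes>\<^bsub>part N x\<^esub> \<kappa> x c)"
      by (simp add: zHomD(3)[OF t(1)] zHomD(3)[OF t(2)] hom_mult[OF actN] zHomD(2)[OF t(1)] zHomD(2)[OF t(2)])
  qed
  have one_closed: "\<one>\<^bsub>zHom X P N\<^esub> \<in> carrier (zHom X P N)"
    unfolding one
  proof (rule zHom_restrictI[OF X P])
    show "(\<lambda>c. \<one>\<^bsub>part N x\<^esub>) \<in> hom (part P x) (part N x)" if "x \<in> carrier X" for x
      using mN[OF that] by (auto intro!: homI monoid.one_closed simp: monoid.l_one)
    show "\<one>\<^bsub>part N (x \<otimes>\<^bsub>X\<^esub> y)\<^esub> = act N y x a \<one>\<^bsub>part N x\<^esub>" if "x \<in> carrier X" "y \<in> carrier X" for x y a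
      using hom_one[OF actN[OF that] mN(2)[OF that(1)] mN(2)] that by simp
  qed
  show ?thesis
  proof (rule comm_groupI)
    fix \<theta> assume t: "\<theta> \<in> carrier (zHom X P N)"
    define \<kappa> where "\<kappa> = (\<lambda>x\<in>carrier X. \<lambda>c\<in>carrier (part P x). inv\<^bsub>part N x\<^esub> \<theta> x c)"
    have k: "\<kappa> \<in> carrier (zHom X P N)"
      unfolding \<kappa>_def
    proof (rule zHom_restrictI[OF X P])
      fix x assume x: "x \<in> carrier X"
      interpret Nx: comm_group "part N x" by (rule grN[OF x])
      show "(\<lambda>c. inv\<^bsub>part N x\<^esub> \<theta> x c) \<in> hom (part P x) (part N x)"
        by (rule homI) (simp_all add: hom_mult[OF zHomD(1)[OF t x]] zHomD(2)[OF t x] Nx.inv_mult)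
    next
      fix x y a c assume xy: "x \<in> carrier X" "y \<in> carrier X" "c \<in> carrier (part P x)"
      interpret h: group_hom "part N x" "part N (x \<otimes>\<^bsub>X\<^esub> y)" "act N y x a"
        using mN(2) xy actN by (simp add: group_hom_def group_hom_axioms_def)
      show "inv\<^bsub>part N (x \<otimes>\<^bsub>X\<^esub> y)\<^esub> \<theta> (x \<otimes>\<^bsub>X\<^esub> y) (act P y x a c) = act N y x a (inv\<^bsub>part N x\<^esub> \<theta> x c)"
        using xy by (simp add: zHomD(3)[OF t] zHomD(2)[OF t])
    qed
    have "\<kappa> \<otimes>\<^bsub>zHom X P N\<^esub> \<theta> = \<one>\<^bsub>zHom X P N\<^esub>"
      by (rule zHom_eqI[OF mult_closed[OF k t] one_closed])
        (simp add: mult one \<kappa>_def zHomD(2)[OF t] group.l_inv[OF mN(2)])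
    with k show "\<exists>\<kappa>\<in>carrier (zHom X P N). \<kappa> \<otimes>\<^bsub>zHom X P N\<^esub> \<theta> = \<one>\<^bsub>zHom X P N\<^esub>" by blast
  next
    fix \<theta> \<kappa> assume t: "\<theta> \<in> carrier (zHom X P N)" "\<kappa> \<in> carrier (zHom X P N)"
    show "\<theta> \<otimes>\<^bsub>zHom X P N\<^esub> \<kappa> \<in> carrier (zHom X P N)" by (rule mult_closed[OF t])
    show "\<theta> \<otimes>\<^bsub>zHom X P N\<^esub> \<kappa> = \<kappa> \<otimes>\<^bsub>zHom X P N\<^esub> \<theta>"
      by (rule zHom_eqI[OF mult_closed[OF t] mult_closed[OF t(2,1)]])
        (simp add: mult zHomD(2)[OF t(1)] zHomD(2)[OF t(2)] comm_monoid.m_comm[OF comm_group.axioms(1)[OF grN]])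
  next
    fix \<theta> \<kappa> \<mu> assume t: "\<theta> \<in> carrier (zHom X P N)" "\<kappa> \<in> carrier (zHom X P N)" "\<mu> \<in> carrier (zHom X P N)"
    show "\<theta> \<otimes>\<^bsub>zHom X P N\<^esub> \<kappa> \<otimes>\<^bsub>zHom X P N\<^esub> \<mu> = \<theta> \<otimes>\<^bsub>zHom X P N\<^esub> (\<kappa> \<otimes>\<^bsub>zHom X P N\<^esub> \<mu>)"
      by (rule zHom_eqI[OF mult_closed[OF mult_closed[OF t(1,2)] t(3)] mult_closed[OF t(1) mult_closed[OF t(2,3)]]])
        (simp add: mult monoid.m_assoc[OF mN(1)] zHomD(2)[OF t(1)] zHomD(2)[OF t(2)] zHomD(2)[OF t(3)])
  next
    fix \<theta> assume t: "\<theta> \<in> carrier (zHom X P N)"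
    show "\<one>\<^bsub>zHom X P N\<^esub> \<otimes>\<^bsub>zHom X P N\<^esub> \<theta> = \<theta>"
      by (rule zHom_eqI[OF mult_closed[OF one_closed t] t])
        (simp add: mult one monoid.l_one[OF mN(1)] zHomD(2)[OF t])
  qed (rule one_closed)
qed

text \<open>
  Restriction of cochains along a map of modules; the change of grading monoid serves naturality.
\<close>

definition zHom_pre ::
    "'x monoid \<Rightarrow> ('x, int, 'c) gmod \<Rightarrow> ('x \<Rightarrow> 'y) \<Rightarrow> ('x \<Rightarrow> 'c \<Rightarrow> 'd) \<Rightarrow> ('y \<Rightarrow> 'd \<Rightarrow> 'n) \<Rightarrow> ('x \<Rightarrow> 'c \<Rightarrow> 'n)" where
  "zHom_pre X P g \<phi> \<theta> = (\<lambda>x\<in>carrier X. \<lambda>c\<in>carrier (part P x). \<theta> (g x) (\<phi> x c))"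

lemma zHom_pre_closed:
  assumes X: "comm_monoid X" and g: "g \<in> hom X X'"
    and part: "\<And>x. x \<in> carrier X \<Longrightarrow> part N x = part N' (g x)"
    and act: "\<And>x y a n. x \<in> carrier X \<Longrightarrow> y \<in> carrier X \<Longrightarrow> act N y x a n = act N' (g y) (g x) a n"
    and P: "pre_gmod X P" and \<phi>: "gmod_map X g P P' \<phi>" and \<theta>: "\<theta> \<in> carrier (zHom X' P' N')"
  shows "zHom_pre X P g \<phi> \<theta> \<in> carrier (zHom X P N)"
  unfolding zHom_pre_def
proof (rule zHom_restrictI[OF X P])
  fix x assume x: "x \<in> carrier X"
  show "(\<lambda>c. \<theta> (g x) (\<phi> x c)) \<in> hom (part P x) (part N x)"
    using Group.hom_compose[OF gmod_mapD(1)[OF \<phi> x] zHomD(1)[OF \<theta> hom_in_carrier[OF g x]]]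
    by (simp add: o_def part[OF x])
next
  fix x y a c assume "x \<in> carrier X" "y \<in> carrier X" "c \<in> carrier (part P x)"
  then show "\<theta> (g (x \<otimes>\<^bsub>X\<^esub> y)) (\<phi> (x \<otimes>\<^bsub>X\<^esub> y) (act P y x a c)) = act N y x a (\<theta> (g x) (\<phi> x c))"
    using zHomD(3)[OF \<theta>, of "g x" "g y" "\<phi> x c" a] gmod_mapD(2,3)[OF \<phi>] hom_in_carrier[OF g]
    by (simp add: act hom_mult[OF g])
qed

lemma zHom_pre_hom:
  assumes X: "comm_monoid X" and g: "g \<in> hom X X'"
    and part: "\<And>x. x \<in> carrier X \<Longrightarrow> part N x = part N' (g x)"
    and act: "\<And>x y a n. x \<in> carrier X \<Longrightarrow> y \<in> carrier X \<Longrightarrow> act N y x a n = act N' (g y) (g x) a n"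
    and P: "pre_gmod X P" and \<phi>: "gmod_map X g P P' \<phi>"
  shows "zHom_pre X P g \<phi> \<in> hom (zHom X' P' N') (zHom X P N)"
proof (rule homI)
  show "zHom_pre X P g \<phi> \<theta> \<in> carrier (zHom X P N)" if "\<theta> \<in> carrier (zHom X' P' N')" for \<theta>
    by (rule zHom_pre_closed[OF X g part act P \<phi> that])
  show "zHom_pre X P g \<phi> (\<theta> \<otimes>\<^bsub>zHom X' P' N'\<^esub> \<kappa>) = zHom_pre X P g \<phi> \<theta> \<otimes>\<^bsub>zHom X P N\<^esub> zHom_pre X P g \<phi> \<kappa>" for \<theta> \<kappa>
    using hom_in_carrier[OF g] gmod_mapD(2)[OF \<phi>]
    by (auto simp: zHom_pre_def gmod_Hom_def fun_eq_iff restrict_def part)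
qed

section \<open>Simplicial modules and their deformation retracts\<close>

locale simplicial_gmod =
  fixes X :: "'x monoid" and P :: "nat \<Rightarrow> ('x, int, 'c) gmod" and d :: "'x \<Rightarrow> nat \<Rightarrow> nat \<Rightarrow> 'c \<Rightarrow> 'c"
  assumes X: "comm_monoid X"
    and pre: "pre_gmod X (P n)"
    and face: "i \<le> Suc n \<Longrightarrow> gmod_map X id (P (Suc n)) (P n) (\<lambda>x. d x n i)"
begin

definition diff :: "'x \<Rightarrow> nat \<Rightarrow> 'c \<Rightarrow> 'c" where
  "diff x = simp_diff (\<lambda>n. part (P n) x) (d x)"

lemma parts: "x \<in> carrier X \<Longrightarrow> simplicial_group (\<lambda>n. part (P n) x) (d x)"
  using pre_gmodD(1)[OF pre] gmod_mapD(1)[OF face] by (intro simplicial_group.intro) simp_all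

lemma is_group: "x \<in> carrier X \<Longrightarrow> group (part (P n) x)"
  using pre_gmodD(1)[OF pre] by (simp add: comm_group_def)

lemma diff_hom: "x \<in> carrier X \<Longrightarrow> diff x n \<in> hom (part (P (Suc n)) x) (part (P n) x)"
  unfolding diff_def using simplicial_group.simp_diff_hom[OF parts] .

text \<open>
  Cochains are maps of modules. The coboundary composes them with the alternating sum of the faces and has to
  produce maps of modules again.
\<close>

lemma diff_map: "gmod_map X id (P (Suc n)) (P n) (\<lambda>x. diff x n)"
  unfolding gmod_map_def
proof (intro conjI ballI allI)
  interpret X: comm_monoid X by (rule X)
  show "diff x n \<in> hom (part (P (Suc n)) x) (part (P n) (id x))" if "x \<in> carrier X" for x
    using diff_hom that by simp
  fix x y a c assume xy: "x \<in> carrier X" "y \<in> carrier X" and c: "c \<in> carrier (part (P (Suc n)) x)"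
  have xy': "x \<otimes>\<^bsub>X\<^esub> y \<in> carrier X" using xy by simp
  interpret G: comm_group "part (P n) (x \<otimes>\<^bsub>X\<^esub> y)" by (rule pre_gmodD(1)[OF pre xy'])
  have "act (P n) y x a (diff x n c) =
      (\<Otimes>\<^bsub>part (P n) (x \<otimes>\<^bsub>X\<^esub> y)\<^esub>i\<in>{..Suc n}. act (P n) y x a (d x n i c) [^]\<^bsub>part (P n) (x \<otimes>\<^bsub>X\<^esub> y)\<^esub> ((-1) ^ i :: int))"
    unfolding diff_def simp_diff_def
    by (rule hom_signed_finprod[OF pre_gmodD(1)[OF pre xy(1)] G.comm_group_axioms pre_gmodD(3)[OF pre xy]])
      (use gmod_mapD(2)[OF face] xy c in auto)
  also have "\<dots> = diff (x \<otimes>\<^bsub>X\<^esub> y) n (act (P (Suc n)) y x a c)"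
    unfolding diff_def simp_diff_def
  proof (rule G.finprod_cong')
    fix i assume "i \<in> {..Suc n}"
    then show "act (P n) y x a (d x n i c) [^]\<^bsub>part (P n) (x \<otimes>\<^bsub>X\<^esub> y)\<^esub> ((-1) ^ i :: int) =
        d (x \<otimes>\<^bsub>X\<^esub> y) n i (act (P (Suc n)) y x a c) [^]\<^bsub>part (P n) (x \<otimes>\<^bsub>X\<^esub> y)\<^esub> ((-1) ^ i :: int)"
      using gmod_mapD(3)[OF face xy c] by simp
  qed (use gmod_mapD(2)[OF face xy'] pre_gmodD(2)[OF pre xy c] in auto)
  finally show "diff (x \<otimes>\<^bsub>X\<^esub> y) n (act (P (Suc n)) y x a c) = act (P n) (id y) (id x) a (diff x n c)"
    by simp
qed

lemma tensor:
  assumes M: "right_gmod X (graded_monoid_ring X) M"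
  shows "simplicial_group (\<lambda>n. gmod_tensor X (graded_monoid_ring X) M (P n)) (\<lambda>n i. ztensor_map X M (P n) id (\<lambda>z. d z n i))"
  by (intro simplicial_group.intro comm_group_ztensor[OF X M pre] ztensor_map_id_hom[OF X M pre pre face])

definition coboundary :: "nat \<Rightarrow> ('x \<Rightarrow> 'c \<Rightarrow> 'n) \<Rightarrow> ('x \<Rightarrow> 'c \<Rightarrow> 'n)" where
  "coboundary n \<theta> = (\<lambda>x\<in>carrier X. \<lambda>c\<in>carrier (part (P (Suc n)) x). \<theta> x (diff x n c))"

lemma coboundary_eq: "coboundary n = zHom_pre X (P (Suc n)) id (\<lambda>x. diff x n)"
  by (simp add: coboundary_def zHom_pre_def fun_eq_iff)

lemma id_hom: "id \<in> hom X X"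
  by (simp add: hom_def)

lemma coboundary_hom:
  "coboundary n \<in> hom (zHom X (P n) N) (zHom X (P (Suc n)) N)"
  unfolding coboundary_eq by (rule zHom_pre_hom[OF X id_hom _ _ pre diff_map]) simp_all

context
  fixes N :: "('x, int, 'n) gmod"
  assumes N: "left_gmod X (graded_monoid_ring X) N"
begin

lemma comm_group_cochains: "comm_group (zHom X (P n) N)"
  by (rule comm_group_zHom[OF X pre N])

lemma group_cochains: "group (zHom X (P n) N)"
  using comm_group_cochains by (simp add: comm_group_def)

lemma coboundary_group_hom: "group_hom (zHom X (P n) N) (zHom X (P (Suc n)) N) (coboundary n)"
  by (intro group_hom.intro group_hom_axioms.intro group_cochains coboundary_hom)

lemma subgroup_cocycles: "subgroup (kernel (zHom X (P n) N) (zHom X (P (Suc n)) N) (coboundary n)) (zHom X (P n) N)"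
  by (rule group_hom.subgroup_kernel[OF coboundary_group_hom])

lemma subgroup_coboundaries: "subgroup (coboundaries (\<lambda>n. zHom X (P n) N) coboundary n) (zHom X (P n) N)"
proof (cases n)
  case 0
  then show ?thesis using group.triv_subgroup[OF group_cochains] by (simp add: coboundaries_def)
next
  case (Suc k)
  then show ?thesis using group_hom.img_is_subgroup[OF coboundary_group_hom, of k] by (simp add: coboundaries_def)
qed

end

end

locale simplicial_gmod_map =
  P: simplicial_gmod X P d + P': simplicial_gmod X' P' d'
  for X :: "'x monoid" and P :: "nat \<Rightarrow> ('x, int, 'c) gmod" and d
    and X' :: "'y monoid" and P' :: "nat \<Rightarrow> ('y, int, 'd) gmod" and d' +
  fixes g :: "'x \<Rightarrow> 'y" and \<phi> :: "nat \<Rightarrow> 'x \<Rightarrow> 'c \<Rightarrow> 'd"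
  assumes g: "g \<in> hom X X'"
    and \<phi>: "gmod_map X g (P n) (P' n) (\<phi> n)"
    and \<phi>_face: "i \<le> Suc n \<Longrightarrow> x \<in> carrier X \<Longrightarrow> c \<in> carrier (part (P (Suc n)) x) \<Longrightarrow>
      \<phi> n x (d x n i c) = d' (g x) n i (\<phi> (Suc n) x c)"
begin

lemma gx: "x \<in> carrier X \<Longrightarrow> g x \<in> carrier X'"
  using g by (rule hom_in_carrier)

lemma parts:
  assumes x: "x \<in> carrier X"
  shows "simplicial_map (\<lambda>n. part (P n) x) (d x) (\<lambda>n. part (P' n) (g x)) (d' (g x)) (\<lambda>n. \<phi> n x)"
proof -
  interpret A: simplicial_group "\<lambda>n. part (P n) x" "d x" by (rule P.parts[OF x])
  interpret B: simplicial_group "\<lambda>n. part (P' n) (g x)" "d' (g x)" by (rule P'.parts[OF gx[OF x]])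
  show ?thesis
    by (intro simplicial_map.intro simplicial_map_axioms.intro A.simplicial_group_axioms B.simplicial_group_axioms)
      (use gmod_mapD(1)[OF \<phi> x] \<phi>_face[OF _ x] in simp_all)
qed

lemma \<phi>_diff:
  "x \<in> carrier X \<Longrightarrow> c \<in> carrier (part (P (Suc n)) x) \<Longrightarrow> \<phi> n x (P.diff x n c) = P'.diff (g x) n (\<phi> (Suc n) x c)"
  unfolding P.diff_def P'.diff_def by (rule simplicial_map.\<phi>_diff[OF parts])

context
  fixes M' :: "('y, int, 'm) gmod" and M :: "('x, int, 'm) gmod"
  assumes M': "right_gmod X' (graded_monoid_ring X') M'" and M: "right_gmod X (graded_monoid_ring X) M"
    and part: "\<And>x. x \<in> carrier X \<Longrightarrow> part M x = part M' (g x)"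
    and act: "\<And>x y a m. x \<in> carrier X \<Longrightarrow> y \<in> carrier X \<Longrightarrow> act M y x a m = act M' (g y) (g x) a m"
begin

lemma tensor:
  "simplicial_map
    (\<lambda>n. gmod_tensor X (graded_monoid_ring X) M (P n)) (\<lambda>n i. ztensor_map X M (P n) id (\<lambda>z. d z n i))
    (\<lambda>n. gmod_tensor X' (graded_monoid_ring X') M' (P' n)) (\<lambda>n i. ztensor_map X' M' (P' n) id (\<lambda>z. d' z n i))
    (\<lambda>n. ztensor_map X' M' (P' n) g (\<phi> n))"
proof -
  interpret A: simplicial_group "\<lambda>n. gmod_tensor X (graded_monoid_ring X) M (P n)" "\<lambda>n i. ztensor_map X M (P n) id (\<lambda>z. d z n i)"
    by (rule P.tensor[OF M])
  interpret B: simplicial_group "\<lambda>n. gmod_tensor X' (graded_monoid_ring X') M' (P' n)" "\<lambda>n i. ztensor_map X' M' (P' n) id (\<lambda>z. d' z n i)"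
    by (rule P'.tensor[OF M'])
  have t1: "ztensor_map X' M' (P' n) g (\<phi> n) \<in>
      hom (gmod_tensor X (graded_monoid_ring X) M (P n)) (gmod_tensor X' (graded_monoid_ring X') M' (P' n))" for n
    by (rule ztensor_map_hom[OF P.X P'.X g M' M part act P.pre P'.pre \<phi>])
  have t2: "ztensor_map X' M' (P' n) g (\<phi> n) (ztensor_class X M (P n) (z, m, c)) = ztensor_class X' M' (P' n) (g z, m, \<phi> n z c)"
    if "z \<in> carrier X" "m \<in> carrier (part M z)" "c \<in> carrier (part (P n) z)" for n z m c
    by (rule ztensor_map_class[OF P.X P'.X g M' M part act P.pre P'.pre \<phi> that])
  show ?thesis
  proof (intro simplicial_map.intro simplicial_map_axioms.intro A.simplicial_group_axioms B.simplicial_group_axioms, goal_cases)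
    case (1 n)
    show ?case by (rule t1)
  next
    case (2 i n c)
    note d = ztensor_map_id_class[OF P.X M P.pre P.pre P.face[OF 2(1)]]
    note d' = ztensor_map_id_class[OF P'.X M' P'.pre P'.pre P'.face[OF 2(1)]]
    have "(ztensor_map X' M' (P' n) g (\<phi> n) \<circ> ztensor_map X M (P n) id (\<lambda>z. d z n i)) c =
        (ztensor_map X' M' (P' n) id (\<lambda>z. d' z n i) \<circ> ztensor_map X' M' (P' (Suc n)) g (\<phi> (Suc n))) c"
    proof (rule ztensor_hom_eqI[OF P.X M P.pre B.is_group Group.hom_compose[OF A.face_hom[OF 2(1)] t1]
            Group.hom_compose[OF t1 B.face_hom[OF 2(1)]] _ 2(2)])
      fix z m c assume z: "z \<in> carrier X" "m \<in> carrier (part M z)" "c \<in> carrier (part (P (Suc n)) z)"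
      have dc: "d z n i c \<in> carrier (part (P n) z)"
        using gmod_mapD(2)[OF P.face[OF 2(1)] z(1,3)] by simp
      have "m \<in> carrier (part M' (g z))" using z part by simp
      then show "(ztensor_map X' M' (P' n) g (\<phi> n) \<circ> ztensor_map X M (P n) id (\<lambda>z. d z n i)) (ztensor_class X M (P (Suc n)) (z, m, c)) =
        (ztensor_map X' M' (P' n) id (\<lambda>z. d' z n i) \<circ> ztensor_map X' M' (P' (Suc n)) g (\<phi> (Suc n))) (ztensor_class X M (P (Suc n)) (z, m, c))"
        by (simp add: d[OF z] t2[OF z(1,2) dc] t2[OF z] d'[OF gx[OF z(1)] _ gmod_mapD(2)[OF \<phi> z(1,3)]] \<phi>_face[OF 2(1) z(1,3)])
    qed
    then show ?case by simp
  qed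
qed

end

context
  fixes N' :: "('y, int, 'n) gmod" and N :: "('x, int, 'n) gmod"
  assumes N': "left_gmod X' (graded_monoid_ring X') N'" and N: "left_gmod X (graded_monoid_ring X) N"
    and part: "\<And>x. x \<in> carrier X \<Longrightarrow> part N x = part N' (g x)"
    and act: "\<And>x y a n. x \<in> carrier X \<Longrightarrow> y \<in> carrier X \<Longrightarrow> act N y x a n = act N' (g y) (g x) a n"
begin

abbreviation pre_map :: "nat \<Rightarrow> ('y \<Rightarrow> 'd \<Rightarrow> 'n) \<Rightarrow> ('x \<Rightarrow> 'c \<Rightarrow> 'n)" where
  "pre_map n \<equiv> zHom_pre X (P n) g (\<phi> n)"

lemma pre_map_hom: "pre_map n \<in> hom (zHom X' (P' n) N') (zHom X (P n) N)"
  by (rule zHom_pre_hom[OF P.X g part act P.pre \<phi>])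

lemma pre_map_coboundary: "pre_map (Suc n) (P'.coboundary n \<theta>) = P.coboundary n (pre_map n \<theta>)"
  using gmod_mapD(2)[OF P.diff_map] gmod_mapD(2)[OF \<phi>] gx \<phi>_diff
  by (auto simp: zHom_pre_def P.coboundary_def P'.coboundary_def fun_eq_iff restrict_def)

lemma pre_map_coboundaries:
  "pre_map n ` coboundaries (\<lambda>n. zHom X' (P' n) N') P'.coboundary n \<subseteq> coboundaries (\<lambda>n. zHom X (P n) N) P.coboundary n"
proof (cases n)
  case 0
  then show ?thesis
    using hom_one[OF pre_map_hom[of 0] P'.group_cochains[OF N'] P.group_cochains[OF N]] by (simp add: coboundaries_def)
next
  case (Suc k)
  then show ?thesis
    using hom_in_carrier[OF pre_map_hom[of k]] by (auto simp: coboundaries_def pre_map_coboundary)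
qed

lemma pre_map_cocycles:
  "pre_map n ` kernel (zHom X' (P' n) N') (zHom X' (P' (Suc n)) N') (P'.coboundary n) \<subseteq>
    kernel (zHom X (P n) N) (zHom X (P (Suc n)) N) (P.coboundary n)"
  using hom_in_carrier[OF pre_map_hom[of n]] hom_one[OF pre_map_hom[of "Suc n"] P'.group_cochains[OF N'] P.group_cochains[OF N]]
  by (auto simp: kernel_def pre_map_coboundary[symmetric])

lemma pre_map_coset:
  assumes "\<theta> \<in> carrier (zHom X' (P' n) N')"
  shows "coset_map (zHom X (P n) N) (coboundaries (\<lambda>n. zHom X (P n) N) P.coboundary n) (pre_map n)
      (coboundaries (\<lambda>n. zHom X' (P' n) N') P'.coboundary n #>\<^bsub>zHom X' (P' n) N'\<^esub> \<theta>) =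
    coboundaries (\<lambda>n. zHom X (P n) N) P.coboundary n #>\<^bsub>zHom X (P n) N\<^esub> pre_map n \<theta>"
  by (rule coset_map_coset[OF P'.group_cochains[OF N'] P.group_cochains[OF N] P'.subgroup_coboundaries[OF N']
      P.subgroup_coboundaries[OF N] pre_map_hom pre_map_coboundaries assms])

end

end

lemma (in simplicial_gmod) carrier_cohomology:
  "carrier (cohomology (\<lambda>n. zHom X (P n) N) coboundary n) =
    (\<lambda>\<theta>. coboundaries (\<lambda>n. zHom X (P n) N) coboundary n #>\<^bsub>zHom X (P n) N\<^esub> \<theta>) `
      kernel (zHom X (P n) N) (zHom X (P (Suc n)) N) (coboundary n)"
  by (simp add: cohomology_def carrier_update_Mod)

locale gmod_retract =
  I: simplicial_gmod_map X P d X Q e id \<iota> + R: simplicial_gmod_map X Q e X P d id r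
  for X :: "'x monoid" and P :: "nat \<Rightarrow> ('x, int, 'c) gmod" and d and Q :: "nat \<Rightarrow> ('x, int, 'd) gmod" and e and \<iota> and r +
  fixes h :: "nat \<Rightarrow> nat \<Rightarrow> 'x \<Rightarrow> 'd \<Rightarrow> 'd"
  assumes retract: "x \<in> carrier X \<Longrightarrow> b \<in> carrier (part (P n) x) \<Longrightarrow> r n x (\<iota> n x b) = b"
    and h: "j \<le> n \<Longrightarrow> gmod_map X id (Q n) (Q (Suc n)) (h n j)"
    and h_first: "x \<in> carrier X \<Longrightarrow> c \<in> carrier (part (Q n) x) \<Longrightarrow> e x n 0 (h n 0 x c) = \<iota> n x (r n x c)"
    and h_last: "x \<in> carrier X \<Longrightarrow> c \<in> carrier (part (Q n) x) \<Longrightarrow> e x n (Suc n) (h n n x c) = c"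
    and h_less: "x \<in> carrier X \<Longrightarrow> i < j \<Longrightarrow> j \<le> n \<Longrightarrow> c \<in> carrier (part (Q n) x) \<Longrightarrow>
      e x n i (h n j x c) = h (n - 1) (j - 1) x (e x (n - 1) i c)"
    and h_middle: "x \<in> carrier X \<Longrightarrow> Suc j \<le> n \<Longrightarrow> c \<in> carrier (part (Q n) x) \<Longrightarrow>
      e x n (Suc j) (h n j x c) = e x n (Suc j) (h n (Suc j) x c)"
    and h_greater: "x \<in> carrier X \<Longrightarrow> Suc j < i \<Longrightarrow> i \<le> Suc n \<Longrightarrow> c \<in> carrier (part (Q n) x) \<Longrightarrow>
      e x n i (h n j x c) = h (n - 1) j x (e x (n - 1) (i - 1) c)"
begin

lemma simplicial_retract_parts:
  assumes x: "x \<in> carrier X"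
  shows "simplicial_retract (\<lambda>n. part (P n) x) (d x) (\<lambda>n. part (Q n) x) (e x) (\<lambda>n. \<iota> n x) (\<lambda>n. r n x) (\<lambda>n j. h n j x)"
proof (intro simplicial_retract.intro simplicial_retract_axioms.intro)
  show "simplicial_map (\<lambda>n. part (P n) x) (d x) (\<lambda>n. part (Q n) x) (e x) (\<lambda>n. \<iota> n x)"
    using I.parts[OF x] by simp
  show "simplicial_map (\<lambda>n. part (Q n) x) (e x) (\<lambda>n. part (P n) x) (d x) (\<lambda>n. r n x)"
    using R.parts[OF x] by simp
  show "h n j x \<in> hom (part (Q n) x) (part (Q (Suc n)) x)" if "j \<le> n" for j n
    using gmod_mapD(1)[OF h[OF that] x] by simp
  show "e x n i (h n j x c) = h (n - 1) (j - 1) x (e x (n - 1) i c)"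
    if "i < j" "j \<le> n" "c \<in> carrier (part (Q n) x)" for i j n c
    by (rule h_less[OF x that])
  show "e x n i (h n j x c) = h (n - 1) j x (e x (n - 1) (i - 1) c)"
    if "Suc j < i" "i \<le> Suc n" "c \<in> carrier (part (Q n) x)" for i j n c
    by (rule h_greater[OF x that])
qed (use x retract h_first h_last h_middle in auto)

text \<open>
  The identities of a retract are equations between compositions of module maps. The functor that tensors
  with \<open>M\<close> preserves them, and on the generators they are the given ones.
\<close>

lemma simplicial_retract_tensor:
  assumes M: "right_gmod X (graded_monoid_ring X) M"
  shows "simplicial_retract
    (\<lambda>n. gmod_tensor X (graded_monoid_ring X) M (P n)) (\<lambda>n i. ztensor_map X M (P n) id (\<lambda>z. d z n i))
    (\<lambda>n. gmod_tensor X (graded_monoid_ring X) M (Q n)) (\<lambda>n i. ztensor_map X M (Q n) id (\<lambda>z. e z n i))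
    (\<lambda>n. ztensor_map X M (Q n) id (\<iota> n)) (\<lambda>n. ztensor_map X M (P n) id (r n))
    (\<lambda>n j. ztensor_map X M (Q (Suc n)) id (h n j))"
    (is "simplicial_retract ?C ?d ?D ?e ?\<iota> ?r ?h")
proof -
  interpret I': simplicial_map ?C ?d ?D ?e ?\<iota>
    by (rule I.tensor[OF M M]) simp_all
  interpret R': simplicial_map ?D ?e ?C ?d ?r
    by (rule R.tensor[OF M M]) simp_all
  note X = I.P.X and preP = I.P.pre and preQ = I.P'.pre
  have hh: "?h n j \<in> hom (?D n) (?D (Suc n))" if "j \<le> n" for n j
    by (rule ztensor_map_id_hom[OF X M preQ preQ h[OF that]])
  note cl = ztensor_map_id_class[OF X M]
  note c\<iota> = cl[OF preP preQ I.\<phi>] and cr = cl[OF preQ preP R.\<phi>]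
    and ce = cl[OF preQ preQ I.P'.face] and ch = cl[OF preQ preQ h]
  note D\<iota> = gmod_mapD(2)[OF I.\<phi>, unfolded id_apply] and Dr = gmod_mapD(2)[OF R.\<phi>, unfolded id_apply]
    and De = gmod_mapD(2)[OF I.P'.face, unfolded id_apply] and Dh = gmod_mapD(2)[OF h, unfolded id_apply]
  have eqQ: "k t = k' t"
    if "k \<in> hom (?D n) (?D m)" "k' \<in> hom (?D n) (?D m)" "t \<in> carrier (?D n)"
      "\<And>z m c. z \<in> carrier X \<Longrightarrow> m \<in> carrier (part M z) \<Longrightarrow> c \<in> carrier (part (Q n) z) \<Longrightarrow>
        k (ztensor_class X M (Q n) (z, m, c)) = k' (ztensor_class X M (Q n) (z, m, c))" for k k' n m t
    by (rule ztensor_hom_eqI[OF X M preQ I'.D.is_group that(1,2) that(4) that(3)])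
  note comp = Group.hom_compose
  have face_hom: "?e n i \<in> hom (?D (Suc n)) (?D n)" if "i \<le> Suc n" for n i
    by (rule I'.D.face_hom[OF that])
  have id_D: "(\<lambda>t. t) \<in> hom (?D n) (?D n)" for n by (simp add: hom_def)
  show ?thesis
  proof (intro simplicial_retract.intro simplicial_retract_axioms.intro I'.simplicial_map_axioms R'.simplicial_map_axioms, goal_cases)
    case (1 b n)
    have "(?r n \<circ> ?\<iota> n) b = (\<lambda>t. t) b"
      by (rule ztensor_hom_eqI[OF X M preP I'.C.is_group comp[OF I'.\<phi>_hom R'.\<phi>_hom] _ _ 1])
        (simp_all add: hom_def c\<iota> cr D\<iota> retract)
    then show ?case by simp
  next
    case (2 j n)
    then show ?case by (rule hh)
  next
    case (3 c n)
    have "(?e n 0 \<circ> ?h n 0) c = (?\<iota> n \<circ> ?r n) c"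
      by (rule eqQ[OF comp[OF hh face_hom] comp[OF R'.\<phi>_hom I'.\<phi>_hom] 3])
        (simp_all add: c\<iota> cr ce ch Dr Dh h_first)
    then show ?case by simp
  next
    case (4 c n)
    have "(?e n (Suc n) \<circ> ?h n n) c = (\<lambda>t. t) c"
      by (rule eqQ[OF comp[OF hh face_hom] id_D 4]) (simp_all add: ce ch Dh h_last)
    then show ?case by simp
  next
    case (5 i j n c)
    then obtain k where k: "n = Suc k" "i \<le> Suc k" "j - 1 \<le> k" by (cases n) auto
    have eh: "?e n i \<circ> ?h n j \<in> hom (?D n) (?D n)"
      by (rule comp[OF hh face_hom]) (use 5 in auto)
    have he: "?h k (j - 1) \<circ> ?e k i \<in> hom (?D n) (?D n)"
      using comp[OF face_hom[OF k(2)] hh[OF k(3)]] k(1) by simp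
    have "(?e n i \<circ> ?h n j) c = (?h k (j - 1) \<circ> ?e k i) c"
      by (rule eqQ[OF eh he 5(3)]) (use 5 k h_less[where n = n] in \<open>simp_all add: ce ch Dh De\<close>)
    then show ?case by (simp add: k(1))
  next
    case (6 j n c)
    have eh: "?e n (Suc j) \<circ> ?h n j \<in> hom (?D n) (?D n)" "?e n (Suc j) \<circ> ?h n (Suc j) \<in> hom (?D n) (?D n)"
      by (rule comp[OF hh face_hom]; use 6 in simp)+
    have "(?e n (Suc j) \<circ> ?h n j) c = (?e n (Suc j) \<circ> ?h n (Suc j)) c"
      by (rule eqQ[OF eh 6(2)]) (use 6 h_middle[where n = n] in \<open>simp_all add: ce ch Dh\<close>)
    then show ?case by simp
  next
    case (7 j i n c)
    then obtain k where k: "n = Suc k" "i - 1 \<le> Suc k" "j \<le> k" by (cases n) auto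
    have eh: "?e n i \<circ> ?h n j \<in> hom (?D n) (?D n)"
      by (rule comp[OF hh face_hom]) (use 7 k in auto)
    have he: "?h k j \<circ> ?e k (i - 1) \<in> hom (?D n) (?D n)"
      using comp[OF face_hom[OF k(2)] hh[OF k(3)]] k(1) by simp
    have "(?e n i \<circ> ?h n j) c = (?h k j \<circ> ?e k (i - 1)) c"
      by (rule eqQ[OF eh he 7(3)]) (use 7 k h_greater[where n = n] in \<open>simp_all add: ce ch Dh De\<close>)
    then show ?case by (simp add: k(1))
  qed
qed

text \<open>
  On the part of each degree this is the chain homotopy of the retract;
  as a map of modules it can be composed with cochains.
\<close>

definition mod_htpy :: "nat \<Rightarrow> 'x \<Rightarrow> 'd \<Rightarrow> 'd" where
  "mod_htpy n x c = (\<Otimes>\<^bsub>part (Q (Suc n)) x\<^esub>j\<in>{..n}. h n j x c [^]\<^bsub>part (Q (Suc n)) x\<^esub> ((-1) ^ j :: int))"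

lemma mod_htpy_eq: "x \<in> carrier X \<Longrightarrow> mod_htpy n x = simplicial_retract.chain_htpy (\<lambda>n. part (Q n) x) (\<lambda>n j. h n j x) n"
  using simplicial_retract.chain_htpy_def[OF simplicial_retract_parts] by (simp add: mod_htpy_def fun_eq_iff)

lemma mod_htpy_map: "gmod_map X id (Q n) (Q (Suc n)) (mod_htpy n)"
  unfolding gmod_map_def
proof (intro conjI ballI allI)
  interpret X: comm_monoid X by (rule I.P.X)
  show "mod_htpy n x \<in> hom (part (Q n) x) (part (Q (Suc n)) (id x))" if "x \<in> carrier X" for x
    using simplicial_retract.chain_htpy_hom[OF simplicial_retract_parts[OF that], of n] mod_htpy_eq[OF that] by simp
  fix x y a c assume xy: "x \<in> carrier X" "y \<in> carrier X" and c: "c \<in> carrier (part (Q n) x)"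
  have xy': "x \<otimes>\<^bsub>X\<^esub> y \<in> carrier X" using xy by simp
  note pre = I.P'.pre
  interpret G: comm_group "part (Q (Suc n)) (x \<otimes>\<^bsub>X\<^esub> y)" by (rule pre_gmodD(1)[OF pre xy'])
  have "act (Q (Suc n)) y x a (mod_htpy n x c) =
      (\<Otimes>\<^bsub>part (Q (Suc n)) (x \<otimes>\<^bsub>X\<^esub> y)\<^esub>j\<in>{..n}. act (Q (Suc n)) y x a (h n j x c) [^]\<^bsub>part (Q (Suc n)) (x \<otimes>\<^bsub>X\<^esub> y)\<^esub> ((-1) ^ j :: int))"
    unfolding mod_htpy_def
    by (rule hom_signed_finprod[OF pre_gmodD(1)[OF pre xy(1)] G.comm_group_axioms pre_gmodD(3)[OF pre xy]])
      (use gmod_mapD(2)[OF h] xy c in auto)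
  also have "\<dots> = mod_htpy n (x \<otimes>\<^bsub>X\<^esub> y) (act (Q n) y x a c)"
    unfolding mod_htpy_def
  proof (rule G.finprod_cong')
    fix j assume "j \<in> {..n}"
    then show "act (Q (Suc n)) y x a (h n j x c) [^]\<^bsub>part (Q (Suc n)) (x \<otimes>\<^bsub>X\<^esub> y)\<^esub> ((-1) ^ j :: int) =
        h n j (x \<otimes>\<^bsub>X\<^esub> y) (act (Q n) y x a c) [^]\<^bsub>part (Q (Suc n)) (x \<otimes>\<^bsub>X\<^esub> y)\<^esub> ((-1) ^ j :: int)"
      using gmod_mapD(3)[OF h xy c] by simp
  qed (use gmod_mapD(2)[OF h xy'] pre_gmodD(2)[OF pre xy c] in auto)
  finally show "mod_htpy n (x \<otimes>\<^bsub>X\<^esub> y) (act (Q n) y x a c) = act (Q (Suc n)) (id y) (id x) a (mod_htpy n x c)"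
    by simp
qed

lemma mod_htpy_chain:
  assumes x: "x \<in> carrier X" and c: "c \<in> carrier (part (Q n) x)"
  shows "I.P'.diff x n (mod_htpy n x c) \<otimes>\<^bsub>part (Q n) x\<^esub>
      (if n = 0 then \<one>\<^bsub>part (Q n) x\<^esub> else mod_htpy (n - 1) x (I.P'.diff x (n - 1) c)) =
    \<iota> n x (r n x c) \<otimes>\<^bsub>part (Q n) x\<^esub> inv\<^bsub>part (Q n) x\<^esub> c"
  using simplicial_retract.chain_htpy[OF simplicial_retract_parts[OF x] c]
  unfolding mod_htpy_eq[OF x] I.P'.diff_def .

text \<open>
  A cochain \<open>w\<close> on \<open>P\<close> is the restriction along \<open>\<iota>\<close> of its composite with \<open>r\<close>, which gives surjectivity.
  For a cocycle \<open>z\<close> on \<open>Q\<close>, composing the homotopy identity with \<open>z\<close> shows that \<open>z\<close> differs from its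
  composite with \<open>\<iota> \<circ> r\<close> by the coboundary of \<open>z \<circ> mod_htpy\<close>, which gives injectivity.
\<close>

theorem cohomology_iso:
  assumes N: "left_gmod X (graded_monoid_ring X) N"
  shows "coset_map (zHom X (P n) N) (coboundaries (\<lambda>n. zHom X (P n) N) I.P.coboundary n) (zHom_pre X (P n) id (\<iota> n))
    \<in> iso (cohomology (\<lambda>n. zHom X (Q n) N) I.P'.coboundary n) (cohomology (\<lambda>n. zHom X (P n) N) I.P.coboundary n)"
  unfolding cohomology_def
proof (rule coset_map_iso[OF I.P'.comm_group_cochains[OF N] I.P.comm_group_cochains[OF N]
      I.P'.subgroup_cocycles[OF N] I.P.subgroup_cocycles[OF N]
      I.P'.subgroup_coboundaries[OF N] I.P.subgroup_coboundaries[OF N]])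
  let ?KP = "\<lambda>n. zHom X (P n) N" and ?KQ = "\<lambda>n. zHom X (Q n) N"
  have 1: "\<And>x. x \<in> carrier X \<Longrightarrow> part N x = part N (id x)" "\<And>x y a n. act N y x a n = act N (id y) (id x) a n"
    by simp_all
  note preI = I.pre_map_hom[OF N N 1] I.pre_map_coboundaries[OF N N 1] I.pre_map_cocycles[OF N N 1] I.pre_map_coboundary[OF N N 1]
  note preR = R.pre_map_hom[OF N N 1] R.pre_map_coboundaries[OF N N 1] R.pre_map_cocycles[OF N N 1] R.pre_map_coboundary[OF N N 1]
  show "zHom_pre X (P n) id (\<iota> n) \<in> hom (?KQ n) (?KP n)" by (rule preI(1))
  show "zHom_pre X (P n) id (\<iota> n) ` coboundaries ?KQ I.P'.coboundary n \<subseteq> coboundaries ?KP I.P.coboundary n"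
    by (rule preI(2))
  show "zHom_pre X (P n) id (\<iota> n) ` kernel (?KQ n) (?KQ (Suc n)) (I.P'.coboundary n) \<subseteq>
      kernel (?KP n) (?KP (Suc n)) (I.P.coboundary n)"
    by (rule preI(3))
  show "\<exists>z\<in>kernel (?KQ n) (?KQ (Suc n)) (I.P'.coboundary n).
      zHom_pre X (P n) id (\<iota> n) z \<otimes>\<^bsub>?KP n\<^esub> inv\<^bsub>?KP n\<^esub> w \<in> coboundaries ?KP I.P.coboundary n"
    if w: "w \<in> kernel (?KP n) (?KP (Suc n)) (I.P.coboundary n)" for w
  proof (rule bexI)
    have wc: "w \<in> carrier (?KP n)" using w by (simp add: kernel_def)
    show rw: "zHom_pre X (Q n) id (r n) w \<in> kernel (?KQ n) (?KQ (Suc n)) (I.P'.coboundary n)"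
      using preR(3) w by blast
    have "zHom_pre X (P n) id (\<iota> n) (zHom_pre X (Q n) id (r n) w) = w"
    proof (rule zHom_eqI[OF _ wc])
      show "zHom_pre X (P n) id (\<iota> n) (zHom_pre X (Q n) id (r n) w) \<in> carrier (?KP n)"
        using hom_in_carrier[OF preI(1) hom_in_carrier[OF preR(1) wc]] .
      show "zHom_pre X (P n) id (\<iota> n) (zHom_pre X (Q n) id (r n) w) x c = w x c"
        if "x \<in> carrier X" "c \<in> carrier (part (P n) x)" for x c
        using that gmod_mapD(2)[OF I.\<phi> that] by (simp add: zHom_pre_def retract)
    qed
    then show "zHom_pre X (P n) id (\<iota> n) (zHom_pre X (Q n) id (r n) w) \<otimes>\<^bsub>?KP n\<^esub> inv\<^bsub>?KP n\<^esub> w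
        \<in> coboundaries ?KP I.P.coboundary n"
      using group.r_inv[OF I.P.group_cochains[OF N] wc] subgroup.one_closed[OF I.P.subgroup_coboundaries[OF N]] by simp
  qed
  show "z \<in> coboundaries ?KQ I.P'.coboundary n"
    if z: "z \<in> kernel (?KQ n) (?KQ (Suc n)) (I.P'.coboundary n)"
      and b: "zHom_pre X (P n) id (\<iota> n) z \<in> coboundaries ?KP I.P.coboundary n" for z
  proof -
    interpret K: comm_group "?KQ n" by (rule I.P'.comm_group_cochains[OF N])
    note sub = I.P'.subgroup_coboundaries[OF N, of n]
    have zc: "z \<in> carrier (?KQ n)" and z0: "I.P'.coboundary n z = \<one>\<^bsub>?KQ (Suc n)\<^esub>"
      using z by (simp_all add: kernel_def)
    let ?rz = "zHom_pre X (Q n) id (r n) (zHom_pre X (P n) id (\<iota> n) z)"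
    have rz: "?rz \<in> coboundaries ?KQ I.P'.coboundary n" using preR(2) b by blast
    define u where "u = (if n = 0 then \<one>\<^bsub>?KQ n\<^esub> else I.P'.coboundary (n - 1) (zHom_pre X (Q (n - 1)) id (mod_htpy (n - 1)) z))"
    have Hz: "zHom_pre X (Q k) id (mod_htpy k) z \<in> carrier (?KQ k)" if "n = Suc k" for k
      using zHom_pre_closed[OF I.P.X I.P.id_hom 1 I.P'.pre mod_htpy_map, of z k] zc that by simp
    have u: "u \<in> coboundaries ?KQ I.P'.coboundary n"
      using Hz by (cases n) (simp_all add: u_def coboundaries_def)
    note uc = subgroup.mem_carrier[OF sub u] and rzc = subgroup.mem_carrier[OF sub rz]
    have "u \<otimes>\<^bsub>?KQ n\<^esub> z = ?rz"
    proof (rule zHom_eqI[OF K.m_closed[OF uc zc] rzc])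
      fix x c assume x: "x \<in> carrier X" and c: "c \<in> carrier (part (Q n) x)"
      interpret Q: comm_group "part (Q n) x" by (rule pre_gmodD(1)[OF I.P'.pre x])
      interpret Nx: comm_group "part N x" by (rule left_gmodD(1)[OF N x])
      interpret z: group_hom "part (Q n) x" "part N x" "z x"
        by (intro group_hom.intro group_hom_axioms.intro zHomD(1)[OF zc x] Q.is_group Nx.is_group)
      let ?h = "if n = 0 then \<one>\<^bsub>part (Q n) x\<^esub> else mod_htpy (n - 1) x (I.P'.diff x (n - 1) c)"
      have Hc: "mod_htpy n x c \<in> carrier (part (Q (Suc n)) x)" using gmod_mapD(2)[OF mod_htpy_map x c] by simp
      have dH: "I.P'.diff x n (mod_htpy n x c) \<in> carrier (part (Q n) x)"
        using hom_in_carrier[OF I.P'.diff_hom[OF x] Hc] .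
      have hc: "?h \<in> carrier (part (Q n) x)"
        using gmod_mapD(2)[OF mod_htpy_map x hom_in_carrier[OF I.P'.diff_hom[OF x]], of c "n - 1"] c Q.one_closed
        by (cases n) simp_all
      have "\<iota> n x (r n x c) \<in> carrier (part (Q n) x)"
        using gmod_mapD(2)[OF I.\<phi> x gmod_mapD(2)[OF R.\<phi> x c, unfolded id_apply]] by simp
      note cl = this hc dH c
      have "z x (I.P'.diff x n (mod_htpy n x c)) = I.P'.coboundary n z x (mod_htpy n x c)"
        using x Hc by (simp add: I.P'.coboundary_def)
      also have "\<dots> = \<one>\<^bsub>part N x\<^esub>"
        unfolding z0 using x Hc by (simp add: gmod_Hom_def)
      finally have "z x (I.P'.diff x n (mod_htpy n x c) \<otimes>\<^bsub>part (Q n) x\<^esub> ?h) = z x ?h"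
        using cl by simp
      then have "z x ?h = z x (\<iota> n x (r n x c)) \<otimes>\<^bsub>part N x\<^esub> inv\<^bsub>part N x\<^esub> z x c"
        unfolding mod_htpy_chain[OF x c] using cl by simp
      then have "z x ?h \<otimes>\<^bsub>part N x\<^esub> z x c = z x (\<iota> n x (r n x c))"
        using cl by (simp add: Nx.m_assoc)
      moreover have "u x c = z x ?h"
      proof (cases n)
        case 0
        then show ?thesis using x c z.hom_one by (simp add: u_def gmod_Hom_def)
      next
        case (Suc k)
        then have "I.P'.diff x k c \<in> carrier (part (Q k) x)"
          using hom_in_carrier[OF I.P'.diff_hom[OF x]] c by blast
        then show ?thesis using x c Suc by (simp add: u_def I.P'.coboundary_def zHom_pre_def)
      qed
      moreover have "?rz x c = z x (\<iota> n x (r n x c))"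
        using x c gmod_mapD(2)[OF R.\<phi> x c] by (simp add: zHom_pre_def)
      ultimately show "(u \<otimes>\<^bsub>?KQ n\<^esub> z) x c = ?rz x c"
        using x c by (simp add: gmod_Hom_def)
    qed
    then have "z = inv\<^bsub>?KQ n\<^esub> u \<otimes>\<^bsub>?KQ n\<^esub> ?rz"
      using K.inv_solve_left[OF zc uc rzc] by simp
    then show ?thesis using subgroup.m_closed[OF sub subgroup.m_inv_closed[OF sub u] rz] by simp
  qed
qed

end

section \<open>The two resolutions as simplicial modules\<close>

text \<open>
  From here on elements of the resolutions are handled through their carriers and augmentations, and
  unfolding the recursions would only get in the way.
\<close>

declare cm_iter.simps [simp del] ca_iter.simps [simp del] cm_aug.simps [simp del] ca_aug.simps [simp del]
  gaug.simps [simp del]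

abbreviation (input) zring :: "'x monoid \<Rightarrow> ('x, int) gring" where
  "zring \<equiv> graded_monoid_ring"

abbreviation cm_gens where
  "cm_gens X n x \<equiv> cm_Ab_gens X (cm_iter X (Suc n)) (cm_aug X (Suc n)) x"
abbreviation cm_rels where
  "cm_rels X n x \<equiv> cm_Ab_rels X (cm_iter X (Suc n)) (cm_aug X (Suc n)) x"
abbreviation cm_class where
  "cm_class X n x \<equiv> presented_class (cm_gens X n x) (cm_rels X n x)"
abbreviation ca_gens where
  "ca_gens X n x \<equiv> ca_Ab_gens X (zring X) (ca_iter X (zring X) (Suc n)) x"
abbreviation ca_rels where
  "ca_rels X n x \<equiv> ca_Ab_rels X (zring X) (ca_iter X (zring X) (Suc n)) (ca_aug X (zring X) (Suc n)) x"
abbreviation ca_class where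
  "ca_class X n x \<equiv> presented_class (ca_gens X n x) (ca_rels X n x)"

text \<open>
  The monoid resolution in the language of modules, so that one notion of simplicial module covers
  both resolutions.
\<close>

definition cm_gmod :: "'x monoid \<Rightarrow> nat \<Rightarrow> ('x, int, 'x cm_el) gmod" where
  "cm_gmod X n = left_beck_gmod X (cm_res X n)"

lemma part_cm_gmod: "part (cm_gmod X n) x = presented (cm_gens X n x) (cm_rels X n x)"
  by (simp add: cm_gmod_def left_beck_gmod_def cm_res_def cm_Ab_def)

lemma part_ca_res: "part (ca_res X (zring X) n) x = presented (ca_gens X n x) (ca_rels X n x)"
  by (simp add: ca_res_def ca_Ab_def)

lemma act_cm_gmod:
  "act (cm_gmod X n) y x k c =
    tr (cm_Ab X (cm_iter X (Suc n)) (cm_aug X (Suc n))) y x c [^]\<^bsub>part (cm_gmod X n) (x \<otimes>\<^bsub>X\<^esub> y)\<^esub> k"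
  by (simp add: cm_gmod_def left_beck_gmod_def cm_res_def)

context grading_monoid
begin

lemma cm_iter_closed:
  "a \<in> carrier (cm_iter G k) \<Longrightarrow> b \<in> carrier (cm_iter G k) \<Longrightarrow> a \<otimes>\<^bsub>cm_iter G k\<^esub> b \<in> carrier (cm_iter G k)"
  using comm_monoid_cm_iter[OF comm_monoid_axioms, of k] by (simp add: comm_monoid_def monoid.m_closed)

lemma cm_iter_monoid: "monoid (cm_iter G k)"
  using comm_monoid_cm_iter[OF comm_monoid_axioms, of k] by (simp add: comm_monoid_def)

lemma cm_aug_hom: "cm_aug G k \<in> hom (cm_iter G k) G"
  by (rule homI)
    (simp_all add: cm_aug_eq cm_iter_closed nested_degree_closed hom_mult[OF nested_degree_hom(1)])

lemma cm_gens_iff: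
  "(u, y) \<in> cm_gens G n x \<longleftrightarrow> u \<in> carrier G \<and> y \<in> carrier (cm_iter G (Suc n)) \<and> u \<otimes> nested_degree G y = x"
  by (auto simp: cm_Ab_gens_def cm_aug_eq)

lemma cm_rels_closed: "cm_rels G n x \<subseteq> carrier (free_Abelian_group (cm_gens G n x))"
  by (rule cm_Ab_rels_closed[OF comm_monoid_axioms cm_iter_monoid cm_aug_hom])

lemma cm_rels_cases:
  assumes "r \<in> cm_rels G n x"
  obtains u y y' where
    "r = frag_of (u, y \<otimes>\<^bsub>cm_iter G (Suc n)\<^esub> y') - frag_of (u \<otimes> nested_degree G y, y') - frag_of (u \<otimes> nested_degree G y', y)"
    "u \<in> carrier G" "y \<in> carrier (cm_iter G (Suc n))" "y' \<in> carrier (cm_iter G (Suc n))"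
    "u \<otimes> (nested_degree G y \<otimes> nested_degree G y') = x"
proof -
  obtain u y y' where *: "u \<in> carrier G" "y \<in> carrier (cm_iter G (Suc n))" "y' \<in> carrier (cm_iter G (Suc n))"
    "r = frag_of (u, y \<otimes>\<^bsub>cm_iter G (Suc n)\<^esub> y') - frag_of (u \<otimes> cm_aug G (Suc n) y, y') - frag_of (u \<otimes> cm_aug G (Suc n) y', y)"
    "u \<otimes> (cm_aug G (Suc n) y \<otimes> cm_aug G (Suc n) y') = x"
    using assms unfolding cm_Ab_rels_def by blast
  then show thesis
    using cm_aug_eq[OF *(2)] cm_aug_eq[OF *(3)] by (intro that[of u y y']) (simp_all)
qed

lemma cm_rels_intro:
  assumes "u \<in> carrier G" "y \<in> carrier (cm_iter G (Suc n))" "y' \<in> carrier (cm_iter G (Suc n))"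
    "u \<otimes> (nested_degree G y \<otimes> nested_degree G y') = x"
  shows "frag_of (u, y \<otimes>\<^bsub>cm_iter G (Suc n)\<^esub> y') - frag_of (u \<otimes> nested_degree G y, y') - frag_of (u \<otimes> nested_degree G y', y)
    \<in> cm_rels G n x"
  using assms cm_aug_eq[OF assms(2)] cm_aug_eq[OF assms(3)] unfolding cm_Ab_rels_def
  by (simp) metis

lemma comm_group_cm: "comm_group (part (cm_gmod G n) x)"
  unfolding part_cm_gmod by (rule comm_group_presented[OF cm_rels_closed])

lemma group_cm: "group (part (cm_gmod G n) x)"
  using comm_group_cm by (simp add: comm_group_def)

lemma cm_tr_hom:
  "y \<in> carrier G \<Longrightarrow> tr (cm_Ab G (cm_iter G (Suc n)) (cm_aug G (Suc n))) y x \<in> hom (part (cm_gmod G n) x) (part (cm_gmod G n) (x \<otimes> y))"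
  using cm_Ab_tr(1)[OF comm_monoid_axioms cm_iter_monoid cm_aug_hom, of y "Suc n" x]
  unfolding part_cm_gmod by (simp add: cm_Ab_def)

lemma pre_gmod_cm: "pre_gmod G (cm_gmod G n)"
  unfolding pre_gmod_def
proof (intro conjI ballI allI)
  fix x y k assume "x \<in> carrier G" "y \<in> carrier G"
  then have "(\<lambda>c. tr (cm_Ab G (cm_iter G (Suc n)) (cm_aug G (Suc n))) y x c [^]\<^bsub>part (cm_gmod G n) (x \<otimes> y)\<^esub> (k::int)) \<in>
      hom (part (cm_gmod G n) x) (part (cm_gmod G n) (x \<otimes> y))"
    by (intro int_pow_hom(1) cm_tr_hom comm_group_cm)
  then show "act (cm_gmod G n) y x k \<in> hom (part (cm_gmod G n) x) (part (cm_gmod G n) (x \<otimes> y))"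
    by (simp add: act_cm_gmod[abs_def])
qed (rule comm_group_cm)

lemma cm_class_closed: "s \<in> cm_gens G n x \<Longrightarrow> cm_class G n x s \<in> carrier (part (cm_gmod G n) x)"
  unfolding part_cm_gmod by (rule presented_class_closed)

lemma act_cm_class:
  assumes "(u, b) \<in> cm_gens G n x" "y \<in> carrier G"
  shows "act (cm_gmod G n) y x k (cm_class G n x (u, b)) = cm_class G n (x \<otimes> y) (y \<otimes> u, b) [^]\<^bsub>part (cm_gmod G n) (x \<otimes> y)\<^esub> k"
  using cm_Ab_tr(2)[OF comm_monoid_axioms cm_iter_monoid cm_aug_hom assms(2,1)]
  by (simp add: act_cm_gmod)

lemma cm_gens_act: "(u, b) \<in> cm_gens G n x \<Longrightarrow> y \<in> carrier G \<Longrightarrow> (y \<otimes> u, b) \<in> cm_gens G n (x \<otimes> y)"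
  using nested_degree_closed[of b "Suc n"] by (auto simp: cm_gens_iff m_ac)

lemma cm_hom_eqI:
  assumes "group H" "k \<in> hom (part (cm_gmod G n) x) H" "k' \<in> hom (part (cm_gmod G n) x) H"
    and "\<And>u y. (u, y) \<in> cm_gens G n x \<Longrightarrow> k (cm_class G n x (u, y)) = k' (cm_class G n x (u, y))"
    and "c \<in> carrier (part (cm_gmod G n) x)"
  shows "k c = k' c"
  using presented_hom_eqI[OF cm_rels_closed assms(1), of k n x k' c] assms(2-) unfolding part_cm_gmod by force

lemma ca_aug_hom: "ca_aug G (zring G) (Suc k) \<in> gring_hom G (ca_iter G (zring G) (Suc k)) (zring G)"
proof -
  note A = comm_gring_gel[of "Suc k"]
  show ?thesis
    unfolding gring_hom_def
  proof (intro CollectI conjI ballI homI)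
    fix x a b assume x: "x \<in> carrier G" and ab: "a \<in> gel G (Suc k) x" "b \<in> gel G (Suc k) x"
    show "ca_aug G (zring G) (Suc k) x (a \<otimes>\<^bsub>part (ca_iter G (zring G) (Suc k)) x\<^esub> b) =
        ca_aug G (zring G) (Suc k) x a \<otimes>\<^bsub>part (zring G) x\<^esub> ca_aug G (zring G) (Suc k) x b"
      using ca_aug_eq[OF x ab(1)] ca_aug_eq[OF x ab(2)] ca_aug_eq[OF x comm_gring_add_closed[OF A x ab]]
      by (simp add: free_gring_simps ca_iter.simps(2) poly_subst_add graded_monoid_ring_def gaug.simps(2))
  next
    show "ca_aug G (zring G) (Suc k) \<one> (gone (ca_iter G (zring G) (Suc k))) = gone (zring G)"
      using ca_aug_eq[OF one_closed comm_gringD(2)[OF A]]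
      by (simp add: free_gring_simps ca_iter.simps(2) graded_monoid_ring_def gaug.simps(2))
  next
    fix x y a b assume x: "x \<in> carrier G" "y \<in> carrier G" and ab: "a \<in> gel G (Suc k) x" "b \<in> gel G (Suc k) y"
    show "ca_aug G (zring G) (Suc k) (x \<otimes> y) (gmul (ca_iter G (zring G) (Suc k)) x y a b) =
        gmul (zring G) x y (ca_aug G (zring G) (Suc k) x a) (ca_aug G (zring G) (Suc k) y b)"
      using ca_aug_eq[OF x(1) ab(1)] ca_aug_eq[OF x(2) ab(2)]
        ca_aug_eq[OF m_closed[OF x] comm_gring_mult_closed[OF A x ab]]
      by (simp add: free_gring_simps ca_iter.simps(2) poly_subst_mult graded_monoid_ring_def gaug.simps(2))
  qed simp
qed

lemmas ca_hyps = comm_monoid_axioms comm_gring_graded comm_gring_gel ca_aug_hom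

lemma ca_gens_iff:
  "(u, a, v, b) \<in> ca_gens G n x \<longleftrightarrow> u \<in> carrier G \<and> v \<in> carrier G \<and> u \<otimes> v = x \<and> b \<in> gel G (Suc n) v"
  by (simp add: ca_Ab_gens_def)

lemma ca_rels_closed: "ca_rels G n x \<subseteq> carrier (free_Abelian_group (ca_gens G n x))"
  by (rule ca_Ab_rels_closed[OF ca_hyps])

lemma ca_rels_cases:
  assumes "r \<in> ca_rels G n x"
  obtains
    (left) u v a a' b where
      "r = frag_of (u, a + a', v, b) - frag_of (u, a, v, b) - frag_of (u, a', v, b)"
      "u \<in> carrier G" "v \<in> carrier G" "u \<otimes> v = x" "b \<in> gel G (Suc n) v"
  | (right) u v a b b' where
      "r = frag_of (u, a, v, GPoly (unGPoly b + unGPoly b')) - frag_of (u, a, v, b) - frag_of (u, a, v, b')"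
      "u \<in> carrier G" "v \<in> carrier G" "u \<otimes> v = x" "b \<in> gel G (Suc n) v" "b' \<in> gel G (Suc n) v"
  | (Leibniz) u v w a b b' where
      "r = frag_of (u, a, v \<otimes> w, GPoly (unGPoly b * unGPoly b'))
        - frag_of (u \<otimes> v, a * gaug (Suc n) b, w, b') - frag_of (u \<otimes> w, a * gaug (Suc n) b', v, b)"
      "u \<in> carrier G" "v \<in> carrier G" "w \<in> carrier G" "u \<otimes> (v \<otimes> w) = x" "b \<in> gel G (Suc n) v" "b' \<in> gel G (Suc n) w"
  using assms
proof (cases rule: ca_Ab_rels_cases)
  case (left u v a a' b)
  then show thesis by (intro that(1)[of u a a' v b]) (simp_all add: graded_monoid_ring_def)
next
  case (right u v a b b')
  then show thesis by (intro that(2)[of u a v b b']) (simp_all add: free_gring_simps ca_iter.simps(2))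
next
  case (Leibniz u v w a b b')
  have "ca_aug G (zring G) (Suc n) v b = gaug (Suc n) b" "ca_aug G (zring G) (Suc n) w b' = gaug (Suc n) b'"
    using ca_aug_eq Leibniz by blast+
  with Leibniz show thesis
    by (intro that(3)[of u a v w b b'])
      (simp_all add: free_gring_simps ca_iter.simps(2) graded_monoid_ring_def)
qed

lemma ca_rels_intros:
  "u \<in> carrier G \<Longrightarrow> v \<in> carrier G \<Longrightarrow> u \<otimes> v = x \<Longrightarrow> b \<in> gel G (Suc n) v \<Longrightarrow>
    frag_of (u, a + a', v, b) - frag_of (u, a, v, b) - frag_of (u, a', v, b) \<in> ca_rels G n x"
  "u \<in> carrier G \<Longrightarrow> v \<in> carrier G \<Longrightarrow> u \<otimes> v = x \<Longrightarrow> b \<in> gel G (Suc n) v \<Longrightarrow> b' \<in> gel G (Suc n) v \<Longrightarrow>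
    frag_of (u, a, v, GPoly (unGPoly b + unGPoly b')) - frag_of (u, a, v, b) - frag_of (u, a, v, b') \<in> ca_rels G n x"
  "u \<in> carrier G \<Longrightarrow> v \<in> carrier G \<Longrightarrow> w \<in> carrier G \<Longrightarrow> u \<otimes> (v \<otimes> w) = x \<Longrightarrow>
    b \<in> gel G (Suc n) v \<Longrightarrow> b' \<in> gel G (Suc n) w \<Longrightarrow>
    frag_of (u, a, v \<otimes> w, GPoly (unGPoly b * unGPoly b'))
      - frag_of (u \<otimes> v, a * gaug (Suc n) b, w, b') - frag_of (u \<otimes> w, a * gaug (Suc n) b', v, b) \<in> ca_rels G n x"
proof -
  note I = ca_Ab_rels_intros[where X = G and A = "zring G" and B = "ca_iter G (zring G) (Suc n)" and \<beta> = "ca_aug G (zring G) (Suc n)"]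
  show "frag_of (u, a + a', v, b) - frag_of (u, a, v, b) - frag_of (u, a', v, b) \<in> ca_rels G n x"
    if "u \<in> carrier G" "v \<in> carrier G" "u \<otimes> v = x" "b \<in> gel G (Suc n) v"
    using I(1)[of u v x a a' b] that by (simp add: graded_monoid_ring_def)
  show "frag_of (u, a, v, GPoly (unGPoly b + unGPoly b')) - frag_of (u, a, v, b) - frag_of (u, a, v, b') \<in> ca_rels G n x"
    if "u \<in> carrier G" "v \<in> carrier G" "u \<otimes> v = x" "b \<in> gel G (Suc n) v" "b' \<in> gel G (Suc n) v"
    using I(2)[of u v x a b b'] that by (simp add: free_gring_simps ca_iter.simps(2))
  show "frag_of (u, a, v \<otimes> w, GPoly (unGPoly b * unGPoly b'))
      - frag_of (u \<otimes> v, a * gaug (Suc n) b, w, b') - frag_of (u \<otimes> w, a * gaug (Suc n) b', v, b) \<in> ca_rels G n x"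
    if *: "u \<in> carrier G" "v \<in> carrier G" "w \<in> carrier G" "u \<otimes> (v \<otimes> w) = x"
      "b \<in> gel G (Suc n) v" "b' \<in> gel G (Suc n) w"
  proof -
    have "gmul (zring G) u v a (ca_aug G (zring G) (Suc n) v b) = a * gaug (Suc n) b"
      "gmul (zring G) u w a (ca_aug G (zring G) (Suc n) w b') = a * gaug (Suc n) b'"
      using ca_aug_eq[OF *(2,5)] ca_aug_eq[OF *(3,6)] by (simp_all add: graded_monoid_ring_def)
    moreover have "gmul (ca_iter G (zring G) (Suc n)) v w b b' = GPoly (unGPoly b * unGPoly b')"
      by (simp add: free_gring_simps ca_iter.simps(2))
    ultimately show ?thesis
      using I(3)[of u v w x a b b'] * by (simp only: carrier_graded_monoid_ring UNIV_I)
  qed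
qed

lemma comm_group_ca: "comm_group (part (ca_res G (zring G) n) x)"
  unfolding part_ca_res by (rule comm_group_presented[OF ca_rels_closed])

lemma group_ca: "group (part (ca_res G (zring G) n) x)"
  using comm_group_ca by (simp add: comm_group_def)

lemma pre_gmod_ca: "pre_gmod G (ca_res G (zring G) n)"
  unfolding pre_gmod_def
proof (intro conjI ballI allI)
  fix x y k assume "x \<in> carrier G" "y \<in> carrier G"
  then show "act (ca_res G (zring G) n) y x k \<in> hom (part (ca_res G (zring G) n) x) (part (ca_res G (zring G) n) (x \<otimes> y))"
    unfolding ca_res_def by (intro ca_Ab_act(1)[OF ca_hyps]) simp_all
qed (rule comm_group_ca)

lemma ca_class_closed: "s \<in> ca_gens G n x \<Longrightarrow> ca_class G n x s \<in> carrier (part (ca_res G (zring G) n) x)"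
  unfolding part_ca_res by (rule presented_class_closed)

lemma act_ca_class:
  assumes "(u, a, v, b) \<in> ca_gens G n x" "x \<in> carrier G" "y \<in> carrier G"
  shows "act (ca_res G (zring G) n) y x k (ca_class G n x (u, a, v, b)) = ca_class G n (x \<otimes> y) (y \<otimes> u, k * a, v, b)"
proof -
  have "gmul (zring G) y u k a = k * a" by (simp add: graded_monoid_ring_def)
  then show ?thesis
    using ca_Ab_act(2)[OF ca_hyps assms(2,3) _ assms(1), of k] unfolding ca_res_def by simp
qed

lemma ca_gens_act:
  "(u, a, v, b) \<in> ca_gens G n x \<Longrightarrow> y \<in> carrier G \<Longrightarrow> (y \<otimes> u, k * a, v, b) \<in> ca_gens G n (x \<otimes> y)"
  by (auto simp: ca_gens_iff m_ac)

lemma ca_hom_eqI: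
  assumes "group H" "k \<in> hom (part (ca_res G (zring G) n) x) H" "k' \<in> hom (part (ca_res G (zring G) n) x) H"
    and "\<And>u a v b. (u, a, v, b) \<in> ca_gens G n x \<Longrightarrow> k (ca_class G n x (u, a, v, b)) = k' (ca_class G n x (u, a, v, b))"
    and "c \<in> carrier (part (ca_res G (zring G) n) x)"
  shows "k c = k' c"
  using presented_hom_eqI[OF ca_rels_closed assms(1), of k n x k' c] assms(2-) unfolding part_ca_res by force

end

text \<open>
  Both sides of the compatibility with the action are homomorphisms, so that generators suffice.
\<close>

lemma gmod_map_ca:
  assumes X: "comm_monoid X" and P': "pre_gmod X' P'" and g: "g \<in> hom X X'"
    and hom: "\<And>x. x \<in> carrier X \<Longrightarrow> \<phi> x \<in> hom (part (ca_res X (zring X) n) x) (part P' (g x))"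
    and eq: "\<And>x y k u a v b. x \<in> carrier X \<Longrightarrow> y \<in> carrier X \<Longrightarrow> (u, a, v, b) \<in> ca_gens X n x \<Longrightarrow>
      \<phi> (x \<otimes>\<^bsub>X\<^esub> y) (ca_class X n (x \<otimes>\<^bsub>X\<^esub> y) (y \<otimes>\<^bsub>X\<^esub> u, k * a, v, b)) =
      act P' (g y) (g x) k (\<phi> x (ca_class X n x (u, a, v, b)))"
  shows "gmod_map X g (ca_res X (zring X) n) P' \<phi>"
  unfolding gmod_map_def
proof (intro conjI ballI allI hom)
  interpret grading_monoid X using X ..
  fix x y k c assume x: "x \<in> carrier X" "y \<in> carrier X" and c: "c \<in> carrier (part (ca_res X (zring X) n) x)"
  have g': "g x \<in> carrier X'" "g y \<in> carrier X'" "g (x \<otimes>\<^bsub>X\<^esub> y) = g x \<otimes>\<^bsub>X'\<^esub> g y"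
    using hom_in_carrier[OF g] hom_mult[OF g] x by auto
  have P'': "group (part P' (g x \<otimes>\<^bsub>X'\<^esub> g y))"
    using hom_in_carrier[OF g m_closed[OF x]] pre_gmodD(1)[OF P'] g' by (simp add: comm_group_def)
  have "(\<phi> (x \<otimes>\<^bsub>X\<^esub> y) \<circ> act (ca_res X (zring X) n) y x k) c = (act P' (g y) (g x) k \<circ> \<phi> x) c"
    by (rule ca_hom_eqI[OF P'' Group.hom_compose[OF pre_gmodD(3)[OF pre_gmod_ca x] hom[OF m_closed[OF x], unfolded g'(3)]]
        Group.hom_compose[OF hom[OF x(1)] pre_gmodD(3)[OF P' g'(1,2)]] _ c])
      (simp add: act_ca_class x eq)
  then show "\<phi> (x \<otimes>\<^bsub>X\<^esub> y) (act (ca_res X (zring X) n) y x k c) = act P' (g y) (g x) k (\<phi> x c)" by simp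
qed

lemma gmod_map_cm:
  assumes X: "comm_monoid X" and P': "pre_gmod X' P'" and g: "g \<in> hom X X'"
    and hom: "\<And>x. x \<in> carrier X \<Longrightarrow> \<phi> x \<in> hom (part (cm_gmod X n) x) (part P' (g x))"
    and eq: "\<And>x y k u b. x \<in> carrier X \<Longrightarrow> y \<in> carrier X \<Longrightarrow> (u, b) \<in> cm_gens X n x \<Longrightarrow>
      \<phi> (x \<otimes>\<^bsub>X\<^esub> y) (cm_class X n (x \<otimes>\<^bsub>X\<^esub> y) (y \<otimes>\<^bsub>X\<^esub> u, b)) [^]\<^bsub>part P' (g (x \<otimes>\<^bsub>X\<^esub> y))\<^esub> (k::int) =
      act P' (g y) (g x) k (\<phi> x (cm_class X n x (u, b)))"
  shows "gmod_map X g (cm_gmod X n) P' \<phi>"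
  unfolding gmod_map_def
proof (intro conjI ballI allI hom)
  interpret grading_monoid X using X ..
  fix x y k c assume x: "x \<in> carrier X" "y \<in> carrier X" and c: "c \<in> carrier (part (cm_gmod X n) x)"
  have g': "g x \<in> carrier X'" "g y \<in> carrier X'" "g (x \<otimes>\<^bsub>X\<^esub> y) = g x \<otimes>\<^bsub>X'\<^esub> g y"
    using hom_in_carrier[OF g] hom_mult[OF g] x by auto
  have P'': "group (part P' (g x \<otimes>\<^bsub>X'\<^esub> g y))"
    using hom_in_carrier[OF g m_closed[OF x]] pre_gmodD(1)[OF P'] g' by (simp add: comm_group_def)
  note h' = hom[OF m_closed[OF x], unfolded g'(3)]
  have "(\<phi> (x \<otimes>\<^bsub>X\<^esub> y) \<circ> act (cm_gmod X n) y x k) c = (act P' (g y) (g x) k \<circ> \<phi> x) c"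
  proof (rule cm_hom_eqI[OF P'' Group.hom_compose[OF pre_gmodD(3)[OF pre_gmod_cm x] h']
        Group.hom_compose[OF hom[OF x(1)] pre_gmodD(3)[OF P' g'(1,2)]] _ c])
    fix u b assume ub: "(u, b) \<in> cm_gens X n x"
    show "(\<phi> (x \<otimes>\<^bsub>X\<^esub> y) \<circ> act (cm_gmod X n) y x k) (cm_class X n x (u, b)) =
        (act P' (g y) (g x) k \<circ> \<phi> x) (cm_class X n x (u, b))"
      using eq[OF x ub, of k] hom_int_pow[OF h' cm_class_closed[OF cm_gens_act[OF ub x(2)]] group_cm P'', of k]
      by (simp add: act_cm_class[OF ub x(2)] g'(3))
  qed
  then show "\<phi> (x \<otimes>\<^bsub>X\<^esub> y) (act (cm_gmod X n) y x k c) = act P' (g y) (g x) k (\<phi> x c)" by simp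
qed

section \<open>Functoriality of the abelianizations\<close>

text \<open>
  A substitution respects sums and products, hence the relations of bilinearity, and the Leibniz rule as
  soon as it also respects augmentations, by which that rule multiplies.
\<close>

lemma ca_Ab_map:
  assumes X: "comm_monoid X" and X': "comm_monoid X'" and g: "g \<in> hom X X'"
    and h: "\<And>u a. h u a = a"
    and f: "\<And>v t. v \<in> carrier X \<Longrightarrow> t \<in> gel X (Suc k) v \<Longrightarrow> f v t \<in> gel X' (Suc k') (g v)"
    and G: "\<And>v t. v \<in> carrier X \<Longrightarrow> t \<in> gel X (Suc k) v \<Longrightarrow> f v t = poly_map G t"
    and aug: "\<And>v t. v \<in> carrier X \<Longrightarrow> t \<in> gel X (Suc k) v \<Longrightarrow> gaug (Suc k') (f v t) = gaug (Suc k) t"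
  defines "\<phi> \<equiv> \<lambda>x. ca_Ab_map X' (zring X') (ca_iter X' (zring X') (Suc k')) (ca_aug X' (zring X') (Suc k')) g h f (g x)"
  shows ca_Ab_map_gmod: "gmod_map X g (ca_res X (zring X) k) (ca_res X' (zring X') k') \<phi>"
    and ca_Ab_map_class: "x \<in> carrier X \<Longrightarrow> (u, a, v, b) \<in> ca_gens X k x \<Longrightarrow>
      \<phi> x (ca_class X k x (u, a, v, b)) = ca_class X' k' (g x) (g u, a, g v, f v b)"
proof -
  interpret X: grading_monoid X using X ..
  interpret X': grading_monoid X' using X' ..
  let ?m = "\<lambda>(u, a, v, b). (g u, h u a, g v, f v b)"
  note gc = hom_in_carrier[OF g] and gm = hom_mult[OF g]
  have gens: "?m s \<in> ca_gens X' k' (g x)" if "s \<in> ca_gens X k x" for s x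
  proof -
    obtain u a v b where s: "s = (u, a, v, b)" by (cases s)
    then show ?thesis
      using that f[of v b] gm[of u v] gc by (auto simp: X.ca_gens_iff X'.ca_gens_iff)
  qed
  have add: "GPoly (unGPoly b + unGPoly b') \<in> gel X (Suc k) v" if "v \<in> carrier X" "b \<in> gel X (Suc k) v" "b' \<in> gel X (Suc k) v" for v b b'
    using comm_gring_add_closed[OF X.comm_gring_gel that] by (simp add: free_gring_simps ca_iter.simps(2))
  have mul: "GPoly (unGPoly b * unGPoly b') \<in> gel X (Suc k) (v \<otimes>\<^bsub>X\<^esub> w)"
    if "v \<in> carrier X" "w \<in> carrier X" "b \<in> gel X (Suc k) v" "b' \<in> gel X (Suc k) w" for v w b b'
    using comm_gring_mult_closed[OF X.comm_gring_gel that] by (simp add: free_gring_simps ca_iter.simps(2))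
  have rels: "frag_extend (\<lambda>s. frag_of (?m s)) r \<in> ca_rels X' k' (g x)" if r: "r \<in> ca_rels X k x" for r x
    using r
  proof (cases rule: X.ca_rels_cases)
    case (left u v a a' b)
    then show ?thesis
      using X'.ca_rels_intros(1)[of "g u" "g v" "g x" "f v b" k' a a'] gc gm[of u v] f
      by (simp add: frag_extend_diff h)
  next
    case (right u v a b b')
    have "f v (GPoly (unGPoly b + unGPoly b')) = GPoly (unGPoly (f v b) + unGPoly (f v b'))"
      using right G add by (simp add: poly_map_def poly_subst_add)
    then show ?thesis
      using X'.ca_rels_intros(2)[of "g u" "g v" "g x" "f v b" k' "f v b'" a] gc gm[of u v] f right
      by (simp add: frag_extend_diff h)
  next
    case (Leibniz u v w a b b')
    have "f (v \<otimes>\<^bsub>X\<^esub> w) (GPoly (unGPoly b * unGPoly b')) = GPoly (unGPoly (f v b) * unGPoly (f w b'))"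
      using Leibniz G mul by (simp add: poly_map_def poly_subst_mult)
    moreover have "g x = g u \<otimes>\<^bsub>X'\<^esub> (g v \<otimes>\<^bsub>X'\<^esub> g w)"
      using Leibniz by (simp add: gm flip: Leibniz(5))
    ultimately show ?thesis
      using X'.ca_rels_intros(3)[of "g u" "g v" "g w" "g x" "f v b" k' "f w b'" a] gc f Leibniz(2-) aug
      by (simp add: Leibniz(1) frag_extend_diff h gm)
  qed
  show cl: "\<phi> x (ca_class X k x (u, a, v, b)) = ca_class X' k' (g x) (g u, a, g v, f v b)"
    if "x \<in> carrier X" "(u, a, v, b) \<in> ca_gens X k x" for x u a v b
    using presented_map_class[OF X.ca_rels_closed X'.ca_rels_closed gens rels that(2)]
    by (simp add: \<phi>_def ca_Ab_map_def h)
  show "gmod_map X g (ca_res X (zring X) k) (ca_res X' (zring X') k') \<phi>"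
  proof (rule gmod_map_ca[OF X X'.pre_gmod_ca g])
    show "\<phi> x \<in> hom (part (ca_res X (zring X) k) x) (part (ca_res X' (zring X') k') (g x))" if "x \<in> carrier X" for x
      unfolding part_ca_res \<phi>_def ca_Ab_map_def
      by (rule presented_map_hom[OF X.ca_rels_closed X'.ca_rels_closed gens rels])
    fix x y c u a v b assume *: "x \<in> carrier X" "y \<in> carrier X" "(u, a, v, b) \<in> ca_gens X k x"
    have "(g u, a, g v, f v b) \<in> ca_gens X' k' (g x)" using gens[OF *(3)] by (simp add: h)
    moreover have "u \<in> carrier X" using *(3) by (simp add: X.ca_gens_iff)
    ultimately show "\<phi> (x \<otimes>\<^bsub>X\<^esub> y) (ca_class X k (x \<otimes>\<^bsub>X\<^esub> y) (y \<otimes>\<^bsub>X\<^esub> u, c * a, v, b)) =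
        act (ca_res X' (zring X') k') (g y) (g x) c (\<phi> x (ca_class X k x (u, a, v, b)))"
      using * by (simp add: cl X.ca_gens_act X'.act_ca_class gc gm)
  qed
qed

lemma cm_Ab_map:
  assumes X: "comm_monoid X" and X': "comm_monoid X'" and g: "g \<in> hom X X'"
    and f: "f \<in> hom (cm_iter X (Suc k)) (cm_iter X' (Suc k'))"
    and deg: "\<And>t. t \<in> carrier (cm_iter X (Suc k)) \<Longrightarrow> nested_degree X' (f t) = g (nested_degree X t)"
  defines "\<phi> \<equiv> \<lambda>x. cm_Ab_map X' (cm_iter X' (Suc k')) (cm_aug X' (Suc k')) g f (g x)"
  shows cm_Ab_map_gmod: "gmod_map X g (cm_gmod X k) (cm_gmod X' k') \<phi>"
    and cm_Ab_map_class: "x \<in> carrier X \<Longrightarrow> (u, y) \<in> cm_gens X k x \<Longrightarrow>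
      \<phi> x (cm_class X k x (u, y)) = cm_class X' k' (g x) (g u, f y)"
    and cm_Ab_map_elt: "x \<in> carrier X \<Longrightarrow> Poly_Mapping.keys p \<subseteq> cm_gens X k x \<Longrightarrow>
      \<phi> x (presented_elt (cm_gens X k x) (cm_rels X k x) p) =
      presented_elt (cm_gens X' k' (g x)) (cm_rels X' k' (g x)) (frag_extend (\<lambda>(u, y). frag_of (g u, f y)) p)"
proof -
  interpret X: grading_monoid X using X ..
  interpret X': grading_monoid X' using X' ..
  let ?m = "\<lambda>(u, y). (g u, f y)"
  note gc = hom_in_carrier[OF g] and gm = hom_mult[OF g] and fc = hom_in_carrier[OF f] and fm = hom_mult[OF f]
  have gens: "?m s \<in> cm_gens X' k' (g x)" if "s \<in> cm_gens X k x" for s x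
  proof -
    obtain u y where s: "s = (u, y)" by (cases s)
    then show ?thesis
      using that fc[of y] gc[of u] deg[of y] X.nested_degree_closed[of y "Suc k"] gm[of u "nested_degree X y"]
      by (auto simp: X.cm_gens_iff X'.cm_gens_iff)
  qed
  have rels: "frag_extend (\<lambda>s. frag_of (?m s)) r \<in> cm_rels X' k' (g x)" if r: "r \<in> cm_rels X k x" for r x
    using r
  proof (cases rule: X.cm_rels_cases)
    case (1 u y y')
    note nd = X.nested_degree_closed[OF 1(3)] X.nested_degree_closed[OF 1(4)]
    have "g x = g u \<otimes>\<^bsub>X'\<^esub> (nested_degree X' (f y) \<otimes>\<^bsub>X'\<^esub> nested_degree X' (f y'))"
      using 1(2-4) nd by (simp add: gm deg flip: 1(5))
    from X'.cm_rels_intro[OF gc[OF 1(2)] fc[OF 1(3)] fc[OF 1(4)] this[symmetric]]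
    show ?thesis using 1(2-4) nd by (simp add: 1(1) frag_extend_diff fm gm deg)
  qed
  note R = X.cm_rels_closed X'.cm_rels_closed
  show cl: "\<phi> x (cm_class X k x (u, y)) = cm_class X' k' (g x) (g u, f y)"
    if "x \<in> carrier X" "(u, y) \<in> cm_gens X k x" for x u y
    using presented_map_class[OF R gens rels that(2)]
    by (simp add: \<phi>_def cm_Ab_map_def)
  show "\<phi> x (presented_elt (cm_gens X k x) (cm_rels X k x) p) =
      presented_elt (cm_gens X' k' (g x)) (cm_rels X' k' (g x)) (frag_extend (\<lambda>(u, y). frag_of (g u, f y)) p)"
    if "x \<in> carrier X" "Poly_Mapping.keys p \<subseteq> cm_gens X k x" for x p
  proof -
    have "Poly_Mapping.keys (frag_of (?m s)) \<subseteq> cm_gens X' k' (g x)" if "s \<in> cm_gens X k x" for s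
      using gens[OF that] by simp
    moreover have "presented_elt (cm_gens X' k' (g x)) (cm_rels X' k' (g x)) (frag_extend (\<lambda>s. frag_of (?m s)) r) =
        \<one>\<^bsub>presented (cm_gens X' k' (g x)) (cm_rels X' k' (g x))\<^esub>" if "r \<in> cm_rels X k x" for r
      by (rule presented_elt_rel[OF X'.cm_rels_closed rels[OF that]])
    ultimately show ?thesis
      using presented_extend_elt[OF X.cm_rels_closed[of k x] X'.cm_rels_closed[of k' "g x"],
          where f = "\<lambda>s. frag_of (?m s)", OF _ _ that(2)]
      by (simp add: \<phi>_def cm_Ab_map_def presented_map_eq_extend case_prod_unfold)
  qed
  show "gmod_map X g (cm_gmod X k) (cm_gmod X' k') \<phi>"
  proof (rule gmod_map_cm[OF X X'.pre_gmod_cm g])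
    show "\<phi> x \<in> hom (part (cm_gmod X k) x) (part (cm_gmod X' k') (g x))" if "x \<in> carrier X" for x
      unfolding part_cm_gmod \<phi>_def cm_Ab_map_def
      by (rule presented_map_hom[OF R gens rels])
    fix x y c u b assume *: "x \<in> carrier X" "y \<in> carrier X" "(u, b) \<in> cm_gens X k x"
    have "(g u, f b) \<in> cm_gens X' k' (g x)" using gens[OF *(3)] by simp
    moreover have "u \<in> carrier X" using *(3) by (simp add: X.cm_gens_iff)
    ultimately show "\<phi> (x \<otimes>\<^bsub>X\<^esub> y) (cm_class X k (x \<otimes>\<^bsub>X\<^esub> y) (y \<otimes>\<^bsub>X\<^esub> u, b)) [^]\<^bsub>part (cm_gmod X' k') (g (x \<otimes>\<^bsub>X\<^esub> y))\<^esub> (c::int) =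
        act (cm_gmod X' k') (g y) (g x) c (\<phi> x (cm_class X k x (u, b)))"
      using * by (simp add: cl X.cm_gens_act X'.act_cm_class gc gm)
  qed
qed

section \<open>The deformation retract\<close>

lemma frag_cmul_right_diff: "frag_cmul k (p - q) = frag_cmul k p - frag_cmul k q"
  by (rule poly_mapping_eqI) (simp add: lookup_minus right_diff_distrib)

text \<open>
  For a polynomial \<open>q\<close> with monomials \<open>m\<close>, this is the combination of the generators given by the
  \<open>m\<close>, translated by \<open>u\<close>: the value at \<open>q\<close> of the additive extension of the universal derivation.
\<close>

definition nested_terms :: "'x \<Rightarrow> ('x nested multiset \<Rightarrow>\<^sub>0 int) \<Rightarrow> ('x \<times> 'x nested \<Rightarrow>\<^sub>0 int)" where
  "nested_terms u = frag_extend (\<lambda>m. frag_of (u, Node m))"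

definition res_embed :: "'x monoid \<Rightarrow> nat \<Rightarrow> 'x \<Rightarrow> 'x cm_el \<Rightarrow> ('x, int) ca_el" where
  "res_embed X n x = presented_map (ca_gens X n x) (ca_rels X n x) (\<lambda>(u, y). (u, 1, nested_degree X y, embed X y))"

text \<open>
  A generator stands for \<open>a\<close> times the differential of \<open>b\<close>, translated by \<open>u\<close>. It goes to \<open>a\<close> times
  the sum of the differentials of the monomials in the linearization of \<open>b\<close>.
\<close>

definition res_lin :: "'x monoid \<Rightarrow> nat \<Rightarrow> 'x \<Rightarrow> ('x, int) ca_el \<Rightarrow> 'x cm_el" where
  "res_lin X n x = presented_extend (cm_gens X n x) (cm_rels X n x)
    (\<lambda>(u, a, v, b). frag_cmul a (nested_terms u (lin_poly n b)))"

definition res_htpy :: "'x monoid \<Rightarrow> nat \<Rightarrow> nat \<Rightarrow> 'x \<Rightarrow> ('x, int) ca_el \<Rightarrow> ('x, int) ca_el" where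
  "res_htpy X n j x = ca_Ab_map X (zring X) (ca_iter X (zring X) (Suc (Suc n))) (ca_aug X (zring X) (Suc (Suc n)))
    id (\<lambda>_. id) (\<lambda>_. htpy X j n) x"

context grading_monoid
begin

lemma id_hom: "id \<in> hom G G"
  by (simp add: hom_def)

abbreviation cm_elt where
  "cm_elt n x \<equiv> presented_elt (cm_gens G n x) (cm_rels G n x)"
abbreviation ca_elt where
  "ca_elt n x \<equiv> presented_elt (ca_gens G n x) (ca_rels G n x)"

lemma nested_polysD:
  assumes "q \<in> nested_polys G n v" "m \<in> Poly_Mapping.keys q"
  shows "Node m \<in> carrier (cm_iter G (Suc n))" "nested_degree G (Node m) = v" "set_mset m \<subseteq> carrier (cm_iter G n)"
  using assms by (auto simp: homog_polys_def homog_monos_def carrier_cm_iter_Suc)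

lemma keys_nested_terms:
  assumes "q \<in> nested_polys G n v" "u \<in> carrier G" "u \<otimes> v = x"
  shows "Poly_Mapping.keys (nested_terms u q) \<subseteq> cm_gens G n x"
proof
  fix s assume "s \<in> Poly_Mapping.keys (nested_terms u q)"
  then obtain m where m: "m \<in> Poly_Mapping.keys q" "s = (u, Node m)"
    using keys_frag_extend[of "\<lambda>m. frag_of (u, Node m)" q] by (auto simp: nested_terms_def)
  then show "s \<in> cm_gens G n x"
    using nested_polysD(1,2)[OF assms(1) m(1)] assms(2,3) by (simp add: cm_gens_iff del: nested_degree.simps)
qed

lemma keys_cmul_nested_terms:
  assumes "q \<in> nested_polys G n v" "u \<in> carrier G" "u \<otimes> v = x"
  shows "Poly_Mapping.keys (frag_cmul a (nested_terms u q)) \<subseteq> cm_gens G n x"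
  using keys_nested_terms[OF assms] keys_cmul[of a "nested_terms u q"] by blast

lemma embed_mult:
  assumes "y \<in> carrier (cm_iter G (Suc n))" "y' \<in> carrier (cm_iter G (Suc n))"
  shows "embed G (y \<otimes>\<^bsub>cm_iter G (Suc n)\<^esub> y') = GPoly (unGPoly (embed G y) * unGPoly (embed G y'))"
  using assms by (auto simp: carrier_cm_iter_Suc cm_iter.simps(2) free_cmon_def frag_of_mult)

lemma res_embed_gens:
  assumes "s \<in> cm_gens G n x"
  shows "(\<lambda>(u, y). (u, 1, nested_degree G y, embed G y)) s \<in> ca_gens G n x"
proof -
  obtain u y where s: "s = (u, y)" by (cases s)
  then show ?thesis
    using assms embed_closed[of y "Suc n"] nested_degree_closed[of y "Suc n"]
    by (auto simp: cm_gens_iff ca_gens_iff)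
qed

text \<open>
  The Leibniz rule of the ring becomes that of the monoid because embedded elements have augmentation 1.
\<close>

lemma res_embed_rels:
  assumes "r \<in> cm_rels G n x"
  shows "frag_extend (\<lambda>s. frag_of ((\<lambda>(u, y). (u, 1, nested_degree G y, embed G y)) s)) r \<in> ca_rels G n x"
  using assms
proof (cases rule: cm_rels_cases)
  case (1 u y y')
  note nd = nested_degree_closed[OF 1(3)] nested_degree_closed[OF 1(4)]
  show ?thesis
    using ca_rels_intros(3)[OF 1(2) nd 1(5) embed_closed[OF 1(3)] embed_closed[OF 1(4)], of 1] 1(2-4)
    by (simp add: 1(1) frag_extend_diff embed_mult hom_mult[OF nested_degree_hom(1)] gaug_embed)
qed

lemma res_embed_hom: "res_embed G n x \<in> hom (part (cm_gmod G n) x) (part (ca_res G (zring G) n) x)"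
  unfolding part_cm_gmod part_ca_res res_embed_def
  by (rule presented_map_hom[OF cm_rels_closed ca_rels_closed res_embed_gens res_embed_rels])

lemma res_embed_class:
  assumes "(u, y) \<in> cm_gens G n x"
  shows "res_embed G n x (cm_class G n x (u, y)) = ca_class G n x (u, 1, nested_degree G y, embed G y)"
  using presented_map_class[OF cm_rels_closed ca_rels_closed res_embed_gens res_embed_rels assms]
  by (simp add: res_embed_def)

lemma res_embed_elt:
  assumes "Poly_Mapping.keys p \<subseteq> cm_gens G n x"
  shows "res_embed G n x (cm_elt n x p) = ca_elt n x (frag_extend (\<lambda>(u, y). frag_of (u, 1, nested_degree G y, embed G y)) p)"
proof -
  let ?m = "\<lambda>(u, y). (u, 1, nested_degree G y, embed G y)"
  have "Poly_Mapping.keys (frag_of (?m s)) \<subseteq> ca_gens G n x" if "s \<in> cm_gens G n x" for s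
    using res_embed_gens[OF that] by simp
  moreover have "ca_elt n x (frag_extend (\<lambda>s. frag_of (?m s)) r) = \<one>\<^bsub>presented (ca_gens G n x) (ca_rels G n x)\<^esub>"
    if "r \<in> cm_rels G n x" for r
    by (rule presented_elt_rel[OF ca_rels_closed res_embed_rels[OF that]])
  ultimately show ?thesis
    using presented_extend_elt[OF cm_rels_closed[of n x] ca_rels_closed[of n x], where f = "\<lambda>s. frag_of (?m s)", OF _ _ assms]
    by (simp add: res_embed_def presented_map_eq_extend case_prod_unfold)
qed

text \<open>
  The relations of bilinearity, used to move integer coefficients and sums of ring elements out of a
  generator.
\<close>

lemma ca_class_coeff:
  assumes "(u, 1, v, b) \<in> ca_gens G n x"
  shows "ca_class G n x (u, a, v, b) = ca_class G n x (u, 1, v, b) [^]\<^bsub>part (ca_res G (zring G) n) x\<^esub> a"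
proof -
  have g: "(u, k, v, b) \<in> ca_gens G n x" for k using assms by (simp add: ca_gens_iff)
  have "(\<lambda>k. ca_class G n x (u, k, v, b)) \<in> hom integer_group (part (ca_res G (zring G) n) x)"
  proof (rule homI)
    show "ca_class G n x (u, k, v, b) \<in> carrier (part (ca_res G (zring G) n) x)" for k
      by (rule ca_class_closed[OF g])
    show "ca_class G n x (u, k \<otimes>\<^bsub>integer_group\<^esub> l, v, b) =
        ca_class G n x (u, k, v, b) \<otimes>\<^bsub>part (ca_res G (zring G) n) x\<^esub> ca_class G n x (u, l, v, b)" for k l
      using presented_class_eqI[OF ca_rels_closed ca_rels_intros(1)[of u v x b n k l] g g g] assms
      by (simp add: part_ca_res ca_gens_iff)
  qed
  from hom_int_pow[OF this, of 1 a] show ?thesis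
    by (simp add: group_ca)
qed

lemma ca_class_add:
  assumes "u \<in> carrier G" "v \<in> carrier G" "u \<otimes> v = x"
    "p \<in> homog_polys G (gvars G n) fst v" "q \<in> homog_polys G (gvars G n) fst v"
  shows "ca_class G n x (u, a, v, GPoly (p + q)) =
    ca_class G n x (u, a, v, GPoly p) \<otimes>\<^bsub>part (ca_res G (zring G) n) x\<^esub> ca_class G n x (u, a, v, GPoly q)"
proof -
  have g: "(u, a, v, GPoly r) \<in> ca_gens G n x" if "r \<in> homog_polys G (gvars G n) fst v" for r
    using assms that by (simp add: ca_gens_iff gel_Suc)
  show ?thesis
    using presented_class_eqI[OF ca_rels_closed ca_rels_intros(2)[of u v x "GPoly p" n "GPoly q" a, unfolded unGPoly_GPoly]
        g[OF homog_polys_add[OF assms(4,5)]] g[OF assms(4)] g[OF assms(5)]] assms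
    by (simp add: part_ca_res gel_Suc)
qed

lemma ca_class_poly_hom:
  assumes "u \<in> carrier G" "v \<in> carrier G" "u \<otimes> v = x"
  shows "(\<lambda>p. ca_class G n x (u, a, v, GPoly p)) \<in>
    hom (free_Abelian_group (homog_monos G (gvars G n) fst v)) (part (ca_res G (zring G) n) x)"
proof (rule homI)
  have g: "(u, a, v, GPoly r) \<in> ca_gens G n x" if "r \<in> homog_polys G (gvars G n) fst v" for r
    using assms that by (simp add: ca_gens_iff gel_Suc)
  fix p assume "p \<in> carrier (free_Abelian_group (homog_monos G (gvars G n) fst v))"
  then show "ca_class G n x (u, a, v, GPoly p) \<in> carrier (part (ca_res G (zring G) n) x)"
    by (intro ca_class_closed g) (simp add: homog_polys_def)
qed (simp add: ca_class_add[OF assms] homog_polys_def)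

lemma ca_class_embed_poly:
  assumes u: "u \<in> carrier G" "v \<in> carrier G" "u \<otimes> v = x" and q: "q \<in> nested_polys G n v"
  shows "ca_class G n x (u, 1, v, GPoly (embed_poly G q)) =
    ca_elt n x (frag_extend (\<lambda>m. frag_of (u, 1, v, embed G (Node m))) q)"
proof -
  let ?F = "free_Abelian_group (homog_monos G (gvars G n) fst v)"
  let ?P = "part (ca_res G (zring G) n) x"
  interpret A: group_hom ?F ?P "\<lambda>p. ca_class G n x (u, 1, v, GPoly p)"
    by (intro group_hom.intro group_hom_axioms.intro ca_class_poly_hom u group_ca) simp
  let ?M = "homog_monos G (carrier (cm_iter G n)) (nested_degree G) v"
  have M: "embed_poly G r \<in> carrier ?F" if "Poly_Mapping.keys r \<subseteq> ?M" for r
    using embed_poly_closed[of r n v] that by (simp add: homog_polys_def)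
  have g: "(u, 1, v, embed G (Node m)) \<in> ca_gens G n x" if "m \<in> ?M" for m
    using M[of "frag_of m"] that u by (simp add: ca_gens_iff gel_Suc embed_Node homog_polys_def del: embed.simps)
  have K: "Poly_Mapping.keys (frag_extend (\<lambda>m. frag_of (u, 1, v, embed G (Node m))) r) \<subseteq> ca_gens G n x"
    if "Poly_Mapping.keys r \<subseteq> ?M" for r
    using keys_frag_extend[of "\<lambda>m. frag_of (u, 1, v, embed G (Node m))" r] g that by fastforce
  have "Poly_Mapping.keys q \<subseteq> ?M" using q by (simp add: homog_polys_def)
  then have "Poly_Mapping.keys q \<subseteq> ?M \<and> ca_class G n x (u, 1, v, GPoly (embed_poly G q)) =
    ca_elt n x (frag_extend (\<lambda>m. frag_of (u, 1, v, embed G (Node m))) q)"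
  proof (induction q rule: frag_induction)
    case zero
    then show ?case using A.hom_one presented_elt_zero[OF ca_rels_closed] by (simp add: embed_poly_def part_ca_res)
  next
    case (one m)
    then show ?case by (simp add: presented_class_eq_elt embed_Node del: embed.simps)
  next
    case (diff p q)
    then have pq: "Poly_Mapping.keys p \<subseteq> ?M" "Poly_Mapping.keys q \<subseteq> ?M" by auto
    have "embed_poly G (p - q) = embed_poly G p \<otimes>\<^bsub>?F\<^esub> inv\<^bsub>?F\<^esub> embed_poly G q"
      using M[OF pq(2)] by (simp add: embed_poly_def poly_subst_diff)
    then have "ca_class G n x (u, 1, v, GPoly (embed_poly G (p - q))) =
        ca_class G n x (u, 1, v, GPoly (embed_poly G p)) \<otimes>\<^bsub>?P\<^esub> inv\<^bsub>?P\<^esub> ca_class G n x (u, 1, v, GPoly (embed_poly G q))"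
      using A.hom_mult[OF M[OF pq(1)] group.inv_closed[OF _ M[OF pq(2)]]] A.hom_inv[OF M[OF pq(2)]]
      by (simp only: group_free_Abelian_group)
    then show ?case
      using diff keys_diff[of p q] presented_elt_diff[OF ca_rels_closed K[OF pq(1)] K[OF pq(2)]]
      by (auto simp: frag_extend_diff part_ca_res)
  qed
  then show ?thesis by simp
qed

text \<open>
  For monomials this is a relation of the abelianization, and the expression is bilinear in \<open>q\<close> and \<open>q'\<close>.
  The sums of coefficients are the augmentations of \<open>q\<close> and \<open>q'\<close>.
\<close>

lemma Leibniz_nested_terms:
  assumes u: "u \<in> carrier G" "v \<in> carrier G" "w \<in> carrier G" "u \<otimes> (v \<otimes> w) = x"
    and q: "q \<in> nested_polys G n v" and q': "q' \<in> nested_polys G n w"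
  shows "cm_elt n x (nested_terms u (q * q')
      - frag_cmul (poly_subst (\<lambda>_. 1) q) (nested_terms (u \<otimes> v) q')
      - frag_cmul (poly_subst (\<lambda>_. 1) q') (nested_terms (u \<otimes> w) q)) = \<one>\<^bsub>presented (cm_gens G n x) (cm_rels G n x)\<^esub>"
proof -
  define T where "T = (\<lambda>q q'. nested_terms u (q * q')
      - frag_cmul (poly_subst (\<lambda>_. 1) q) (nested_terms (u \<otimes> v) q')
      - frag_cmul (poly_subst (\<lambda>_. 1) q') (nested_terms (u \<otimes> w) q))"
  let ?E = "generate (free_Abelian_group (cm_gens G n x)) (cm_rels G n x)"
  let ?M = "homog_monos G (carrier (cm_iter G n)) (nested_degree G)"
  note R = cm_rels_closed
  have sub: "subgroup ?E (free_Abelian_group (cm_gens G n x))"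
    using presented_normal[OF R] by (simp add: normal_def)
  have diff: "a - b \<in> ?E" if "a \<in> ?E" "b \<in> ?E" for a b
    using subgroup.m_closed[OF sub that(1) subgroup.m_inv_closed[OF sub that(2)]] subgroup.subset[OF sub] that(2) by auto
  have T_diff: "T (p - p') q = T p q - T p' q" "T p (q - q') = T p q - T p q'" for p p' q q'
    by (simp_all add: T_def nested_terms_def frag_extend_diff left_diff_distrib right_diff_distrib poly_subst_diff
        frag_cmul_diff_distrib frag_cmul_right_diff)
  have T_mono: "T (frag_of m) (frag_of m') \<in> ?E" if m: "m \<in> ?M v" "m' \<in> ?M w" for m m'
  proof -
    have N: "Node m \<in> carrier (cm_iter G (Suc n))" "nested_degree G (Node m) = v"
      "Node m' \<in> carrier (cm_iter G (Suc n))" "nested_degree G (Node m') = w"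
      using m by (simp_all add: homog_monos_def carrier_cm_iter_Suc)
    have "T (frag_of m) (frag_of m') = frag_of (u, Node m \<otimes>\<^bsub>cm_iter G (Suc n)\<^esub> Node m')
        - frag_of (u \<otimes> v, Node m') - frag_of (u \<otimes> w, Node m)"
      by (simp add: T_def nested_terms_def frag_of_mult cm_iter.simps(2) free_cmon_def)
    moreover have "\<dots> \<in> cm_rels G n x"
      using cm_rels_intro[OF u(1) N(1,3), of x] u N(2,4) by simp
    ultimately show ?thesis by (auto intro: generate.incl)
  qed
  have zero: "0 \<in> ?E" using subgroup.one_closed[OF sub] by simp
  have T0: "T 0 q = 0" "T q 0 = 0" for q by (simp_all add: T_def nested_terms_def)
  have T_left: "T (frag_of m) q' \<in> ?E" if m: "m \<in> ?M v" for m
  proof -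
    have "Poly_Mapping.keys q' \<subseteq> ?M w" using q' by (simp add: homog_polys_def)
    then show ?thesis
      by (induction q' rule: frag_induction) (auto simp: T0 zero T_mono[OF m] T_diff diff)
  qed
  have "Poly_Mapping.keys q \<subseteq> ?M v" using q by (simp add: homog_polys_def)
  then have "T q q' \<in> ?E"
    by (induction q rule: frag_induction) (auto simp: T0 zero T_left T_diff diff)
  moreover have "Poly_Mapping.keys (T q q') \<subseteq> cm_gens G n x"
    using subsetD[OF subgroup.subset[OF sub] calculation] by simp
  ultimately show ?thesis
    using presented_elt_one_iff[OF R] unfolding T_def by blast
qed

lemma unGPoly_lin:
  "lin_poly n (GPoly (unGPoly b + unGPoly b')) = lin_poly n b + lin_poly n b'"
  "lin_poly n (GPoly (unGPoly b * unGPoly b')) = lin_poly n b * lin_poly n b'"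
  by (simp_all add: lin_poly_def poly_subst_add poly_subst_mult)

lemma res_lin_gens:
  assumes "s \<in> ca_gens G n x"
  shows "Poly_Mapping.keys ((\<lambda>(u, a, v, b). frag_cmul a (nested_terms u (lin_poly n b))) s) \<subseteq> cm_gens G n x"
proof -
  obtain u a v b where s: "s = (u, a, v, b)" by (cases s)
  then have "(u, a, v, b) \<in> ca_gens G n x" using assms by simp
  then show ?thesis
    using keys_cmul_nested_terms[OF lin_poly_closed, of b n v u x a] by (simp add: s ca_gens_iff)
qed

lemma res_lin_rels:
  assumes "r \<in> ca_rels G n x"
  shows "cm_elt n x (frag_extend (\<lambda>(u, a, v, b). frag_cmul a (nested_terms u (lin_poly n b))) r) =
    \<one>\<^bsub>presented (cm_gens G n x) (cm_rels G n x)\<^esub>"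
  using assms
proof (cases rule: ca_rels_cases)
  case (left u v a a' b)
  then show ?thesis
    using presented_elt_zero[OF cm_rels_closed] by (simp add: frag_extend_diff frag_cmul_distrib)
next
  case (right u v a b b')
  then show ?thesis
    using presented_elt_zero[OF cm_rels_closed]
    by (simp add: frag_extend_diff unGPoly_lin nested_terms_def frag_extend_add frag_cmul_distrib2)
next
  case (Leibniz u v w a b b')
  let ?q = "lin_poly n b" and ?q' = "lin_poly n b'"
  note qs = lin_poly_closed[OF Leibniz(6)] lin_poly_closed[OF Leibniz(7)]
  let ?t = "nested_terms u (?q * ?q')
      - frag_cmul (poly_subst (\<lambda>_. 1) ?q) (nested_terms (u \<otimes> v) ?q')
      - frag_cmul (poly_subst (\<lambda>_. 1) ?q') (nested_terms (u \<otimes> w) ?q)"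
  have x: "u \<otimes> v \<otimes> w = x" "u \<otimes> w \<otimes> v = x" using Leibniz(2-5) by (auto simp: m_assoc m_comm[of v w])
  have qq: "?q * ?q' \<in> nested_polys G n (v \<otimes> w)"
    using homog_polys_mult[OF nested_degree_image qs] .
  have "Poly_Mapping.keys (p - p' - p'') \<subseteq> S" if "Poly_Mapping.keys p \<subseteq> S" "Poly_Mapping.keys p' \<subseteq> S" "Poly_Mapping.keys p'' \<subseteq> S"
    for p p' p'' :: "'x \<times> 'x nested \<Rightarrow>\<^sub>0 int" and S
    using that keys_diff[of "p - p'" p''] keys_diff[of p p'] by blast
  then have K: "Poly_Mapping.keys ?t \<subseteq> cm_gens G n x"
    using keys_nested_terms[OF qq Leibniz(2,5)] keys_cmul_nested_terms[OF qs(2) _ x(1)]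
      keys_cmul_nested_terms[OF qs(1) _ x(2)] Leibniz(2-4) by (meson m_closed)
  have "frag_extend (\<lambda>(u, a, v, b). frag_cmul a (nested_terms u (lin_poly n b))) r = frag_cmul a ?t"
    by (simp add: Leibniz(1) frag_extend_diff unGPoly_lin coeff_sum_lin_poly frag_cmul_right_diff)
  then show ?thesis
    using presented_elt_cmul[OF cm_rels_closed K, of a] Leibniz_nested_terms[OF Leibniz(2-5) qs] comm_group_presented[OF cm_rels_closed[of n x]]
    by (simp add: comm_group_def group.int_pow_one)
qed

lemma res_lin_hom: "res_lin G n x \<in> hom (part (ca_res G (zring G) n) x) (part (cm_gmod G n) x)"
  unfolding part_cm_gmod part_ca_res res_lin_def
  by (rule presented_extend_hom[OF ca_rels_closed cm_rels_closed res_lin_gens res_lin_rels])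

lemma res_lin_class:
  assumes "(u, a, v, b) \<in> ca_gens G n x"
  shows "res_lin G n x (ca_class G n x (u, a, v, b)) = cm_elt n x (frag_cmul a (nested_terms u (lin_poly n b)))"
  using presented_extend_class[OF ca_rels_closed cm_rels_closed res_lin_gens res_lin_rels assms]
  by (simp add: res_lin_def)

lemma act_cm_elt:
  assumes x: "x \<in> carrier G" "y \<in> carrier G" and p: "Poly_Mapping.keys p \<subseteq> cm_gens G n x"
  shows "act (cm_gmod G n) y x k (cm_elt n x p) =
    cm_elt n (x \<otimes> y) (frag_cmul k (frag_extend (\<lambda>(u, b). frag_of (y \<otimes> u, b)) p))"
proof -
  let ?f = "\<lambda>p. frag_extend (\<lambda>(u, b). frag_of (y \<otimes> u, b)) p"
  note R = cm_rels_closed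
  interpret h: group_hom "part (cm_gmod G n) x" "part (cm_gmod G n) (x \<otimes> y)" "act (cm_gmod G n) y x k"
    by (intro group_hom.intro group_hom_axioms.intro group_cm pre_gmodD(3)[OF pre_gmod_cm x])
  have f: "Poly_Mapping.keys (frag_of (y \<otimes> u, b)) \<subseteq> cm_gens G n (x \<otimes> y)" if "(u, b) \<in> cm_gens G n x" for u b
    using cm_gens_act[OF that x(2)] by simp
  have K: "Poly_Mapping.keys (frag_cmul k (?f p)) \<subseteq> cm_gens G n (x \<otimes> y)" if "Poly_Mapping.keys p \<subseteq> cm_gens G n x" for p
    using keys_cmul[of k "?f p"] keys_frag_extend[of "\<lambda>(u, b). frag_of (y \<otimes> u, b)" p] f that by fastforce
  have "Poly_Mapping.keys p \<subseteq> cm_gens G n x \<and> act (cm_gmod G n) y x k (cm_elt n x p) = cm_elt n (x \<otimes> y) (frag_cmul k (?f p))"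
    using p
  proof (induction p rule: frag_induction)
    case zero
    then show ?case using h.hom_one by (simp add: presented_elt_zero[OF R] part_cm_gmod)
  next
    case (one s)
    then obtain u b where ub: "s = (u, b)" "(u, b) \<in> cm_gens G n x" by (cases s) auto
    then show ?case
      using act_cm_class[OF ub(2) x(2), of k] presented_elt_cmul[OF R f[OF ub(2)], of k]
      by (simp add: presented_class_eq_elt part_cm_gmod)
  next
    case (diff p q)
    then have pq: "Poly_Mapping.keys p \<subseteq> cm_gens G n x" "Poly_Mapping.keys q \<subseteq> cm_gens G n x" by auto
    have c: "cm_elt n x p \<in> carrier (part (cm_gmod G n) x)" "cm_elt n x q \<in> carrier (part (cm_gmod G n) x)"
      using presented_elt_closed[OF R] pq by (simp_all add: part_cm_gmod)
    show ?case
      using diff keys_diff[of p q] h.hom_mult[OF c(1) group.inv_closed[OF group_cm c(2)]] h.hom_inv[OF c(2)]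
        presented_elt_diff[OF R pq] presented_elt_diff[OF R K[OF pq(1)] K[OF pq(2)]]
      by (auto simp: frag_extend_diff frag_cmul_right_diff part_cm_gmod)
  qed
  then show ?thesis by simp
qed

lemma res_embed_gmod: "gmod_map G id (cm_gmod G n) (ca_res G (zring G) n) (res_embed G n)"
proof (rule gmod_map_cm[OF comm_monoid_axioms pre_gmod_ca id_hom])
  show "res_embed G n x \<in> hom (part (cm_gmod G n) x) (part (ca_res G (zring G) n) (id x))" for x
    using res_embed_hom by simp
  fix x y k u b assume *: "x \<in> carrier G" "y \<in> carrier G" "(u, b) \<in> cm_gens G n x"
  have "(u, 1, nested_degree G b, embed G b) \<in> ca_gens G n x" using res_embed_gens[OF *(3)] by simp
  from act_ca_class[OF this *(1,2), of k] ca_class_coeff[OF ca_gens_act[OF this *(2), of 1, simplified], of k]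
  show "res_embed G n (x \<otimes> y) (cm_class G n (x \<otimes> y) (y \<otimes> u, b)) [^]\<^bsub>part (ca_res G (zring G) n) (id (x \<otimes> y))\<^esub> k =
      act (ca_res G (zring G) n) (id y) (id x) k (res_embed G n x (cm_class G n x (u, b)))"
    by (simp add: res_embed_class[OF cm_gens_act[OF *(3,2)]] res_embed_class[OF *(3)])
qed

lemma res_lin_gmod: "gmod_map G id (ca_res G (zring G) n) (cm_gmod G n) (res_lin G n)"
proof (rule gmod_map_ca[OF comm_monoid_axioms pre_gmod_cm id_hom])
  show "res_lin G n x \<in> hom (part (ca_res G (zring G) n) x) (part (cm_gmod G n) (id x))" for x
    using res_lin_hom by simp
  fix x y k u a v b assume *: "x \<in> carrier G" "y \<in> carrier G" "(u, a, v, b) \<in> ca_gens G n x"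
  then have u: "u \<in> carrier G" "u \<otimes> v = x" and q: "lin_poly n b \<in> nested_polys G n v"
    using lin_poly_closed by (auto simp: ca_gens_iff)
  have "nested_terms (y \<otimes> u) (lin_poly n b) = frag_extend (\<lambda>(u, b). frag_of (y \<otimes> u, b)) (nested_terms u (lin_poly n b))"
    unfolding nested_terms_def using frag_extend_compose[of "\<lambda>(u, b). frag_of (y \<otimes> u, b)" "\<lambda>m. (u, Node m)" "lin_poly n b"]
    by (simp add: o_def)
  then show "res_lin G n (x \<otimes> y) (ca_class G n (x \<otimes> y) (y \<otimes> u, k * a, v, b)) =
      act (cm_gmod G n) (id y) (id x) k (res_lin G n x (ca_class G n x (u, a, v, b)))"
    using act_cm_elt[OF *(1,2) keys_cmul_nested_terms[OF q u], of k a]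
    by (simp add: res_lin_class[OF ca_gens_act[OF *(3,2)]] res_lin_class[OF *(3)] frag_extend_cmul)
qed

lemma cm_face_hom: "i \<le> k \<Longrightarrow> cm_face G i k \<in> hom (cm_iter G (Suc k)) (cm_iter G k)"
proof (rule homI)
  fix a b assume i: "i \<le> k" and ab: "a \<in> carrier (cm_iter G (Suc k))" "b \<in> carrier (cm_iter G (Suc k))"
  show "cm_face G i k a \<in> carrier (cm_iter G k)" by (rule cm_face_closed[OF i ab(1)])
  obtain m m' where m: "a = Node m" "set_mset m \<subseteq> carrier (cm_iter G k)" "b = Node m'" "set_mset m' \<subseteq> carrier (cm_iter G k)"
    using ab by (auto simp: carrier_cm_iter_Suc)
  have ab': "a \<otimes>\<^bsub>cm_iter G (Suc k)\<^esub> b = Node (m + m')" by (simp add: m cm_iter.simps(2) free_cmon_def)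
  interpret I: grading_monoid "cm_iter G k" using comm_monoid_cm_iter[OF comm_monoid_axioms] ..
  show "cm_face G i k (a \<otimes>\<^bsub>cm_iter G (Suc k)\<^esub> b) = cm_face G i k a \<otimes>\<^bsub>cm_iter G k\<^esub> cm_face G i k b"
  proof (cases i)
    case 0
    then show ?thesis unfolding ab' using I.mset_prod_union[OF m(2,4)] by (simp add: m cm_counit_def)
  next
    case (Suc j)
    then obtain l where "k = Suc l" using i by (cases k) auto
    then show ?thesis unfolding ab' Suc by (simp add: m cm_iter.simps(2) free_cmon_def)
  qed
qed

lemma cm_res_face:
  assumes i: "i \<le> Suc n"
  shows cm_res_face_gmod: "gmod_map G id (cm_gmod G (Suc n)) (cm_gmod G n) (\<lambda>x. cm_res_face G x n i)"
    and cm_res_face_class: "x \<in> carrier G \<Longrightarrow> (u, y) \<in> cm_gens G (Suc n) x \<Longrightarrow>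
      cm_res_face G x n i (cm_class G (Suc n) x (u, y)) = cm_class G n x (u, cm_face G i (Suc n) y)"
    and cm_res_face_elt: "x \<in> carrier G \<Longrightarrow> Poly_Mapping.keys p \<subseteq> cm_gens G (Suc n) x \<Longrightarrow>
      cm_res_face G x n i (cm_elt (Suc n) x p) = cm_elt n x (frag_extend (\<lambda>(u, y). frag_of (u, cm_face G i (Suc n) y)) p)"
proof -
  have d: "nested_degree G (cm_face G i (Suc n) t) = id (nested_degree G t)"
    if "t \<in> carrier (cm_iter G (Suc (Suc n)))" for t
    using nested_degree_face[OF i that] by simp
  note m = cm_Ab_map[where g = id and f = "cm_face G i (Suc n)", OF comm_monoid_axioms comm_monoid_axioms id_hom cm_face_hom[OF i] d]
  show "gmod_map G id (cm_gmod G (Suc n)) (cm_gmod G n) (\<lambda>x. cm_res_face G x n i)"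
    using m(1) by (simp add: cm_res_face_def)
  show "x \<in> carrier G \<Longrightarrow> (u, y) \<in> cm_gens G (Suc n) x \<Longrightarrow>
      cm_res_face G x n i (cm_class G (Suc n) x (u, y)) = cm_class G n x (u, cm_face G i (Suc n) y)"
    using m(2)[of x u y] by (simp add: cm_res_face_def)
  show "x \<in> carrier G \<Longrightarrow> Poly_Mapping.keys p \<subseteq> cm_gens G (Suc n) x \<Longrightarrow>
      cm_res_face G x n i (cm_elt (Suc n) x p) = cm_elt n x (frag_extend (\<lambda>(u, y). frag_of (u, cm_face G i (Suc n) y)) p)"
    using m(3)[of x p] by (simp add: cm_res_face_def)
qed

lemma gface_poly_map: "\<exists>g. gface i (Suc k) = poly_map g"
  by (cases i) (auto simp: fun_eq_iff)

lemma htpy_poly_map: "\<exists>g. htpy X j n = poly_map g"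
  by (cases j) (auto simp: fun_eq_iff)

lemma ca_gens_face:
  "i \<le> Suc n \<Longrightarrow> (u, a, v, b) \<in> ca_gens G (Suc n) x \<Longrightarrow> (u, a, v, gface i (Suc n) b) \<in> ca_gens G n x"
  using gface_closed[of i "Suc n" v b] by (simp add: ca_gens_iff)

lemma ca_gens_htpy:
  "j \<le> n \<Longrightarrow> (u, a, v, b) \<in> ca_gens G n x \<Longrightarrow> (u, a, v, htpy G j n b) \<in> ca_gens G (Suc n) x"
  using htpy_closed[of j n v b] by (simp add: ca_gens_iff)

lemma ca_res_face:
  assumes i: "i \<le> Suc n"
  shows ca_res_face_gmod: "gmod_map G id (ca_res G (zring G) (Suc n)) (ca_res G (zring G) n) (\<lambda>x. ca_res_face G (zring G) x n i)"
    and ca_res_face_class: "x \<in> carrier G \<Longrightarrow> (u, a, v, b) \<in> ca_gens G (Suc n) x \<Longrightarrow>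
      ca_res_face G (zring G) x n i (ca_class G (Suc n) x (u, a, v, b)) = ca_class G n x (u, a, v, gface i (Suc n) b)"
proof -
  obtain g where g: "gface i (Suc n) = (poly_map g :: ('x, int) gnested \<Rightarrow> ('x, int) gnested)" using gface_poly_map by blast
  have eq: "ca_face G (zring G) i (Suc n) v t = poly_map g t" if "v \<in> carrier G" "t \<in> gel G (Suc (Suc n)) v" for v t
    using ca_face_eq[OF i that] g by simp
  have cl: "poly_map g t \<in> gel G (Suc n) v" if "v \<in> carrier G" "t \<in> gel G (Suc (Suc n)) v" for v t
    using gface_closed[OF i that] g by simp
  have aug: "gaug (Suc n) (poly_map g t) = gaug (Suc (Suc n)) t"
    if "v \<in> carrier G" "t \<in> gel G (Suc (Suc n)) v" for v t
    using gaug_gface[OF i that(2)] g by simp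
  note m = ca_Ab_map[where X = G and X' = G and g = id and h = "\<lambda>_. id" and f = "ca_face G (zring G) i (Suc n)" and G = g
      and k = "Suc n" and k' = n]
  have "gmod_map G id (ca_res G (zring G) (Suc n)) (ca_res G (zring G) n) (\<lambda>x. ca_Ab_map G (zring G)
      (ca_iter G (zring G) (Suc n)) (ca_aug G (zring G) (Suc n)) id (\<lambda>_. id) (ca_face G (zring G) i (Suc n)) (id x))"
    by (rule m(1)) (simp_all add: comm_monoid_axioms id_hom cl eq aug)
  then show "gmod_map G id (ca_res G (zring G) (Suc n)) (ca_res G (zring G) n) (\<lambda>x. ca_res_face G (zring G) x n i)"
    by (simp add: ca_res_face_def)
  show "ca_res_face G (zring G) x n i (ca_class G (Suc n) x (u, a, v, b)) = ca_class G n x (u, a, v, gface i (Suc n) b)"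
    if "x \<in> carrier G" "(u, a, v, b) \<in> ca_gens G (Suc n) x"
  proof -
    have "ca_Ab_map G (zring G) (ca_iter G (zring G) (Suc n)) (ca_aug G (zring G) (Suc n)) id (\<lambda>_. id)
        (ca_face G (zring G) i (Suc n)) (id x) (ca_class G (Suc n) x (u, a, v, b)) =
        ca_class G n (id x) (id u, a, id v, ca_face G (zring G) i (Suc n) v b)"
      by (rule m(2)[OF _ _ _ _ _ _ _ that]) (simp_all add: comm_monoid_axioms id_hom cl eq aug)
    then show ?thesis
      using that ca_face_eq[OF i, of v b] by (simp add: ca_gens_iff ca_res_face_def)
  qed
qed

lemma res_htpy:
  assumes j: "j \<le> n"
  shows res_htpy_gmod: "gmod_map G id (ca_res G (zring G) n) (ca_res G (zring G) (Suc n)) (res_htpy G n j)"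
    and res_htpy_class: "x \<in> carrier G \<Longrightarrow> (u, a, v, b) \<in> ca_gens G n x \<Longrightarrow>
      res_htpy G n j x (ca_class G n x (u, a, v, b)) = ca_class G (Suc n) x (u, a, v, htpy G j n b)"
proof -
  obtain g where g: "htpy G j n = poly_map g" using htpy_poly_map by blast
  have eq: "htpy G j n t = poly_map g t" for t using g by simp
  have cl: "htpy G j n t \<in> gel G (Suc (Suc n)) (id v)" if "v \<in> carrier G" "t \<in> gel G (Suc n) v" for v t
    using htpy_closed[OF j that] by simp
  have aug: "gaug (Suc (Suc n)) (htpy G j n t) = gaug (Suc n) t"
    if "v \<in> carrier G" "t \<in> gel G (Suc n) v" for v t
    using gaug_htpy[OF j that(2)] .
  note m = ca_Ab_map[where X = G and X' = G and g = id and h = "\<lambda>_. id" and f = "\<lambda>_. htpy G j n" and G = g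
      and k = n and k' = "Suc n"]
  have "gmod_map G id (ca_res G (zring G) n) (ca_res G (zring G) (Suc n)) (\<lambda>x. ca_Ab_map G (zring G)
      (ca_iter G (zring G) (Suc (Suc n))) (ca_aug G (zring G) (Suc (Suc n))) id (\<lambda>_. id) (\<lambda>_. htpy G j n) (id x))"
    by (rule m(1)) (simp_all add: comm_monoid_axioms id_hom cl[unfolded id_apply eq] eq aug[unfolded eq])
  then show "gmod_map G id (ca_res G (zring G) n) (ca_res G (zring G) (Suc n)) (res_htpy G n j)"
    by (simp add: res_htpy_def[abs_def])
  show "res_htpy G n j x (ca_class G n x (u, a, v, b)) = ca_class G (Suc n) x (u, a, v, htpy G j n b)"
    if "x \<in> carrier G" "(u, a, v, b) \<in> ca_gens G n x"
  proof -
    have "ca_Ab_map G (zring G) (ca_iter G (zring G) (Suc (Suc n))) (ca_aug G (zring G) (Suc (Suc n))) id (\<lambda>_. id)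
        (\<lambda>_. htpy G j n) (id x) (ca_class G n x (u, a, v, b)) = ca_class G (Suc n) (id x) (id u, a, id v, htpy G j n b)"
      by (rule m(2)[OF _ _ _ _ _ _ _ that]) (simp_all add: comm_monoid_axioms id_hom cl[unfolded id_apply eq] eq aug[unfolded eq])
    then show ?thesis by (simp add: res_htpy_def)
  qed
qed

lemma simplicial_gmod_cm: "simplicial_gmod G (cm_gmod G) (cm_res_face G)"
  by (intro simplicial_gmod.intro comm_monoid_axioms pre_gmod_cm cm_res_face_gmod)

lemma simplicial_gmod_ca: "simplicial_gmod G (ca_res G (zring G)) (ca_res_face G (zring G))"
  by (intro simplicial_gmod.intro comm_monoid_axioms pre_gmod_ca ca_res_face_gmod)

lemma res_embed_face:
  assumes i: "i \<le> Suc n" and x: "x \<in> carrier G" and c: "c \<in> carrier (part (cm_gmod G (Suc n)) x)"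
  shows "res_embed G n x (cm_res_face G x n i c) = ca_res_face G (zring G) x n i (res_embed G (Suc n) x c)"
proof -
  note d = gmod_mapD(1)[OF cm_res_face_gmod[OF i] x, unfolded id_apply]
    and e = gmod_mapD(1)[OF ca_res_face_gmod[OF i] x, unfolded id_apply]
  have "(res_embed G n x \<circ> cm_res_face G x n i) c = (ca_res_face G (zring G) x n i \<circ> res_embed G (Suc n) x) c"
  proof (rule cm_hom_eqI[OF group_ca Group.hom_compose[OF d res_embed_hom] Group.hom_compose[OF res_embed_hom e] _ c])
    fix u y assume uy: "(u, y) \<in> cm_gens G (Suc n) x"
    then have y: "y \<in> carrier (cm_iter G (Suc (Suc n)))" by (simp add: cm_gens_iff)
    have uy': "(u, cm_face G i (Suc n) y) \<in> cm_gens G n x"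
      using uy cm_face_closed[OF i y] nested_degree_face[OF i y] by (simp add: cm_gens_iff)
    have "(u, 1, nested_degree G y, embed G y) \<in> ca_gens G (Suc n) x" using res_embed_gens[OF uy] by simp
    then show "(res_embed G n x \<circ> cm_res_face G x n i) (cm_class G (Suc n) x (u, y)) =
        (ca_res_face G (zring G) x n i \<circ> res_embed G (Suc n) x) (cm_class G (Suc n) x (u, y))"
      by (simp add: cm_res_face_class[OF i x uy] res_embed_class[OF uy'] res_embed_class[OF uy] ca_res_face_class[OF i x]
          embed_face[OF i y] nested_degree_face[OF i y])
  qed
  then show ?thesis by simp
qed

lemma nested_terms_face:
  assumes i: "i \<le> Suc n" and v: "v \<in> carrier G" and b: "b \<in> gel G (Suc (Suc n)) v"
  shows "nested_terms u (lin_poly n (gface i (Suc n) b)) =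
    frag_extend (\<lambda>(u, y). frag_of (u, cm_face G i (Suc n) y)) (nested_terms u (lin_poly (Suc n) b))"
proof -
  have "nested_terms u (lin_poly n (gface i (Suc n) b)) =
      frag_extend (\<lambda>m. frag_of (u, Node (children (cm_face G i (Suc n) (Node m))))) (lin_poly (Suc n) b)"
    unfolding lin_poly_face[OF i v b] nested_terms_def
    using frag_extend_compose[of "\<lambda>m. frag_of (u, Node m)" "\<lambda>m. children (cm_face G i (Suc n) (Node m))"]
    by (simp add: o_def)
  also have "\<dots> = frag_extend (\<lambda>m. frag_of (u, cm_face G i (Suc n) (Node m))) (lin_poly (Suc n) b)"
  proof (rule frag_extend_eq)
    fix m assume "m \<in> Poly_Mapping.keys (lin_poly (Suc n) b)"
    from cm_face_closed[OF i nested_polysD(1)[OF lin_poly_closed[OF b] this]]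
    show "frag_of (u, Node (children (cm_face G i (Suc n) (Node m)))) = frag_of (u, cm_face G i (Suc n) (Node m))"
      by (auto simp: carrier_cm_iter_Suc)
  qed
  also have "\<dots> = frag_extend (\<lambda>(u, y). frag_of (u, cm_face G i (Suc n) y)) (nested_terms u (lin_poly (Suc n) b))"
    unfolding nested_terms_def
    using frag_extend_compose[of "\<lambda>(u, y). frag_of (u, cm_face G i (Suc n) y)" "\<lambda>m. (u, Node m)"]
    by (simp add: o_def)
  finally show ?thesis .
qed

lemma res_lin_face:
  assumes i: "i \<le> Suc n" and x: "x \<in> carrier G" and c: "c \<in> carrier (part (ca_res G (zring G) (Suc n)) x)"
  shows "res_lin G n x (ca_res_face G (zring G) x n i c) = cm_res_face G x n i (res_lin G (Suc n) x c)"
proof -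
  note d = gmod_mapD(1)[OF cm_res_face_gmod[OF i] x, unfolded id_apply]
    and e = gmod_mapD(1)[OF ca_res_face_gmod[OF i] x, unfolded id_apply]
  have "(res_lin G n x \<circ> ca_res_face G (zring G) x n i) c = (cm_res_face G x n i \<circ> res_lin G (Suc n) x) c"
  proof (rule ca_hom_eqI[OF group_cm Group.hom_compose[OF e res_lin_hom] Group.hom_compose[OF res_lin_hom d] _ c])
    fix u a v b assume g: "(u, a, v, b) \<in> ca_gens G (Suc n) x"
    then have *: "u \<in> carrier G" "v \<in> carrier G" "u \<otimes> v = x" "b \<in> gel G (Suc (Suc n)) v" by (auto simp: ca_gens_iff)
    show "(res_lin G n x \<circ> ca_res_face G (zring G) x n i) (ca_class G (Suc n) x (u, a, v, b)) =
        (cm_res_face G x n i \<circ> res_lin G (Suc n) x) (ca_class G (Suc n) x (u, a, v, b))"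
      using cm_res_face_elt[OF i x keys_cmul_nested_terms[OF lin_poly_closed[OF *(4)] *(1,3), of a]]
      by (simp add: ca_res_face_class[OF i x g] res_lin_class[OF g] res_lin_class[OF ca_gens_face[OF i g]]
          nested_terms_face[OF i *(2,4)] frag_extend_cmul)
  qed
  then show ?thesis by simp
qed

lemma res_lin_embed:
  assumes c: "c \<in> carrier (part (cm_gmod G n) x)"
  shows "res_lin G n x (res_embed G n x c) = c"
proof -
  have "(res_lin G n x \<circ> res_embed G n x) c = (\<lambda>c. c) c"
  proof (rule cm_hom_eqI[OF group_cm Group.hom_compose[OF res_embed_hom res_lin_hom] _ _ c])
    show "(\<lambda>c. c) \<in> hom (part (cm_gmod G n) x) (part (cm_gmod G n) x)" by (simp add: hom_def)
    fix u y assume uy: "(u, y) \<in> cm_gens G n x"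
    then obtain m where m: "y = Node m" "set_mset m \<subseteq> carrier (cm_iter G n)"
      by (auto simp: cm_gens_iff carrier_cm_iter_Suc)
    have g: "(u, 1, nested_degree G y, embed G y) \<in> ca_gens G n x" using res_embed_gens[OF uy] by simp
    have "nested_terms u (lin_poly n (embed G y)) = frag_of (u, y)"
      unfolding m(1) lin_poly_embed[OF m(2)] by (simp add: nested_terms_def)
    then show "(res_lin G n x \<circ> res_embed G n x) (cm_class G n x (u, y)) = cm_class G n x (u, y)"
      unfolding o_apply res_embed_class[OF uy] res_lin_class[OF g] by (simp add: presented_class_eq_elt)
  qed
  then show ?thesis by simp
qed

text \<open>
  The embedding of a combination of multisets is the polynomial with the corresponding monomials, and
  differentials are additive in the ring element.
\<close>

lemma res_embed_lin_class:
  assumes g: "(u, a, v, b) \<in> ca_gens G n x"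
  shows "res_embed G n x (res_lin G n x (ca_class G n x (u, a, v, b))) = ca_class G n x (u, a, v, relin G n b)"
proof -
  let ?q = "lin_poly n b"
  have *: "u \<in> carrier G" "v \<in> carrier G" "u \<otimes> v = x" "b \<in> gel G (Suc n) v" using g by (auto simp: ca_gens_iff)
  note q = lin_poly_closed[OF *(4)]
  have r: "(u, 1, v, relin G n b) \<in> ca_gens G n x"
    using * embed_poly_closed[OF q] by (simp add: ca_gens_iff relin_def gel_Suc)
  let ?t = "frag_extend (\<lambda>m. frag_of (u, 1 :: int, v, embed G (Node m))) ?q"
  have "frag_extend (\<lambda>(u, y). frag_of (u, 1, nested_degree G y, embed G y)) (nested_terms u ?q) =
      frag_extend (\<lambda>m. frag_of (u, 1, nested_degree G (Node m), embed G (Node m))) ?q"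
    unfolding nested_terms_def
    using frag_extend_compose[of "\<lambda>(u, y). frag_of (u, 1, nested_degree G y, embed G y)" "\<lambda>m. (u, Node m)"]
    by (simp add: o_def del: embed.simps nested_degree.simps)
  also have "\<dots> = ?t"
    by (rule frag_extend_eq) (simp only: nested_polysD(2)[OF q])
  finally have t: "frag_extend (\<lambda>(u, y). frag_of (u, 1, nested_degree G y, embed G y)) (nested_terms u ?q) = ?t" .
  have "Poly_Mapping.keys ?t \<subseteq> ca_gens G n x"
  proof
    fix s assume "s \<in> Poly_Mapping.keys ?t"
    then obtain m where m: "m \<in> Poly_Mapping.keys ?q" "s = (u, 1, v, embed G (Node m))"
      using keys_frag_extend[of "\<lambda>m. frag_of (u, 1, v, embed G (Node m))" ?q] by auto
    have "embed G (Node m) \<in> gel G (Suc n) v"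
      using embed_closed[OF nested_polysD(1)[OF q m(1)]] nested_polysD(2)[OF q m(1)] by simp
    then show "s \<in> ca_gens G n x" using * m by (simp add: ca_gens_iff del: embed.simps)
  qed
  from presented_elt_cmul[OF ca_rels_closed this, of a]
  have "ca_elt n x (frag_cmul a ?t) = ca_class G n x (u, a, v, relin G n b)"
    using ca_class_embed_poly[OF *(1-3) q] ca_class_coeff[OF r, of a] by (simp add: part_ca_res relin_def)
  then show ?thesis
    using res_embed_elt[OF keys_cmul_nested_terms[OF q *(1,3), of a]]
    by (simp add: res_lin_class[OF g] frag_extend_cmul t)
qed

text \<open>
  All identities are checked on generators, where they are those of \<open>embed\<close>, \<open>lin\<close> and \<open>htpy\<close>.
\<close>

theorem gmod_retract:
  "gmod_retract G (cm_gmod G) (cm_res_face G) (ca_res G (zring G)) (ca_res_face G (zring G))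
    (res_embed G) (res_lin G) (res_htpy G)"
proof -
  let ?A = "zring G"
  let ?Q = "\<lambda>n x. part (ca_res G ?A n) x" and ?e = "ca_res_face G ?A"
  have I: "simplicial_gmod_map G (cm_gmod G) (cm_res_face G) G (ca_res G ?A) ?e id (res_embed G)"
    by (intro simplicial_gmod_map.intro simplicial_gmod_map_axioms.intro simplicial_gmod_cm simplicial_gmod_ca
        id_hom res_embed_gmod) (simp add: res_embed_face)
  have R: "simplicial_gmod_map G (ca_res G ?A) ?e G (cm_gmod G) (cm_res_face G) id (res_lin G)"
    by (intro simplicial_gmod_map.intro simplicial_gmod_map_axioms.intro simplicial_gmod_cm simplicial_gmod_ca
        id_hom res_lin_gmod) (simp add: res_lin_face)
  have e: "?e x n i \<in> hom (?Q (Suc n) x) (?Q n x)" if "i \<le> Suc n" "x \<in> carrier G" for x n i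
    using gmod_mapD(1)[OF ca_res_face_gmod[OF that(1)] that(2)] by simp
  have h: "res_htpy G n j x \<in> hom (?Q n x) (?Q (Suc n) x)" if "j \<le> n" "x \<in> carrier G" for x n j
    using gmod_mapD(1)[OF res_htpy_gmod[OF that(1)] that(2)] by simp
  note comp = Group.hom_compose
  note classes = ca_res_face_class ca_gens_face res_htpy_class ca_gens_htpy
  have id_Q: "(\<lambda>c. c) \<in> hom (?Q n x) (?Q n x)" for n x by (simp add: hom_def)
  show ?thesis
  proof (intro gmod_retract.intro gmod_retract_axioms.intro I R, goal_cases)
    case (1 x b n)
    then show ?case by (simp add: res_lin_embed)
  next
    case (2 j n)
    then show ?case by (rule res_htpy_gmod)
  next
    case (3 x c n)
    have "(?e x n 0 \<circ> res_htpy G n 0 x) c = (res_embed G n x \<circ> res_lin G n x) c"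
    proof (rule ca_hom_eqI[OF group_ca comp[OF h e] comp[OF res_lin_hom res_embed_hom] _ 3(2)])
      fix u a v b assume g: "(u, a, v, b) \<in> ca_gens G n x"
      show "(?e x n 0 \<circ> res_htpy G n 0 x) (ca_class G n x (u, a, v, b)) =
          (res_embed G n x \<circ> res_lin G n x) (ca_class G n x (u, a, v, b))"
        using gface_0_htpy[of n G b] g 3(1)
        by (simp add: classes res_embed_lin_class del: gface.simps htpy.simps)
    qed (use 3 in simp_all)
    then show ?case by simp
  next
    case (4 x c n)
    have "(?e x n (Suc n) \<circ> res_htpy G n n x) c = (\<lambda>c. c) c"
    proof (rule ca_hom_eqI[OF group_ca comp[OF h e] id_Q _ 4(2)])
      fix u a v b assume g: "(u, a, v, b) \<in> ca_gens G n x"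
      have "gface (Suc n) (Suc n) (htpy G n n b) = b"
        using gface_last_htpy[of v b n] g by (simp add: ca_gens_iff)
      then show "(?e x n (Suc n) \<circ> res_htpy G n n x) (ca_class G n x (u, a, v, b)) = ca_class G n x (u, a, v, b)"
        using g 4(1) by (simp add: classes del: gface.simps htpy.simps)
    qed (use 4 in simp_all)
    then show ?case by simp
  next
    case (5 x i j n c)
    then obtain k where k: "n = Suc k" "i \<le> Suc k" "j - 1 \<le> k" by (cases n) auto
    have "(?e x n i \<circ> res_htpy G n j x) c = (res_htpy G k (j - 1) x \<circ> ?e x k i) c"
    proof (rule ca_hom_eqI[OF group_ca comp[OF h e] comp[OF e[OF k(2) 5(1)] h[OF k(3) 5(1)], folded k(1)] _ 5(4)])
      fix u a v b assume g: "(u, a, v, b) \<in> ca_gens G n x"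
      have eq: "gface i (Suc n) (htpy G j n b) = htpy G (j - 1) k (gface i n b)"
        using gface_htpy_less[of i j n v b] g 5 k by (simp add: ca_gens_iff)
      have g': "(u, a, v, b) \<in> ca_gens G (Suc k) x" using g k by simp
      have "res_htpy G k (j - 1) x (?e x k i (ca_class G n x (u, a, v, b))) = ca_class G n x (u, a, v, htpy G (j - 1) k (gface i n b))"
        unfolding k(1) by (simp only: ca_res_face_class[OF k(2) 5(1) g'] res_htpy_class[OF k(3) 5(1) ca_gens_face[OF k(2) g']])
      moreover have "?e x n i (res_htpy G n j x (ca_class G n x (u, a, v, b))) = ca_class G n x (u, a, v, gface i (Suc n) (htpy G j n b))"
        using 5 g k by (simp add: classes del: gface.simps htpy.simps)
      ultimately show "(?e x n i \<circ> res_htpy G n j x) (ca_class G n x (u, a, v, b)) =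
          (res_htpy G k (j - 1) x \<circ> ?e x k i) (ca_class G n x (u, a, v, b))"
        by (simp add: eq)
    qed (use 5 in simp_all)
    then show ?case by (simp add: k(1))
  next
    case (6 x j n c)
    have "(?e x n (Suc j) \<circ> res_htpy G n j x) c = (?e x n (Suc j) \<circ> res_htpy G n (Suc j) x) c"
    proof (rule ca_hom_eqI[OF group_ca comp[OF h e] comp[OF h e] _ 6(3)])
      fix u a v b assume g: "(u, a, v, b) \<in> ca_gens G n x"
      have "gface (Suc j) (Suc n) (htpy G j n b) = gface (Suc j) (Suc n) (htpy G (Suc j) n b)"
        using gface_htpy_middle[of j n v b] g 6 by (simp add: ca_gens_iff)
      then show "(?e x n (Suc j) \<circ> res_htpy G n j x) (ca_class G n x (u, a, v, b)) =
          (?e x n (Suc j) \<circ> res_htpy G n (Suc j) x) (ca_class G n x (u, a, v, b))"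
        using g 6 by (simp add: classes del: gface.simps htpy.simps)
    qed (use 6 in simp_all)
    then show ?case by simp
  next
    case (7 x j i n c)
    then obtain k where k: "n = Suc k" "i - 1 \<le> Suc k" "j \<le> k" by (cases n) auto
    have "(?e x n i \<circ> res_htpy G n j x) c = (res_htpy G k j x \<circ> ?e x k (i - 1)) c"
    proof (rule ca_hom_eqI[OF group_ca comp[OF h e] comp[OF e[OF k(2) 7(1)] h[OF k(3) 7(1)], folded k(1)] _ 7(4)])
      fix u a v b assume g: "(u, a, v, b) \<in> ca_gens G n x"
      have eq: "gface i (Suc n) (htpy G j n b) = htpy G j k (gface (i - 1) n b)"
        using gface_htpy_greater[of j i n v b] g 7 k by (simp add: ca_gens_iff)
      have g': "(u, a, v, b) \<in> ca_gens G (Suc k) x" using g k by simp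
      have "res_htpy G k j x (?e x k (i - 1) (ca_class G n x (u, a, v, b))) = ca_class G n x (u, a, v, htpy G j k (gface (i - 1) n b))"
        unfolding k(1) by (simp only: ca_res_face_class[OF k(2) 7(1) g'] res_htpy_class[OF k(3) 7(1) ca_gens_face[OF k(2) g']])
      moreover have "?e x n i (res_htpy G n j x (ca_class G n x (u, a, v, b))) = ca_class G n x (u, a, v, gface i (Suc n) (htpy G j n b))"
        using 7 g k by (simp add: classes del: gface.simps htpy.simps)
      ultimately show "(?e x n i \<circ> res_htpy G n j x) (ca_class G n x (u, a, v, b)) =
          (res_htpy G k j x \<circ> ?e x k (i - 1)) (ca_class G n x (u, a, v, b))"
        by (simp add: eq)
    qed (use 7 k in simp_all)
    then show ?case by (simp add: k(1))
  qed
qed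

end

section \<open>Naturality in the monoid\<close>

context
  fixes X :: "'x monoid" and X' :: "'y monoid" and f :: "'x \<Rightarrow> 'y"
  assumes X: "comm_monoid X" and X': "comm_monoid X'" and f: "f \<in> hom X X'" "f \<one>\<^bsub>X\<^esub> = \<one>\<^bsub>X'\<^esub>"
begin

interpretation X: grading_monoid X using X ..
interpretation X': grading_monoid X' using X' ..

lemma map_nested_closed: "t \<in> carrier (cm_iter X k) \<Longrightarrow> map_nested f t \<in> carrier (cm_iter X' k)"
proof (induction k arbitrary: t)
  case 0
  then show ?case using hom_in_carrier[OF f(1)] by (auto simp: cm_iter.simps(1))
next
  case (Suc k)
  then obtain m where m: "t = Node m" "set_mset m \<subseteq> carrier (cm_iter X k)" by (auto simp: carrier_cm_iter_Suc)
  then have "map_nested f ` set_mset m \<subseteq> carrier (cm_iter X' k)" using Suc.IH by blast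
  then show ?case by (simp add: m(1) carrier_cm_iter_Suc)
qed

lemma map_nested_hom:
  "map_nested f \<in> hom (cm_iter X k) (cm_iter X' k)" "map_nested f \<one>\<^bsub>cm_iter X k\<^esub> = \<one>\<^bsub>cm_iter X' k\<^esub>"
proof -
  show "map_nested f \<in> hom (cm_iter X k) (cm_iter X' k)"
  proof (rule homI)
    fix a b assume "a \<in> carrier (cm_iter X k)" "b \<in> carrier (cm_iter X k)"
    then show "map_nested f (a \<otimes>\<^bsub>cm_iter X k\<^esub> b) = map_nested f a \<otimes>\<^bsub>cm_iter X' k\<^esub> map_nested f b"
      by (cases k) (auto simp: cm_iter.simps free_cmon_def hom_mult[OF f(1)])
  qed (rule map_nested_closed)
  show "map_nested f \<one>\<^bsub>cm_iter X k\<^esub> = \<one>\<^bsub>cm_iter X' k\<^esub>"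
    by (cases k) (simp_all add: cm_iter.simps free_cmon_def f)
qed

lemma nested_degree_map: "t \<in> carrier (cm_iter X k) \<Longrightarrow> nested_degree X' (map_nested f t) = f (nested_degree X t)"
proof (induction k arbitrary: t)
  case 0
  then show ?case by (auto simp: cm_iter.simps(1))
next
  case (Suc k)
  then obtain m where m: "t = Node m" "set_mset m \<subseteq> carrier (cm_iter X k)" by (auto simp: carrier_cm_iter_Suc)
  have "set_mset (image_mset (nested_degree X) m) \<subseteq> carrier X" using m(2) X.nested_degree_closed by auto
  from mset_prod_hom[OF X X' f this] have "f (nested_degree X t) = mset_prod X' (image_mset (\<lambda>z. f (nested_degree X z)) m)"
    by (simp add: m image_mset.compositionality o_def)
  also have "image_mset (\<lambda>z. f (nested_degree X z)) m = image_mset (\<lambda>z. nested_degree X' (map_nested f z)) m"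
    by (rule image_mset_cong) (use Suc.IH m(2) in auto)
  finally show ?case by (simp add: m image_mset.compositionality o_def)
qed

lemma cm_face_map:
  "i \<le> k \<Longrightarrow> t \<in> carrier (cm_iter X (Suc k)) \<Longrightarrow> cm_face X' i k (map_nested f t) = map_nested f (cm_face X i k t)"
proof (induction i arbitrary: k t)
  case 0
  then obtain m where m: "t = Node m" "set_mset m \<subseteq> carrier (cm_iter X k)" by (auto simp: carrier_cm_iter_Suc)
  show ?case
    using mset_prod_hom[OF comm_monoid_cm_iter[OF X] comm_monoid_cm_iter[OF X'] map_nested_hom m(2)]
    by (simp add: m(1) cm_counit_def)
next
  case (Suc i)
  then obtain m j where m: "t = Node m" "set_mset m \<subseteq> carrier (cm_iter X k)" "k = Suc j" "i \<le> j"
    by (cases k) (auto simp: carrier_cm_iter_Suc)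
  have "image_mset (\<lambda>z. cm_face X' i j (map_nested f z)) m = image_mset (\<lambda>z. map_nested f (cm_face X i j z)) m"
    by (rule image_mset_cong) (use Suc.IH[OF m(4)] m in auto)
  then show ?case by (simp add: m image_mset.compositionality o_def)
qed

abbreviation iter_map :: "nat \<Rightarrow> 'x \<Rightarrow> ('x, int) gnested \<Rightarrow> ('y, int) gnested" where
  "iter_map \<equiv> ca_iter_map f (graded_monoid_ring_map f)"

lemma iter_map_Suc: "iter_map (Suc k) x t = poly_map (\<lambda>(y, s). var (f y, iter_map k y s)) t"
  by (simp add: gpoly_map_eq)

lemma iter_map_closed: "x \<in> carrier X \<Longrightarrow> t \<in> gel X k x \<Longrightarrow> iter_map k x t \<in> gel X' k (f x)"
proof (induction k arbitrary: x t)
  case 0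
  then show ?case by (simp add: gel_0 graded_monoid_ring_map_def)
next
  case (Suc k)
  show ?case
    unfolding iter_map_Suc
  proof (rule gvars_poly_map_closed[OF X X' f Suc.prems(2)])
    fix y s assume "y \<in> carrier X" "s \<in> gel X k y"
    then show "(\<lambda>(y, s). var (f y, iter_map k y s)) (y, s) \<in> homog_polys X' (gvars X' k) fst (f y)"
      using X'.gvar_homog[OF hom_in_carrier[OF f(1)] Suc.IH] by simp
  qed
qed

lemma gaug_iter_map: "x \<in> carrier X \<Longrightarrow> t \<in> gel X k x \<Longrightarrow> gaug k (iter_map k x t) = gaug k t"
proof (induction k arbitrary: x t)
  case 0
  then show ?case by (simp add: graded_monoid_ring_map_def gaug.simps)
next
  case (Suc k)
  have "poly_subst (\<lambda>v. poly_subst (\<lambda>(y, s). gaug k s) ((\<lambda>(y, s). var (f y, iter_map k y s)) v)) (unGPoly t) =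
      poly_subst (\<lambda>(y, s). gaug k s) (unGPoly t)"
    by (rule poly_subst_cong) (use X.gel_varD[OF Suc.prems(2)] Suc.IH in auto)
  then show ?case unfolding iter_map_Suc gaug.simps unGPoly_poly_map poly_subst_subst .
qed

lemma gface_iter_map:
  "i \<le> k \<Longrightarrow> x \<in> carrier X \<Longrightarrow> t \<in> gel X (Suc k) x \<Longrightarrow> gface i k (iter_map (Suc k) x t) = iter_map k x (gface i k t)"
proof (induction i arbitrary: k x t)
  case 0
  show ?case
  proof (cases k)
    case k: 0
    show ?thesis by (simp add: k gpoly_map_eq poly_subst_subst case_prod_unfold graded_monoid_ring_map_def)
  next
    case (Suc j)
    show ?thesis unfolding Suc iter_map_Suc
      by (simp add: poly_map_poly_map case_prod_unfold gpoly_map_eq)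
  qed
next
  case (Suc i)
  then obtain j where j: "k = Suc j" "i \<le> j" by (cases k) auto
  have "poly_map (\<lambda>(y, s). var (f y, gface i j (iter_map (Suc j) y s))) t = poly_map (\<lambda>(y, s). var (f y, iter_map j y (gface i j s))) t"
    by (rule X.poly_map_cong[OF Suc.prems(3)]) (use Suc.IH[OF j(2)] j(1) in \<open>simp del: ca_iter_map.simps\<close>)
  then show ?case
    unfolding j(1) iter_map_Suc[of "Suc j"] iter_map_Suc[of j] gface.simps
    by (simp add: poly_map_poly_map case_prod_unfold iter_map_Suc del: ca_iter_map.simps gface.simps)
qed

text \<open>
  The embedding makes no choices, so that it commutes with the maps that \<open>f\<close> induces on both sides.
  This is the source of all naturality statements.
\<close>

lemma embed_map_nested:
  "t \<in> carrier (cm_iter X k) \<Longrightarrow> embed X' (map_nested f t) = iter_map k (nested_degree X t) (embed X t)"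
proof (induction k arbitrary: t)
  case 0
  then show ?case by (auto simp: cm_iter.simps(1) graded_monoid_ring_map_def)
next
  case (Suc k)
  then obtain m where m: "t = Node m" "set_mset m \<subseteq> carrier (cm_iter X k)" by (auto simp: carrier_cm_iter_Suc)
  have "image_mset (\<lambda>z. (nested_degree X' (map_nested f z), embed X' (map_nested f z))) m =
      image_mset (\<lambda>z. (f (nested_degree X z), iter_map k (nested_degree X z) (embed X z))) m"
    by (rule image_mset_cong) (use nested_degree_map Suc.IH m(2) in auto)
  then show ?case
    unfolding iter_map_Suc
    by (simp add: m poly_map_def image_mset.compositionality o_def prod_mset_var)
qed

lemma cm_res_map:
  shows cm_res_map_gmod: "gmod_map X f (cm_gmod X n) (cm_gmod X' n) (cm_res_map X' f n)"
    and cm_res_map_class: "x \<in> carrier X \<Longrightarrow> (u, y) \<in> cm_gens X n x \<Longrightarrow>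
      cm_res_map X' f n x (cm_class X n x (u, y)) = cm_class X' n (f x) (f u, map_nested f y)"
proof -
  note m = cm_Ab_map[where g = f and f = "map_nested f", OF X X' f(1) map_nested_hom(1) nested_degree_map]
  show "gmod_map X f (cm_gmod X n) (cm_gmod X' n) (cm_res_map X' f n)"
    using m(1) by (simp add: cm_res_map_def[abs_def])
  show "x \<in> carrier X \<Longrightarrow> (u, y) \<in> cm_gens X n x \<Longrightarrow>
      cm_res_map X' f n x (cm_class X n x (u, y)) = cm_class X' n (f x) (f u, map_nested f y)"
    using m(2) by (simp add: cm_res_map_def)
qed

abbreviation zca_res_map where
  "zca_res_map n \<equiv> ca_res_map X' (zring X') f (graded_monoid_ring_map f) n"

lemma ca_res_map:
  shows ca_res_map_gmod: "gmod_map X f (ca_res X (zring X) n) (ca_res X' (zring X') n) (zca_res_map n)"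
    and ca_res_map_class: "x \<in> carrier X \<Longrightarrow> (u, a, v, b) \<in> ca_gens X n x \<Longrightarrow>
      zca_res_map n x (ca_class X n x (u, a, v, b)) = ca_class X' n (f x) (f u, a, f v, iter_map (Suc n) v b)"
proof -
  have h: "graded_monoid_ring_map f u a = a" for u a by (simp add: graded_monoid_ring_map_def)
  note m = ca_Ab_map[where X = X and X' = X' and g = f and h = "graded_monoid_ring_map f" and f = "iter_map (Suc n)"
      and G = "\<lambda>(y, s). var (f y, iter_map n y s)" and k = n and k' = n, OF X X' f(1)]
  show "gmod_map X f (ca_res X (zring X) n) (ca_res X' (zring X') n) (zca_res_map n)"
    unfolding ca_res_map_def[abs_def]
    by (rule m(1)[OF h iter_map_closed iter_map_Suc gaug_iter_map])
  show "zca_res_map n x (ca_class X n x (u, a, v, b)) = ca_class X' n (f x) (f u, a, f v, iter_map (Suc n) v b)"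
    if "x \<in> carrier X" "(u, a, v, b) \<in> ca_gens X n x"
    unfolding ca_res_map_def[abs_def]
    by (rule m(2)[OF h iter_map_closed iter_map_Suc gaug_iter_map that])
qed

lemma cm_res_map_simplicial:
  "simplicial_gmod_map X (cm_gmod X) (cm_res_face X) X' (cm_gmod X') (cm_res_face X') f (cm_res_map X' f)"
proof (intro simplicial_gmod_map.intro simplicial_gmod_map_axioms.intro X.simplicial_gmod_cm X'.simplicial_gmod_cm f(1) cm_res_map_gmod)
  fix i n x c assume i: "i \<le> Suc n" and x: "x \<in> carrier X" and c: "c \<in> carrier (part (cm_gmod X (Suc n)) x)"
  note fx = hom_in_carrier[OF f(1) x]
  note d = gmod_mapD(1)[OF X.cm_res_face_gmod[OF i] x, unfolded id_apply]
    and d' = gmod_mapD(1)[OF X'.cm_res_face_gmod[OF i] fx, unfolded id_apply]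
    and g = gmod_mapD(1)[OF cm_res_map_gmod x]
  have "(cm_res_map X' f n x \<circ> cm_res_face X x n i) c = (cm_res_face X' (f x) n i \<circ> cm_res_map X' f (Suc n) x) c"
  proof (rule X.cm_hom_eqI[OF X'.group_cm Group.hom_compose[OF d g] Group.hom_compose[OF g d'] _ c])
    fix u y assume uy: "(u, y) \<in> cm_gens X (Suc n) x"
    then have y: "y \<in> carrier (cm_iter X (Suc (Suc n)))" and u: "u \<in> carrier X" "u \<otimes>\<^bsub>X\<^esub> nested_degree X y = x"
      by (simp_all add: X.cm_gens_iff)
    have 1: "(u, cm_face X i (Suc n) y) \<in> cm_gens X n x"
      using uy X.cm_face_closed[OF i y] X.nested_degree_face[OF i y] by (simp add: X.cm_gens_iff)
    have 2: "(f u, map_nested f y) \<in> cm_gens X' (Suc n) (f x)"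
      using u hom_in_carrier[OF f(1)] map_nested_closed[OF y] nested_degree_map[OF y] hom_mult[OF f(1) u(1) X.nested_degree_closed[OF y]]
      by (simp add: X'.cm_gens_iff)
    show "(cm_res_map X' f n x \<circ> cm_res_face X x n i) (cm_class X (Suc n) x (u, y)) =
        (cm_res_face X' (f x) n i \<circ> cm_res_map X' f (Suc n) x) (cm_class X (Suc n) x (u, y))"
      by (simp only: o_apply X.cm_res_face_class[OF i x uy] cm_res_map_class[OF x 1] cm_res_map_class[OF x uy]
          X'.cm_res_face_class[OF i fx 2] cm_face_map[OF i y])
  qed
  then show "cm_res_map X' f n x (cm_res_face X x n i c) = cm_res_face X' (f x) n i (cm_res_map X' f (Suc n) x c)"
    by simp
qed

lemma ca_res_map_simplicial:
  "simplicial_gmod_map X (ca_res X (zring X)) (ca_res_face X (zring X)) X' (ca_res X' (zring X')) (ca_res_face X' (zring X'))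
    f zca_res_map"
proof (intro simplicial_gmod_map.intro simplicial_gmod_map_axioms.intro X.simplicial_gmod_ca X'.simplicial_gmod_ca f(1) ca_res_map_gmod)
  fix i n x c assume i: "i \<le> Suc n" and x: "x \<in> carrier X" and c: "c \<in> carrier (part (ca_res X (zring X) (Suc n)) x)"
  note fx = hom_in_carrier[OF f(1) x]
  note e = gmod_mapD(1)[OF X.ca_res_face_gmod[OF i] x, unfolded id_apply]
    and e' = gmod_mapD(1)[OF X'.ca_res_face_gmod[OF i] fx, unfolded id_apply]
    and g = gmod_mapD(1)[OF ca_res_map_gmod x]
  have "(zca_res_map n x \<circ> ca_res_face X (zring X) x n i) c = (ca_res_face X' (zring X') (f x) n i \<circ> zca_res_map (Suc n) x) c"
  proof (rule X.ca_hom_eqI[OF X'.group_ca Group.hom_compose[OF e g] Group.hom_compose[OF g e'] _ c])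
    fix u a v b assume ub: "(u, a, v, b) \<in> ca_gens X (Suc n) x"
    then have u: "u \<in> carrier X" "v \<in> carrier X" "u \<otimes>\<^bsub>X\<^esub> v = x" "b \<in> gel X (Suc (Suc n)) v"
      by (simp_all add: X.ca_gens_iff)
    have 2: "(f u, a, f v, iter_map (Suc (Suc n)) v b) \<in> ca_gens X' (Suc n) (f x)"
      using u hom_in_carrier[OF f(1)] iter_map_closed[OF u(2,4)] hom_mult[OF f(1) u(1,2)]
      by (simp add: X'.ca_gens_iff del: ca_iter_map.simps)
    show "(zca_res_map n x \<circ> ca_res_face X (zring X) x n i) (ca_class X (Suc n) x (u, a, v, b)) =
        (ca_res_face X' (zring X') (f x) n i \<circ> zca_res_map (Suc n) x) (ca_class X (Suc n) x (u, a, v, b))"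
      by (simp only: o_apply X.ca_res_face_class[OF i x ub] ca_res_map_class[OF x X.ca_gens_face[OF i ub]] ca_res_map_class[OF x ub]
          X'.ca_res_face_class[OF i fx 2] gface_iter_map[OF i u(2,4)])
  qed
  then show "zca_res_map n x (ca_res_face X (zring X) x n i c) = ca_res_face X' (zring X') (f x) n i (zca_res_map (Suc n) x c)"
    by simp
qed

lemma res_embed_natural:
  assumes x: "x \<in> carrier X" and c: "c \<in> carrier (part (cm_gmod X n) x)"
  shows "res_embed X' n (f x) (cm_res_map X' f n x c) = zca_res_map n x (res_embed X n x c)"
proof -
  note g = gmod_mapD(1)[OF cm_res_map_gmod x] and g' = gmod_mapD(1)[OF ca_res_map_gmod x]
  have "(res_embed X' n (f x) \<circ> cm_res_map X' f n x) c = (zca_res_map n x \<circ> res_embed X n x) c"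
  proof (rule X.cm_hom_eqI[OF X'.group_ca Group.hom_compose[OF g X'.res_embed_hom] Group.hom_compose[OF X.res_embed_hom g'] _ c])
    fix u y assume uy: "(u, y) \<in> cm_gens X n x"
    then have y: "y \<in> carrier (cm_iter X (Suc n))" and u: "u \<in> carrier X" "u \<otimes>\<^bsub>X\<^esub> nested_degree X y = x"
      by (simp_all add: X.cm_gens_iff)
    have 1: "(u, 1, nested_degree X y, embed X y) \<in> ca_gens X n x" using X.res_embed_gens[OF uy] by simp
    have 2: "(f u, map_nested f y) \<in> cm_gens X' n (f x)"
      using u hom_in_carrier[OF f(1)] map_nested_closed[OF y] nested_degree_map[OF y] hom_mult[OF f(1) u(1) X.nested_degree_closed[OF y]]
      by (simp add: X'.cm_gens_iff)
    show "(res_embed X' n (f x) \<circ> cm_res_map X' f n x) (cm_class X n x (u, y)) = (zca_res_map n x \<circ> res_embed X n x) (cm_class X n x (u, y))"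
      by (simp only: o_apply X.res_embed_class[OF uy] cm_res_map_class[OF x uy] X'.res_embed_class[OF 2] ca_res_map_class[OF x 1]
          nested_degree_map[OF y] embed_map_nested[OF y])
  qed
  then show ?thesis by simp
qed

end

section \<open>Beck modules as modules over the graded monoid ring\<close>

lemma part_left_beck_gmod [simp]: "part (left_beck_gmod X N) = part N"
  by (simp add: left_beck_gmod_def)

lemma part_right_beck_gmod [simp]: "part (right_beck_gmod M) = part M"
  by (simp add: right_beck_gmod_def)

lemma part_cm_gmod_res: "part (cm_gmod X n) = part (cm_res X n)"
  by (simp add: cm_gmod_def)

context grading_monoid
begin

lemma cm_res_tr_hom: "x \<in> carrier G \<Longrightarrow> y \<in> carrier G \<Longrightarrow> tr (cm_res G n) y x \<in> hom (part (cm_res G n) x) (part (cm_res G n) (x \<otimes> y))"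
  using cm_tr_hom[of y n x] by (simp add: part_cm_gmod_res cm_res_def)

lemma act_cm_gmod_res: "act (cm_gmod G n) y x k c = tr (cm_res G n) y x c [^]\<^bsub>part (cm_res G n) (x \<otimes> y)\<^esub> k"
  by (simp add: cm_gmod_def left_beck_gmod_def)

text \<open>
  The generator of the graded monoid ring in degree \<open>y\<close> acts by transport along \<open>y\<close>, and its integer
  multiples act by powers of this. Homomorphisms of groups commute with powers.
\<close>

lemma beck_Hom_eq_zHom:
  fixes N :: "('x, 'c) beck"
  assumes N: "left_beck G N"
  shows "beck_Hom G (cm_res G n) N = zHom G (cm_gmod G n) (left_beck_gmod G N)"
proof -
  have grN: "group (part N x)" if "x \<in> carrier G" for x
    using N that by (simp add: left_beck_def comm_group_def)
  have trN: "tr N y x \<in> hom (part N x) (part N (x \<otimes> y))" if "x \<in> carrier G" "y \<in> carrier G" for x y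
    using N that by (simp add: left_beck_def)
  have grP: "group (part (cm_res G n) x)" for x
    using group_cm[of n x] by (simp add: part_cm_gmod_res)
  have "(\<forall>x\<in>carrier G. \<forall>y\<in>carrier G. \<forall>c\<in>carrier (part (cm_res G n) x).
          \<theta> (x \<otimes> y) (tr (cm_res G n) y x c) = tr N y x (\<theta> x c)) \<longleftrightarrow>
      (\<forall>x\<in>carrier G. \<forall>y\<in>carrier G. \<forall>k. \<forall>c\<in>carrier (part (cm_res G n) x).
          \<theta> (x \<otimes> y) (act (cm_gmod G n) y x k c) = act (left_beck_gmod G N) y x k (\<theta> x c))" (is "?L \<longleftrightarrow> ?R")
    if \<theta>: "\<And>x. x \<in> carrier G \<Longrightarrow> \<theta> x \<in> hom (part (cm_res G n) x) (part N x)" for \<theta> :: "'x \<Rightarrow> 'x cm_el \<Rightarrow> 'c"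
  proof
    assume L: ?L
    show ?R
    proof (intro ballI allI)
      fix x y c and k :: int
      assume xy: "x \<in> carrier G" "y \<in> carrier G" and c: "c \<in> carrier (part (cm_res G n) x)"
      have "\<theta> (x \<otimes> y) (tr (cm_res G n) y x c [^]\<^bsub>part (cm_res G n) (x \<otimes> y)\<^esub> k) =
          \<theta> (x \<otimes> y) (tr (cm_res G n) y x c) [^]\<^bsub>part N (x \<otimes> y)\<^esub> k"
        by (rule hom_int_pow[OF \<theta> _ grP grN]) (use xy hom_in_carrier[OF cm_res_tr_hom[OF xy] c] in simp_all)
      then show "\<theta> (x \<otimes> y) (act (cm_gmod G n) y x k c) = act (left_beck_gmod G N) y x k (\<theta> x c)"
        using L xy c by (simp add: act_cm_gmod_res left_beck_gmod_def)
    qed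
  next
    assume R: ?R
    show ?L
    proof (intro ballI)
      fix x y c assume xy: "x \<in> carrier G" "y \<in> carrier G" and c: "c \<in> carrier (part (cm_res G n) x)"
      have "tr N y x (\<theta> x c) \<in> carrier (part N (x \<otimes> y))"
        using hom_in_carrier[OF trN[OF xy] hom_in_carrier[OF \<theta>[OF xy(1)] c]] .
      then have "act (left_beck_gmod G N) y x 1 (\<theta> x c) = tr N y x (\<theta> x c)"
        using xy by (simp add: left_beck_gmod_def group.int_pow_1[OF grN])
      moreover have "act (cm_gmod G n) y x 1 c = tr (cm_res G n) y x c"
        using hom_in_carrier[OF cm_res_tr_hom[OF xy] c] by (simp add: act_cm_gmod_res group.int_pow_1[OF grP])
      ultimately show "\<theta> (x \<otimes> y) (tr (cm_res G n) y x c) = tr N y x (\<theta> x c)"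
        using R xy c by metis
    qed
  qed
  then show ?thesis
    unfolding beck_Hom_def gmod_Hom_def part_cm_gmod_res part_left_beck_gmod carrier_graded_monoid_ring
    by (auto intro!: Collect_cong)
qed

text \<open>
  The two sets of relations differ in the balancing: along the morphisms of the Leech category only, or for
  all integer multiples of them. The latter relations follow from the former because classes are
  bilinear.
\<close>

lemma beck_tensor_generate_eq:
  assumes M: "right_beck G M"
  shows "tensor_gens G M (cm_res G n) = tensor_gens G (right_beck_gmod M) (cm_gmod G n)"
    and "generate (free_Abelian_group (tensor_gens G M (cm_res G n))) (beck_tensor_rels G M (cm_res G n)) =
      generate (free_Abelian_group (tensor_gens G M (cm_res G n))) (ztensor_rels G (right_beck_gmod M) (cm_gmod G n))"
proof -
  let ?N = "cm_res G n" and ?M = "right_beck_gmod M" and ?P = "cm_gmod G n"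
  let ?S = "tensor_gens G M ?N" and ?B = "beck_tensor_rels G M ?N" and ?Z = "ztensor_rels G ?M ?P"
  let ?F = "free_Abelian_group ?S"
  show gens: "?S = tensor_gens G ?M ?P"
    by (simp add: tensor_gens_def part_cm_gmod_res)
  have bil: "bilinear_rels G M ?N = bilinear_rels G ?M ?P"
    by (simp add: bilinear_rels_def part_cm_gmod_res)
  have grM: "comm_group (part M x)" if "x \<in> carrier G" for x using M that by (simp add: right_beck_def)
  then have grM': "group (part M x)" if "x \<in> carrier G" for x using that by (simp add: comm_group_def)
  have trM: "tr M y x \<in> hom (part M (x \<otimes> y)) (part M x)" if "x \<in> carrier G" "y \<in> carrier G" for x y
    using M that by (simp add: right_beck_def)
  have grN: "group (part ?N x)" for x using group_cm[of n x] by (simp add: part_cm_gmod_res)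
  have M': "right_gmod G (zring G) ?M" by (rule right_gmod_right_beck_gmod[OF comm_monoid_axioms M])
  have Z: "?Z \<subseteq> carrier ?F"
    unfolding gens by (rule ztensor_rels_closed[OF comm_monoid_axioms M' pre_gmod_cm])
  have sZ: "subgroup (generate ?F ?Z) ?F" using presented_normal[OF Z] by (simp add: normal_def)
  have tr_closed: "tr M y x m \<in> carrier (part M x)" "tr ?N y x c \<in> carrier (part ?N (x \<otimes> y))"
    if "x \<in> carrier G" "y \<in> carrier G" "m \<in> carrier (part M (x \<otimes> y))" "c \<in> carrier (part ?N x)" for x y m c
    using hom_in_carrier[OF trM] hom_in_carrier[OF cm_res_tr_hom] that by auto
  have BZ: "?B \<subseteq> generate ?F ?Z"
  proof
    fix r assume "r \<in> ?B"
    then consider "r \<in> bilinear_rels G ?M ?P" | x y m c where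
      "r = frag_of (x, tr M y x m, c) - frag_of (x \<otimes> y, m, tr ?N y x c)"
      "x \<in> carrier G" "y \<in> carrier G" "m \<in> carrier (part M (x \<otimes> y))" "c \<in> carrier (part ?N x)"
      unfolding beck_tensor_rels_def bil by blast
    then show "r \<in> generate ?F ?Z"
    proof cases
      case 1
      then show ?thesis by (intro generate.incl) (simp add: gmod_tensor_rels_def)
    next
      case 2
      have "act ?P y x 1 c = tr ?N y x c" "act ?M y x 1 m = tr M y x m"
        using tr_closed[OF 2(2-5)] 2(2)
        by (simp_all add: act_cm_gmod_res right_beck_gmod_def group.int_pow_1[OF grN] group.int_pow_1[OF grM'])
      then have rel: "- r \<in> ?Z"
        using ztensor_rels_intros(3)[of x G y m ?M c ?P 1] 2 by (simp add: part_cm_gmod_res)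
      then have "Poly_Mapping.keys (- r) \<subseteq> ?S" using subsetD[OF Z rel] by simp
      then have "r = inv\<^bsub>?F\<^esub> (- r)" by simp
      then show ?thesis using generate.inv[OF rel, of ?F] by simp
    qed
  qed
  then have B: "?B \<subseteq> carrier ?F" using subgroup.subset[OF sZ] by blast
  have sB: "subgroup (generate ?F ?B) ?F" using presented_normal[OF B] by (simp add: normal_def)
  let ?cl = "presented_class ?S ?B" and ?T = "presented ?S ?B"
  interpret T: comm_group ?T by (rule comm_group_presented[OF B])
  have bil1: "frag_of (z, m \<otimes>\<^bsub>part M z\<^esub> m', c) - frag_of (z, m, c) - frag_of (z, m', c) \<in> ?B"
    and bil2: "frag_of (z, m, c \<otimes>\<^bsub>part ?N z\<^esub> c') - frag_of (z, m, c) - frag_of (z, m, c') \<in> ?B"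
    if "z \<in> carrier G" "m \<in> carrier (part M z)" "m' \<in> carrier (part M z)" "c \<in> carrier (part ?N z)" "c' \<in> carrier (part ?N z)"
    for z m m' c c'
    using that unfolding beck_tensor_rels_def bilinear_rels_def by blast+
  have S: "(z, m, c) \<in> ?S \<longleftrightarrow> z \<in> carrier G \<and> m \<in> carrier (part M z) \<and> c \<in> carrier (part ?N z)" for z m c
    by (simp add: tensor_gens_def)
  have powM: "?cl (z, m [^]\<^bsub>part M z\<^esub> (k::int), c) = ?cl (z, m, c) [^]\<^bsub>?T\<^esub> k"
    if z: "z \<in> carrier G" "m \<in> carrier (part M z)" "c \<in> carrier (part ?N z)" for z m c k
  proof -
    have "(\<lambda>m. ?cl (z, m, c)) \<in> hom (part M z) ?T"
    proof (rule homI)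
      fix m m' assume m: "m \<in> carrier (part M z)" "m' \<in> carrier (part M z)"
      then have "m \<otimes>\<^bsub>part M z\<^esub> m' \<in> carrier (part M z)"
        using grM'[OF z(1)] by (simp add: group_def monoid.m_closed)
      then show "?cl (z, m \<otimes>\<^bsub>part M z\<^esub> m', c) = ?cl (z, m, c) \<otimes>\<^bsub>?T\<^esub> ?cl (z, m', c)"
        using presented_class_eqI[OF B bil1[OF z(1) m z(3,3)]] m z by (simp add: S)
    qed (simp add: presented_class_closed S z)
    from hom_int_pow[OF this z(2) grM'[OF z(1)] T.is_group] show ?thesis .
  qed
  have powN: "?cl (z, m, c [^]\<^bsub>part ?N z\<^esub> (k::int)) = ?cl (z, m, c) [^]\<^bsub>?T\<^esub> k"
    if z: "z \<in> carrier G" "m \<in> carrier (part M z)" "c \<in> carrier (part ?N z)" for z m c k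
  proof -
    have "(\<lambda>c. ?cl (z, m, c)) \<in> hom (part ?N z) ?T"
    proof (rule homI)
      fix c c' assume c: "c \<in> carrier (part ?N z)" "c' \<in> carrier (part ?N z)"
      then have "c \<otimes>\<^bsub>part ?N z\<^esub> c' \<in> carrier (part ?N z)"
        using grN by (simp add: group_def monoid.m_closed)
      then show "?cl (z, m, c \<otimes>\<^bsub>part ?N z\<^esub> c') = ?cl (z, m, c) \<otimes>\<^bsub>?T\<^esub> ?cl (z, m, c')"
        using presented_class_eqI[OF B bil2[OF z(1,2,2) c]] c z by (simp add: S)
    qed (simp add: presented_class_closed S z)
    from hom_int_pow[OF this z(3) grN T.is_group] show ?thesis .
  qed
  have ZB: "?Z \<subseteq> generate ?F ?B"
  proof
    fix r assume r: "r \<in> ?Z"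
    then consider "r \<in> bilinear_rels G M ?N" | x y m k c where
      "r = frag_of (x \<otimes> y, m, act ?P y x k c) - frag_of (x, act ?M y x k m, c)"
      "x \<in> carrier G" "y \<in> carrier G" "m \<in> carrier (part M (x \<otimes> y))" "c \<in> carrier (part ?N x)"
      unfolding gmod_tensor_rels_def bil[symmetric] part_right_beck_gmod part_cm_gmod_res by blast
    then show "r \<in> generate ?F ?B"
    proof cases
      case 1
      then show ?thesis by (intro generate.incl) (simp add: beck_tensor_rels_def)
    next
      case 2
      note t = tr_closed[OF 2(2-5)] and xy = m_closed[OF 2(2,3)]
      have rel: "frag_of (x, tr M y x m, c) - frag_of (x \<otimes> y, m, tr ?N y x c) \<in> ?B"
        using 2 unfolding beck_tensor_rels_def by blast
      have g: "(x, tr M y x m, c) \<in> ?S" "(x \<otimes> y, m, tr ?N y x c) \<in> ?S" using t 2 xy by (simp_all add: S)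
      have eq: "?cl (x, tr M y x m, c) = ?cl (x \<otimes> y, m, tr ?N y x c)"
        using presented_elt_rel[OF B rel] presented_elt_diff_one_iff[OF B] g by (simp add: presented_class_eq_elt)
      have a: "act ?P y x k c = tr ?N y x c [^]\<^bsub>part ?N (x \<otimes> y)\<^esub> k" "act ?M y x k m = tr M y x m [^]\<^bsub>part M x\<^esub> k"
        by (simp_all add: act_cm_gmod_res right_beck_gmod_def)
      have "?cl (x \<otimes> y, m, act ?P y x k c) = ?cl (x, act ?M y x k m, c)"
        unfolding a powN[OF xy 2(4) t(2)] powM[OF 2(2) t(1) 2(5)] eq ..
      moreover have g': "(x \<otimes> y, m, act ?P y x k c) \<in> ?S" "(x, act ?M y x k m, c) \<in> ?S"
        using t 2 xy by (simp_all add: S a group.int_pow_closed[OF grN] group.int_pow_closed[OF grM'])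
      ultimately have "presented_elt ?S ?B r = \<one>\<^bsub>?T\<^esub>"
        unfolding 2(1) using presented_elt_diff_one_iff[OF B] by (simp add: presented_class_eq_elt)
      moreover have "Poly_Mapping.keys r \<subseteq> ?S" using subsetD[OF Z r] by simp
      ultimately show ?thesis using presented_elt_one_iff[OF B] by blast
    qed
  qed
  show "generate ?F ?B = generate ?F ?Z"
    using group.generate_subgroup_incl[OF group_free_Abelian_group BZ sZ]
      group.generate_subgroup_incl[OF group_free_Abelian_group ZB sB] by blast
qed

lemma beck_tensor_eq:
  assumes M: "right_beck G M"
  shows "beck_tensor G M (cm_res G n) = gmod_tensor G (zring G) (right_beck_gmod M) (cm_gmod G n)"
    and "presented_map (tensor_gens G M (cm_res G n)) (beck_tensor_rels G M (cm_res G n)) =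
      presented_map (tensor_gens G (right_beck_gmod M) (cm_gmod G n)) (ztensor_rels G (right_beck_gmod M) (cm_gmod G n))"
  using presented_eqI[OF beck_tensor_generate_eq(2)[OF M]] beck_tensor_generate_eq(1)[OF M]
  by (simp_all add: beck_tensor_def gmod_tensor_def)

end

lemma left_beck_pullback:
  assumes "comm_monoid X" and f: "f \<in> hom X X'" "f \<one>\<^bsub>X\<^esub> = \<one>\<^bsub>X'\<^esub>" and N: "left_beck X' N"
  shows "left_beck X (beck_pullback f N)"
proof -
  interpret comm_monoid X by fact
  show ?thesis
    using N hom_in_carrier[OF f(1)] f(2) by (simp add: left_beck_def beck_pullback_def hom_mult[OF f(1)])
qed

lemma right_beck_pullback:
  assumes "comm_monoid X" and f: "f \<in> hom X X'" "f \<one>\<^bsub>X\<^esub> = \<one>\<^bsub>X'\<^esub>" and M: "right_beck X' M"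
  shows "right_beck X (beck_pullback f M)"
proof -
  interpret comm_monoid X by fact
  show ?thesis
    using M hom_in_carrier[OF f(1)] f(2) by (simp add: right_beck_def beck_pullback_def hom_mult[OF f(1)])
qed

section \<open>The comparison isomorphisms\<close>

text \<open>
  This identifies the maps induced by functions that agree on carriers only.
\<close>

lemma coset_map_cong: "(\<And>c. c \<in> C \<Longrightarrow> \<phi> c = \<psi> c) \<Longrightarrow> coset_map G H \<phi> C = coset_map G H \<psi> C"
  by (simp add: coset_map_def)

lemma update_Mod:
  assumes G: "comm_group G" and Z: "subgroup Z G" and B: "subgroup B G"
  shows group_update_Mod: "group (G\<lparr>carrier := Z\<rparr> Mod B)"
    and int_pow_update_Mod: "z \<in> Z \<Longrightarrow> (B #>\<^bsub>G\<^esub> z) [^]\<^bsub>G\<lparr>carrier := Z\<rparr> Mod B\<^esub> (k::int) = B #>\<^bsub>G\<^esub> (z [^]\<^bsub>G\<^esub> k)"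
proof -
  interpret G: comm_group G by fact
  interpret N: normal B G by (rule G.subgroup_imp_normal[OF B])
  have Q: "group (G Mod B)" by (rule N.factorgroup_is_group)
  interpret p: group_hom G "G Mod B" "\<lambda>z. B #>\<^bsub>G\<^esub> z"
    by (intro group_hom.intro group_hom_axioms.intro G.is_group Q N.r_coset_hom_Mod)
  have eq: "G\<lparr>carrier := Z\<rparr> Mod B = (G Mod B)\<lparr>carrier := (\<lambda>z. B #>\<^bsub>G\<^esub> z) ` Z\<rparr>"
    using carrier_update_Mod[where G = G and Z = Z and B = B] by (simp add: FactGroup_def set_mult_def[abs_def])
  have sub: "subgroup ((\<lambda>z. B #>\<^bsub>G\<^esub> z) ` Z) (G Mod B)"
    by (rule p.subgroup_img_is_subgroup[OF Z])
  show "group (G\<lparr>carrier := Z\<rparr> Mod B)"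
    unfolding eq by (rule subgroup.subgroup_is_group[OF sub Q])
  show "(B #>\<^bsub>G\<^esub> z) [^]\<^bsub>G\<lparr>carrier := Z\<rparr> Mod B\<^esub> k = B #>\<^bsub>G\<^esub> (z [^]\<^bsub>G\<^esub> k)" if z: "z \<in> Z"
    unfolding eq using group.int_pow_consistent[OF Q sub, of "B #>\<^bsub>G\<^esub> z" k] p.hom_int_pow[of z k] subgroup.mem_carrier[OF Z z] z
    by simp
qed

lemma (in simplicial_group) int_pow_simp_pi:
  "z \<in> simp_cycles C d n \<Longrightarrow>
    (simp_boundaries C d n #>\<^bsub>C n\<^esub> z) [^]\<^bsub>simp_pi C d n\<^esub> (k::int) = simp_boundaries C d n #>\<^bsub>C n\<^esub> (z [^]\<^bsub>C n\<^esub> k)"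
  unfolding simp_pi_def by (rule int_pow_update_Mod[OF comm_group subgroup_cycles subgroup_boundaries])

lemma (in simplicial_group) simp_pi_coset_subset:
  "z \<in> carrier (C n) \<Longrightarrow> simp_boundaries C d n #>\<^bsub>C n\<^esub> z \<subseteq> carrier (C n)"
  using monoid.r_coset_subset_G[OF group.is_monoid[OF is_group] subgroup.subset[OF subgroup_boundaries]] .

text \<open>
  Hence acting on homology classes is acting on representatives.
\<close>

lemma (in simplicial_gmod) act_simplicial:
  assumes xy: "x \<in> carrier X" "y \<in> carrier X"
  shows "simplicial_map (\<lambda>n. part (P n) x) (d x) (\<lambda>n. part (P n) (x \<otimes>\<^bsub>X\<^esub> y)) (d (x \<otimes>\<^bsub>X\<^esub> y)) (\<lambda>n. act (P n) y x a)"
proof -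
  interpret X: comm_monoid X by (rule X)
  show ?thesis
    by (intro simplicial_map.intro simplicial_map_axioms.intro parts pre_gmodD(3)[OF pre])
      (use xy gmod_mapD(3)[OF face xy] in simp_all)
qed

subsection \<open>Homology\<close>

definition homology_comparison :: "'x monoid \<Rightarrow> nat \<Rightarrow> 'x \<Rightarrow> 'x cm_el set \<Rightarrow> ('x, int) ca_el set" where
  "homology_comparison X n x =
    simp_pi_map (\<lambda>k. part (ca_res X (zring X) k) x) (ca_res_face X (zring X) x) n (res_embed X n x)"

text \<open>
  The graded monoid ring acts on the homology of the monoid by powers of the transport maps. On
  representatives this is the action on the resolution, with which the embedding commutes.
\<close>

lemma homology_comparison_iso:
  assumes X: "comm_monoid X"
  shows "homology_comparison X n \<in> gmod_iso X (zring X) (left_beck_gmod X (HQ_CM X n)) (HQ_CA X (zring X) n)"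
  unfolding gmod_iso_def
proof (intro CollectI conjI ballI)
  interpret X: grading_monoid X using X ..
  interpret gmod_retract X "cm_gmod X" "cm_res_face X" "ca_res X (zring X)" "ca_res_face X (zring X)"
    "res_embed X" "res_lin X" "res_htpy X" by (rule X.gmod_retract)
  have part_CM: "part (left_beck_gmod X (HQ_CM X n)) x = simp_pi (\<lambda>k. part (cm_gmod X k) x) (cm_res_face X x) n" for x
    by (simp add: HQ_CM_def part_cm_gmod_res)
  have part_CA: "part (HQ_CA X (zring X) n) x = simp_pi (\<lambda>k. part (ca_res X (zring X) k) x) (ca_res_face X (zring X) x) n" for x
    by (simp add: HQ_CA_def)
  show "homology_comparison X n x \<in> iso (part (left_beck_gmod X (HQ_CM X n)) x) (part (HQ_CA X (zring X) n) x)"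
    if "x \<in> carrier X" for x
    unfolding part_CM part_CA homology_comparison_def by (rule simplicial_retract.simp_pi_iso[OF simplicial_retract_parts[OF that]])
  fix x y a c assume xy: "x \<in> carrier X" "y \<in> carrier X" and c: "c \<in> carrier (part (left_beck_gmod X (HQ_CM X n)) x)"
  have xy': "x \<otimes>\<^bsub>X\<^esub> y \<in> carrier X" using xy by simp
  let ?B = "\<lambda>x. simp_boundaries (\<lambda>k. part (cm_gmod X k) x) (cm_res_face X x) n"
  let ?B' = "\<lambda>x. simp_boundaries (\<lambda>k. part (ca_res X (zring X) k) x) (ca_res_face X (zring X) x) n"
  let ?P = "\<lambda>x. part (cm_gmod X n) x" and ?Q = "\<lambda>x. part (ca_res X (zring X) n) x"
  interpret act1: simplicial_map "\<lambda>k. part (cm_gmod X k) x" "cm_res_face X x" "\<lambda>k. part (cm_gmod X k) (x \<otimes>\<^bsub>X\<^esub> y)"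
    "cm_res_face X (x \<otimes>\<^bsub>X\<^esub> y)" "\<lambda>k. act (cm_gmod X k) y x 1"
    by (rule I.P.act_simplicial[OF xy])
  interpret actQ: simplicial_map "\<lambda>k. part (ca_res X (zring X) k) x" "ca_res_face X (zring X) x"
    "\<lambda>k. part (ca_res X (zring X) k) (x \<otimes>\<^bsub>X\<^esub> y)" "ca_res_face X (zring X) (x \<otimes>\<^bsub>X\<^esub> y)" "\<lambda>k. act (ca_res X (zring X) k) y x a"
    by (rule I.P'.act_simplicial[OF xy])
  interpret cx: simplicial_map "\<lambda>k. part (cm_gmod X k) x" "cm_res_face X x" "\<lambda>k. part (ca_res X (zring X) k) x"
    "ca_res_face X (zring X) x" "\<lambda>k. res_embed X k x" using I.parts[OF xy(1)] by simp
  interpret cxy: simplicial_map "\<lambda>k. part (cm_gmod X k) (x \<otimes>\<^bsub>X\<^esub> y)" "cm_res_face X (x \<otimes>\<^bsub>X\<^esub> y)"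
    "\<lambda>k. part (ca_res X (zring X) k) (x \<otimes>\<^bsub>X\<^esub> y)" "ca_res_face X (zring X) (x \<otimes>\<^bsub>X\<^esub> y)" "\<lambda>k. res_embed X k (x \<otimes>\<^bsub>X\<^esub> y)"
    using I.parts[OF xy'] by simp
  obtain z where z: "z \<in> simp_cycles (\<lambda>k. part (cm_gmod X k) x) (cm_res_face X x) n" "c = ?B x #>\<^bsub>?P x\<^esub> z"
    using c unfolding part_CM carrier_simp_pi by blast
  have zc: "z \<in> carrier (?P x)" using subgroup.mem_carrier[OF act1.C.subgroup_cycles z(1)] .
  have tr: "tr (cm_res X n) y x b = act (cm_gmod X n) y x 1 b" if "b \<in> carrier (?P x)" for b
    using hom_in_carrier[OF X.cm_res_tr_hom[OF xy], of b n] that X.group_cm[of n "x \<otimes>\<^bsub>X\<^esub> y"]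
    by (simp add: X.act_cm_gmod_res part_cm_gmod_res group.int_pow_1)
  have "act (left_beck_gmod X (HQ_CM X n)) y x a c =
      simp_pi_map (\<lambda>k. part (cm_gmod X k) (x \<otimes>\<^bsub>X\<^esub> y)) (cm_res_face X (x \<otimes>\<^bsub>X\<^esub> y)) n (tr (cm_res X n) y x) c
        [^]\<^bsub>simp_pi (\<lambda>k. part (cm_gmod X k) (x \<otimes>\<^bsub>X\<^esub> y)) (cm_res_face X (x \<otimes>\<^bsub>X\<^esub> y)) n\<^esub> a"
    by (simp add: left_beck_gmod_def HQ_CM_def part_cm_gmod_res)
  also have "simp_pi_map (\<lambda>k. part (cm_gmod X k) (x \<otimes>\<^bsub>X\<^esub> y)) (cm_res_face X (x \<otimes>\<^bsub>X\<^esub> y)) n (tr (cm_res X n) y x) c =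
      simp_pi_map (\<lambda>k. part (cm_gmod X k) (x \<otimes>\<^bsub>X\<^esub> y)) (cm_res_face X (x \<otimes>\<^bsub>X\<^esub> y)) n (act (cm_gmod X n) y x 1) c"
    unfolding simp_pi_map_def z(2) by (rule coset_map_cong) (use act1.C.simp_pi_coset_subset[OF zc] tr in blast)
  also have "\<dots> = ?B (x \<otimes>\<^bsub>X\<^esub> y) #>\<^bsub>?P (x \<otimes>\<^bsub>X\<^esub> y)\<^esub> act (cm_gmod X n) y x 1 z"
    unfolding z(2) by (rule act1.simp_pi_map_coset[OF zc])
  also have "\<dots> [^]\<^bsub>simp_pi (\<lambda>k. part (cm_gmod X k) (x \<otimes>\<^bsub>X\<^esub> y)) (cm_res_face X (x \<otimes>\<^bsub>X\<^esub> y)) n\<^esub> a =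
      ?B (x \<otimes>\<^bsub>X\<^esub> y) #>\<^bsub>?P (x \<otimes>\<^bsub>X\<^esub> y)\<^esub> (act (cm_gmod X n) y x 1 z [^]\<^bsub>?P (x \<otimes>\<^bsub>X\<^esub> y)\<^esub> a)"
    by (rule act1.D.int_pow_simp_pi) (use act1.\<phi>_cycles z(1) in blast)
  also have "act (cm_gmod X n) y x 1 z [^]\<^bsub>?P (x \<otimes>\<^bsub>X\<^esub> y)\<^esub> a = act (cm_gmod X n) y x a z"
    unfolding tr[OF zc, symmetric] by (simp add: X.act_cm_gmod_res part_cm_gmod_res)
  finally have "homology_comparison X n (x \<otimes>\<^bsub>X\<^esub> y) (act (left_beck_gmod X (HQ_CM X n)) y x a c) =
      ?B' (x \<otimes>\<^bsub>X\<^esub> y) #>\<^bsub>?Q (x \<otimes>\<^bsub>X\<^esub> y)\<^esub> res_embed X n (x \<otimes>\<^bsub>X\<^esub> y) (act (cm_gmod X n) y x a z)"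
    using cxy.simp_pi_map_coset[OF pre_gmodD(2)[OF I.P.pre xy zc]] by (simp add: homology_comparison_def)
  also have "res_embed X n (x \<otimes>\<^bsub>X\<^esub> y) (act (cm_gmod X n) y x a z) = act (ca_res X (zring X) n) y x a (res_embed X n x z)"
    using gmod_mapD(3)[OF X.res_embed_gmod xy zc] by simp
  also have "?B' (x \<otimes>\<^bsub>X\<^esub> y) #>\<^bsub>?Q (x \<otimes>\<^bsub>X\<^esub> y)\<^esub> \<dots> =
      act (HQ_CA X (zring X) n) y x a (homology_comparison X n x c)"
    using actQ.simp_pi_map_coset[OF hom_in_carrier[OF X.res_embed_hom zc]] cx.simp_pi_map_coset[OF zc]
    by (simp add: HQ_CA_def homology_comparison_def z(2))
  finally show "homology_comparison X n (x \<otimes>\<^bsub>X\<^esub> y) (act (left_beck_gmod X (HQ_CM X n)) y x a c) =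
      act (HQ_CA X (zring X) n) y x a (homology_comparison X n x c)" .
qed

lemma homology_comparison_natural:
  assumes X: "comm_monoid X" and X': "comm_monoid X'" and f: "f \<in> hom X X'" "f \<one>\<^bsub>X\<^esub> = \<one>\<^bsub>X'\<^esub>"
    and x: "x \<in> carrier X" and c: "c \<in> carrier (part (HQ_CM X n) x)"
  shows "homology_comparison X' n (f x) (HQ_CM_map X' f n x c) =
    HQ_CA_map X' (zring X') f (graded_monoid_ring_map f) n x (homology_comparison X n x c)"
proof -
  interpret X: grading_monoid X using X ..
  interpret X': grading_monoid X' using X' ..
  note fx = hom_in_carrier[OF f(1) x]
  interpret E: simplicial_map "\<lambda>k. part (cm_gmod X k) x" "cm_res_face X x" "\<lambda>k. part (ca_res X (zring X) k) x"
    "ca_res_face X (zring X) x" "\<lambda>k. res_embed X k x"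
    using simplicial_gmod_map.parts[OF gmod_retract.axioms(1)[OF X.gmod_retract] x] by simp
  interpret E': simplicial_map "\<lambda>k. part (cm_gmod X' k) (f x)" "cm_res_face X' (f x)" "\<lambda>k. part (ca_res X' (zring X') k) (f x)"
    "ca_res_face X' (zring X') (f x)" "\<lambda>k. res_embed X' k (f x)"
    using simplicial_gmod_map.parts[OF gmod_retract.axioms(1)[OF X'.gmod_retract] fx] by simp
  interpret M: simplicial_map "\<lambda>k. part (cm_gmod X k) x" "cm_res_face X x" "\<lambda>k. part (cm_gmod X' k) (f x)" "cm_res_face X' (f x)"
    "\<lambda>k. cm_res_map X' f k x" by (rule simplicial_gmod_map.parts[OF cm_res_map_simplicial[OF X X' f] x])
  interpret A: simplicial_map "\<lambda>k. part (ca_res X (zring X) k) x" "ca_res_face X (zring X) x" "\<lambda>k. part (ca_res X' (zring X') k) (f x)"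
    "ca_res_face X' (zring X') (f x)" "\<lambda>k. ca_res_map X' (zring X') f (graded_monoid_ring_map f) k x"
    by (rule simplicial_gmod_map.parts[OF ca_res_map_simplicial[OF X X' f] x])
  obtain z where z: "z \<in> simp_cycles (\<lambda>k. part (cm_gmod X k) x) (cm_res_face X x) n"
      "c = simp_boundaries (\<lambda>k. part (cm_gmod X k) x) (cm_res_face X x) n #>\<^bsub>part (cm_gmod X n) x\<^esub> z"
    using c unfolding HQ_CM_def part_cm_gmod_res[symmetric] by (auto simp: carrier_simp_pi)
  have zc: "z \<in> carrier (part (cm_gmod X n) x)" using subgroup.mem_carrier[OF E.C.subgroup_cycles z(1)] .
  show ?thesis
    using E.simp_pi_map_coset[OF zc] M.simp_pi_map_coset[OF zc] E'.simp_pi_map_coset[OF hom_in_carrier[OF M.\<phi>_hom zc]]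
      A.simp_pi_map_coset[OF hom_in_carrier[OF E.\<phi>_hom zc]] res_embed_natural[OF X X' f x zc]
    by (simp add: homology_comparison_def HQ_CM_map_def HQ_CA_map_def z(2) part_cm_gmod_res)
qed

subsection \<open>Homology with coefficients\<close>

definition tensor_comparison ::
    "'x monoid \<Rightarrow> ('x, 'm) beck \<Rightarrow> nat \<Rightarrow> ('x \<times> 'm \<times> 'x cm_el \<Rightarrow>\<^sub>0 int) set set \<Rightarrow>
     ('x \<times> 'm \<times> ('x, int) ca_el \<Rightarrow>\<^sub>0 int) set set" where
  "tensor_comparison X M n =
    simp_pi_map (ca_tensor_res X (zring X) (right_beck_gmod M)) (ca_tensor_res_face X (zring X) (right_beck_gmod M)) n
      (ztensor_map X (right_beck_gmod M) (ca_res X (zring X) n) id (res_embed X n))"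

lemma cm_tensor_res_eq:
  assumes X: "comm_monoid X" and M: "right_beck X M"
  shows "cm_tensor_res X M = (\<lambda>n. gmod_tensor X (zring X) (right_beck_gmod M) (cm_gmod X n))"
    and "cm_tensor_res_face X M = (\<lambda>n i. ztensor_map X (right_beck_gmod M) (cm_gmod X n) id (\<lambda>z. cm_res_face X z n i))"
proof -
  interpret X: grading_monoid X using X ..
  show "cm_tensor_res X M = (\<lambda>n. gmod_tensor X (zring X) (right_beck_gmod M) (cm_gmod X n))"
    by (simp add: cm_tensor_res_def X.beck_tensor_eq(1)[OF M] fun_eq_iff)
  show "cm_tensor_res_face X M = (\<lambda>n i. ztensor_map X (right_beck_gmod M) (cm_gmod X n) id (\<lambda>z. cm_res_face X z n i))"
    by (simp add: cm_tensor_res_face_def ztensor_map_def X.beck_tensor_eq(2)[OF M] fun_eq_iff)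
qed

lemma ca_tensor_res_eq:
  "ca_tensor_res X (zring X) M = (\<lambda>n. gmod_tensor X (zring X) M (ca_res X (zring X) n))"
  "ca_tensor_res_face X (zring X) M = (\<lambda>n i. ztensor_map X M (ca_res X (zring X) n) id (\<lambda>z. ca_res_face X (zring X) z n i))"
  by (simp_all add: ca_tensor_res_def ca_tensor_res_face_def ztensor_map_def fun_eq_iff)

lemma tensor_comparison_iso:
  assumes X: "comm_monoid X" and M: "right_beck X M"
  shows "tensor_comparison X M n \<in> iso (HQ_CM_homology X M n) (HQ_CA_homology X (zring X) (right_beck_gmod M) n)"
proof -
  interpret X: grading_monoid X using X ..
  show ?thesis
    unfolding tensor_comparison_def HQ_CM_homology_def HQ_CA_homology_def cm_tensor_res_eq[OF X M] ca_tensor_res_eq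
    by (rule simplicial_retract.simp_pi_iso[OF gmod_retract.simplicial_retract_tensor[OF X.gmod_retract
            right_gmod_right_beck_gmod[OF X M]]])
qed

lemma tensor_comparison_natural:
  fixes X :: "'x monoid" and X' :: "'y monoid" and M :: "('y, 'm) beck"
  assumes X: "comm_monoid X" and X': "comm_monoid X'" and f: "f \<in> hom X X'" "f \<one>\<^bsub>X\<^esub> = \<one>\<^bsub>X'\<^esub>"
    and M: "right_beck X' M" and c: "c \<in> carrier (HQ_CM_homology X (beck_pullback f M) n)"
  shows "tensor_comparison X' M n (HQ_CM_homology_map X' f M n c) =
    HQ_CA_homology_map X' (zring X') f (graded_monoid_ring_map f) (right_beck_gmod M) n
      (tensor_comparison X (beck_pullback f M) n c)"
proof -
  interpret X: grading_monoid X using X ..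
  interpret X': grading_monoid X' using X' ..
  let ?f = "beck_pullback f M" and ?Mf = "right_beck_gmod (beck_pullback f M)" and ?M = "right_beck_gmod M"
  note M0 = right_beck_pullback[OF X f M]
  note gM0 = right_gmod_right_beck_gmod[OF X M0] and gM = right_gmod_right_beck_gmod[OF X' M]
  have part: "part ?Mf x = part ?M (f x)" for x :: 'x by (simp add: beck_pullback_def)
  have act: "act ?Mf y x a m = act ?M (f y) (f x) a m" for x y a m
    by (simp add: right_beck_gmod_def beck_pullback_def)
  let ?P = "cm_gmod X" and ?P' = "cm_gmod X'" and ?Q = "ca_res X (zring X)" and ?Q' = "ca_res X' (zring X')"
  let ?g = "\<lambda>n. ca_res_map X' (zring X') f (graded_monoid_ring_map f) n"
  let ?C = "\<lambda>n. gmod_tensor X (zring X) ?Mf (?P n)" and ?d = "\<lambda>n i. ztensor_map X ?Mf (?P n) id (\<lambda>z. cm_res_face X z n i)"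
  let ?D = "\<lambda>n. gmod_tensor X (zring X) ?Mf (?Q n)" and ?e = "\<lambda>n i. ztensor_map X ?Mf (?Q n) id (\<lambda>z. ca_res_face X (zring X) z n i)"
  let ?C' = "\<lambda>n. gmod_tensor X' (zring X') ?M (?P' n)" and ?d' = "\<lambda>n i. ztensor_map X' ?M (?P' n) id (\<lambda>z. cm_res_face X' z n i)"
  let ?D' = "\<lambda>n. gmod_tensor X' (zring X') ?M (?Q' n)" and ?e' = "\<lambda>n i. ztensor_map X' ?M (?Q' n) id (\<lambda>z. ca_res_face X' (zring X') z n i)"
  interpret E: simplicial_map ?C ?d ?D ?e "\<lambda>n. ztensor_map X ?Mf (?Q n) id (res_embed X n)"
    by (rule simplicial_retract.axioms(1)[OF gmod_retract.simplicial_retract_tensor[OF X.gmod_retract gM0]])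
  interpret E': simplicial_map ?C' ?d' ?D' ?e' "\<lambda>n. ztensor_map X' ?M (?Q' n) id (res_embed X' n)"
    by (rule simplicial_retract.axioms(1)[OF gmod_retract.simplicial_retract_tensor[OF X'.gmod_retract gM]])
  interpret F: simplicial_map ?C ?d ?C' ?d' "\<lambda>n. ztensor_map X' ?M (?P' n) f (cm_res_map X' f n)"
    by (rule simplicial_gmod_map.tensor[OF cm_res_map_simplicial[OF X X' f] gM gM0 part act])
  interpret A: simplicial_map ?D ?e ?D' ?e' "\<lambda>n. ztensor_map X' ?M (?Q' n) f (?g n)"
    by (rule simplicial_gmod_map.tensor[OF ca_res_map_simplicial[OF X X' f] gM gM0 part act])
  obtain z where z: "z \<in> simp_cycles ?C ?d n" "c = simp_boundaries ?C ?d n #>\<^bsub>?C n\<^esub> z"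
    using c unfolding HQ_CM_homology_def cm_tensor_res_eq[OF X M0] carrier_simp_pi by blast
  have zc: "z \<in> carrier (?C n)" using subgroup.mem_carrier[OF E.C.subgroup_cycles z(1)] .
  have nat: "ztensor_map X' ?M (?Q' n) id (res_embed X' n) (ztensor_map X' ?M (?P' n) f (cm_res_map X' f n) z) =
      ztensor_map X' ?M (?Q' n) f (?g n) (ztensor_map X ?Mf (?Q n) id (res_embed X n) z)"
  proof -
    have "(ztensor_map X' ?M (?Q' n) id (res_embed X' n) \<circ> ztensor_map X' ?M (?P' n) f (cm_res_map X' f n)) z =
      (ztensor_map X' ?M (?Q' n) f (?g n) \<circ> ztensor_map X ?Mf (?Q n) id (res_embed X n)) z"
    proof (rule ztensor_hom_eqI[OF X gM0 X.pre_gmod_cm E'.D.is_group Group.hom_compose[OF F.\<phi>_hom E'.\<phi>_hom]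
          Group.hom_compose[OF E.\<phi>_hom A.\<phi>_hom] _ zc])
      fix x m b assume xmb: "x \<in> carrier X" "m \<in> carrier (part ?Mf x)" "b \<in> carrier (part (cm_gmod X n) x)"
      note fx = hom_in_carrier[OF f(1) xmb(1)]
      have m: "m \<in> carrier (part ?M (f x))" using xmb part by simp
      have b: "cm_res_map X' f n x b \<in> carrier (part (cm_gmod X' n) (f x))"
        by (rule gmod_mapD(2)[OF cm_res_map_gmod[OF X X' f] xmb(1,3)])
      have b': "res_embed X n x b \<in> carrier (part (?Q n) x)" by (rule hom_in_carrier[OF X.res_embed_hom xmb(3)])
      have F: "ztensor_map X' ?M (?P' n) f (cm_res_map X' f n) (ztensor_class X ?Mf (?P n) (x, m, b)) =
          ztensor_class X' ?M (?P' n) (f x, m, cm_res_map X' f n x b)"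
        by (rule ztensor_map_class[OF X X' f(1) gM gM0 part act X.pre_gmod_cm X'.pre_gmod_cm cm_res_map_gmod[OF X X' f] xmb])
      have A: "ztensor_map X' ?M (?Q' n) f (?g n) (ztensor_class X ?Mf (?Q n) (x, m, res_embed X n x b)) =
          ztensor_class X' ?M (?Q' n) (f x, m, ?g n x (res_embed X n x b))"
        by (rule ztensor_map_class[OF X X' f(1) gM gM0 part act X.pre_gmod_ca X'.pre_gmod_ca ca_res_map_gmod[OF X X' f] xmb(1,2) b'])
      show "(ztensor_map X' ?M (?Q' n) id (res_embed X' n) \<circ> ztensor_map X' ?M (?P' n) f (cm_res_map X' f n))
            (ztensor_class X ?Mf (?P n) (x, m, b)) =
          (ztensor_map X' ?M (?Q' n) f (?g n) \<circ> ztensor_map X ?Mf (?Q n) id (res_embed X n)) (ztensor_class X ?Mf (?P n) (x, m, b))"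
        by (simp only: o_apply F A ztensor_map_id_class[OF X gM0 X.pre_gmod_cm X.pre_gmod_ca X.res_embed_gmod xmb]
            ztensor_map_id_class[OF X' gM X'.pre_gmod_cm X'.pre_gmod_ca X'.res_embed_gmod fx m b] res_embed_natural[OF X X' f xmb(1,3)])
    qed
    then show ?thesis by simp
  qed
  have "HQ_CM_homology_map X' f M n = simp_pi_map ?C' ?d' n (ztensor_map X' ?M (?P' n) f (cm_res_map X' f n))"
    unfolding HQ_CM_homology_map_def cm_tensor_res_eq[OF X' M] ztensor_map_def X'.beck_tensor_eq(2)[OF M] ..
  moreover have "HQ_CA_homology_map X' (zring X') f (graded_monoid_ring_map f) ?M n =
      simp_pi_map ?D' ?e' n (ztensor_map X' ?M (?Q' n) f (?g n))"
    unfolding HQ_CA_homology_map_def ca_tensor_res_eq ztensor_map_def ..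
  ultimately show ?thesis
    using E.simp_pi_map_coset[OF zc] F.simp_pi_map_coset[OF zc] E'.simp_pi_map_coset[OF hom_in_carrier[OF F.\<phi>_hom zc]]
      A.simp_pi_map_coset[OF hom_in_carrier[OF E.\<phi>_hom zc]] nat
    by (simp add: tensor_comparison_def ca_tensor_res_eq z(2))
qed

subsection \<open>Cohomology\<close>

text \<open>
  Cochains on the ring resolution restrict along the embedding. Since restriction is contravariant, the
  comparison from the cohomology of the monoid to that of the ring is its inverse.
\<close>

definition cohomology_restriction ::
    "'x monoid \<Rightarrow> ('x, 'c) beck \<Rightarrow> nat \<Rightarrow> ('x \<Rightarrow> ('x, int) ca_el \<Rightarrow> 'c) set \<Rightarrow> ('x \<Rightarrow> 'x cm_el \<Rightarrow> 'c) set" where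
  "cohomology_restriction X N n =
    coset_map (cm_cochains X N n) (coboundaries (cm_cochains X N) (cm_coboundary X) n)
      (zHom_pre X (cm_gmod X n) id (res_embed X n))"

definition cohomology_comparison ::
    "'x monoid \<Rightarrow> ('x, 'c) beck \<Rightarrow> nat \<Rightarrow> ('x \<Rightarrow> 'x cm_el \<Rightarrow> 'c) set \<Rightarrow> ('x \<Rightarrow> ('x, int) ca_el \<Rightarrow> 'c) set" where
  "cohomology_comparison X N n =
    inv_into (carrier (HQ_CA_cohomology X (zring X) (left_beck_gmod X N) n)) (cohomology_restriction X N n)"

lemma cm_cochains_eq:
  assumes "comm_monoid X" "left_beck X N"
  shows "cm_cochains X N = (\<lambda>n. zHom X (cm_gmod X n) (left_beck_gmod X N))"
proof -
  interpret X: grading_monoid X using assms(1) ..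
  show ?thesis by (simp add: cm_cochains_def X.beck_Hom_eq_zHom[OF assms(2)] fun_eq_iff)
qed

lemma cm_coboundary_eq:
  assumes "comm_monoid X"
  shows "cm_coboundary X = simplicial_gmod.coboundary X (cm_gmod X) (cm_res_face X)"
proof -
  interpret X: grading_monoid X using assms ..
  interpret simplicial_gmod X "cm_gmod X" "cm_res_face X" by (rule X.simplicial_gmod_cm)
  show ?thesis
    by (simp add: cm_coboundary_def coboundary_def diff_def cm_res_diff_def part_cm_gmod_res fun_eq_iff)
qed

lemma ca_cochains_eq: "ca_cochains X (zring X) N = (\<lambda>n. zHom X (ca_res X (zring X) n) N)"
  by (simp add: ca_cochains_def fun_eq_iff)

lemma ca_coboundary_eq:
  assumes "comm_monoid X"
  shows "ca_coboundary X (zring X) = simplicial_gmod.coboundary X (ca_res X (zring X)) (ca_res_face X (zring X))"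
proof -
  interpret X: grading_monoid X using assms ..
  interpret simplicial_gmod X "ca_res X (zring X)" "ca_res_face X (zring X)" by (rule X.simplicial_gmod_ca)
  show ?thesis
    by (simp add: ca_coboundary_def coboundary_def diff_def ca_res_diff_def fun_eq_iff)
qed

lemma cohomology_restriction_iso:
  assumes X: "comm_monoid X" and N: "left_beck X N"
  shows "cohomology_restriction X N n \<in>
    iso (HQ_CA_cohomology X (zring X) (left_beck_gmod X N) n) (HQ_CM_cohomology X N n)"
proof -
  interpret X: grading_monoid X using X ..
  show ?thesis
    unfolding cohomology_restriction_def HQ_CA_cohomology_def HQ_CM_cohomology_def cm_cochains_eq[OF X N]
      cm_coboundary_eq[OF X] ca_cochains_eq ca_coboundary_eq[OF X]
    by (rule gmod_retract.cohomology_iso[OF X.gmod_retract left_gmod_left_beck_gmod[OF X N]])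
qed

lemma group_HQ_CA_cohomology:
  assumes X: "comm_monoid X" and N: "left_beck X N"
  shows "group (HQ_CA_cohomology X (zring X) (left_beck_gmod X N) n)"
proof -
  interpret X: grading_monoid X using X ..
  interpret simplicial_gmod X "ca_res X (zring X)" "ca_res_face X (zring X)" by (rule X.simplicial_gmod_ca)
  note N' = left_gmod_left_beck_gmod[OF X N]
  show ?thesis
    unfolding HQ_CA_cohomology_def ca_cochains_eq ca_coboundary_eq[OF X] cohomology_def
    by (rule group_update_Mod[OF comm_group_cochains[OF N'] subgroup_cocycles[OF N'] subgroup_coboundaries[OF N']])
qed

lemma cohomology_comparison_iso:
  assumes X: "comm_monoid X" and N: "left_beck X N"
  shows "cohomology_comparison X N n \<in>
    iso (HQ_CM_cohomology X N n) (HQ_CA_cohomology X (zring X) (left_beck_gmod X N) n)"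
  unfolding cohomology_comparison_def
  by (rule group.iso_set_sym[OF group_HQ_CA_cohomology[OF X N] cohomology_restriction_iso[OF X N]])

text \<open>
  The two pulled-back modules agree in the degrees of \<open>X\<close>, and a group of homomorphisms looks
  at these only.
\<close>

lemma zHom_pullback_eq:
  assumes X: "comm_monoid X" and f: "f \<in> hom X X'"
  shows "zHom X P (gmod_pullback f (graded_monoid_ring_map f) (left_beck_gmod X' N)) =
    zHom X P (left_beck_gmod X (beck_pullback f N))"
proof -
  interpret comm_monoid X by fact
  have "act (gmod_pullback f (graded_monoid_ring_map f) (left_beck_gmod X' N)) y x a n =
      act (left_beck_gmod X (beck_pullback f N)) y x a n" if "x \<in> carrier X" "y \<in> carrier X" for x y a n
    using that by (simp add: gmod_pullback_def left_beck_gmod_def beck_pullback_def graded_monoid_ring_map_def hom_mult[OF f])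
  moreover have "part (gmod_pullback f (graded_monoid_ring_map f) (left_beck_gmod X' N)) =
      part (left_beck_gmod X (beck_pullback f N))"
    by (simp add: gmod_pullback_def beck_pullback_def)
  ultimately show ?thesis by (simp add: gmod_Hom_def cong: conj_cong)
qed

lemma cohomology_comparison_natural:
  fixes X :: "'x monoid" and X' :: "'y monoid" and N :: "('y, 'c) beck"
  assumes X: "comm_monoid X" and X': "comm_monoid X'" and f: "f \<in> hom X X'" "f \<one>\<^bsub>X\<^esub> = \<one>\<^bsub>X'\<^esub>"
    and N: "left_beck X' N" and c: "c \<in> carrier (HQ_CM_cohomology X' N n)"
  shows "cohomology_comparison X (beck_pullback f N) n (HQ_CM_cohomology_map X X' f N n c) =
    HQ_CA_cohomology_map X (zring X) X' (zring X') f (graded_monoid_ring_map f) (left_beck_gmod X' N) n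
      (cohomology_comparison X' N n c)"
proof -
  interpret X: grading_monoid X using X ..
  interpret X': grading_monoid X' using X' ..
  let ?Nf = "left_beck_gmod X (beck_pullback f N)" and ?N = "left_beck_gmod X' N"
  note N0 = left_beck_pullback[OF X f N]
  note gN0 = left_gmod_left_beck_gmod[OF X N0] and gN = left_gmod_left_beck_gmod[OF X' N]
  have part: "part ?Nf x = part ?N (f x)" for x :: 'x by (simp add: beck_pullback_def)
  have act: "act ?Nf y x a m = act ?N (f y) (f x) a m" if "x \<in> carrier X" "y \<in> carrier X" for x y a m
    using that by (simp add: left_beck_gmod_def beck_pullback_def hom_mult[OF f(1)])
  have id: "\<And>x. x \<in> carrier X \<Longrightarrow> part ?Nf x = part ?Nf (id x)" "\<And>x y a n. act ?Nf y x a n = act ?Nf (id y) (id x) a n"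
    "\<And>x. x \<in> carrier X' \<Longrightarrow> part ?N x = part ?N (id x)" "\<And>x y a n. act ?N y x a n = act ?N (id y) (id x) a n"
    by simp_all
  let ?g = "\<lambda>n. ca_res_map X' (zring X') f (graded_monoid_ring_map f) n"
  interpret E: simplicial_gmod_map X "cm_gmod X" "cm_res_face X" X "ca_res X (zring X)" "ca_res_face X (zring X)" id "res_embed X"
    by (rule gmod_retract.axioms(1)[OF X.gmod_retract])
  interpret E': simplicial_gmod_map X' "cm_gmod X'" "cm_res_face X'" X' "ca_res X' (zring X')" "ca_res_face X' (zring X')" id "res_embed X'"
    by (rule gmod_retract.axioms(1)[OF X'.gmod_retract])
  interpret F: simplicial_gmod_map X "cm_gmod X" "cm_res_face X" X' "cm_gmod X'" "cm_res_face X'" f "cm_res_map X' f"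
    by (rule cm_res_map_simplicial[OF X X' f])
  interpret A: simplicial_gmod_map X "ca_res X (zring X)" "ca_res_face X (zring X)" X' "ca_res X' (zring X')" "ca_res_face X' (zring X')" f ?g
    by (rule ca_res_map_simplicial[OF X X' f])
  let ?KP = "\<lambda>n. zHom X (cm_gmod X n) ?Nf" and ?KQ = "\<lambda>n. zHom X (ca_res X (zring X) n) ?Nf"
  let ?KP' = "\<lambda>n. zHom X' (cm_gmod X' n) ?N" and ?KQ' = "\<lambda>n. zHom X' (ca_res X' (zring X') n) ?N"
  have HCM: "HQ_CM_cohomology X (beck_pullback f N) n = cohomology ?KP E.P.coboundary n"
      "HQ_CM_cohomology X' N n = cohomology ?KP' E'.P.coboundary n"
    unfolding HQ_CM_cohomology_def
    by (simp_all only: cm_cochains_eq[OF X N0] cm_cochains_eq[OF X' N] cm_coboundary_eq[OF X] cm_coboundary_eq[OF X'])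
  have HCA: "HQ_CA_cohomology X (zring X) ?Nf n = cohomology ?KQ E.P'.coboundary n"
      "HQ_CA_cohomology X' (zring X') ?N n = cohomology ?KQ' E'.P'.coboundary n"
    unfolding HQ_CA_cohomology_def
    by (simp_all only: ca_cochains_eq ca_coboundary_eq[OF X] ca_coboundary_eq[OF X'])
  have bij: "bij_betw (cohomology_restriction X (beck_pullback f N) n)
        (carrier (HQ_CA_cohomology X (zring X) ?Nf n)) (carrier (HQ_CM_cohomology X (beck_pullback f N) n))"
    and bij': "bij_betw (cohomology_restriction X' N n)
        (carrier (HQ_CA_cohomology X' (zring X') ?N n)) (carrier (HQ_CM_cohomology X' N n))"
    using cohomology_restriction_iso[OF X N0] cohomology_restriction_iso[OF X' N] by (simp_all add: iso_def)
  define b where "b = cohomology_comparison X' N n c"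
  have b: "b \<in> carrier (HQ_CA_cohomology X' (zring X') ?N n)" "cohomology_restriction X' N n b = c"
    unfolding b_def cohomology_comparison_def
    using bij_betw_imp_surj_on[OF bij'] c by (simp_all add: inv_into_into f_inv_into_f)
  obtain \<theta> where \<theta>: "\<theta> \<in> kernel (?KQ' n) (?KQ' (Suc n)) (E'.P'.coboundary n)"
      "b = coboundaries ?KQ' E'.P'.coboundary n #>\<^bsub>?KQ' n\<^esub> \<theta>"
    using b(1) unfolding HCA E'.P'.carrier_cohomology by blast
  have \<theta>c: "\<theta> \<in> carrier (?KQ' n)" using \<theta>(1) by (simp add: kernel_def)
  define b0 where "b0 = HQ_CA_cohomology_map X (zring X) X' (zring X') f (graded_monoid_ring_map f) ?N n b"
  have mapA: "HQ_CA_cohomology_map X (zring X) X' (zring X') f (graded_monoid_ring_map f) ?N n =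
      coset_map (?KQ n) (coboundaries ?KQ E.P'.coboundary n) (A.pre_map n)"
    unfolding HQ_CA_cohomology_map_def ca_cochains_eq zHom_pullback_eq[OF X f(1)] ca_coboundary_eq[OF X] zHom_pre_def ..
  have mapF: "HQ_CM_cohomology_map X X' f N n = coset_map (?KP n) (coboundaries ?KP E.P.coboundary n) (F.pre_map n)"
    unfolding HQ_CM_cohomology_map_def cm_cochains_eq[OF X N0] cm_coboundary_eq[OF X] zHom_pre_def part_cm_gmod_res ..
  have resE: "cohomology_restriction X (beck_pullback f N) n = coset_map (?KP n) (coboundaries ?KP E.P.coboundary n) (E.pre_map n)"
    unfolding cohomology_restriction_def cm_cochains_eq[OF X N0] cm_coboundary_eq[OF X] ..
  have resE': "cohomology_restriction X' N n = coset_map (?KP' n) (coboundaries ?KP' E'.P.coboundary n) (E'.pre_map n)"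
    unfolding cohomology_restriction_def cm_cochains_eq[OF X' N] cm_coboundary_eq[OF X'] ..
  have A\<theta>: "A.pre_map n \<theta> \<in> kernel (?KQ n) (?KQ (Suc n)) (E.P'.coboundary n)"
    using A.pre_map_cocycles[OF gN gN0 part act] \<theta>(1) by blast
  have b0: "b0 = coboundaries ?KQ E.P'.coboundary n #>\<^bsub>?KQ n\<^esub> A.pre_map n \<theta>"
    unfolding b0_def mapA \<theta>(2) by (rule A.pre_map_coset[OF gN gN0 part act \<theta>c])
  have b0c: "b0 \<in> carrier (HQ_CA_cohomology X (zring X) ?Nf n)"
    unfolding HCA E.P'.carrier_cohomology b0 using A\<theta> by blast
  have nat: "E.pre_map n (A.pre_map n \<theta>) = F.pre_map n (E'.pre_map n \<theta>)"
    using res_embed_natural[OF X X' f] hom_in_carrier[OF X.res_embed_hom] gmod_mapD(2)[OF cm_res_map_gmod[OF X X' f]]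
      hom_in_carrier[OF f(1)]
    by (auto simp: zHom_pre_def fun_eq_iff restrict_def)
  have "cohomology_restriction X (beck_pullback f N) n b0 =
      coboundaries ?KP E.P.coboundary n #>\<^bsub>?KP n\<^esub> E.pre_map n (A.pre_map n \<theta>)"
    unfolding resE b0 by (rule E.pre_map_coset[OF gN0 gN0 id(1,2) subgroup.mem_carrier[OF E.P'.subgroup_cocycles[OF gN0] A\<theta>]])
  also have "\<dots> = HQ_CM_cohomology_map X X' f N n (coboundaries ?KP' E'.P.coboundary n #>\<^bsub>?KP' n\<^esub> E'.pre_map n \<theta>)"
    unfolding mapF nat
    by (rule F.pre_map_coset[OF gN gN0 part act hom_in_carrier[OF E'.pre_map_hom[OF gN gN id(3,4)] \<theta>c], symmetric])
  also have "coboundaries ?KP' E'.P.coboundary n #>\<^bsub>?KP' n\<^esub> E'.pre_map n \<theta> = c"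
    unfolding b(2)[symmetric] resE' \<theta>(2) by (rule E'.pre_map_coset[OF gN gN id(3,4) \<theta>c, symmetric])
  finally have "cohomology_comparison X (beck_pullback f N) n (HQ_CM_cohomology_map X X' f N n c) = b0"
    unfolding cohomology_comparison_def using inv_into_f_f[OF bij_betw_imp_inj_on[OF bij] b0c] by simp
  then show ?thesis by (simp add: b0_def b_def)
qed

section \<open>Quillen homology of a monoid and of its graded monoid ring\<close>

theorem theorem5p2:
  shows
  "(\<exists>\<Phi> :: 'x monoid \<Rightarrow> nat \<Rightarrow> 'x \<Rightarrow> 'x cm_el set \<Rightarrow> ('x, int) ca_el set.
      (\<forall>X n. comm_monoid X \<longrightarrow>
        \<Phi> X n \<in> gmod_iso X (graded_monoid_ring X)
                  (left_beck_gmod X (HQ_CM X n)) (HQ_CA X (graded_monoid_ring X) n)) \<and>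
      (\<forall>X X' f n. comm_monoid X \<and> comm_monoid X' \<and> f \<in> hom X X' \<and> f \<one>\<^bsub>X\<^esub> = \<one>\<^bsub>X'\<^esub> \<longrightarrow>
        (\<forall>x\<in>carrier X. \<forall>c\<in>carrier (part (HQ_CM X n) x).
          \<Phi> X' n (f x) (HQ_CM_map X' f n x c) =
          HQ_CA_map X' (graded_monoid_ring X') f (graded_monoid_ring_map f) n x (\<Phi> X n x c))))
   \<and>
   (\<exists>\<Phi> :: 'x monoid \<Rightarrow> ('x, 'm) beck \<Rightarrow> nat \<Rightarrow>
        ('x \<times> 'm \<times> 'x cm_el \<Rightarrow>\<^sub>0 int) set set \<Rightarrow> ('x \<times> 'm \<times> ('x, int) ca_el \<Rightarrow>\<^sub>0 int) set set.
      (\<forall>X M n. comm_monoid X \<and> right_beck X M \<longrightarrow>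
        \<Phi> X M n \<in> iso (HQ_CM_homology X M n)
                      (HQ_CA_homology X (graded_monoid_ring X) (right_beck_gmod M) n)) \<and>
      (\<forall>X X' f M n. comm_monoid X \<and> comm_monoid X' \<and> f \<in> hom X X' \<and> f \<one>\<^bsub>X\<^esub> = \<one>\<^bsub>X'\<^esub> \<and>
          right_beck X' M \<longrightarrow>
        (\<forall>c\<in>carrier (HQ_CM_homology X (beck_pullback f M) n).
          \<Phi> X' M n (HQ_CM_homology_map X' f M n c) =
          HQ_CA_homology_map X' (graded_monoid_ring X') f (graded_monoid_ring_map f)
            (right_beck_gmod M) n (\<Phi> X (beck_pullback f M) n c))))
   \<and>
   (\<exists>\<Phi> :: 'x monoid \<Rightarrow> ('x, 'c) beck \<Rightarrow> nat \<Rightarrow>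
        ('x \<Rightarrow> 'x cm_el \<Rightarrow> 'c) set \<Rightarrow> ('x \<Rightarrow> ('x, int) ca_el \<Rightarrow> 'c) set.
      (\<forall>X N n. comm_monoid X \<and> left_beck X N \<longrightarrow>
        \<Phi> X N n \<in> iso (HQ_CM_cohomology X N n)
                      (HQ_CA_cohomology X (graded_monoid_ring X) (left_beck_gmod X N) n)) \<and>
      (\<forall>X X' f N n. comm_monoid X \<and> comm_monoid X' \<and> f \<in> hom X X' \<and> f \<one>\<^bsub>X\<^esub> = \<one>\<^bsub>X'\<^esub> \<and>
          left_beck X' N \<longrightarrow>
        (\<forall>c\<in>carrier (HQ_CM_cohomology X' N n).
          \<Phi> X (beck_pullback f N) n (HQ_CM_cohomology_map X X' f N n c) =
          HQ_CA_cohomology_map X (graded_monoid_ring X) X' (graded_monoid_ring X')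
            f (graded_monoid_ring_map f) (left_beck_gmod X' N) n (\<Phi> X' N n c))))"
  by (intro conjI exI[of _ homology_comparison] exI[of _ tensor_comparison] exI[of _ cohomology_comparison]
      allI impI ballI; (elim conjE)?;
    (rule homology_comparison_iso homology_comparison_natural tensor_comparison_iso tensor_comparison_natural
      cohomology_comparison_iso cohomology_comparison_natural; assumption))

end
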